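(* For the pairing $X=L$ the algebras of quantized right and left differential operators on $\mathcal A_q^+$ satisfy $$\mathcal D_L^R=\mathcal D_L^L={\mathcal W}eyl_q(n,n).$$ Moreover, the representation $\mathcal O^L_{\Lambda'}$ is given by such differential operators together with $\mathrm{End}(V'_\Lambda)$: for every $u\in\mathcal U_q$, $\mathcal O^L_{\Lambda'}(u)\in{\mathcal W}eyl_q(n,n)\otimes\mathrm{End}(V'_\Lambda)$ as operators on $\mathcal A_q^+\otimes V'_\Lambda$.
   Context: Let $n\ge1$ and let $q\in\mathbb C\setminus\{0\}$ not be a root of unity. $\mathcal U_q=\mathcal U_q(su(n,n)^{\mathbb C})$ is the quantized enveloping algebra of type $A_{2n-1}$ over $\mathbb C$ with generators $E_\alpha,F_\alpha,K_\alpha^{\pm1}$, $\alpha\in\Pi=\{\mu_1,\dots,\mu_{n-1},\beta,\nu_1,\dots,\nu_{n-1}\}$; the Dynkin diagram is the chain $\mu_{n-1}-\cdots-\mu_1-\beta-\nu_1-\cdots-\nu_{n-1}$, with $(\alpha,\alpha)=2$, $(\alpha,\alpha')=-1$ for neighbours and $0$ otherwise. Relations: $K_\alpha E_{\alpha'}K_\alpha^{-1}=q^{(\alpha,\alpha')}E_{\alpha'}$, $K_\alpha F_{\alpha'}K_\alpha^{-1}=q^{-(\alpha,\alpha')}F_{\alpha'}$, $[E_\alpha,F_{\alpha'}]=\delta_{\alpha\alpha'}(K_\alpha-K_\alpha^{-1})/(q-q^{-1})$, and the quantum Serre relations. Antipode: $S(E_\alpha)=-K_\alpha^{-1}E_\alpha$,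 $S(F_\alpha)=-F_\alpha K_\alpha$, $S(K_\alpha)=K_\alpha^{-1}$. Lusztig automorphisms: $T_\alpha(E_\alpha)=-F_\alpha K_\alpha$, $T_\alpha(F_\alpha)=-K_\alpha^{-1}E_\alpha$, $T_\alpha(K_\gamma)=K_\gamma K_\alpha^{-(\alpha,\gamma)}$; for neighbours $T_\alpha(E_\gamma)=E_\alpha E_\gamma-q^{-1}E_\gamma E_\alpha$, $T_\alpha(F_\gamma)=F_\gamma F_\alpha-qF_\alpha F_\gamma$; for $\gamma\ne\alpha$ not a neighbour $T_\alpha$ fixes $E_\gamma,F_\gamma$. For $1\le i,j\le n$: $Z_{ij}=T_{\nu_{j-1}}\cdots T_{\nu_1}T_{\mu_{i-1}}\cdots T_{\mu_1}(E_\beta)$, $W_{ij}=T_{\nu_{j-1}}\cdots T_{\nu_1}T_{\mu_{i-1}}\cdots T_{\mu_1}(F_\beta)$ (empty products are the identity). $\mathcal A_q^\pm$ are the subalgebras generated by the $Z_{ij}$ ($+$) and the $W_{ij}$ ($-$); they have bases $Z^{\mathbf a}=Z_{11}^{a_{11}}Z_{21}^{a_{21}}\cdots Z_{n1}^{a_{n1}}Z_{12}^{a_{12}}\cdots Z_{nn}^{a_{nn}}$ and $W^{\mathbf a}$ (same ordering), $\mathbf a\in\mathbb N_0^{n^2}$. With $[a]=(q^a-q^{-a})/(q-q^{-1})$ and $e_{ij}$ the unit multi-index, define on $\mathcal A_q^+$ the operators $M^o_{ij}Z^{\mathbf a}=Z^{\mathbf a+e_{ij}}$, $D^o_{ij}Z^{\mathbf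 a}=[a_{ij}]Z^{\mathbf a-e_{ij}}$. ${\mathcal W}eyl_q(n,n)$ is the algebra of operators generated by all $M^o_{ij},D^o_{ij}$. The pairing $(\cdot,\cdot)_L$ between $\mathcal A_q^-$ and $\mathcal A_q^+$ is $(W^{\mathbf b},Z^{\mathbf a})_L=\delta_{\mathbf a,\mathbf b}\left(\frac{-1}{q-q^{-1}}\right)^{|\mathbf a|}\prod_{i,j}[a_{ij}]!$, $|\mathbf a|=\sum a_{ij}$. Left and right multiplication operators: ${}_aM(u)=au$, $M_a(u)=ua$. For an operator $T$ on $\mathcal A_q^-$, $\widehat T^L$ is the operator on $\mathcal A_q^+$ with $(Tw,u)_L=(w,\widehat T^Lu)_L$ for all $w\in\mathcal A_q^-,u\in\mathcal A_q^+$. $\mathcal D_L^R$ is the algebra of operators on $\mathcal A_q^+$ generated by all $\widehat{M_{W_{ij}}}^L$, $M_{Z_{ij}}$, ${}_{Z_{ij}}M$; $\mathcal D_L^L$ is generated by all $\widehat{{}_{W_{ij}}M}^L$, $M_{Z_{ij}}$, ${}_{Z_{ij}}M$. Let $\mathcal U_q(\mathfrak k^{\mathbb C})$ be the subalgebra generated by all $K_\alpha^{\pm1}$ ($\alpha\in\Pi$) and $E_\alpha,F_\alpha$ for $\alpha\ne\beta$. Let $V_\Lambda$ be the finite-dimensional irreducible $\mathcal U_q(\mathfrak k^{\mathbb C})$-module with highest weight vector $v_\Lambda$ satisfying $K_{\mu_i}v_\Lambda=q^{\lambda_i^\mu}v_\Lambda$, $K_{\nu_i}v_\Lambda=q^{\lambda_i^\nu}v_\Lambda$,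 $K_\beta v_\Lambda=q^\lambda v_\Lambda$, with $\lambda_i^\mu,\lambda_i^\nu\in\mathbb N_0$ and $\lambda\in\mathbb R$ (a value of $q^\lambda$ being fixed). $V'_\Lambda$ is its dual space with canonical pairing $(v',v)_\Lambda$; its lowest weight is $\Lambda'=-\Lambda$. Extend $V_\Lambda$ to $\mathcal U_q(\mathfrak k^{\mathbb C})\mathcal A_q^+$ by letting all $Z_{ij}$ act by $0$; the quantized generalized Verma module is $\mathcal M(V_\Lambda)=\mathcal U_q\otimes_{\mathcal U_q(\mathfrak k^{\mathbb C})\mathcal A_q^+}V_\Lambda=\mathcal A_q^-\otimes V_\Lambda$, with left action denoted $L_\Lambda$. Pair it with $\mathcal A_q^+\otimes V'_\Lambda$ by $(w\otimes v,z\otimes v')_L=(w,z)_L(v',v)_\Lambda$. For $u\in\mathcal U_q$, $\mathcal O^L_{\Lambda'}(u)$ is the operator on $\mathcal A_q^+\otimes V'_\Lambda$ determined by $(\eta,\mathcal O^L_{\Lambda'}(u)\xi)_L=(L_\Lambda(S(u))\eta,\xi)_L$ for all $\eta\in\mathcal M(V_\Lambda)$, $\xi\in\mathcal A_q^+\otimes V'_\Lambda$. *)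

theory Defs
  imports "HOL-Analysis.Analysis" "HOL-Library.FuncSet"
begin

section \<open>Complex vector spaces and complex algebras\<close>

class complex_module = ab_group_add +
  fixes scaleC :: "complex \<Rightarrow> 'a \<Rightarrow> 'a" (infixr "*\<^sub>C" 75)
  assumes scaleC_add_right: "c *\<^sub>C (x + y) = c *\<^sub>C x + c *\<^sub>C y"
    and scaleC_add_left: "(b + c) *\<^sub>C x = b *\<^sub>C x + c *\<^sub>C x"
    and scaleC_scaleC: "b *\<^sub>C c *\<^sub>C x = (b * c) *\<^sub>C x"
    and scaleC_one: "1 *\<^sub>C x = x"

class complex_algebra = complex_module + ring_1 +
  assumes mult_scaleC_left: "(c *\<^sub>C x) * y = c *\<^sub>C (x * y)"
    and mult_scaleC_right: "x * (c *\<^sub>C y) = c *\<^sub>C (x * y)"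

global_interpretation cvs: vector_space "scaleC :: complex \<Rightarrow> 'a \<Rightarrow> 'a::complex_module"
  by standard (simp_all add: scaleC_add_right scaleC_add_left scaleC_scaleC scaleC_one)

instantiation vec :: (complex_module, finite) complex_module
begin

definition scaleC_vec :: "complex \<Rightarrow> 'a ^ 'b \<Rightarrow> 'a ^ 'b"
  where "c *\<^sub>C x = (\<chi> i. c *\<^sub>C (x $ i))"

instance
  by standard
    (simp_all add: scaleC_vec_def vec_eq_iff scaleC_add_right scaleC_add_left scaleC_scaleC scaleC_one)

end

definition linear_on :: "'a::complex_module set \<Rightarrow> ('a \<Rightarrow> 'b::complex_module) \<Rightarrow> bool"
  where "linear_on A T \<longleftrightarrow>
    (\<forall>x\<in>A. \<forall>y\<in>A. T (x + y) = T x + T y) \<and> (\<forall>c. \<forall>x\<in>A. T (c *\<^sub>C x) = c *\<^sub>C T x)"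

inductive_set subalgebra_gen :: "'a::complex_algebra set \<Rightarrow> 'a set" for X where
  gen: "x \<in> X \<Longrightarrow> x \<in> subalgebra_gen X"
| one: "1 \<in> subalgebra_gen X"
| add: "x \<in> subalgebra_gen X \<Longrightarrow> y \<in> subalgebra_gen X \<Longrightarrow> x + y \<in> subalgebra_gen X"
| scale: "x \<in> subalgebra_gen X \<Longrightarrow> c *\<^sub>C x \<in> subalgebra_gen X"
| mult: "x \<in> subalgebra_gen X \<Longrightarrow> y \<in> subalgebra_gen X \<Longrightarrow> x * y \<in> subalgebra_gen X"

text \<open>An operator on a subspace \<open>A\<close> is an extensional function (\<open>undefined\<close> outside \<open>A\<close>), so
  that equality of operators is equality on \<open>A\<close>.\<close>

definition operators_on :: "'a::complex_module set \<Rightarrow> ('a \<Rightarrow> 'a) set"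
  where "operators_on A = {T. T \<in> A \<rightarrow>\<^sub>E A \<and> linear_on A T}"

inductive_set operator_algebra :: "'a::complex_module set \<Rightarrow> ('a \<Rightarrow> 'a) set \<Rightarrow> ('a \<Rightarrow> 'a) set"
  for A G where
  gen: "T \<in> G \<Longrightarrow> T \<in> operator_algebra A G"
| ident: "(\<lambda>x\<in>A. x) \<in> operator_algebra A G"
| add: "S \<in> operator_algebra A G \<Longrightarrow> T \<in> operator_algebra A G \<Longrightarrow>
    (\<lambda>x\<in>A. S x + T x) \<in> operator_algebra A G"
| scale: "T \<in> operator_algebra A G \<Longrightarrow> (\<lambda>x\<in>A. c *\<^sub>C T x) \<in> operator_algebra A G"
| comp: "S \<in> operator_algebra A G \<Longrightarrow> T \<in> operator_algebra A G \<Longrightarrow>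
    compose A S T \<in> operator_algebra A G"

definition left_mult :: "'a::complex_algebra set \<Rightarrow> 'a \<Rightarrow> 'a \<Rightarrow> 'a"
  where "left_mult A a = (\<lambda>u\<in>A. a * u)"

definition right_mult :: "'a::complex_algebra set \<Rightarrow> 'a \<Rightarrow> 'a \<Rightarrow> 'a"
  where "right_mult A a = (\<lambda>u\<in>A. u * a)"

section \<open>Algebras presented by generators and relations\<close>

datatype (letters: 'g) aterm =
    Gen 'g
  | Cst complex
  | Add "'g aterm" "'g aterm"  (infixl "\<oplus>" 65)
  | Mul "'g aterm" "'g aterm"  (infixl "\<odot>" 70)

abbreviation Sub :: "'g aterm \<Rightarrow> 'g aterm \<Rightarrow> 'g aterm"  (infixl "\<ominus>" 65)
  where "s \<ominus> t \<equiv> s \<oplus> Cst (-1) \<odot> t"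

primrec aterm_power :: "'g aterm \<Rightarrow> nat \<Rightarrow> 'g aterm" where
  "aterm_power t 0 = Cst 1"
| "aterm_power t (Suc k) = t \<odot> aterm_power t k"

primrec eval_aterm :: "('g \<Rightarrow> 'a) \<Rightarrow> 'g aterm \<Rightarrow> 'a::complex_algebra" where
  "eval_aterm g (Gen x) = g x"
| "eval_aterm g (Cst c) = c *\<^sub>C 1"
| "eval_aterm g (s \<oplus> t) = eval_aterm g s + eval_aterm g t"
| "eval_aterm g (s \<odot> t) = eval_aterm g s * eval_aterm g t"

text \<open>The least congruence on terms containing the relations \<open>R\<close> whose quotient is a unital
  associative complex algebra.\<close>

inductive alg_cong :: "('g aterm \<times> 'g aterm) set \<Rightarrow> 'g aterm \<Rightarrow> 'g aterm \<Rightarrow> bool"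
  for R where
  rel: "(s, t) \<in> R \<Longrightarrow> alg_cong R s t"
| refl: "alg_cong R t t"
| sym: "alg_cong R s t \<Longrightarrow> alg_cong R t s"
| trans: "alg_cong R s t \<Longrightarrow> alg_cong R t u \<Longrightarrow> alg_cong R s u"
| add_cong: "alg_cong R s s' \<Longrightarrow> alg_cong R t t' \<Longrightarrow> alg_cong R (s \<oplus> t) (s' \<oplus> t')"
| mul_cong: "alg_cong R s s' \<Longrightarrow> alg_cong R t t' \<Longrightarrow> alg_cong R (s \<odot> t) (s' \<odot> t')"
| add_assoc: "alg_cong R (s \<oplus> t \<oplus> u) (s \<oplus> (t \<oplus> u))"
| add_commute: "alg_cong R (s \<oplus> t) (t \<oplus> s)"
| add_zero: "alg_cong R (t \<oplus> Cst 0) t"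
| add_neg: "alg_cong R (t \<ominus> t) (Cst 0)"
| mul_assoc: "alg_cong R (s \<odot> t \<odot> u) (s \<odot> (t \<odot> u))"
| mul_one: "alg_cong R (Cst 1 \<odot> t) t"
| distrib_right: "alg_cong R ((s \<oplus> t) \<odot> u) (s \<odot> u \<oplus> t \<odot> u)"
| distrib_left: "alg_cong R (s \<odot> (t \<oplus> u)) (s \<odot> t \<oplus> s \<odot> u)"
| cst_add: "alg_cong R (Cst a \<oplus> Cst b) (Cst (a + b))"
| cst_mul: "alg_cong R (Cst a \<odot> Cst b) (Cst (a * b))"
| cst_central: "alg_cong R (Cst a \<odot> t) (t \<odot> Cst a)"

text \<open>The algebra of all elements of type \<open>'a\<close>, with the elements \<open>g x\<close> for \<open>x \<in> G\<close>, is the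
  complex algebra given by the generators \<open>G\<close> and the relations \<open>R\<close>. Derivations of
  \<open>alg_cong\<close> may pass through letters outside \<open>G\<close>; if \<open>R\<close> only mentions letters of \<open>G\<close>,
  replacing the others by \<open>Cst 0\<close> removes them.\<close>

definition presented_by ::
    "'g set \<Rightarrow> ('g aterm \<times> 'g aterm) set \<Rightarrow> ('g \<Rightarrow> 'a::complex_algebra) \<Rightarrow> bool"
  where "presented_by G R g \<longleftrightarrow>
    (\<forall>x. \<exists>t. letters t \<subseteq> G \<and> eval_aterm g t = x) \<and>
    (\<forall>s t. letters s \<subseteq> G \<longrightarrow> letters t \<subseteq> G \<longrightarrow>
       (eval_aterm g s = eval_aterm g t \<longleftrightarrow> alg_cong R s t))"

section \<open>The quantized enveloping algebra\<close>

datatype root = Mu nat | Beta | Nu nat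

definition simple_roots :: "nat \<Rightarrow> root set"
  where "simple_roots n = insert Beta (Mu ` {1..<n} \<union> Nu ` {1..<n})"

text \<open>Position of a simple root in the chain
  \<open>\<mu>\<^sub>n\<^sub>-\<^sub>1 - \<dots> - \<mu>\<^sub>1 - \<beta> - \<nu>\<^sub>1 - \<dots> - \<nu>\<^sub>n\<^sub>-\<^sub>1\<close>.\<close>

primrec root_position :: "root \<Rightarrow> int" where
  "root_position (Mu i) = - int i"
| "root_position Beta = 0"
| "root_position (Nu i) = int i"

definition root_form :: "root \<Rightarrow> root \<Rightarrow> int"
  where "root_form \<alpha> \<gamma> =
    (if \<alpha> = \<gamma> then 2 else if \<bar>root_position \<alpha> - root_position \<gamma>\<bar> = 1 then -1 else 0)"

datatype gen = GenE root | GenF root | GenK root | GenKinv root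

definition Uq_gens :: "nat \<Rightarrow> gen set"
  where "Uq_gens n =
    GenE ` simple_roots n \<union> GenF ` simple_roots n \<union> GenK ` simple_roots n \<union> GenKinv ` simple_roots n"

abbreviation tE :: "root \<Rightarrow> gen aterm" where "tE \<alpha> \<equiv> Gen (GenE \<alpha>)"
abbreviation tF :: "root \<Rightarrow> gen aterm" where "tF \<alpha> \<equiv> Gen (GenF \<alpha>)"
abbreviation tK :: "root \<Rightarrow> gen aterm" where "tK \<alpha> \<equiv> Gen (GenK \<alpha>)"
abbreviation tKinv :: "root \<Rightarrow> gen aterm" where "tKinv \<alpha> \<equiv> Gen (GenKinv \<alpha>)"

definition serre :: "complex \<Rightarrow> gen aterm \<Rightarrow> gen aterm \<Rightarrow> gen aterm"
  where "serre q x y =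
    x \<odot> x \<odot> y \<ominus> Cst (q + inverse q) \<odot> (x \<odot> y \<odot> x) \<oplus> y \<odot> x \<odot> x"

definition Uq_relations :: "nat \<Rightarrow> complex \<Rightarrow> (gen aterm \<times> gen aterm) set"
  where "Uq_relations n q =
    (\<Union>\<alpha>\<in>simple_roots n. {(tK \<alpha> \<odot> tKinv \<alpha>, Cst 1), (tKinv \<alpha> \<odot> tK \<alpha>, Cst 1)}) \<union>
    (\<Union>\<alpha>\<in>simple_roots n. \<Union>\<gamma>\<in>simple_roots n.
      {(tK \<alpha> \<odot> tK \<gamma>, tK \<gamma> \<odot> tK \<alpha>),
       (tK \<alpha> \<odot> tE \<gamma> \<odot> tKinv \<alpha>, Cst (q powi root_form \<alpha> \<gamma>) \<odot> tE \<gamma>),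
       (tK \<alpha> \<odot> tF \<gamma> \<odot> tKinv \<alpha>, Cst (q powi (- root_form \<alpha> \<gamma>)) \<odot> tF \<gamma>),
       (tE \<alpha> \<odot> tF \<gamma> \<ominus> tF \<gamma> \<odot> tE \<alpha>,
        if \<alpha> = \<gamma> then Cst (1 / (q - inverse q)) \<odot> (tK \<alpha> \<ominus> tKinv \<alpha>) else Cst 0)}) \<union>
    {(serre q (tE \<alpha>) (tE \<gamma>), Cst 0) | \<alpha> \<gamma>.
      \<alpha> \<in> simple_roots n \<and> \<gamma> \<in> simple_roots n \<and> root_form \<alpha> \<gamma> = -1} \<union>
    {(serre q (tF \<alpha>) (tF \<gamma>), Cst 0) | \<alpha> \<gamma>.
      \<alpha> \<in> simple_roots n \<and> \<gamma> \<in> simple_roots n \<and> root_form \<alpha> \<gamma> = -1} \<union>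
    {(tE \<alpha> \<odot> tE \<gamma>, tE \<gamma> \<odot> tE \<alpha>) | \<alpha> \<gamma>.
      \<alpha> \<in> simple_roots n \<and> \<gamma> \<in> simple_roots n \<and> root_form \<alpha> \<gamma> = 0} \<union>
    {(tF \<alpha> \<odot> tF \<gamma>, tF \<gamma> \<odot> tF \<alpha>) | \<alpha> \<gamma>.
      \<alpha> \<in> simple_roots n \<and> \<gamma> \<in> simple_roots n \<and> root_form \<alpha> \<gamma> = 0}"

text \<open>In the rest of the theory \<open>g :: gen \<Rightarrow> 'a\<close> is the family of generators of an algebra
  of type \<open>'a\<close> with the following property.\<close>

definition is_Uq :: "nat \<Rightarrow> complex \<Rightarrow> (gen \<Rightarrow> 'a::complex_algebra) \<Rightarrow> bool"
  where "is_Uq n q g \<longleftrightarrow> presented_by (Uq_gens n) (Uq_relations n q) g"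

definition antipode :: "nat \<Rightarrow> (gen \<Rightarrow> 'a) \<Rightarrow> 'a \<Rightarrow> 'a::complex_algebra"
  where "antipode n g = (THE S. linear_on UNIV S \<and> S 1 = 1 \<and> (\<forall>x y. S (x * y) = S y * S x) \<and>
    (\<forall>\<alpha>\<in>simple_roots n.
      S (g (GenE \<alpha>)) = - (g (GenKinv \<alpha>) * g (GenE \<alpha>)) \<and>
      S (g (GenF \<alpha>)) = - (g (GenF \<alpha>) * g (GenK \<alpha>)) \<and>
      S (g (GenK \<alpha>)) = g (GenKinv \<alpha>) \<and>
      S (g (GenKinv \<alpha>)) = g (GenK \<alpha>)))"

section \<open>Lusztig automorphisms and the quadratic algebras\<close>

definition tKpow :: "root \<Rightarrow> int \<Rightarrow> gen aterm"
  where "tKpow \<alpha> m =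
    (if m \<ge> 0 then aterm_power (tK \<alpha>) (nat m) else aterm_power (tKinv \<alpha>) (nat (- m)))"

primrec lusztig_gen :: "complex \<Rightarrow> root \<Rightarrow> gen \<Rightarrow> gen aterm" where
  "lusztig_gen q \<alpha> (GenE \<gamma>) =
    (if \<gamma> = \<alpha> then Cst (-1) \<odot> (tF \<alpha> \<odot> tK \<alpha>)
     else if root_form \<alpha> \<gamma> = -1 then tE \<alpha> \<odot> tE \<gamma> \<ominus> Cst (inverse q) \<odot> (tE \<gamma> \<odot> tE \<alpha>)
     else tE \<gamma>)"
| "lusztig_gen q \<alpha> (GenF \<gamma>) =
    (if \<gamma> = \<alpha> then Cst (-1) \<odot> (tKinv \<alpha> \<odot> tE \<alpha>)
     else if root_form \<alpha> \<gamma> = -1 then tF \<gamma> \<odot> tF \<alpha> \<ominus> Cst q \<odot> (tF \<alpha> \<odot> tF \<gamma>)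
     else tF \<gamma>)"
| "lusztig_gen q \<alpha> (GenK \<gamma>) = tK \<gamma> \<odot> tKpow \<alpha> (- root_form \<alpha> \<gamma>)"
| "lusztig_gen q \<alpha> (GenKinv \<gamma>) = tKinv \<gamma> \<odot> tKpow \<alpha> (root_form \<alpha> \<gamma>)"

text \<open>The algebra endomorphism of the term algebra lifting \<open>T\<^sub>\<alpha>\<close>: since \<open>T\<^sub>\<alpha>\<close> is an algebra
  homomorphism, \<open>T\<^sub>\<alpha> (eval_aterm g t) = eval_aterm g (lusztig q \<alpha> t)\<close>.\<close>

primrec lusztig :: "complex \<Rightarrow> root \<Rightarrow> gen aterm \<Rightarrow> gen aterm" where
  "lusztig q \<alpha> (Gen x) = lusztig_gen q \<alpha> x"
| "lusztig q \<alpha> (Cst c) = Cst c"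
| "lusztig q \<alpha> (s \<oplus> t) = lusztig q \<alpha> s \<oplus> lusztig q \<alpha> t"
| "lusztig q \<alpha> (s \<odot> t) = lusztig q \<alpha> s \<odot> lusztig q \<alpha> t"

text \<open>\<open>T (\<nu>\<^sub>j\<^sub>-\<^sub>1) \<dots> T (\<nu>\<^sub>1) T (\<mu>\<^sub>i\<^sub>-\<^sub>1) \<dots> T (\<mu>\<^sub>1)\<close>, the rightmost factor being applied first.\<close>

definition lusztig_word :: "complex \<Rightarrow> nat \<Rightarrow> nat \<Rightarrow> gen aterm \<Rightarrow> gen aterm"
  where "lusztig_word q i j t =
    fold (\<lambda>k. lusztig q (Nu k)) [1..<j] (fold (\<lambda>k. lusztig q (Mu k)) [1..<i] t)"

definition Zel :: "complex \<Rightarrow> (gen \<Rightarrow> 'a) \<Rightarrow> nat \<Rightarrow> nat \<Rightarrow> 'a::complex_algebra"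
  where "Zel q g i j = eval_aterm g (lusztig_word q i j (tE Beta))"

definition Wel :: "complex \<Rightarrow> (gen \<Rightarrow> 'a) \<Rightarrow> nat \<Rightarrow> nat \<Rightarrow> 'a::complex_algebra"
  where "Wel q g i j = eval_aterm g (lusztig_word q i j (tF Beta))"

definition Aplus :: "nat \<Rightarrow> complex \<Rightarrow> (gen \<Rightarrow> 'a) \<Rightarrow> 'a::complex_algebra set"
  where "Aplus n q g = subalgebra_gen {Zel q g i j | i j. i \<in> {1..n} \<and> j \<in> {1..n}}"

definition Aminus :: "nat \<Rightarrow> complex \<Rightarrow> (gen \<Rightarrow> 'a) \<Rightarrow> 'a::complex_algebra set"
  where "Aminus n q g = subalgebra_gen {Wel q g i j | i j. i \<in> {1..n} \<and> j \<in> {1..n}}"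

definition multi_indices :: "nat \<Rightarrow> (nat \<times> nat \<Rightarrow> nat) set"
  where "multi_indices n = {a. \<forall>p. p \<notin> {1..n} \<times> {1..n} \<longrightarrow> a p = 0}"

text \<open>The ordered monomial \<open>X\<^sub>1\<^sub>1^a\<^sub>1\<^sub>1 X\<^sub>2\<^sub>1^a\<^sub>2\<^sub>1 \<dots> X\<^sub>n\<^sub>1^a\<^sub>n\<^sub>1 X\<^sub>1\<^sub>2^a\<^sub>1\<^sub>2 \<dots> X\<^sub>n\<^sub>n^a\<^sub>n\<^sub>n\<close>.\<close>

definition ordered_monomial ::
    "nat \<Rightarrow> (nat \<Rightarrow> nat \<Rightarrow> 'a) \<Rightarrow> (nat \<times> nat \<Rightarrow> nat) \<Rightarrow> 'a::complex_algebra"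
  where "ordered_monomial n X a =
    prod_list [X i j ^ a (i, j). j \<leftarrow> [1..<Suc n], i \<leftarrow> [1..<Suc n]]"

section \<open>Quantized differential operators\<close>

definition qint :: "complex \<Rightarrow> nat \<Rightarrow> complex"
  where "qint q a = (q ^ a - inverse q ^ a) / (q - inverse q)"

definition qfact :: "complex \<Rightarrow> nat \<Rightarrow> complex"
  where "qfact q a = (\<Prod>k=1..a. qint q k)"

definition M_op :: "nat \<Rightarrow> complex \<Rightarrow> (gen \<Rightarrow> 'a) \<Rightarrow> nat \<Rightarrow> nat \<Rightarrow> 'a \<Rightarrow> 'a::complex_algebra"
  where "M_op n q g i j = (THE T. T \<in> operators_on (Aplus n q g) \<and>
    (\<forall>a\<in>multi_indices n. T (ordered_monomial n (Zel q g) a) =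
      ordered_monomial n (Zel q g) (a((i, j) := a (i, j) + 1))))"

text \<open>For \<open>a (i, j) = 0\<close> the coefficient vanishes and the truncated subtraction is harmless.\<close>

definition D_op :: "nat \<Rightarrow> complex \<Rightarrow> (gen \<Rightarrow> 'a) \<Rightarrow> nat \<Rightarrow> nat \<Rightarrow> 'a \<Rightarrow> 'a::complex_algebra"
  where "D_op n q g i j = (THE T. T \<in> operators_on (Aplus n q g) \<and>
    (\<forall>a\<in>multi_indices n. T (ordered_monomial n (Zel q g) a) =
      qint q (a (i, j)) *\<^sub>C ordered_monomial n (Zel q g) (a((i, j) := a (i, j) - 1))))"

definition Weyl :: "nat \<Rightarrow> complex \<Rightarrow> (gen \<Rightarrow> 'a) \<Rightarrow> ('a \<Rightarrow> 'a::complex_algebra) set"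
  where "Weyl n q g = operator_algebra (Aplus n q g)
    ({M_op n q g i j | i j. i \<in> {1..n} \<and> j \<in> {1..n}} \<union>
     {D_op n q g i j | i j. i \<in> {1..n} \<and> j \<in> {1..n}})"

definition pairing :: "nat \<Rightarrow> complex \<Rightarrow> (gen \<Rightarrow> 'a) \<Rightarrow> 'a \<Rightarrow> 'a::complex_algebra \<Rightarrow> complex"
  where "pairing n q g = (THE B.
    (\<forall>w z. w \<notin> Aminus n q g \<or> z \<notin> Aplus n q g \<longrightarrow> B w z = 0) \<and>
    (\<forall>w\<in>Aminus n q g. \<forall>w'\<in>Aminus n q g. \<forall>z\<in>Aplus n q g. B (w + w') z = B w z + B w' z) \<and>
    (\<forall>w\<in>Aminus n q g. \<forall>z\<in>Aplus n q g. \<forall>z'\<in>Aplus n q g. B w (z + z') = B w z + B w z') \<and>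
    (\<forall>c. \<forall>w\<in>Aminus n q g. \<forall>z\<in>Aplus n q g. B (c *\<^sub>C w) z = c * B w z \<and> B w (c *\<^sub>C z) = c * B w z) \<and>
    (\<forall>a\<in>multi_indices n. \<forall>b\<in>multi_indices n.
      B (ordered_monomial n (Wel q g) b) (ordered_monomial n (Zel q g) a) =
      (if a = b
       then (- 1 / (q - inverse q)) ^ (\<Sum>p\<in>{1..n} \<times> {1..n}. a p) *
         (\<Prod>p\<in>{1..n} \<times> {1..n}. qfact q (a p))
       else 0)))"

definition adjoint_L :: "nat \<Rightarrow> complex \<Rightarrow> (gen \<Rightarrow> 'a) \<Rightarrow> ('a \<Rightarrow> 'a) \<Rightarrow> 'a \<Rightarrow> 'a::complex_algebra"
  where "adjoint_L n q g T = (THE T'. T' \<in> operators_on (Aplus n q g) \<and>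
    (\<forall>w\<in>Aminus n q g. \<forall>u\<in>Aplus n q g. pairing n q g (T w) u = pairing n q g w (T' u)))"

definition D_L_R :: "nat \<Rightarrow> complex \<Rightarrow> (gen \<Rightarrow> 'a) \<Rightarrow> ('a \<Rightarrow> 'a::complex_algebra) set"
  where "D_L_R n q g = operator_algebra (Aplus n q g)
    ({adjoint_L n q g (right_mult (Aminus n q g) (Wel q g i j)) | i j. i \<in> {1..n} \<and> j \<in> {1..n}} \<union>
     {right_mult (Aplus n q g) (Zel q g i j) | i j. i \<in> {1..n} \<and> j \<in> {1..n}} \<union>
     {left_mult (Aplus n q g) (Zel q g i j) | i j. i \<in> {1..n} \<and> j \<in> {1..n}})"

definition D_L_L :: "nat \<Rightarrow> complex \<Rightarrow> (gen \<Rightarrow> 'a) \<Rightarrow> ('a \<Rightarrow> 'a::complex_algebra) set"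
  where "D_L_L n q g = operator_algebra (Aplus n q g)
    ({adjoint_L n q g (left_mult (Aminus n q g) (Wel q g i j)) | i j. i \<in> {1..n} \<and> j \<in> {1..n}} \<union>
     {right_mult (Aplus n q g) (Zel q g i j) | i j. i \<in> {1..n} \<and> j \<in> {1..n}} \<union>
     {left_mult (Aplus n q g) (Zel q g i j) | i j. i \<in> {1..n} \<and> j \<in> {1..n}})"

section \<open>The modules\<close>

definition Uk :: "nat \<Rightarrow> (gen \<Rightarrow> 'a) \<Rightarrow> 'a::complex_algebra set"
  where "Uk n g = subalgebra_gen
    (g ` (GenK ` simple_roots n \<union> GenKinv ` simple_roots n \<union>
          GenE ` (simple_roots n - {Beta}) \<union> GenF ` (simple_roots n - {Beta})))"

text \<open>The underlying space of the finite-dimensional module is \<open>complex ^ 'd\<close>; the values of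
  \<open>\<rho>\<close> outside \<open>Uk n g\<close> are irrelevant.\<close>

definition Uk_rep :: "nat \<Rightarrow> (gen \<Rightarrow> 'a) \<Rightarrow> ('a::complex_algebra \<Rightarrow> complex ^ 'd ^ 'd) \<Rightarrow> bool"
  where "Uk_rep n g \<rho> \<longleftrightarrow>
    \<rho> 1 = mat 1 \<and>
    (\<forall>x\<in>Uk n g. \<forall>y\<in>Uk n g. \<rho> (x + y) = \<rho> x + \<rho> y \<and> \<rho> (x * y) = \<rho> x ** \<rho> y) \<and>
    (\<forall>c. \<forall>x\<in>Uk n g. \<rho> (c *\<^sub>C x) = (\<chi> i j. c * \<rho> x $ i $ j))"

definition irreducible_rep ::
    "nat \<Rightarrow> (gen \<Rightarrow> 'a) \<Rightarrow> ('a::complex_algebra \<Rightarrow> complex ^ 'd ^ 'd) \<Rightarrow> bool"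
  where "irreducible_rep n g \<rho> \<longleftrightarrow>
    (\<forall>S. vec.subspace S \<and> (\<forall>x\<in>Uk n g. \<forall>v\<in>S. \<rho> x *v v \<in> S) \<longrightarrow> S = {0} \<or> S = UNIV)"

text \<open>\<open>l\<close> is a logarithm of \<open>q\<close>; it fixes the value \<open>exp (lam * l)\<close> of \<open>q ^ lam\<close>.\<close>

definition highest_weight_vector ::
    "nat \<Rightarrow> complex \<Rightarrow> (gen \<Rightarrow> 'a) \<Rightarrow> ('a::complex_algebra \<Rightarrow> complex ^ 'd ^ 'd) \<Rightarrow>
     (nat \<Rightarrow> nat) \<Rightarrow> (nat \<Rightarrow> nat) \<Rightarrow> real \<Rightarrow> complex \<Rightarrow> complex ^ 'd \<Rightarrow> bool"
  where "highest_weight_vector n q g \<rho> lam_mu lam_nu lam l v \<longleftrightarrow>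
    v \<noteq> 0 \<and>
    (\<forall>\<alpha>\<in>simple_roots n - {Beta}. \<rho> (g (GenE \<alpha>)) *v v = 0) \<and>
    (\<forall>i\<in>{1..<n}. \<rho> (g (GenK (Mu i))) *v v = q ^ lam_mu i *s v) \<and>
    (\<forall>i\<in>{1..<n}. \<rho> (g (GenK (Nu i))) *v v = q ^ lam_nu i *s v) \<and>
    exp l = q \<and> \<rho> (g (GenK Beta)) *v v = exp (of_real lam * l) *s v"

text \<open>For a subspace \<open>A\<close> of \<open>'a\<close>, the tensor products of \<open>A\<close> with \<open>V = complex ^ 'd\<close> and with
  the dual space of \<open>V\<close> are both realized as the vectors in \<open>'a ^ 'd\<close> with entries in \<open>A\<close>, via
  the standard basis of \<open>V\<close> and its dual basis.\<close>

definition tensor_space :: "'a::complex_algebra set \<Rightarrow> ('a ^ 'd) set"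
  where "tensor_space A = {\<eta>. \<forall>i. \<eta> $ i \<in> A}"

definition tensor :: "'a::complex_algebra \<Rightarrow> complex ^ 'd \<Rightarrow> 'a ^ 'd"  (infixr "\<otimes>\<^sub>C" 70)
  where "a \<otimes>\<^sub>C v = (\<chi> i. (v $ i) *\<^sub>C a)"

text \<open>The kernel of the projection from \<open>U \<otimes> V\<close> onto the tensor product of \<open>U\<close> and \<open>V\<close>
  over the subalgebra generated by \<open>Uk n g\<close> and the \<open>Z\<^sub>i\<^sub>j\<close>, which act on \<open>V\<close> by \<open>0\<close>.\<close>

definition balancing :: "nat \<Rightarrow> complex \<Rightarrow> (gen \<Rightarrow> 'a::complex_algebra) \<Rightarrow>
    ('a \<Rightarrow> complex ^ 'd ^ 'd) \<Rightarrow> ('a ^ 'd) set"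
  where "balancing n q g \<rho> = cvs.span
    ({(u * x) \<otimes>\<^sub>C v - u \<otimes>\<^sub>C (\<rho> x *v v) | u x v. x \<in> Uk n g} \<union>
     {(u * Zel q g i j) \<otimes>\<^sub>C v | u i j v. i \<in> {1..n} \<and> j \<in> {1..n}})"

text \<open>The left action of \<open>u\<close> on the generalized Verma module, transported to \<open>Aminus \<otimes> V\<close>,
  whose elements represent the classes modulo \<open>balancing\<close>. The operation \<open>*s\<close> is left
  multiplication on the first tensor factor.\<close>

definition L_action :: "nat \<Rightarrow> complex \<Rightarrow> (gen \<Rightarrow> 'a) \<Rightarrow> ('a \<Rightarrow> complex ^ 'd ^ 'd) \<Rightarrow> 'a \<Rightarrow>
    'a ^ 'd \<Rightarrow> 'a::complex_algebra ^ 'd"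
  where "L_action n q g \<rho> u = (\<lambda>\<eta>\<in>tensor_space (Aminus n q g).
    THE \<eta>'. \<eta>' \<in> tensor_space (Aminus n q g) \<and> u *s \<eta> - \<eta>' \<in> balancing n q g \<rho>)"

text \<open>On elementary tensors this is the product of \<open>pairing\<close> and the canonical pairing of \<open>V\<close>
  with its dual.\<close>

definition tensor_pairing ::
    "nat \<Rightarrow> complex \<Rightarrow> (gen \<Rightarrow> 'a) \<Rightarrow> 'a ^ 'd \<Rightarrow> 'a::complex_algebra ^ 'd \<Rightarrow> complex"
  where "tensor_pairing n q g \<eta> \<xi> = (\<Sum>i\<in>UNIV. pairing n q g (\<eta> $ i) (\<xi> $ i))"

definition O_L :: "nat \<Rightarrow> complex \<Rightarrow> (gen \<Rightarrow> 'a) \<Rightarrow> ('a \<Rightarrow> complex ^ 'd ^ 'd) \<Rightarrow> 'a \<Rightarrow>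
    'a ^ 'd \<Rightarrow> 'a::complex_algebra ^ 'd"
  where "O_L n q g \<rho> u = (THE T. T \<in> operators_on (tensor_space (Aplus n q g)) \<and>
    (\<forall>\<eta>\<in>tensor_space (Aminus n q g). \<forall>\<xi>\<in>tensor_space (Aplus n q g).
      tensor_pairing n q g \<eta> (T \<xi>) =
      tensor_pairing n q g (L_action n q g \<rho> (antipode n g u) \<eta>) \<xi>))"

text \<open>The operator \<open>D \<otimes> \<phi>\<close>, where \<open>\<phi>\<close> is an endomorphism of the dual space of \<open>V\<close>, given by its
  matrix in the dual basis.\<close>

definition tensor_op :: "'a set \<Rightarrow> ('a \<Rightarrow> 'a) \<Rightarrow> complex ^ 'd ^ 'd \<Rightarrow>
    'a ^ 'd \<Rightarrow> 'a::complex_algebra ^ 'd"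
  where "tensor_op A D \<phi> =
    (\<lambda>\<xi>\<in>tensor_space A. \<chi> i. \<Sum>j\<in>UNIV. (\<phi> $ i $ j) *\<^sub>C D (\<xi> $ j))"

inductive_set Weyl_tensor_End ::
    "nat \<Rightarrow> complex \<Rightarrow> (gen \<Rightarrow> 'a) \<Rightarrow> ('a ^ 'd \<Rightarrow> 'a::complex_algebra ^ 'd) set"
  for n q g where
  elementary: "D \<in> Weyl n q g \<Longrightarrow> tensor_op (Aplus n q g) D \<phi> \<in> Weyl_tensor_End n q g"
| add: "S \<in> Weyl_tensor_End n q g \<Longrightarrow> T \<in> Weyl_tensor_End n q g \<Longrightarrow>
    (\<lambda>\<xi>\<in>tensor_space (Aplus n q g). S \<xi> + T \<xi>) \<in> Weyl_tensor_End n q g"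

end

theory Submission
  imports Defs
begin

text \<open>The \<open>Z\<^sub>i\<^sub>j\<close> and the rescaled \<open>W\<^sub>i\<^sub>j\<close> are iterated \<open>q\<close>-commutators of Chevalley generators, and the Serre
  relations make each family a quantum matrix. On ordered monomials, multiplication by a generator is
  therefore \<open>H\<close> composed with the corresponding \<open>M\<^sup>o\<close>, plus an operator built from \<open>M\<^sup>o\<close> and \<open>D\<^sup>o\<close> at
  earlier positions, with \<open>H\<close> an invertible operator of the same kind. Solving this triangular system
  for \<open>M\<^sup>o\<close>, and the adjoint system for \<open>D\<^sup>o\<close>, identifies all three operator algebras.

  For the second part, moving a generator \<open>u\<close> of \<open>U\<close> through an ordered monomial gives
  \<open>u w = \<Sum> D(w) x\<close> for \<open>w\<close> in \<open>A\<^sup>-\<close>, with \<open>D\<close> in the Weyl algebra and \<open>x\<close> in the subalgebra \<open>P\<close> generated by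
  \<open>E\<^sub>\<beta>\<close> and the generators of \<open>U(k)\<close>; \<open>x\<close> then acts on \<open>V\<close>, and adjoints of such \<open>D\<close> are again in the Weyl
  algebra. All these operators are well defined because the monomials \<open>W\<^sup>a\<close> are free over \<open>P\<close>. This is seen in
  the semi-infinite Fock representation, tensored with the regular one: its vacuum detects \<open>P\<close> and its
  one-particle excitations detect the \<open>W\<^sub>i\<^sub>j\<close>.\<close>

text \<open>Most objects of the statement are definite descriptions, so existence and uniqueness
  come first: hence linear independence of the monomials and freeness over \<open>P\<close> precede
  all else. Both come from one representation. In its Fock factor a site is empty or full, so every
  word of a Serre polynomial acts by zero; the regular factor keeps coefficients in \<open>U\<close>
  itself, so that the vacuum entry of an element of \<open>P\<close> still determines it.
  One-particle entries act as a twisted derivation, which lowers the exponent of the last letter of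
  a monomial.

  The invertible \<open>H\<close> are products of powers \<open>q^(m a_p)\<close>; these lie in the
  Weyl algebra because \<open>D M - q^(-1) M D = q^(a_p)\<close> in a single variable. Pushing an
  element through a power of a letter must produce coefficients \<open>q^(m (a - 1)) [a]\<close>
  only. This shapes the commutation lemmas: the weight of the error term past the letter must differ
  by exactly two from that of the pushed element.

  Adjoints stay in the Weyl algebra because raising one exponent multiplies the norm of a monomial
  by \<open>- [a + 1] / (q - q^(-1))\<close>, so that \<open>M\<close> is adjoint to a multiple of
  \<open>D\<close>.\<close>

lemma scaleC_minus1 [simp]: "(-1) *\<^sub>C x = - (x::'a::complex_module)"
  using cvs.scale_minus_left[of 1 x] by (simp add: scaleC_one)

declare scaleC_one [simp]

lemma scaleC_0_left [simp]: "0 *\<^sub>C x = (0::'a::complex_module)"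
  by (rule cvs.scale_zero_left)

lemma scaleC_0_right [simp]: "c *\<^sub>C 0 = (0::'a::complex_module)"
  by (rule cvs.scale_zero_right)

lemma scaleC_minus_right: "c *\<^sub>C (- x) = - (c *\<^sub>C (x::'a::complex_module))"
  by (rule cvs.scale_minus_right)

lemma scaleC_diff_right: "c *\<^sub>C (x - y) = c *\<^sub>C x - c *\<^sub>C (y::'a::complex_module)"
  by (rule cvs.scale_right_diff_distrib)

lemma scaleC_diff_left: "(b - c) *\<^sub>C x = b *\<^sub>C x - c *\<^sub>C (x::'a::complex_module)"
  by (rule cvs.scale_left_diff_distrib)

lemmas scaleC_mult = mult_scaleC_left mult_scaleC_right
lemmas scaleC_ring = scaleC_mult scaleC_scaleC scaleC_add_right scaleC_diff_right scaleC_minus_right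

section \<open>Homomorphisms out of presented algebras\<close>

lemma alg_cong_sound:
  assumes "alg_cong R s t" and "\<forall>(s, t)\<in>R. eval_aterm h s = eval_aterm h t"
  shows "eval_aterm h s = eval_aterm h t"
  using assms(1)
proof induction
  case (rel s t)
  then show ?case using assms(2) by auto
qed (auto simp: algebra_simps scaleC_mult scaleC_scaleC scaleC_add_left)

text \<open>Evaluates some term that represents \<open>x\<close>. Once \<open>h\<close> satisfies
  the relations the choice is immaterial, because terms with equal value under \<open>g\<close> are
  congruent.\<close>

definition presented_hom ::
    "'g set \<Rightarrow> ('g \<Rightarrow> 'a) \<Rightarrow> ('g \<Rightarrow> 'b) \<Rightarrow> 'a::complex_algebra \<Rightarrow> 'b::complex_algebra"
  where "presented_hom G g h x = eval_aterm h (SOME t. letters t \<subseteq> G \<and> eval_aterm g t = x)"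

locale alg_hom =
  fixes \<phi> :: "'a::complex_algebra \<Rightarrow> 'b::complex_algebra"
  assumes add: "\<phi> (x + y) = \<phi> x + \<phi> y"
    and mult: "\<phi> (x * y) = \<phi> x * \<phi> y"
    and one: "\<phi> 1 = 1"
    and scale: "\<phi> (c *\<^sub>C x) = c *\<^sub>C \<phi> x"
begin

lemma zero: "\<phi> 0 = 0"
  using add[of 0 0] by simp

lemma minus: "\<phi> (- x) = - \<phi> x"
  using add[of "- x" x] zero by (simp add: eq_neg_iff_add_eq_0)

lemma diff: "\<phi> (x - y) = \<phi> x - \<phi> y"
  using add[of x "- y"] minus by simp

lemma sum: "\<phi> (sum f A) = (\<Sum>x\<in>A. \<phi> (f x))"
  by (induction A rule: infinite_finite_induct) (simp_all add: zero add)

lemma power: "\<phi> (x ^ k) = \<phi> x ^ k"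
  by (induction k) (simp_all add: one mult)

end

lemma presented_hom_eval:
  assumes "presented_by G R g" and "\<forall>(s, t)\<in>R. eval_aterm h s = eval_aterm h t"
    and "letters t \<subseteq> G"
  shows "presented_hom G g h (eval_aterm g t) = eval_aterm h t"
proof -
  define s where "s = (SOME s. letters s \<subseteq> G \<and> eval_aterm g s = eval_aterm g t)"
  have s: "letters s \<subseteq> G \<and> eval_aterm g s = eval_aterm g t"
    unfolding s_def by (rule someI[of _ t]) (use assms(3) in simp)
  then have "alg_cong R s t"
    using assms(1,3) unfolding presented_by_def by blast
  then show ?thesis
    using alg_cong_sound[OF _ assms(2)] unfolding presented_hom_def s_def by auto
qed

lemma presented_hom:
  fixes g :: "'g \<Rightarrow> 'a::complex_algebra" and h :: "'g \<Rightarrow> 'b::complex_algebra"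
  assumes "presented_by G R g" and "\<forall>(s, t)\<in>R. eval_aterm h s = eval_aterm h t"
  shows "alg_hom (presented_hom G g h)" and "x \<in> G \<Longrightarrow> presented_hom G g h (g x) = h x"
proof -
  note ev = presented_hom_eval[OF assms]
  have ex: "\<exists>t. letters t \<subseteq> G \<and> eval_aterm g t = x" for x :: 'a
    using assms(1) unfolding presented_by_def by blast
  show "alg_hom (presented_hom G g h)"
  proof
    fix x y :: 'a and c :: complex
    obtain s t where st: "letters s \<subseteq> G" "eval_aterm g s = x" "letters t \<subseteq> G" "eval_aterm g t = y"
      using ex by metis
    show "presented_hom G g h (x + y) = presented_hom G g h x + presented_hom G g h y"
      using ev[of "s \<oplus> t"] ev[of s] ev[of t] st by simp
    show "presented_hom G g h (x * y) = presented_hom G g h x * presented_hom G g h y"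
      using ev[of "s \<odot> t"] ev[of s] ev[of t] st by simp
    show "presented_hom G g h (c *\<^sub>C x) = c *\<^sub>C presented_hom G g h x"
      using ev[of "Cst c \<odot> s"] ev[of s] st by (simp add: scaleC_mult)
    show "presented_hom G g h 1 = 1"
      using ev[of "Cst 1"] by simp
  qed
  show "presented_hom G g h (g x) = h x" if "x \<in> G"
    using ev[of "Gen x"] that by simp
qed

lemma presented_induct [consumes 1, case_names gen cst add mult]:
  assumes "presented_by G R g"
    and "\<And>x. x \<in> G \<Longrightarrow> P (g x)" and "\<And>c. P (c *\<^sub>C 1)"
    and "\<And>x y. P x \<Longrightarrow> P y \<Longrightarrow> P (x + y)" and "\<And>x y. P x \<Longrightarrow> P y \<Longrightarrow> P (x * y)"
  shows "P x"
proof -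
  obtain t where t: "letters t \<subseteq> G" "eval_aterm g t = x"
    using assms(1) unfolding presented_by_def by blast
  have "P (eval_aterm g t)" using t(1)
    by (induction t) (use assms in auto)
  then show ?thesis using t by simp
qed

section \<open>Endomorphisms of free right modules\<close>

text \<open>The target of all representations below. Commuting with right multiplication leaves the
  left side of each entry to the regular representation, and it already gives complex linearity,
  since \<open>c *\<^sub>C x = x * (c *\<^sub>C 1)\<close>.\<close>

typedef (overloaded) ('s, 'a) rend = "{T :: ('s \<Rightarrow> 'a::complex_algebra) \<Rightarrow> 's \<Rightarrow> 'a.
    (\<forall>f g. T (\<lambda>s. f s + g s) = (\<lambda>s. T f s + T g s)) \<and> (\<forall>f x. T (\<lambda>s. f s * x) = (\<lambda>s. T f s * x))}"
  morphisms app Rend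
  by (rule exI[of _ id]) simp

setup_lifting type_definition_rend

lemma rend_scaleC:
  assumes "\<And>f x. T (\<lambda>s. f s * x) = (\<lambda>s. T f s * (x::'a::complex_algebra))"
  shows "T (\<lambda>s. c *\<^sub>C f s) = (\<lambda>s. c *\<^sub>C T f s)"
  using assms[of f "c *\<^sub>C 1"] by (simp add: scaleC_mult)

instantiation rend :: (type, complex_algebra) complex_algebra
begin

lift_definition zero_rend :: "('a, 'b) rend" is "\<lambda>f s. 0" by simp
lift_definition one_rend :: "('a, 'b) rend" is "\<lambda>f. f" by simp
lift_definition plus_rend :: "('a, 'b) rend \<Rightarrow> ('a, 'b) rend \<Rightarrow> ('a, 'b) rend"
  is "\<lambda>S T f s. S f s + T f s" by (auto simp: fun_eq_iff algebra_simps)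
lift_definition minus_rend :: "('a, 'b) rend \<Rightarrow> ('a, 'b) rend \<Rightarrow> ('a, 'b) rend"
  is "\<lambda>S T f s. S f s - T f s" by (auto simp: fun_eq_iff algebra_simps)
lift_definition uminus_rend :: "('a, 'b) rend \<Rightarrow> ('a, 'b) rend"
  is "\<lambda>S f s. - S f s" by (auto simp: fun_eq_iff algebra_simps)
lift_definition times_rend :: "('a, 'b) rend \<Rightarrow> ('a, 'b) rend \<Rightarrow> ('a, 'b) rend"
  is "\<lambda>S T f. S (T f)" by auto
lift_definition scaleC_rend :: "complex \<Rightarrow> ('a, 'b) rend \<Rightarrow> ('a, 'b) rend"
  is "\<lambda>c T f s. c *\<^sub>C T f s" by (auto simp: fun_eq_iff algebra_simps scaleC_ring)

instance
proof
  show "(0 :: ('a, 'b) rend) \<noteq> 1"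
  proof transfer
    have "(\<lambda>f s. 0 :: 'b) (\<lambda>_. 1) undefined \<noteq> (\<lambda>f. f) (\<lambda>_. 1 :: 'b) (undefined :: 'a)" by simp
    then show "(\<lambda>(f :: 'a \<Rightarrow> 'b) (s :: 'a). 0 :: 'b) \<noteq> (\<lambda>f. f)" by metis
  qed
  show "S * (c *\<^sub>C T) = c *\<^sub>C (S * T)" for S T :: "('a, 'b) rend" and c
    by transfer (auto simp: rend_scaleC)
  show "S * (T + U) = S * T + S * U" for S T U :: "('a, 'b) rend"
    by transfer auto
qed (transfer; auto simp: scaleC_ring scaleC_add_left fun_eq_iff algebra_simps)+

end

lemmas app_simps = zero_rend.rep_eq one_rend.rep_eq plus_rend.rep_eq minus_rend.rep_eq
  uminus_rend.rep_eq times_rend.rep_eq scaleC_rend.rep_eq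

lemma app_add: "app T (\<lambda>s. f s + g s) = (\<lambda>s. app T f s + app T g s)"
  using app[of T] by auto

lemma app_right: "app T (\<lambda>s. f s * x) = (\<lambda>s. app T f s * x)"
  using app[of T] by auto

lemma app_sum: "app (sum T A) f s = (\<Sum>x\<in>A. app (T x) f s)"
  by (induction A rule: infinite_finite_induct) (simp_all add: app_simps)

section \<open>The defining relations\<close>

text \<open>The relations as a property of four families in any algebra. Instances are the
  generators themselves, the generators with \<open>E\<close> and \<open>F\<close> exchanged, their
  rescalings, the Fock operators and coproducts of two instances.\<close>

locale uq_algebra =
  fixes n :: nat and q :: complex and E F K Ki :: "root \<Rightarrow> 'b::complex_algebra"
  assumes K_Ki: "\<alpha> \<in> simple_roots n \<Longrightarrow> K \<alpha> * Ki \<alpha> = 1"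
    and Ki_K: "\<alpha> \<in> simple_roots n \<Longrightarrow> Ki \<alpha> * K \<alpha> = 1"
    and K_K: "\<alpha> \<in> simple_roots n \<Longrightarrow> \<gamma> \<in> simple_roots n \<Longrightarrow> K \<alpha> * K \<gamma> = K \<gamma> * K \<alpha>"
    and K_E_Ki: "\<alpha> \<in> simple_roots n \<Longrightarrow> \<gamma> \<in> simple_roots n \<Longrightarrow>
      K \<alpha> * E \<gamma> * Ki \<alpha> = q powi root_form \<alpha> \<gamma> *\<^sub>C E \<gamma>"
    and K_F_Ki: "\<alpha> \<in> simple_roots n \<Longrightarrow> \<gamma> \<in> simple_roots n \<Longrightarrow>
      K \<alpha> * F \<gamma> * Ki \<alpha> = q powi (- root_form \<alpha> \<gamma>) *\<^sub>C F \<gamma>"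
    and E_F: "\<alpha> \<in> simple_roots n \<Longrightarrow> \<gamma> \<in> simple_roots n \<Longrightarrow>
      E \<alpha> * F \<gamma> - F \<gamma> * E \<alpha> = (if \<alpha> = \<gamma> then (1 / (q - inverse q)) *\<^sub>C (K \<alpha> - Ki \<alpha>) else 0)"
    and serre_E: "\<alpha> \<in> simple_roots n \<Longrightarrow> \<gamma> \<in> simple_roots n \<Longrightarrow> root_form \<alpha> \<gamma> = -1 \<Longrightarrow>
      E \<alpha> * E \<alpha> * E \<gamma> - (q + inverse q) *\<^sub>C (E \<alpha> * E \<gamma> * E \<alpha>) + E \<gamma> * E \<alpha> * E \<alpha> = 0"
    and serre_F: "\<alpha> \<in> simple_roots n \<Longrightarrow> \<gamma> \<in> simple_roots n \<Longrightarrow> root_form \<alpha> \<gamma> = -1 \<Longrightarrow>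
      F \<alpha> * F \<alpha> * F \<gamma> - (q + inverse q) *\<^sub>C (F \<alpha> * F \<gamma> * F \<alpha>) + F \<gamma> * F \<alpha> * F \<alpha> = 0"
    and E_E: "\<alpha> \<in> simple_roots n \<Longrightarrow> \<gamma> \<in> simple_roots n \<Longrightarrow> root_form \<alpha> \<gamma> = 0 \<Longrightarrow>
      E \<alpha> * E \<gamma> = E \<gamma> * E \<alpha>"
    and F_F: "\<alpha> \<in> simple_roots n \<Longrightarrow> \<gamma> \<in> simple_roots n \<Longrightarrow> root_form \<alpha> \<gamma> = 0 \<Longrightarrow>
      F \<alpha> * F \<gamma> = F \<gamma> * F \<alpha>"

lemma eval_Sub [simp]: "eval_aterm h (s \<ominus> t) = eval_aterm h s - eval_aterm h t"
  by (simp add: scaleC_mult)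

lemma eval_serre: "eval_aterm h (serre q s t) =
    eval_aterm h s * eval_aterm h s * eval_aterm h t -
    (q + inverse q) *\<^sub>C (eval_aterm h s * eval_aterm h t * eval_aterm h s) +
    eval_aterm h t * eval_aterm h s * eval_aterm h s"
  unfolding serre_def
  by (simp add: scaleC_mult scaleC_scaleC scaleC_add_left scaleC_diff_left algebra_simps
      cvs.scale_minus_left)

lemma uq_algebra_iff:
  "uq_algebra n q (\<lambda>\<alpha>. h (GenE \<alpha>)) (\<lambda>\<alpha>. h (GenF \<alpha>)) (\<lambda>\<alpha>. h (GenK \<alpha>)) (\<lambda>\<alpha>. h (GenKinv \<alpha>)) \<longleftrightarrow>
   (\<forall>(s, t)\<in>Uq_relations n q. eval_aterm h s = eval_aterm h t)" (is "?A = ?B")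
proof
  assume ?A
  then interpret uq_algebra n q "\<lambda>\<alpha>. h (GenE \<alpha>)" "\<lambda>\<alpha>. h (GenF \<alpha>)" "\<lambda>\<alpha>. h (GenK \<alpha>)" "\<lambda>\<alpha>. h (GenKinv \<alpha>)" .
  show ?B
    unfolding Uq_relations_def ball_Un
    apply (intro conjI)
    subgoal by (simp add: K_Ki Ki_K)
    subgoal
      apply (intro ballI)
      apply (erule UN_E)+
      apply (elim insertE emptyE)
      apply (simp_all only: prod.case)
         apply (simp add: K_K)
        apply (simp add: K_E_Ki scaleC_mult)
       apply (simp add: K_F_Ki scaleC_mult)
      apply (subst eval_Sub)
      apply (simp add: E_F scaleC_mult)
      done
    subgoal by (auto simp: eval_serre serre_E)
    subgoal by (auto simp: eval_serre serre_F)
    subgoal by (auto intro: E_E)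
    subgoal by (auto intro: F_F)
    done
next
  assume B: ?B
  have *: "eval_aterm h s = eval_aterm h t" if "(s, t) \<in> Uq_relations n q" for s t
    using B that by auto
  show ?A
  proof
    fix \<alpha> \<gamma> :: root assume a: "\<alpha> \<in> simple_roots n" and c: "\<gamma> \<in> simple_roots n"
    have in_rel:
      "(tK \<alpha> \<odot> tKinv \<alpha>, Cst 1) \<in> Uq_relations n q"
      "(tKinv \<alpha> \<odot> tK \<alpha>, Cst 1) \<in> Uq_relations n q"
      "(tK \<alpha> \<odot> tK \<gamma>, tK \<gamma> \<odot> tK \<alpha>) \<in> Uq_relations n q"
      "(tK \<alpha> \<odot> tE \<gamma> \<odot> tKinv \<alpha>, Cst (q powi root_form \<alpha> \<gamma>) \<odot> tE \<gamma>) \<in> Uq_relations n q"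
      "(tK \<alpha> \<odot> tF \<gamma> \<odot> tKinv \<alpha>, Cst (q powi (- root_form \<alpha> \<gamma>)) \<odot> tF \<gamma>) \<in> Uq_relations n q"
      "(tE \<alpha> \<odot> tF \<gamma> \<ominus> tF \<gamma> \<odot> tE \<alpha>,
        if \<alpha> = \<gamma> then Cst (1 / (q - inverse q)) \<odot> (tK \<alpha> \<ominus> tKinv \<alpha>) else Cst 0) \<in> Uq_relations n q"
      "root_form \<alpha> \<gamma> = -1 \<Longrightarrow> (serre q (tE \<alpha>) (tE \<gamma>), Cst 0) \<in> Uq_relations n q"
      "root_form \<alpha> \<gamma> = -1 \<Longrightarrow> (serre q (tF \<alpha>) (tF \<gamma>), Cst 0) \<in> Uq_relations n q"
      "root_form \<alpha> \<gamma> = 0 \<Longrightarrow> (tE \<alpha> \<odot> tE \<gamma>, tE \<gamma> \<odot> tE \<alpha>) \<in> Uq_relations n q"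
      "root_form \<alpha> \<gamma> = 0 \<Longrightarrow> (tF \<alpha> \<odot> tF \<gamma>, tF \<gamma> \<odot> tF \<alpha>) \<in> Uq_relations n q"
      unfolding Uq_relations_def
      subgoal using a by (intro UnI1[OF UnI1[OF UnI1[OF UnI1[OF UnI1]]]] UN_I[of \<alpha>]) simp_all
      subgoal using a by (intro UnI1[OF UnI1[OF UnI1[OF UnI1[OF UnI1]]]] UN_I[of \<alpha>]) simp_all
      subgoal using a c by (intro UnI1[OF UnI1[OF UnI1[OF UnI1[OF UnI2]]]] UN_I[of \<alpha>] UN_I[of \<gamma>]) simp_all
      subgoal using a c by (intro UnI1[OF UnI1[OF UnI1[OF UnI1[OF UnI2]]]] UN_I[of \<alpha>] UN_I[of \<gamma>]) simp_all
      subgoal using a c by (intro UnI1[OF UnI1[OF UnI1[OF UnI1[OF UnI2]]]] UN_I[of \<alpha>] UN_I[of \<gamma>]) simp_all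
      subgoal using a c by (intro UnI1[OF UnI1[OF UnI1[OF UnI1[OF UnI2]]]] UN_I[of \<alpha>] UN_I[of \<gamma>] insertI2 singletonI)
      subgoal using a c by (intro UnI1[OF UnI1[OF UnI1[OF UnI2]]]) blast
      subgoal using a c by (intro UnI1[OF UnI1[OF UnI2]]) blast
      subgoal using a c by (intro UnI1[OF UnI2]) blast
      subgoal using a c by (intro UnI2) blast
      done
    note ev = in_rel[THEN *]
    show "h (GenK \<alpha>) * h (GenKinv \<alpha>) = 1" using ev(1) by simp
    show "h (GenKinv \<alpha>) * h (GenK \<alpha>) = 1" using ev(2) by simp
    show "h (GenK \<alpha>) * h (GenK \<gamma>) = h (GenK \<gamma>) * h (GenK \<alpha>)" using ev(3) by simp
    show "h (GenK \<alpha>) * h (GenE \<gamma>) * h (GenKinv \<alpha>) = q powi root_form \<alpha> \<gamma> *\<^sub>C h (GenE \<gamma>)"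
      using ev(4) by (simp add: scaleC_mult)
    show "h (GenK \<alpha>) * h (GenF \<gamma>) * h (GenKinv \<alpha>) = q powi (- root_form \<alpha> \<gamma>) *\<^sub>C h (GenF \<gamma>)"
      using ev(5) by (simp add: scaleC_mult)
    show "h (GenE \<alpha>) * h (GenF \<gamma>) - h (GenF \<gamma>) * h (GenE \<alpha>) =
        (if \<alpha> = \<gamma> then (1 / (q - inverse q)) *\<^sub>C (h (GenK \<alpha>) - h (GenKinv \<alpha>)) else 0)"
      using ev(6) by (simp add: scaleC_mult split: if_splits)
    show "h (GenE \<alpha>) * h (GenE \<alpha>) * h (GenE \<gamma>) - (q + inverse q) *\<^sub>C (h (GenE \<alpha>) * h (GenE \<gamma>) * h (GenE \<alpha>)) +
        h (GenE \<gamma>) * h (GenE \<alpha>) * h (GenE \<alpha>) = 0" if "root_form \<alpha> \<gamma> = -1"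
      using ev(7)[OF that] by (simp add: eval_serre)
    show "h (GenF \<alpha>) * h (GenF \<alpha>) * h (GenF \<gamma>) - (q + inverse q) *\<^sub>C (h (GenF \<alpha>) * h (GenF \<gamma>) * h (GenF \<alpha>)) +
        h (GenF \<gamma>) * h (GenF \<alpha>) * h (GenF \<alpha>) = 0" if "root_form \<alpha> \<gamma> = -1"
      using ev(8)[OF that] by (simp add: eval_serre)
    show "h (GenE \<alpha>) * h (GenE \<gamma>) = h (GenE \<gamma>) * h (GenE \<alpha>)" if "root_form \<alpha> \<gamma> = 0"
      using ev(9)[OF that] by simp
    show "h (GenF \<alpha>) * h (GenF \<gamma>) = h (GenF \<gamma>) * h (GenF \<alpha>)" if "root_form \<alpha> \<gamma> = 0"
      using ev(10)[OF that] by simp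
  qed
qed

section \<open>Quantum Serre relations\<close>

lemmas scaleC_expand = scaleC_ring scaleC_add_left scaleC_diff_left cvs.scale_minus_left
  ring_distribs mult.assoc

text \<open>The cross relations are those of the two summands of a coproduct, such as
  \<open>e\<close> and \<open>k * E\<close>. Under them all mixed terms of the Serre polynomial
  cancel. Keeping \<open>q\<close> and \<open>r\<close> separate lets the same lemma serve
  \<open>F\<close>, with the two exchanged.\<close>

lemma serre_sum:
  fixes x1 x2 y1 y2 :: "'b::complex_algebra" and q r :: complex
  assumes qr: "q * r = 1"
    and xx: "x2 * x1 = (q * q) *\<^sub>C (x1 * x2)" and xy: "x2 * y1 = r *\<^sub>C (y1 * x2)" and yx: "y2 * x1 = r *\<^sub>C (x1 * y2)"
    and s1: "x1 * x1 * y1 - (q + r) *\<^sub>C (x1 * y1 * x1) + y1 * x1 * x1 = 0"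
    and s2: "x2 * x2 * y2 - (q + r) *\<^sub>C (x2 * y2 * x2) + y2 * x2 * x2 = 0"
  shows "(x1 + x2) * (x1 + x2) * (y1 + y2) - (q + r) *\<^sub>C ((x1 + x2) * (y1 + y2) * (x1 + x2)) +
    (y1 + y2) * (x1 + x2) * (x1 + x2) = 0"
proof -
  have c: "r * q = 1" "q * (r * z) = z" "r * (q * z) = z" for z :: complex
    using qr by (simp_all add: mult.commute mult.left_commute[of _ q] mult.assoc[symmetric])
  have a: "x2 * (x1 * z) = (q * q) *\<^sub>C (x1 * (x2 * z))" "x2 * (y1 * z) = r *\<^sub>C (y1 * (x2 * z))"
    "y2 * (x1 * z) = r *\<^sub>C (x1 * (y2 * z))" for z
    using xx xy yx by (simp_all add: mult.assoc[symmetric] scaleC_mult)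
  have "(x1 + x2) * (x1 + x2) * (y1 + y2) - (q + r) *\<^sub>C ((x1 + x2) * (y1 + y2) * (x1 + x2)) +
    (y1 + y2) * (x1 + x2) * (x1 + x2) =
   (x1 * x1 * y1 - (q + r) *\<^sub>C (x1 * y1 * x1) + y1 * x1 * x1) +
   (x2 * x2 * y2 - (q + r) *\<^sub>C (x2 * y2 * x2) + y2 * x2 * x2)"
    by (simp add: scaleC_expand xx xy yx a qr c algebra_simps)
  then show ?thesis using s1 s2 by simp
qed

text \<open>Here \<open>x\<close> is the middle node of a chain of three and \<open>w\<close> the
  root vector of the whole chain; classically this is \<open>[x, [x', [x, z]]] = 0\<close>.\<close>

lemma bracket_commute:
  fixes x x' z :: "'b::complex_algebra" and q r :: complex
  assumes qr: "q * r = 1" and nz: "q + r \<noteq> 0"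
    and x'z: "x' * z = z * x'"
    and s1: "x * x * x' - (q + r) *\<^sub>C (x * x' * x) + x' * x * x = 0"
    and s2: "x * x * z - (q + r) *\<^sub>C (x * z * x) + z * x * x = 0"
  defines "A \<equiv> x * z - r *\<^sub>C (z * x)"
  defines "w \<equiv> x' * A - r *\<^sub>C (A * x')"
  shows "x * w = w * x"
proof -
  have c: "r * q = 1" "q * (r * z) = z" "r * (q * z) = z" for z :: complex
    using qr by (simp_all add: mult.commute mult.left_commute[of _ q] mult.assoc[symmetric])
  define u where "u = x' * x - r *\<^sub>C (x * x')"
  define B where "B = x * z - q *\<^sub>C (z * x)"
  have xA: "x * A = q *\<^sub>C (A * x)" unfolding A_def
    using s2 by (simp add: scaleC_expand qr c algebra_simps)
  have ux: "u * x = q *\<^sub>C (x * u)" unfolding u_def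
    using s1 by (simp add: scaleC_expand qr c algebra_simps)
  have w: "w = u * z - r *\<^sub>C (z * u)"
    unfolding w_def A_def u_def using x'z
    by (simp add: scaleC_expand qr c algebra_simps) (metis mult.assoc)
  have xA': "x * (A * y) = q *\<^sub>C (A * (x * y))" for y
    using xA by (simp add: mult.assoc[symmetric] scaleC_mult)
  have ux': "u * (x * y) = q *\<^sub>C (x * (u * y))" for y
    using ux by (simp add: mult.assoc[symmetric] scaleC_mult)
  \<comment> \<open>\<open>w\<close> is both a bracket of \<open>x'\<close> with \<open>A\<close>
    and a bracket of \<open>u\<close> with \<open>z\<close>. Moving \<open>x\<close> across each
    form gives one equation; \<open>A\<close> and \<open>B\<close> differ by a multiple of
    \<open>z * x\<close>, so the commutators with \<open>u\<close> can be eliminated, leaving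
    \<open>q + r\<close> times the claim.\<close>
  have 1: "w * x - (r * r) *\<^sub>C (x * w) = r *\<^sub>C (u * A - A * u)"
    unfolding w_def u_def by (simp add: scaleC_expand xA xA' qr c algebra_simps)
  have 2: "x * w - w * x = r *\<^sub>C (u * B - B * u)"
    unfolding w B_def by (simp add: scaleC_expand ux ux' qr c algebra_simps)
  have 3: "(u * B - B * u) = (u * A - A * u) - (q - r) *\<^sub>C (w * x)"
    unfolding w B_def A_def by (simp add: scaleC_expand ux ux' qr c algebra_simps)
  have "q *\<^sub>C (x * w - w * x) = q *\<^sub>C (w * x - (r * r) *\<^sub>C (x * w)) - (q - r) *\<^sub>C (w * x)"
    unfolding 1 2 by (simp add: scaleC_scaleC qr 3)
  then have "(q + r) *\<^sub>C (x * w - w * x) = 0"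
    by (simp add: scaleC_expand qr c algebra_simps)
  then show ?thesis using nz by simp
qed

section \<open>Iterated q-commutators along one arm of the diagram\<close>

definition qbr :: "complex \<Rightarrow> 'b \<Rightarrow> 'b \<Rightarrow> 'b::complex_algebra"
  where "qbr q x y = x * y - inverse q *\<^sub>C (y * x)"

definition qserre :: "complex \<Rightarrow> 'b \<Rightarrow> 'b \<Rightarrow> 'b::complex_algebra"
  where "qserre q x y = x * x * y - (q + inverse q) *\<^sub>C (x * y * x) + y * x * x"

text \<open>Numbered like the rows of a matrix: \<open>chain\<close> at 1 is \<open>z\<close>, and
  at \<open>i\<close> it carries brackets with \<open>x 1\<close> to \<open>x (i - 1)\<close>. The
  value at 0 is a dummy.\<close>

primrec chain :: "complex \<Rightarrow> (nat \<Rightarrow> 'b) \<Rightarrow> 'b \<Rightarrow> nat \<Rightarrow> 'b::complex_algebra" where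
  "chain q x z 0 = z"
| "chain q x z (Suc k) = (if k = 0 then z else qbr q (x k) (chain q x z k))"

lemma chain_1 [simp]: "chain q x z (Suc 0) = z"
  by simp

lemma chain_Suc: "1 \<le> k \<Longrightarrow> chain q x z (Suc k) = qbr q (x k) (chain q x z k)"
  by simp

declare chain.simps [simp del]

lemma qbr_commute:
  fixes y :: "'b::complex_algebra"
  assumes "y * a = a * y" "y * b = b * y"
  shows "y * qbr q a b = qbr q a b * y"
proof -
  have "y * (a * z) = a * (y * z)" "y * (b * z) = b * (y * z)" for z
    using assms by (simp_all add: mult.assoc[symmetric])
  then show ?thesis unfolding qbr_def by (simp add: scaleC_expand assms)
qed

lemma qserre_qbr:
  fixes y :: "'b::complex_algebra"
  assumes "qserre q y a = 0" "y * b = b * y"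
  shows "qserre q y (qbr q a b) = 0" "qserre q y (qbr q b a) = 0"
proof -
  have c: "y * (b * z) = b * (y * z)" for z
    using assms by (simp add: mult.assoc[symmetric])
  have "qserre q y (qbr q a b) = qbr q (qserre q y a) b" "qserre q y (qbr q b a) = qbr q b (qserre q y a)"
    unfolding qserre_def qbr_def by (simp_all add: scaleC_expand assms(2) c algebra_simps)
  then show "qserre q y (qbr q a b) = 0" "qserre q y (qbr q b a) = 0" using assms by (simp_all add: qbr_def)
qed

lemma qbr_assoc:
  fixes a :: "'b::complex_algebra"
  assumes "a * c = c * a"
  shows "qbr q (qbr q a b) c = qbr q a (qbr q b c)"
proof -
  have c: "a * (c * z) = c * (a * z)" for z
    using assms by (simp add: mult.assoc[symmetric])
  show ?thesis unfolding qbr_def by (simp add: scaleC_expand assms c algebra_simps)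
qed

lemma qbr_left_commute:
  fixes a :: "'b::complex_algebra"
  assumes "a * b = b * a"
  shows "qbr q a (qbr q b c) = qbr q b (qbr q a c)"
proof -
  have c: "a * (b * z) = b * (a * z)" for z
    using assms by (simp add: mult.assoc[symmetric])
  show ?thesis unfolding qbr_def by (simp add: scaleC_expand assms c algebra_simps)
qed

text \<open>With \<open>A = qbr q x z\<close>, the Serre polynomial factors as
  \<open>x * A - q *\<^sub>C (A * x)\<close>.\<close>

lemma qserre_top:
  fixes x :: "'b::complex_algebra"
  assumes "q \<noteq> 0" "qserre q x z = 0"
  shows "x * qbr q x z = q *\<^sub>C (qbr q x z * x)"
  using assms unfolding qserre_def qbr_def
  by (simp add: scaleC_expand algebra_simps)

text \<open>The induction step for relations between matrix entries: a bracket with an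
  \<open>x\<close> that commutes with \<open>a\<close> and \<open>e\<close> passes over them, and
  only \<open>b\<close> and \<open>d\<close> move to the next index.\<close>

lemma qbr_raise:
  fixes x :: "'b::complex_algebra"
  assumes "x * a = a * x" "b * a - c *\<^sub>C (a * b) = t *\<^sub>C (e * d)" "x * e = e * x"
  shows "qbr q x b * a - c *\<^sub>C (a * qbr q x b) = t *\<^sub>C (e * qbr q x d)"
proof -
  have xa: "x * (a * z) = a * (x * z)" and xe: "x * (e * z) = e * (x * z)" for z
    using assms by (simp_all add: mult.assoc[symmetric])
  have "qbr q x b * a - c *\<^sub>C (a * qbr q x b) = qbr q x (b * a - c *\<^sub>C (a * b))"
    unfolding qbr_def by (simp add: scaleC_expand assms(1) xa algebra_simps)
  also have "\<dots> = t *\<^sub>C (e * qbr q x d)"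
    unfolding assms(2) qbr_def by (simp add: scaleC_expand xe algebra_simps)
  finally show ?thesis .
qed

lemma qbr_raise_right:
  fixes x :: "'b::complex_algebra"
  assumes "x * b = b * x" "b * a = c *\<^sub>C (a * b)"
  shows "b * qbr q x a = c *\<^sub>C (qbr q x a * b)"
proof -
  have xa: "x * (b * z) = b * (x * z)" for z
    using assms(1) by (simp_all add: mult.assoc[symmetric])
  have "b * qbr q x a - c *\<^sub>C (qbr q x a * b) = qbr q x (b * a - c *\<^sub>C (a * b))"
    unfolding qbr_def by (simp add: scaleC_expand assms(1) xa algebra_simps)
  then show ?thesis using assms(2) by (simp add: qbr_def)
qed

text \<open>Applying \<open>qbr q y\<close> once to \<open>b a = q a b\<close> gives the mixed relation, applying it twice
  the same relation for the raised elements.\<close>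

lemma qbr_square_mixed:
  fixes y :: "'b::complex_algebra"
  assumes q0: "q \<noteq> 0" and ba: "b * a = q *\<^sub>C (a * b)"
  shows "qbr q y b * a + inverse q *\<^sub>C (b * qbr q y a) = q *\<^sub>C (qbr q y a * b) + a * qbr q y b"
proof -
  define r where "r = inverse q"
  have c: "q * r = 1" "r * q = 1" "q * (r * z) = z" "r * (q * z) = z" for z :: complex
    using q0 by (simp_all add: r_def)
  have ba': "b * (a * z) = q *\<^sub>C (a * (b * z))" for z
    using ba by (simp add: mult.assoc[symmetric] scaleC_mult)
  have *: "y * (b * a) = q *\<^sub>C (y * (a * b))" using ba by (simp add: scaleC_mult)
  show ?thesis unfolding qbr_def r_def[symmetric]
    by (simp add: scaleC_expand ba ba' * c algebra_simps)
qed

lemma qbr_square_raise: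
  fixes y :: "'b::complex_algebra"
  assumes q0: "q \<noteq> 0" and q2: "q + inverse q \<noteq> 0" and ba: "b * a = q *\<^sub>C (a * b)"
    and ya: "y * qbr q y a = q *\<^sub>C (qbr q y a * y)" and yb: "y * qbr q y b = q *\<^sub>C (qbr q y b * y)"
  shows "qbr q y b * qbr q y a = q *\<^sub>C (qbr q y a * qbr q y b)"
proof -
  define r where "r = inverse q"
  have c: "q * r = 1" "r * q = 1" "q * (r * z) = z" "r * (q * z) = z" for z :: complex
    using q0 by (simp_all add: r_def)
  define a' where "a' = qbr q y a"
  define b' where "b' = qbr q y b"
  have 1: "y * a = a' + r *\<^sub>C (a * y)" "y * b = b' + r *\<^sub>C (b * y)"
    unfolding a'_def b'_def qbr_def r_def by auto
  have y1: "y * (a * z) = a' * z + r *\<^sub>C (a * (y * z))" "y * (b * z) = b' * z + r *\<^sub>C (b * (y * z))" for z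
    by (simp_all add: mult.assoc[symmetric] 1 ring_distribs scaleC_mult)
  note y = ya[folded a'_def] yb[folded b'_def]
  have y': "y * (a' * z) = q *\<^sub>C (a' * (y * z))" "y * (b' * z) = q *\<^sub>C (b' * (y * z))" for z
    by (simp_all add: mult.assoc[symmetric] y scaleC_mult)
  have m: "b' * a + r *\<^sub>C (b * a') = q *\<^sub>C (a' * b) + a * b'"
    using qbr_square_mixed[OF q0 ba, of y] unfolding a'_def b'_def r_def .
  have "(q *\<^sub>C (b' * a') + r *\<^sub>C (b' * a') + (b' * a + r *\<^sub>C (b * a')) * y)
      = ((q * q) *\<^sub>C (a' * b') + a' * b' + (q *\<^sub>C (a' * b) + a * b') * y)"
    using arg_cong[OF m, of "\<lambda>u. y * u"]
    by (simp add: scaleC_expand 1 y1 y y' c algebra_simps)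
  then have "(q + r) *\<^sub>C (b' * a') = (q + r) *\<^sub>C (q *\<^sub>C (a' * b'))"
    unfolding m by (simp add: scaleC_expand c)
  then have "b' * a' = q *\<^sub>C (a' * b')"
    using q2 unfolding r_def by (rule cvs.scale_left_imp_eq[rotated])
  then show ?thesis unfolding a'_def b'_def .
qed

text \<open>One arm \<open>x 1\<close>, \<open>x 2\<close>, ... of the diagram with a root vector
  \<open>z\<close> attached at its end: of the arm, only \<open>x 1\<close> interacts with
  \<open>z\<close>.\<close>

locale serre_chain =
  fixes n :: nat and q :: complex and x :: "nat \<Rightarrow> 'b::complex_algebra" and z :: 'b
  assumes q0: "q \<noteq> 0" and q2: "q + inverse q \<noteq> 0"
    and x_comm: "1 \<le> i \<Longrightarrow> i + 2 \<le> k \<Longrightarrow> k < n \<Longrightarrow> x i * x k = x k * x i"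
    and x_serre: "1 \<le> i \<Longrightarrow> i + 1 < n \<Longrightarrow> qserre q (x i) (x (i + 1)) = 0"
      "1 \<le> i \<Longrightarrow> i + 1 < n \<Longrightarrow> qserre q (x (i + 1)) (x i) = 0"
    and xz_comm: "2 \<le> k \<Longrightarrow> k < n \<Longrightarrow> x k * z = z * x k"
    and xz_serre: "1 < n \<Longrightarrow> qserre q (x 1) z = 0"
begin

abbreviation "c i \<equiv> chain q x z i"

lemma chain_above: "1 \<le> i \<Longrightarrow> i < k \<Longrightarrow> k < n \<Longrightarrow> x k * c i = c i * x k"
proof (induction i rule: nat_induct_at_least)
  case base
  then show ?case using xz_comm by simp
next
  case (Suc i)
  then have "x k * x i = x i * x k" using x_comm[of i k] by simp
  then show ?case using Suc by (simp add: chain_Suc qbr_commute)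
qed

lemma chain_serre: "1 \<le> i \<Longrightarrow> i < n \<Longrightarrow> qserre q (x i) (c i) = 0"
proof (induction i rule: nat_induct_at_least)
  case base
  then show ?case using xz_serre by simp
next
  case (Suc i)
  then show ?case using x_serre(2)[of i] chain_above[of i "Suc i"]
    by (simp add: chain_Suc qserre_qbr)
qed

lemma chain_top: "1 \<le> i \<Longrightarrow> i < n \<Longrightarrow> x i * c (Suc i) = q *\<^sub>C (c (Suc i) * x i)"
  using qserre_top[OF q0 chain_serre] by (simp add: chain_Suc)

lemma chain_below: "1 \<le> k \<Longrightarrow> k + 2 \<le> i \<Longrightarrow> i \<le> n \<Longrightarrow> x k * c i = c i * x k"
proof (induction i rule: less_induct)
  case (less i)
  show ?case
  proof (cases "i = k + 2")
    case True
    \<comment> \<open>\<open>x k\<close> is the middle node between \<open>x (k + 1)\<close> and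
      \<open>c k\<close>, so \<open>bracket_commute\<close> applies to the three of them.\<close>
    have "x k * qbr q (x (k + 1)) (qbr q (x k) (c k)) = qbr q (x (k + 1)) (qbr q (x k) (c k)) * x k"
      unfolding qbr_def
      by (rule bracket_commute[of q "inverse q"])
         (use less.prems True q0 q2 x_serre(1)[of k] chain_serre[of k] chain_above[of k "k + 1"]
          in \<open>simp_all add: qserre_def\<close>)
    then show ?thesis using True less.prems by (simp add: chain_Suc)
  next
    case False
    then obtain m where m: "i = Suc m" "k + 2 \<le> m" using less.prems by (cases i) auto
    then show ?thesis using less.IH[of m] less.prems x_comm[of k m]
      by (simp add: chain_Suc qbr_commute)
  qed
qed

lemma chain_off: "1 \<le> k \<Longrightarrow> k < n \<Longrightarrow> 1 \<le> i \<Longrightarrow> i \<le> n \<Longrightarrow> k \<noteq> i \<Longrightarrow> Suc k \<noteq> i \<Longrightarrow> x k * c i = c i * x k"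
  using chain_above[of i k] chain_below[of k i] by (cases "i < k") auto

end

section \<open>Quantum matrices from the Serre relations\<close>

locale serre_family =
  fixes n :: nat and q :: complex and X :: "root \<Rightarrow> 'b::complex_algebra"
  assumes q0: "q \<noteq> 0" and q2: "q + inverse q \<noteq> 0"
    and X_serre: "\<alpha> \<in> simple_roots n \<Longrightarrow> \<gamma> \<in> simple_roots n \<Longrightarrow> root_form \<alpha> \<gamma> = -1 \<Longrightarrow> qserre q (X \<alpha>) (X \<gamma>) = 0"
    and X_comm: "\<alpha> \<in> simple_roots n \<Longrightarrow> \<gamma> \<in> simple_roots n \<Longrightarrow> root_form \<alpha> \<gamma> = 0 \<Longrightarrow> X \<alpha> * X \<gamma> = X \<gamma> * X \<alpha>"

text \<open>The entry at \<open>(i, j)\<close> is a root vector for the sum of \<open>Beta\<close>,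
  the first \<open>i - 1\<close> roots \<open>Mu\<close> and the first \<open>j - 1\<close> roots
  \<open>Nu\<close>.\<close>

definition qmat :: "complex \<Rightarrow> (root \<Rightarrow> 'b) \<Rightarrow> nat \<Rightarrow> nat \<Rightarrow> 'b::complex_algebra"
  where "qmat q X i j = chain q (\<lambda>k. X (Mu k)) (chain q (\<lambda>k. X (Nu k)) (X Beta) j) i"

text \<open>The diagram automorphism that exchanges the two arms; it transposes the matrix
  (\<open>z_flip\<close>) and turns every fact about columns into one about rows.\<close>

primrec flip :: "root \<Rightarrow> root" where
  "flip (Mu i) = Nu i" | "flip Beta = Beta" | "flip (Nu i) = Mu i"

lemma simple_roots_simps [simp]:
  "Beta \<in> simple_roots n" "Mu i \<in> simple_roots n \<longleftrightarrow> 1 \<le> i \<and> i < n" "Nu i \<in> simple_roots n \<longleftrightarrow> 1 \<le> i \<and> i < n"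
  unfolding simple_roots_def by auto

lemma flip_simple: "flip \<alpha> \<in> simple_roots n \<longleftrightarrow> \<alpha> \<in> simple_roots n"
  by (cases \<alpha>) auto

lemma root_form_flip: "root_form (flip \<alpha>) (flip \<gamma>) = root_form \<alpha> \<gamma>"
  by (cases \<alpha>; cases \<gamma>) (auto simp: root_form_def)

context serre_family
begin

abbreviation "z \<equiv> qmat q X"

lemma flip: "serre_family n q (\<lambda>\<alpha>. X (flip \<alpha>))"
  by unfold_locales (auto intro!: q0 q2 X_serre X_comm simp: flip_simple root_form_flip)

lemma mu_row_comm: assumes "1 \<le> j" "j \<le> n" "2 \<le> k" "k < n"
  shows "X (Mu k) * chain q (\<lambda>k. X (Nu k)) (X Beta) j = chain q (\<lambda>k. X (Nu k)) (X Beta) j * X (Mu k)"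
  using assms
proof (induction j rule: nat_induct_at_least)
  case base
  then show ?case by (auto intro!: X_comm simp: root_form_def)
next
  case (Suc j)
  have "X (Mu k) * X (Nu j) = X (Nu j) * X (Mu k)"
    by (rule X_comm) (use Suc in \<open>auto simp: root_form_def\<close>)
  then show ?case using Suc by (auto simp: chain_Suc intro!: qbr_commute)
qed

lemma mu_row_serre: assumes "1 \<le> j" "j \<le> n" "1 < n"
  shows "qserre q (X (Mu 1)) (chain q (\<lambda>k. X (Nu k)) (X Beta) j) = 0"
  using assms
proof (induction j rule: nat_induct_at_least)
  case base
  then show ?case by (auto intro!: X_serre simp: root_form_def)
next
  case (Suc j)
  have "X (Mu 1) * X (Nu j) = X (Nu j) * X (Mu 1)"
    by (rule X_comm) (use Suc in \<open>auto simp: root_form_def\<close>)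
  then show ?case using Suc by (auto simp: chain_Suc intro!: qserre_qbr)
qed

lemma mu_chain: assumes "1 \<le> j" "j \<le> n"
  shows "serre_chain n q (\<lambda>k. X (Mu k)) (chain q (\<lambda>k. X (Nu k)) (X Beta) j)"
  by unfold_locales (use mu_row_comm[OF assms] mu_row_serre[OF assms] in \<open>auto intro!: q0 q2 X_serre X_comm simp: root_form_def\<close>)

lemma z_mu: "1 \<le> i \<Longrightarrow> z (Suc i) j = qbr q (X (Mu i)) (z i j)"
  unfolding qmat_def by (simp add: chain_Suc)

lemma z_1_nu: "1 \<le> j \<Longrightarrow> z 1 (Suc j) = qbr q (X (Nu j)) (z 1 j)"
  unfolding qmat_def by (simp add: chain_Suc)

lemma z_11: "z 1 1 = X Beta"
  unfolding qmat_def by simp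

lemma z_nu: assumes "1 \<le> i" "i \<le> n" "1 \<le> j" "j < n"
  shows "z i (Suc j) = qbr q (X (Nu j)) (z i j)"
  using assms
proof (induction i rule: nat_induct_at_least)
  case base
  then show ?case using z_1_nu by simp
next
  case (Suc i)
  have "X (Nu j) * X (Mu i) = X (Mu i) * X (Nu j)"
    by (rule X_comm) (use Suc in \<open>auto simp: root_form_def\<close>)
  then show ?case using Suc by (simp add: z_mu qbr_left_commute)
qed

lemma z_flip: assumes "1 \<le> i" "i \<le> n" "1 \<le> j" "j \<le> n"
  shows "qmat q (\<lambda>\<alpha>. X (flip \<alpha>)) j i = z i j"
  using assms(3,4)
proof (induction j rule: nat_induct_at_least)
  case base
  have "qmat q (\<lambda>\<alpha>. X (flip \<alpha>)) 1 i = z i 1" using assms(1,2)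
    by (induction i rule: nat_induct_at_least) (simp_all add: qmat_def chain_Suc)
  then show ?case by simp
next
  case (Suc j)
  interpret f: serre_family n q "\<lambda>\<alpha>. X (flip \<alpha>)" by (rule flip)
  show ?case using Suc assms(1,2) by (simp add: f.z_mu z_nu)
qed

lemma mu_z_top: "1 \<le> i \<Longrightarrow> i < n \<Longrightarrow> 1 \<le> j \<Longrightarrow> j \<le> n \<Longrightarrow>
    X (Mu i) * z (Suc i) j = q *\<^sub>C (z (Suc i) j * X (Mu i))"
  using serre_chain.chain_top[OF mu_chain] unfolding qmat_def by blast

lemma mu_z_off: "1 \<le> k \<Longrightarrow> k < n \<Longrightarrow> 1 \<le> i \<Longrightarrow> i \<le> n \<Longrightarrow> 1 \<le> j \<Longrightarrow> j \<le> n \<Longrightarrow> k \<noteq> i \<Longrightarrow> Suc k \<noteq> i \<Longrightarrow>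
    X (Mu k) * z i j = z i j * X (Mu k)"
  using serre_chain.chain_off[OF mu_chain] unfolding qmat_def by blast

lemma nu_z_top: "1 \<le> j \<Longrightarrow> j < n \<Longrightarrow> 1 \<le> i \<Longrightarrow> i \<le> n \<Longrightarrow>
    X (Nu j) * z i (Suc j) = q *\<^sub>C (z i (Suc j) * X (Nu j))"
  using serre_family.mu_z_top[OF flip, of j i] by (simp add: z_flip)

lemma nu_z_off: "1 \<le> k \<Longrightarrow> k < n \<Longrightarrow> 1 \<le> i \<Longrightarrow> i \<le> n \<Longrightarrow> 1 \<le> j \<Longrightarrow> j \<le> n \<Longrightarrow> k \<noteq> j \<Longrightarrow> Suc k \<noteq> j \<Longrightarrow>
    X (Nu k) * z i j = z i j * X (Nu k)"
  using serre_family.mu_z_off[OF flip, of k j i] by (simp add: z_flip)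

text \<open>The seed of all relations within rows and columns: it is a rewriting of the Serre
  relation that is quadratic in \<open>X Beta\<close>.\<close>

lemma z_col_1: "1 < n \<Longrightarrow> z 2 1 * z 1 1 = q *\<^sub>C (z 1 1 * z 2 1)"
proof -
  assume "1 < n"
  then have "qserre q (X Beta) (X (Mu 1)) = 0"
    by (intro X_serre) (auto simp: root_form_def)
  then have "qbr q (X (Mu 1)) (X Beta) * X Beta = q *\<^sub>C (X Beta * qbr q (X (Mu 1)) (X Beta))"
    using q0 by (simp add: qbr_def qserre_def scaleC_expand algebra_simps)
  then show ?thesis using z_mu[of 1 1] z_11 by (simp add: numeral_2_eq_2)
qed

lemma z_col_12: "1 < n \<Longrightarrow> 1 \<le> j \<Longrightarrow> j \<le> n \<Longrightarrow> z 2 j * z 1 j = q *\<^sub>C (z 1 j * z 2 j)"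
proof (induction j)
  case (Suc j)
  show ?case
  proof (cases "j = 0")
    case True
    then show ?thesis using z_col_1 Suc by simp
  next
    case False
    then show ?thesis
      using Suc qbr_square_raise[OF q0 q2, of "z 2 j" "z 1 j" "X (Nu j)"]
        nu_z_top[of j 1] nu_z_top[of j 2] z_nu[of 1 j] z_nu[of 2 j] by simp
  qed
qed simp

text \<open>The lower entry is raised from row 2 to row \<open>k\<close> while the upper one stays
  in row 1; then the upper one is raised to row \<open>i\<close>. Each bracket commutes with the
  entry that rests.\<close>

lemma z_col: assumes "1 \<le> i" "i < k" "k \<le> n" "1 \<le> j" "j \<le> n"
  shows "z k j * z i j = q *\<^sub>C (z i j * z k j)"
proof -
  have 1: "z k j * z 1 j = q *\<^sub>C (z 1 j * z k j)" if "2 \<le> k" "k \<le> n" for k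
    using that
  proof (induction k rule: nat_induct_at_least)
    case base
    then show ?case using z_col_12 assms by simp
  next
    case (Suc k)
    then show ?case
      using qbr_raise[of "X (Mu k)" "z 1 j" "z k j" q 0 1] mu_z_off[of k 1 j] assms
      by (simp add: z_mu)
  qed
  show ?thesis using assms(1,2)
  proof (induction i rule: nat_induct_at_least)
    case base
    then show ?case using 1 assms by simp
  next
    case (Suc i)
    then show ?case
      using qbr_raise_right[of "X (Mu i)" "z k j" "z i j" q] mu_z_off[of i k j] assms
      by (simp add: z_mu)
  qed
qed

lemma z_row: assumes "1 \<le> i" "i \<le> n" "1 \<le> j" "j < l" "l \<le> n"
  shows "z i l * z i j = q *\<^sub>C (z i j * z i l)"
  using serre_family.z_col[OF flip, of j l i] assms by (simp add: z_flip)

lemma z_square: assumes "1 \<le> i" "i < n" "1 \<le> j" "j < n"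
  shows "z (Suc i) j * z i (Suc j) = z i (Suc j) * z (Suc i) j"
    and "z (Suc i) (Suc j) * z i j - z i j * z (Suc i) (Suc j) =
      (q - inverse q) *\<^sub>C (z i (Suc j) * z (Suc i) j)"
proof -
  define r where "r = inverse q"
  have c: "q * r = 1" "r * q = 1" "q * (r * z) = z" "r * (q * z) = z" for z :: complex
    using q0 by (simp_all add: r_def)
  define a b c d where "a = z i j" and "b = z (Suc i) j" and "c = z i (Suc j)" and "d = z (Suc i) (Suc j)"
  note abcd = a_def b_def c_def d_def
  \<comment> \<open>Two routes to the corner \<open>d\<close>: raising the column relation along the
    rows of the square, and the row relation along its columns. They differ only by exchanging
    \<open>b\<close> and \<open>c\<close>, so comparing them gives \<open>q + r\<close> times the
    commutator of \<open>b\<close> and \<open>c\<close>.\<close>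
  have 1: "d * a + r *\<^sub>C (b * c) = q *\<^sub>C (c * b) + a * d"
    using qbr_square_mixed[OF q0 z_col[of i "Suc i" j], of "X (Nu j)"] assms
    by (simp add: z_nu abcd r_def)
  have 2: "d * a + r *\<^sub>C (c * b) = q *\<^sub>C (b * c) + a * d"
    using qbr_square_mixed[OF q0 z_row[of i j "Suc j"], of "X (Mu i)"] assms
    by (simp add: z_mu[symmetric] abcd r_def)
  have "(q + r) *\<^sub>C (b * c) = (q + r) *\<^sub>C (c * b)"
  proof -
    have "(d * a + r *\<^sub>C (b * c)) + (q *\<^sub>C (b * c) + a * d) = (d * a + r *\<^sub>C (c * b)) + (q *\<^sub>C (c * b) + a * d)"
      using 1 2 by simp
    then show ?thesis by (simp add: scaleC_add_left algebra_simps)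
  qed
  then have 3: "b * c = c * b"
    using q2 unfolding r_def by (rule cvs.scale_left_imp_eq[rotated])
  then show "z (Suc i) j * z i (Suc j) = z i (Suc j) * z (Suc i) j" by (simp add: abcd)
  show "z (Suc i) (Suc j) * z i j - z i j * z (Suc i) (Suc j) =
      (q - inverse q) *\<^sub>C (z i (Suc j) * z (Suc i) j)"
    unfolding abcd[symmetric] using 1 unfolding 3 r_def by (simp add: scaleC_diff_left algebra_simps)
qed

lemma z_anti: assumes "1 \<le> i" "i < k" "k \<le> n" "1 \<le> j" "j < l" "l \<le> n"
  shows "z k j * z i l = z i l * z k j"
proof -
  have 1: "z k j * z i (Suc j) = z i (Suc j) * z k j" using assms(2,3)
  proof (induction k rule: less_induct)
    case (less k)
    then obtain m where m: "k = Suc m" "i \<le> m" by (cases k) auto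
    show ?case
    proof (cases "i = m")
      case True
      then show ?thesis using z_square(1)[of i j] m assms less.prems by simp
    next
      case False
      then show ?thesis
        using m less qbr_raise[of "X (Mu m)" "z i (Suc j)" "z m j" 1 0 1] mu_z_off[of m i "Suc j"] assms
        by (simp add: z_mu)
    qed
  qed
  show ?thesis using assms(5,6)
  proof (induction l rule: less_induct)
    case (less l)
    then obtain m where m: "l = Suc m" "j \<le> m" by (cases l) auto
    show ?case
    proof (cases "j = m")
      case True
      then show ?thesis using 1 m by simp
    next
      case False
      then show ?thesis
        using m less qbr_raise_right[of "X (Nu m)" "z k j" "z i m" 1] nu_z_off[of m k j] assms
        by (simp add: z_nu)
    qed
  qed
qed

text \<open>The relation of an adjacent square is raised in the row index and then in the column
  index. For the second raising \<open>z_anti\<close> reorders the quadratic term, so that the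
  factor to be raised stands on the right, as \<open>qbr_raise\<close> requires.\<close>

lemma z_diag: assumes "1 \<le> i" "i < k" "k \<le> n" "1 \<le> j" "j < l" "l \<le> n"
  shows "z k l * z i j - z i j * z k l = (q - inverse q) *\<^sub>C (z i l * z k j)"
proof -
  have 1: "z k (Suc j) * z i j - z i j * z k (Suc j) = (q - inverse q) *\<^sub>C (z i (Suc j) * z k j)"
    using assms(2,3)
  proof (induction k rule: less_induct)
    case (less k)
    then obtain m where m: "k = Suc m" "i \<le> m" by (cases k) auto
    show ?case
    proof (cases "i = m")
      case True
      then show ?thesis using z_square(2)[of i j] m assms less.prems by simp
    next
      case False
      then show ?thesis
        using m less qbr_raise[of "X (Mu m)" "z i j" "z m (Suc j)" 1 "q - inverse q" "z i (Suc j)" "z m j"]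
          mu_z_off[of m i "Suc j"] mu_z_off[of m i j] assms
        by (simp add: z_mu)
    qed
  qed
  show ?thesis using assms(5,6)
  proof (induction l rule: less_induct)
    case (less l)
    then obtain m where m: "l = Suc m" "j \<le> m" by (cases l) auto
    show ?case
    proof (cases "j = m")
      case True
      then show ?thesis using 1 m by simp
    next
      case False
      then have "z k m * z i j - z i j * z k m = (q - inverse q) *\<^sub>C (z k j * z i m)"
        using m less.IH[of m] less.prems z_anti[of i k j m] assms by simp
      then have "z k l * z i j - z i j * z k l = (q - inverse q) *\<^sub>C (z k j * z i l)"
        using m less.prems False qbr_raise[of "X (Nu m)" "z i j" "z k m" 1 "q - inverse q" "z k j" "z i m"]
          nu_z_off[of m i j] nu_z_off[of m k j] assms
        by (simp add: z_nu)
      then show ?thesis using z_anti[of i k j l] assms less.prems by simp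
    qed
  qed
qed

end

section \<open>Weights under \<open>K\<close>, and the coproduct of two commuting copies\<close>

lemma comm_assoc: "a * b = b * a \<Longrightarrow> a * (b * c) = b * (a * (c::'b::semigroup_mult))"
  by (simp add: mult.assoc[symmetric])

lemma root_form_commute: "root_form \<alpha> \<gamma> = root_form \<gamma> \<alpha>"
  unfolding root_form_def by (auto simp: abs_minus_commute)

lemma root_form_self [simp]: "root_form \<alpha> \<alpha> = 2"
  unfolding root_form_def by simp

locale uq = uq_algebra +
  assumes q0: "q \<noteq> 0" and q_pow: "\<And>m. 1 \<le> m \<Longrightarrow> q ^ m \<noteq> 1"
begin

lemma q_inv: "q * inverse q = 1" "inverse q * q = 1"
  using q0 by simp_all

lemma q_diff: "q - inverse q \<noteq> 0"
proof
  assume "q - inverse q = 0"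
  then have "q * q = q * inverse q" by simp
  then have "q * q = 1" using q_inv by simp
  then show False using q_pow[of 2] by (simp add: power2_eq_square)
qed

lemma q_sum: "q + inverse q \<noteq> 0"
proof
  assume "q + inverse q = 0"
  then have "q = - inverse q" by (simp add: eq_neg_iff_add_eq_0)
  then have "q * q = q * (- inverse q)" by (rule arg_cong)
  then have "q * q = -1" using q_inv by simp
  then have "q ^ 4 = 1" by (simp add: power4_eq_xxxx)
  then show False using q_pow[of 4] by simp
qed

lemma K_E: "\<alpha> \<in> simple_roots n \<Longrightarrow> \<gamma> \<in> simple_roots n \<Longrightarrow> K \<alpha> * E \<gamma> = q powi root_form \<alpha> \<gamma> *\<^sub>C (E \<gamma> * K \<alpha>)"
  using arg_cong[OF K_E_Ki[of \<alpha> \<gamma>], of "\<lambda>u. u * K \<alpha>"] Ki_K[of \<alpha>] by (simp add: mult.assoc scaleC_mult)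

lemma K_F: "\<alpha> \<in> simple_roots n \<Longrightarrow> \<gamma> \<in> simple_roots n \<Longrightarrow> K \<alpha> * F \<gamma> = q powi (- root_form \<alpha> \<gamma>) *\<^sub>C (F \<gamma> * K \<alpha>)"
  using arg_cong[OF K_F_Ki[of \<alpha> \<gamma>], of "\<lambda>u. u * K \<alpha>"] Ki_K[of \<alpha>] by (simp add: mult.assoc scaleC_mult)

lemma Ki_weight:
  assumes "\<alpha> \<in> simple_roots n" "K \<alpha> * x = q powi m *\<^sub>C (x * K \<alpha>)"
  shows "Ki \<alpha> * x = q powi (- m) *\<^sub>C (x * Ki \<alpha>)"
proof -
  have "Ki \<alpha> * (K \<alpha> * x) * Ki \<alpha> = q powi m *\<^sub>C (Ki \<alpha> * (x * K \<alpha>) * Ki \<alpha>)"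
    using assms by (simp add: scaleC_mult)
  moreover have "Ki \<alpha> * (K \<alpha> * x) * Ki \<alpha> = x * Ki \<alpha>"
    by (simp add: mult.assoc[symmetric] Ki_K[OF assms(1)])
  moreover have "Ki \<alpha> * (x * K \<alpha>) * Ki \<alpha> = Ki \<alpha> * x"
    by (simp add: mult.assoc K_Ki[OF assms(1)])
  ultimately have "x * Ki \<alpha> = q powi m *\<^sub>C (Ki \<alpha> * x)"
    by simp
  then show ?thesis using q0 by (simp add: scaleC_scaleC power_int_minus)
qed

lemma Ki_E: "\<alpha> \<in> simple_roots n \<Longrightarrow> \<gamma> \<in> simple_roots n \<Longrightarrow> Ki \<alpha> * E \<gamma> = q powi (- root_form \<alpha> \<gamma>) *\<^sub>C (E \<gamma> * Ki \<alpha>)"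
  using Ki_weight[OF _ K_E] .

lemma Ki_F: "\<alpha> \<in> simple_roots n \<Longrightarrow> \<gamma> \<in> simple_roots n \<Longrightarrow> Ki \<alpha> * F \<gamma> = q powi root_form \<alpha> \<gamma> *\<^sub>C (F \<gamma> * Ki \<alpha>)"
  using Ki_weight[OF _ K_F] by simp

lemma Ki_K_comm: "\<alpha> \<in> simple_roots n \<Longrightarrow> \<gamma> \<in> simple_roots n \<Longrightarrow> Ki \<alpha> * K \<gamma> = K \<gamma> * Ki \<alpha>"
  using Ki_weight[of \<alpha> "K \<gamma>" 0] K_K by simp

lemma Ki_Ki_comm: "\<alpha> \<in> simple_roots n \<Longrightarrow> \<gamma> \<in> simple_roots n \<Longrightarrow> Ki \<alpha> * Ki \<gamma> = Ki \<gamma> * Ki \<alpha>"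
  using Ki_weight[of \<alpha> "Ki \<gamma>" 0] Ki_K_comm[of \<gamma> \<alpha>] by simp

sublocale e: serre_family n q E
  by unfold_locales (use q0 q_sum serre_E E_E in \<open>auto simp: qserre_def\<close>)

sublocale f: serre_family n q F
  by unfold_locales (use q0 q_sum serre_F F_F in \<open>auto simp: qserre_def\<close>)

end

text \<open>The coproduct \<open>E -> E (x) 1 + K (x) E\<close>,
  \<open>F -> F (x) K^(-1) + 1 (x) F\<close>, realized by two elementwise commuting copies inside
  one algebra instead of a tensor product.\<close>

lemma uq_algebra_tensor:
  fixes e f k ki E F K Ki :: "root \<Rightarrow> 'b::complex_algebra"
  assumes q: "q \<noteq> 0" "\<And>m. 1 \<le> m \<Longrightarrow> q ^ m \<noteq> 1"
    and "uq_algebra n q e f k ki" and "uq_algebra n q E F K Ki"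
    and comm: "\<And>\<alpha> \<gamma> x y. x \<in> {e \<alpha>, f \<alpha>, k \<alpha>, ki \<alpha>} \<Longrightarrow> y \<in> {E \<gamma>, F \<gamma>, K \<gamma>, Ki \<gamma>} \<Longrightarrow> y * x = x * y"
  shows "uq_algebra n q (\<lambda>\<alpha>. e \<alpha> + k \<alpha> * E \<alpha>) (\<lambda>\<alpha>. f \<alpha> * Ki \<alpha> + F \<alpha>) (\<lambda>\<alpha>. k \<alpha> * K \<alpha>) (\<lambda>\<alpha>. ki \<alpha> * Ki \<alpha>)"
proof -
  interpret a: uq n q e f k ki using assms by (simp add: uq_def uq_axioms_def)
  interpret b: uq n q E F K Ki using assms by (simp add: uq_def uq_axioms_def)
  have big: "E \<gamma> * e \<alpha> = e \<alpha> * E \<gamma>" "E \<gamma> * f \<alpha> = f \<alpha> * E \<gamma>" "E \<gamma> * k \<alpha> = k \<alpha> * E \<gamma>" "E \<gamma> * ki \<alpha> = ki \<alpha> * E \<gamma>"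
    "F \<gamma> * e \<alpha> = e \<alpha> * F \<gamma>" "F \<gamma> * f \<alpha> = f \<alpha> * F \<gamma>" "F \<gamma> * k \<alpha> = k \<alpha> * F \<gamma>" "F \<gamma> * ki \<alpha> = ki \<alpha> * F \<gamma>"
    "K \<gamma> * e \<alpha> = e \<alpha> * K \<gamma>" "K \<gamma> * f \<alpha> = f \<alpha> * K \<gamma>" "K \<gamma> * k \<alpha> = k \<alpha> * K \<gamma>" "K \<gamma> * ki \<alpha> = ki \<alpha> * K \<gamma>"
    "Ki \<gamma> * e \<alpha> = e \<alpha> * Ki \<gamma>" "Ki \<gamma> * f \<alpha> = f \<alpha> * Ki \<gamma>" "Ki \<gamma> * k \<alpha> = k \<alpha> * Ki \<gamma>" "Ki \<gamma> * ki \<alpha> = ki \<alpha> * Ki \<gamma>"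
    for \<alpha> \<gamma>
    by (rule comm[of _ \<alpha> _ \<gamma>]; simp)+
  note big' = big[THEN comm_assoc]
  note big = big big'
  show ?thesis
  proof
    fix \<alpha> \<gamma> assume a: "\<alpha> \<in> simple_roots n" and g: "\<gamma> \<in> simple_roots n"
    note aK = a.K_Ki[OF a] b.K_Ki[OF a] a.Ki_K[OF a] b.Ki_K[OF a]
    show "k \<alpha> * K \<alpha> * (ki \<alpha> * Ki \<alpha>) = 1"
      by (simp add: mult.assoc big) (simp add: mult.assoc[symmetric] aK)
    show "ki \<alpha> * Ki \<alpha> * (k \<alpha> * K \<alpha>) = 1"
      by (simp add: mult.assoc big) (simp add: mult.assoc[symmetric] aK)
    show "k \<alpha> * K \<alpha> * (k \<gamma> * K \<gamma>) = k \<gamma> * K \<gamma> * (k \<alpha> * K \<alpha>)"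
      using a.K_K[OF a g] b.K_K[OF a g] by (simp add: mult.assoc big) (simp add: mult.assoc[symmetric])
    have 1: "k \<alpha> * (K \<alpha> * (ki \<alpha> * Ki \<alpha>)) = 1"
      by (simp add: mult.assoc big) (simp add: mult.assoc[symmetric] aK)
    show "k \<alpha> * K \<alpha> * (e \<gamma> + k \<gamma> * E \<gamma>) * (ki \<alpha> * Ki \<alpha>) = q powi root_form \<alpha> \<gamma> *\<^sub>C (e \<gamma> + k \<gamma> * E \<gamma>)"
    proof -
      have "k \<alpha> * K \<alpha> * (e \<gamma> + k \<gamma> * E \<gamma>) = q powi root_form \<alpha> \<gamma> *\<^sub>C ((e \<gamma> + k \<gamma> * E \<gamma>) * (k \<alpha> * K \<alpha>))"
        using a.K_E[OF a g] b.K_E[OF a g] a.K_K[OF a g]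
        by (simp add: scaleC_expand big) (simp add: mult.assoc[symmetric] scaleC_mult)
      then show ?thesis by (simp only: mult_scaleC_left mult.assoc 1 mult_1_right)
    qed
    show "k \<alpha> * K \<alpha> * (f \<gamma> * Ki \<gamma> + F \<gamma>) * (ki \<alpha> * Ki \<alpha>) = q powi - root_form \<alpha> \<gamma> *\<^sub>C (f \<gamma> * Ki \<gamma> + F \<gamma>)"
    proof -
      have "k \<alpha> * K \<alpha> * (f \<gamma> * Ki \<gamma> + F \<gamma>) = q powi - root_form \<alpha> \<gamma> *\<^sub>C ((f \<gamma> * Ki \<gamma> + F \<gamma>) * (k \<alpha> * K \<alpha>))"
        using a.K_F[OF a g] b.K_F[OF a g] b.Ki_K_comm[OF g a]
        by (simp add: scaleC_expand big) (simp add: mult.assoc[symmetric] scaleC_mult)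
      then show ?thesis by (simp only: mult_scaleC_left mult.assoc 1 mult_1_right)
    qed
    show "(e \<alpha> + k \<alpha> * E \<alpha>) * (f \<gamma> * Ki \<gamma> + F \<gamma>) - (f \<gamma> * Ki \<gamma> + F \<gamma>) * (e \<alpha> + k \<alpha> * E \<alpha>) =
      (if \<alpha> = \<gamma> then (1 / (q - inverse q)) *\<^sub>C (k \<alpha> * K \<alpha> - ki \<alpha> * Ki \<alpha>) else 0)"
    proof -
      \<comment> \<open>The only cross terms of the commutator: the weight of
        \<open>k \<alpha>\<close> on \<open>f \<gamma>\<close> and that of
        \<open>Ki \<gamma>\<close> on \<open>E \<alpha>\<close> produce the same power of
        \<open>q\<close> on opposite sides.\<close>
      have kf: "k \<alpha> * f \<gamma> * (E \<alpha> * Ki \<gamma>) = f \<gamma> * k \<alpha> * (Ki \<gamma> * E \<alpha>)"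
        using a.K_F[OF a g] b.Ki_E[OF g a] by (simp add: root_form_commute[of \<gamma>] scaleC_mult)
      have "(e \<alpha> + k \<alpha> * E \<alpha>) * (f \<gamma> * Ki \<gamma> + F \<gamma>) - (f \<gamma> * Ki \<gamma> + F \<gamma>) * (e \<alpha> + k \<alpha> * E \<alpha>) =
        (e \<alpha> * f \<gamma> - f \<gamma> * e \<alpha>) * Ki \<gamma> + k \<alpha> * (E \<alpha> * F \<gamma> - F \<gamma> * E \<alpha>)"
        using kf by (simp add: ring_distribs mult.assoc big)
      then show ?thesis
        by (auto simp: a.E_F[OF a g] b.E_F[OF a g] scaleC_expand)
    qed
    have sE: "qserre q (e \<alpha> + k \<alpha> * E \<alpha>) (e \<gamma> + k \<gamma> * E \<gamma>) = 0" if rf: "root_form \<alpha> \<gamma> = -1"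
      unfolding qserre_def
    proof (rule serre_sum[OF a.q_inv(1)])
      have rf': "root_form \<gamma> \<alpha> = -1" using rf by (simp add: root_form_commute)
      show "k \<alpha> * E \<alpha> * e \<alpha> = (q * q) *\<^sub>C (e \<alpha> * (k \<alpha> * E \<alpha>))"
        using a.K_E[OF a a] by (simp add: mult.assoc big power2_eq_square) (simp add: mult.assoc[symmetric] scaleC_mult)
      show "k \<alpha> * E \<alpha> * e \<gamma> = inverse q *\<^sub>C (e \<gamma> * (k \<alpha> * E \<alpha>))"
        using a.K_E[OF a g] rf by (simp add: mult.assoc big) (simp add: mult.assoc[symmetric] scaleC_mult)
      show "k \<gamma> * E \<gamma> * e \<alpha> = inverse q *\<^sub>C (e \<alpha> * (k \<gamma> * E \<gamma>))"
        using a.K_E[OF g a] rf' by (simp add: mult.assoc big) (simp add: mult.assoc[symmetric] scaleC_mult)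
      have kk: "k \<gamma> * (k \<alpha> * y) = k \<alpha> * (k \<gamma> * y)" for y
        using a.K_K[OF a g] by (simp add: mult.assoc[symmetric])
      have "k \<alpha> * E \<alpha> * (k \<alpha> * E \<alpha>) * (k \<gamma> * E \<gamma>) - (q + inverse q) *\<^sub>C (k \<alpha> * E \<alpha> * (k \<gamma> * E \<gamma>) * (k \<alpha> * E \<alpha>)) +
          k \<gamma> * E \<gamma> * (k \<alpha> * E \<alpha>) * (k \<alpha> * E \<alpha>) =
        k \<alpha> * (k \<alpha> * (k \<gamma> * (E \<alpha> * E \<alpha> * E \<gamma> - (q + inverse q) *\<^sub>C (E \<alpha> * E \<gamma> * E \<alpha>) + E \<gamma> * E \<alpha> * E \<alpha>)))"
        by (simp add: scaleC_expand big kk)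
      then show "k \<alpha> * E \<alpha> * (k \<alpha> * E \<alpha>) * (k \<gamma> * E \<gamma>) - (q + inverse q) *\<^sub>C (k \<alpha> * E \<alpha> * (k \<gamma> * E \<gamma>) * (k \<alpha> * E \<alpha>)) +
          k \<gamma> * E \<gamma> * (k \<alpha> * E \<alpha>) * (k \<alpha> * E \<alpha>) = 0"
        using b.serre_E[OF a g rf] by simp
    qed (rule a.serre_E[OF a g rf])
    then show "root_form \<alpha> \<gamma> = -1 \<Longrightarrow> (e \<alpha> + k \<alpha> * E \<alpha>) * (e \<alpha> + k \<alpha> * E \<alpha>) * (e \<gamma> + k \<gamma> * E \<gamma>) -
        (q + inverse q) *\<^sub>C ((e \<alpha> + k \<alpha> * E \<alpha>) * (e \<gamma> + k \<gamma> * E \<gamma>) * (e \<alpha> + k \<alpha> * E \<alpha>)) +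
        (e \<gamma> + k \<gamma> * E \<gamma>) * (e \<alpha> + k \<alpha> * E \<alpha>) * (e \<alpha> + k \<alpha> * E \<alpha>) = 0"
      by (simp add: qserre_def)
    have sF: "qserre q (f \<alpha> * Ki \<alpha> + F \<alpha>) (f \<gamma> * Ki \<gamma> + F \<gamma>) = 0" if rf: "root_form \<alpha> \<gamma> = -1"
      unfolding qserre_def add.commute[of q]
    proof (rule serre_sum[OF a.q_inv(2)])
      have rf': "root_form \<gamma> \<alpha> = -1" using rf by (simp add: root_form_commute)
      have FKi: "F \<alpha> * Ki \<gamma> = q *\<^sub>C (Ki \<gamma> * F \<alpha>)" "F \<gamma> * Ki \<alpha> = q *\<^sub>C (Ki \<alpha> * F \<gamma>)"
         "F \<alpha> * Ki \<alpha> = (inverse q * inverse q) *\<^sub>C (Ki \<alpha> * F \<alpha>)"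
        using b.Ki_F[OF a g] b.Ki_F[OF g a] b.Ki_F[OF a a] rf rf' q(1)
        by (simp_all add: scaleC_scaleC power2_eq_square field_simps)
      show "F \<alpha> * (f \<alpha> * Ki \<alpha>) = (inverse q * inverse q) *\<^sub>C (f \<alpha> * Ki \<alpha> * F \<alpha>)"
        by (simp add: mult.assoc big FKi scaleC_mult)
      show "F \<alpha> * (f \<gamma> * Ki \<gamma>) = q *\<^sub>C (f \<gamma> * Ki \<gamma> * F \<alpha>)"
        by (simp add: mult.assoc big FKi scaleC_mult)
      show "F \<gamma> * (f \<alpha> * Ki \<alpha>) = q *\<^sub>C (f \<alpha> * Ki \<alpha> * F \<gamma>)"
        by (simp add: mult.assoc big FKi scaleC_mult)
      have kk: "Ki \<gamma> * (Ki \<alpha> * y) = Ki \<alpha> * (Ki \<gamma> * y)" "Ki \<gamma> * Ki \<alpha> = Ki \<alpha> * Ki \<gamma>" for y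
        using b.Ki_Ki_comm[OF a g] by (simp_all add: mult.assoc[symmetric])
      have "f \<alpha> * Ki \<alpha> * (f \<alpha> * Ki \<alpha>) * (f \<gamma> * Ki \<gamma>) - (inverse q + q) *\<^sub>C (f \<alpha> * Ki \<alpha> * (f \<gamma> * Ki \<gamma>) * (f \<alpha> * Ki \<alpha>)) +
          f \<gamma> * Ki \<gamma> * (f \<alpha> * Ki \<alpha>) * (f \<alpha> * Ki \<alpha>) =
        (f \<alpha> * f \<alpha> * f \<gamma> - (q + inverse q) *\<^sub>C (f \<alpha> * f \<gamma> * f \<alpha>) + f \<gamma> * f \<alpha> * f \<alpha>) * (Ki \<alpha> * (Ki \<alpha> * Ki \<gamma>))"
        by (simp add: scaleC_expand big kk add.commute[of q])
      then show "f \<alpha> * Ki \<alpha> * (f \<alpha> * Ki \<alpha>) * (f \<gamma> * Ki \<gamma>) - (inverse q + q) *\<^sub>C (f \<alpha> * Ki \<alpha> * (f \<gamma> * Ki \<gamma>) * (f \<alpha> * Ki \<alpha>)) +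
          f \<gamma> * Ki \<gamma> * (f \<alpha> * Ki \<alpha>) * (f \<alpha> * Ki \<alpha>) = 0"
        using a.serre_F[OF a g rf] by simp
      show "F \<alpha> * F \<alpha> * F \<gamma> - (inverse q + q) *\<^sub>C (F \<alpha> * F \<gamma> * F \<alpha>) + F \<gamma> * F \<alpha> * F \<alpha> = 0"
        using b.serre_F[OF a g rf] by (simp add: add.commute)
    qed
    then show "root_form \<alpha> \<gamma> = -1 \<Longrightarrow> (f \<alpha> * Ki \<alpha> + F \<alpha>) * (f \<alpha> * Ki \<alpha> + F \<alpha>) * (f \<gamma> * Ki \<gamma> + F \<gamma>) -
        (q + inverse q) *\<^sub>C ((f \<alpha> * Ki \<alpha> + F \<alpha>) * (f \<gamma> * Ki \<gamma> + F \<gamma>) * (f \<alpha> * Ki \<alpha> + F \<alpha>)) +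
        (f \<gamma> * Ki \<gamma> + F \<gamma>) * (f \<alpha> * Ki \<alpha> + F \<alpha>) * (f \<alpha> * Ki \<alpha> + F \<alpha>) = 0"
      by (simp add: qserre_def)
    assume rf: "root_form \<alpha> \<gamma> = 0"
    have rf': "root_form \<gamma> \<alpha> = 0" using rf by (simp add: root_form_commute)
    have ke: "k \<alpha> * e \<gamma> = e \<gamma> * k \<alpha>" "k \<gamma> * e \<alpha> = e \<alpha> * k \<gamma>" "Ki \<alpha> * F \<gamma> = F \<gamma> * Ki \<alpha>" "Ki \<gamma> * F \<alpha> = F \<alpha> * Ki \<gamma>"
      using a.K_E[OF a g] a.K_E[OF g a] b.Ki_F[OF a g] b.Ki_F[OF g a] rf rf' by simp_all
    note ke = ke ke[THEN comm_assoc]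
    show "(e \<alpha> + k \<alpha> * E \<alpha>) * (e \<gamma> + k \<gamma> * E \<gamma>) = (e \<gamma> + k \<gamma> * E \<gamma>) * (e \<alpha> + k \<alpha> * E \<alpha>)"
      using a.E_E[OF a g rf] b.E_E[OF a g rf] a.K_K[OF a g]
      by (simp add: ring_distribs mult.assoc big ke) (simp add: mult.assoc[symmetric])
    show "(f \<alpha> * Ki \<alpha> + F \<alpha>) * (f \<gamma> * Ki \<gamma> + F \<gamma>) = (f \<gamma> * Ki \<gamma> + F \<gamma>) * (f \<alpha> * Ki \<alpha> + F \<alpha>)"
      using a.F_F[OF a g rf] b.F_F[OF a g rf] b.Ki_Ki_comm[OF a g]
      by (simp add: ring_distribs mult.assoc big ke) (simp add: mult.assoc[symmetric])
  qed
qed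

section \<open>Commutation of the root vectors with the generators\<close>

text \<open>Minus the form of the given simple root with the root of the entry
  \<open>(i, j)\<close>, that is, the exponent with which \<open>K\<close> passes
  \<open>w i j\<close> (\<open>K_w\<close>).\<close>

primrec root_weight :: "root \<Rightarrow> nat \<Rightarrow> nat \<Rightarrow> int" where
  "root_weight (Mu k) i j = of_bool (k = i) - of_bool (Suc k = i)"
| "root_weight (Nu k) i j = of_bool (k = j) - of_bool (Suc k = j)"
| "root_weight Beta i j = - of_bool (i = 1) - of_bool (j = 1)"

text \<open>\<open>chain\<close> with its starting element removed. The case of one factor is
  separate because a bracket of \<open>x 1\<close> with 1 would give
  \<open>(1 - inverse q) *\<^sub>C x 1\<close> instead of \<open>x 1\<close>.\<close>

primrec unit_chain :: "complex \<Rightarrow> (nat \<Rightarrow> 'b) \<Rightarrow> nat \<Rightarrow> 'b::complex_algebra" where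
  "unit_chain q x 0 = 1"
| "unit_chain q x (Suc k) = (if k = 0 then 1 else if k = 1 then x 1 else qbr q (x k) (unit_chain q x k))"

lemma unit_chain_commute:
  fixes y :: "'b::complex_algebra"
  assumes "\<And>k. 1 \<le> k \<Longrightarrow> k < i \<Longrightarrow> y * x k = x k * y"
  shows "y * unit_chain q x i = unit_chain q x i * y"
  using assms by (induction i) (auto intro: qbr_commute)

lemma qbr_scaleC: "qbr q x (c *\<^sub>C y) = c *\<^sub>C qbr q x y" "qbr q (c *\<^sub>C x) y = c *\<^sub>C qbr q x y"
  unfolding qbr_def by (simp_all add: scaleC_ring mult.commute)

lemma qbr_mult_right:
  fixes x :: "'b::complex_algebra"
  assumes "x * b = b * x"
  shows "qbr q x (a * b) = qbr q x a * b"
proof -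
  have "a * b * x = a * x * b" using assms by (simp add: mult.assoc)
  then show ?thesis unfolding qbr_def by (simp add: left_diff_distrib scaleC_mult mult.assoc)
qed

lemma qbr_mult_left:
  fixes x :: "'b::complex_algebra"
  assumes "x * a = a * x"
  shows "qbr q x (a * b) = a * qbr q x b"
proof -
  have "x * (a * b) = a * (x * b)" using assms by (rule comm_assoc)
  then show ?thesis unfolding qbr_def by (simp add: right_diff_distrib scaleC_mult mult.assoc)
qed

context uq
begin

abbreviation "w \<equiv> qmat q F"

lemma flip_uq: "uq n q (\<lambda>\<alpha>. E (flip \<alpha>)) (\<lambda>\<alpha>. F (flip \<alpha>)) (\<lambda>\<alpha>. K (flip \<alpha>)) (\<lambda>\<alpha>. Ki (flip \<alpha>))"
proof -
  have "flip \<alpha> = flip \<gamma> \<longleftrightarrow> \<alpha> = \<gamma>" for \<alpha> \<gamma> by (cases \<alpha>; cases \<gamma>) auto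
  then show ?thesis
    by unfold_locales (auto intro!: q0 q_pow K_Ki Ki_K K_K E_E F_F serre_E serre_F
        simp: flip_simple root_form_flip K_E_Ki K_F_Ki E_F split del: if_split)
qed

lemma weight_qbr:
  assumes "K \<alpha> * x = q powi a *\<^sub>C (x * K \<alpha>)" "K \<alpha> * y = q powi b *\<^sub>C (y * K \<alpha>)"
  shows "K \<alpha> * qbr q x y = q powi (a + b) *\<^sub>C (qbr q x y * K \<alpha>)"
proof -
  have "K \<alpha> * (x * z) = q powi a *\<^sub>C (x * (K \<alpha> * z))" "K \<alpha> * (y * z) = q powi b *\<^sub>C (y * (K \<alpha> * z))" for z
    using assms by (simp_all add: mult.assoc[symmetric] scaleC_mult)
  then show ?thesis
    unfolding qbr_def using q0 by (simp add: scaleC_expand assms power_int_add algebra_simps)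
qed

lemma K_w_1: assumes "\<alpha> \<in> simple_roots n" "1 \<le> j" "j \<le> n"
  shows "K \<alpha> * w 1 j = q powi root_weight \<alpha> 1 j *\<^sub>C (w 1 j * K \<alpha>)"
  using assms(2,3)
proof (induction j rule: nat_induct_at_least)
  case base
  have "root_weight \<alpha> 1 1 = - root_form \<alpha> Beta"
    using assms(1) by (cases \<alpha>) (auto simp: root_form_def)
  then show ?case using K_F[of \<alpha> Beta] assms(1) by (simp add: f.z_11[simplified])
next
  case (Suc j)
  have "root_weight \<alpha> 1 (Suc j) = - root_form \<alpha> (Nu j) + root_weight \<alpha> 1 j"
    using assms(1) Suc by (cases \<alpha>) (auto simp: root_form_def)
  then show ?case using weight_qbr[OF K_F[of \<alpha> "Nu j"] Suc.IH] Suc assms(1)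
    by (simp add: f.z_1_nu[simplified])
qed

lemma K_w: assumes "\<alpha> \<in> simple_roots n" "1 \<le> i" "i \<le> n" "1 \<le> j" "j \<le> n"
  shows "K \<alpha> * w i j = q powi root_weight \<alpha> i j *\<^sub>C (w i j * K \<alpha>)"
  using assms(2,3)
proof (induction i rule: nat_induct_at_least)
  case base
  then show ?case using K_w_1 assms by simp
next
  case (Suc i)
  have "root_weight \<alpha> (Suc i) j = - root_form \<alpha> (Mu i) + root_weight \<alpha> i j"
    using assms(1) Suc by (cases \<alpha>) (auto simp: root_form_def)
  then show ?case using weight_qbr[OF K_F[of \<alpha> "Mu i"] Suc.IH] Suc assms(1)
    by (simp add: f.z_mu)
qed

lemma Ki_w: assumes "\<alpha> \<in> simple_roots n" "1 \<le> i" "i \<le> n" "1 \<le> j" "j \<le> n"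
  shows "Ki \<alpha> * w i j = q powi (- root_weight \<alpha> i j) *\<^sub>C (w i j * Ki \<alpha>)"
  using Ki_weight[OF assms(1) K_w[OF assms]] .

lemma E_F_comm: "\<alpha> \<in> simple_roots n \<Longrightarrow> \<gamma> \<in> simple_roots n \<Longrightarrow> \<alpha> \<noteq> \<gamma> \<Longrightarrow> E \<alpha> * F \<gamma> = F \<gamma> * E \<alpha>"
  using E_F[of \<alpha> \<gamma>] by simp

lemma E_mu_w_1: assumes "1 \<le> k" "k < n" "1 \<le> j" "j \<le> n"
  shows "E (Mu k) * w 1 j = w 1 j * E (Mu k)"
  using assms(3,4)
proof (induction j rule: nat_induct_at_least)
  case base
  then show ?case using assms E_F_comm by (simp add: f.z_11[simplified])
next
  case (Suc j)
  then show ?case using assms E_F_comm by (simp add: f.z_1_nu[simplified] qbr_commute)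
qed

lemma E_mu_w_above: assumes "i \<le> k" "k < n" "1 \<le> i" "1 \<le> j" "j \<le> n"
  shows "E (Mu k) * w i j = w i j * E (Mu k)"
  using assms(3,1)
proof (induction i rule: nat_induct_at_least)
  case base
  then show ?case using assms E_mu_w_1 by simp
next
  case (Suc i)
  then show ?case using assms E_F_comm by (simp add: f.z_mu qbr_commute)
qed

text \<open>Only the outermost factor \<open>F (Mu i)\<close> interacts. In the q-commutator of
  \<open>K - Ki\<close> with \<open>w i j\<close> the parts with \<open>Ki\<close> cancel, and those
  with \<open>K\<close> leave the factor \<open>q - inverse q\<close>, which removes the
  denominator.\<close>

lemma E_mu_w: assumes "1 \<le> i" "i < n" "1 \<le> j" "j \<le> n"
  shows "E (Mu i) * w (Suc i) j = w (Suc i) j * E (Mu i) + w i j * K (Mu i)"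
proof -
  note c = E_mu_w_above[of i i j]
  have s: "Mu i \<in> simple_roots n" using assms by simp
  have EF: "E (Mu i) * F (Mu i) = F (Mu i) * E (Mu i) + (1 / (q - inverse q)) *\<^sub>C (K (Mu i) - Ki (Mu i))"
    using E_F[OF s s] by (simp add: algebra_simps)
  have "K (Mu i) * w i j = q *\<^sub>C (w i j * K (Mu i))" "Ki (Mu i) * w i j = inverse q *\<^sub>C (w i j * Ki (Mu i))"
    using K_w[OF s, of i j] Ki_w[OF s, of i j] assms by simp_all
  note Kw = this
  have EF': "E (Mu i) * (F (Mu i) * y) = F (Mu i) * (E (Mu i) * y) + (1 / (q - inverse q)) *\<^sub>C (K (Mu i) * y - Ki (Mu i) * y)" for y
    using arg_cong[OF EF, of "\<lambda>u. u * y"] by (simp add: scaleC_mult algebra_simps)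
  have c': "E (Mu i) * w i j = w i j * E (Mu i)" "E (Mu i) * (w i j * y) = w i j * (E (Mu i) * y)" for y
    using c assms by (simp_all add: comm_assoc)
  have "E (Mu i) * w (Suc i) j - w (Suc i) j * E (Mu i) =
    (1 / (q - inverse q)) *\<^sub>C (q *\<^sub>C (w i j * K (Mu i)) - inverse q *\<^sub>C (w i j * K (Mu i)))"
    using assms
    by (simp add: f.z_mu qbr_def scaleC_expand EF EF' c' Kw q_inv algebra_simps)
  also have "\<dots> = w i j * K (Mu i)"
    using q_diff by (simp add: scaleC_diff_left[symmetric] scaleC_scaleC)
  finally show ?thesis by (simp add: algebra_simps)
qed

lemma E_mu_w_off: assumes "1 \<le> k" "k < n" "1 \<le> i" "i \<le> n" "1 \<le> j" "j \<le> n" "i \<noteq> Suc k"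
  shows "E (Mu k) * w i j = w i j * E (Mu k)"
proof (cases "i \<le> k")
  case True
  then show ?thesis using E_mu_w_above assms by simp
next
  case False
  then have "k + 2 \<le> i" using assms by simp
  then show ?thesis using assms(4)
  proof (induction i rule: nat_induct_at_least)
    case base
    have s: "Mu k \<in> simple_roots n" "Mu (Suc k) \<in> simple_roots n" using assms base by auto
    \<comment> \<open>The weight \<open>q\<close> of \<open>K (Mu k)\<close> on the next generator
      compensates the factor \<open>inverse q\<close> of the bracket, so the term created by
      \<open>E_mu_w\<close> disappears one row further down.\<close>
    have KF: "K (Mu k) * F (Mu (Suc k)) = q *\<^sub>C (F (Mu (Suc k)) * K (Mu k))"
      using K_F[OF s] by (simp add: root_form_def)
    have EF: "E (Mu k) * F (Mu (Suc k)) = F (Mu (Suc k)) * E (Mu k)" using E_F_comm[OF s] by simp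
    have Ew: "E (Mu k) * w (Suc k) j = w (Suc k) j * E (Mu k) + w k j * K (Mu k)"
      using E_mu_w[of k j] assms by simp
    have wF: "F (Mu (Suc k)) * w k j = w k j * F (Mu (Suc k))"
      using f.mu_z_off[of "Suc k" k j] assms base by simp
    have Ew': "E (Mu k) * (w (Suc k) j * y) = w (Suc k) j * (E (Mu k) * y) + w k j * (K (Mu k) * y)" for y
      using arg_cong[OF Ew, of "\<lambda>u. u * y"] by (simp add: scaleC_expand)
    show ?case
      by (simp add: f.z_mu qbr_def scaleC_expand Ew Ew' EF EF[THEN comm_assoc] wF wF[THEN comm_assoc] KF q_inv algebra_simps)
  next
    case (Suc i)
    then show ?case using E_F_comm[of "Mu k" "Mu i"] assms by (simp add: f.z_mu qbr_commute)
  qed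
qed

lemma E_nu_w: assumes "1 \<le> i" "i \<le> n" "1 \<le> j" "j < n"
  shows "E (Nu j) * w i (Suc j) = w i (Suc j) * E (Nu j) + w i j * K (Nu j)"
  using uq.E_mu_w[OF flip_uq, of j i] assms by (simp add: f.z_flip)

lemma E_nu_w_off: assumes "1 \<le> k" "k < n" "1 \<le> i" "i \<le> n" "1 \<le> j" "j \<le> n" "j \<noteq> Suc k"
  shows "E (Nu k) * w i j = w i j * E (Nu k)"
  using uq.E_mu_w_off[OF flip_uq, of k j i] assms by (simp add: f.z_flip)

abbreviation "fm \<equiv> unit_chain q (\<lambda>k. F (Mu k))"
abbreviation "fn \<equiv> unit_chain q (\<lambda>k. F (Nu k))"

lemma E_beta_w_11: "E Beta * w 1 1 = w 1 1 * E Beta + (1 / (q - inverse q)) *\<^sub>C (K Beta - Ki Beta)"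
  using E_F[of Beta Beta] by (simp add: f.z_11[simplified] algebra_simps)

lemma E_beta_qbr:
  assumes "\<gamma> \<in> simple_roots n" "\<gamma> \<noteq> Beta" "E Beta * x = x * E Beta + y"
  shows "E Beta * qbr q (F \<gamma>) x = qbr q (F \<gamma>) x * E Beta + qbr q (F \<gamma>) y"
proof -
  have c: "E Beta * F \<gamma> = F \<gamma> * E Beta" using E_F_comm assms by simp
  have "E Beta * (x * z) = x * (E Beta * z) + y * z" for z
    using arg_cong[OF assms(3), of "\<lambda>u. u * z"] by (simp add: ring_distribs mult.assoc)
  then show ?thesis
    unfolding qbr_def by (simp add: scaleC_expand assms(3) c c[THEN comm_assoc] algebra_simps)
qed

text \<open>\<open>K Beta\<close> passes \<open>F \<gamma>\<close> with factor \<open>q\<close>,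
  hence the bracket annihilates its part. So from the second entry on only \<open>Ki Beta\<close>
  occurs, and a single error term is left.\<close>

lemma E_beta_w_21: assumes "\<gamma> \<in> {Mu 1, Nu 1}" "1 < n"
  shows "qbr q (F \<gamma>) ((1 / (q - inverse q)) *\<^sub>C (K Beta - Ki Beta)) = (- inverse q) *\<^sub>C (F \<gamma> * Ki Beta)"
proof -
  have s: "\<gamma> \<in> simple_roots n" "Beta \<in> simple_roots n" "root_form Beta \<gamma> = -1"
    using assms by (auto simp: root_form_def)
  define t where "t = 1 / (q - inverse q)"
  have *: "K Beta * F \<gamma> = q *\<^sub>C (F \<gamma> * K Beta)" "Ki Beta * F \<gamma> = inverse q *\<^sub>C (F \<gamma> * Ki Beta)"
    using K_F[OF s(2,1)] Ki_F[OF s(2,1)] s(3) by simp_all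
  have "t * inverse q * inverse q - t = - inverse q * (t * (q - inverse q))"
    using q0 by (simp add: field_simps)
  also have "\<dots> = - inverse q" using q_diff by (simp add: t_def)
  finally have c: "t * inverse q * inverse q - t = - inverse q" .
  have "qbr q (F \<gamma>) (t *\<^sub>C (K Beta - Ki Beta)) = (t * inverse q * inverse q - t) *\<^sub>C (F \<gamma> * Ki Beta)"
    unfolding qbr_def using q_inv by (simp add: scaleC_expand * algebra_simps)
  then show ?thesis unfolding c by (simp add: t_def)
qed

lemma Ki_qbr_F:
  assumes "\<alpha> \<in> simple_roots n" "\<gamma> \<in> simple_roots n" "root_form \<alpha> \<gamma> = -1" "F \<gamma> * y = y * F \<gamma>"
  shows "\<exists>c. qbr q (F \<gamma>) (y * Ki \<alpha>) = c *\<^sub>C (y * F \<gamma> * Ki \<alpha>)"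
proof -
  have "Ki \<alpha> * F \<gamma> = inverse q *\<^sub>C (F \<gamma> * Ki \<alpha>)"
    using Ki_F[OF assms(1,2)] assms(3) by simp
  then have "qbr q (F \<gamma>) (y * Ki \<alpha>) = (1 - inverse q * inverse q) *\<^sub>C (y * F \<gamma> * Ki \<alpha>)"
    unfolding qbr_def using assms(4) by (simp add: scaleC_expand comm_assoc)
  then show ?thesis by blast
qed

text \<open>The coefficient is \<open>- inverse q\<close> on the first row and column and \<open>inverse q ^ 3 - inverse q\<close>
  elsewhere.\<close>

lemma E_beta_w: assumes "1 \<le> i" "i \<le> n" "1 \<le> j" "j \<le> n" "(i, j) \<noteq> (1, 1)"
  shows "\<exists>c. E Beta * w i j = w i j * E Beta + c *\<^sub>C (fm i * fn j * Ki Beta)"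
proof -
  have 1: "\<exists>c. E Beta * w i 1 = w i 1 * E Beta + c *\<^sub>C (fm i * Ki Beta)" if "2 \<le> i" "i \<le> n" for i
    using that
  proof (induction i rule: nat_induct_at_least)
    case base
    then show ?case
      using E_beta_qbr[OF _ _ E_beta_w_11, of "Mu 1"] E_beta_w_21[of "Mu 1"] f.z_mu[of 1 1]
      by (auto simp: numeral_2_eq_2 intro!: exI[of _ "- inverse q"])
  next
    case (Suc i)
    then obtain c where c: "E Beta * w i 1 = w i 1 * E Beta + c *\<^sub>C (fm i * Ki Beta)" by auto
    have "F (Mu i) * Ki Beta = Ki Beta * F (Mu i)"
      using Ki_F[of Beta "Mu i"] Suc by (simp add: root_form_def)
    then have "qbr q (F (Mu i)) (c *\<^sub>C (fm i * Ki Beta)) = c *\<^sub>C (fm (Suc i) * Ki Beta)"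
      using Suc by (simp add: qbr_scaleC qbr_mult_right)
    then show ?case using E_beta_qbr[OF _ _ c, of "Mu i"] Suc by (auto simp: f.z_mu)
  qed
  have Fnm: "F (Nu k) * fm i = fm i * F (Nu k)" if "1 \<le> k" "k < n" for k
    by (rule unit_chain_commute, rule F_F) (use that assms in \<open>auto simp: root_form_def\<close>)
  have 2: "\<exists>c. E Beta * w i 2 = w i 2 * E Beta + c *\<^sub>C (fm i * fn 2 * Ki Beta)" if "1 < n"
  proof (cases "i = 1")
    case True
    then show ?thesis
      using E_beta_qbr[OF _ _ E_beta_w_11, of "Nu 1"] E_beta_w_21[of "Nu 1"] f.z_nu[of 1 1] that
      by (auto simp: numeral_2_eq_2 intro!: exI[of _ "- inverse q"])
  next
    case False
    then obtain c where c: "E Beta * w i 1 = w i 1 * E Beta + c *\<^sub>C (fm i * Ki Beta)"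
      using 1[of i] assms by auto
    \<comment> \<open>Of the \<open>Nu\<close> brackets only this first one fails to commute with
      \<open>Ki Beta\<close>; it contributes the factor
      \<open>1 - inverse q * inverse q\<close>.\<close>
    obtain d where d: "qbr q (F (Nu 1)) (fm i * Ki Beta) = d *\<^sub>C (fm i * F (Nu 1) * Ki Beta)"
      using Ki_qbr_F[of Beta "Nu 1" "fm i"] Fnm[of 1] \<open>1 < n\<close> by (auto simp: root_form_def)
    show ?thesis
      using E_beta_qbr[OF _ _ c, of "Nu 1"] that f.z_nu[of i 1] assms d
      by (auto simp: numeral_2_eq_2 qbr_scaleC scaleC_scaleC)
  qed
  have 3: "\<exists>c. E Beta * w i j = w i j * E Beta + c *\<^sub>C (fm i * fn j * Ki Beta)" if "2 \<le> j" "j \<le> n" for j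
    using that
  proof (induction j rule: nat_induct_at_least)
    case base
    then show ?case using 2 by simp
  next
    case (Suc j)
    then obtain c where c: "E Beta * w i j = w i j * E Beta + c *\<^sub>C (fm i * fn j * Ki Beta)" by auto
    have "F (Nu j) * Ki Beta = Ki Beta * F (Nu j)"
      using Ki_F[of Beta "Nu j"] Suc by (simp add: root_form_def)
    then have "qbr q (F (Nu j)) (c *\<^sub>C (fm i * fn j * Ki Beta)) = c *\<^sub>C (fm i * fn (Suc j) * Ki Beta)"
      using Suc Fnm[of j] by (simp add: qbr_scaleC qbr_mult_right qbr_mult_left)
    then show ?case using E_beta_qbr[OF _ _ c, of "Nu j"] Suc assms by (auto simp: f.z_nu)
  qed
  show ?thesis
  proof (cases "j = 1")
    case True
    then show ?thesis using 1[of i] assms by auto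
  next
    case False
    then show ?thesis using 3[of j] assms by auto
  qed
qed

text \<open>Only the last generator in \<open>fm i\<close> is adjacent to the end of the chain in
  \<open>w i j\<close> and contributes \<open>q\<close>; the inner ones commute with
  \<open>w i j\<close>.\<close>

lemma fm_w: assumes "2 \<le> i" "i \<le> n" "1 \<le> j" "j \<le> n"
  shows "fm i * w i j = q *\<^sub>C (w i j * fm i)"
proof -
  obtain k where k: "i = Suc k" "1 \<le> k" using assms by (cases i) auto
  have t: "F (Mu k) * w i j = q *\<^sub>C (w i j * F (Mu k))" using f.mu_z_top[of k j] k assms by simp
  show ?thesis
  proof (cases "k = 1")
    case True
    then show ?thesis using t k by simp
  next
    case False
    have "w i j * fm k = fm k * w i j"
      by (rule unit_chain_commute, rule f.mu_z_off[symmetric]) (use k assms in auto)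
    then have c: "fm k * w i j = w i j * fm k" ..
    have t': "F (Mu k) * (w i j * y) = q *\<^sub>C (w i j * (F (Mu k) * y))" for y
      using arg_cong[OF t, of "\<lambda>u. u * y"] by (simp add: mult.assoc scaleC_mult)
    have "fm i = qbr q (F (Mu k)) (fm k)" using k False by simp
    then show ?thesis
      by (simp add: qbr_def scaleC_expand c comm_assoc[OF c] t t' mult.commute)
  qed
qed

lemma fn_w: assumes "2 \<le> j" "j \<le> n" "1 \<le> i" "i \<le> n"
  shows "fn j * w i j = q *\<^sub>C (w i j * fn j)"
  using uq.fm_w[OF flip_uq, of j i] assms by (simp add: f.z_flip)

text \<open>Each index contributes one factor \<open>q\<close>: through \<open>fm\<close> or
  \<open>fn\<close> if it exceeds 1, through \<open>Ki Beta\<close> if it equals 1. The uniform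
  exponent 2, against weight 0 of \<open>E Beta\<close>, is what pushing through powers of
  \<open>w i j\<close> requires.\<close>

lemma E_beta_coeff: assumes "1 \<le> i" "i \<le> n" "1 \<le> j" "j \<le> n" "(i, j) \<noteq> (1, 1)"
  shows "fm i * fn j * Ki Beta * w i j = (q * q) *\<^sub>C (w i j * (fm i * fn j * Ki Beta))"
proof -
  have 1: "fm i * w i j = (if i = 1 then 1 else q) *\<^sub>C (w i j * fm i)" using fm_w[of i j] assms by auto
  have 2: "fn j * w i j = (if j = 1 then 1 else q) *\<^sub>C (w i j * fn j)" using fn_w[of j i] assms by auto
  have 3: "Ki Beta * w i j = ((if i = 1 then q else 1) * (if j = 1 then q else 1)) *\<^sub>C (w i j * Ki Beta)"
    using Ki_w[of Beta i j] assms q0 by (auto simp: power_int_add)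
  note a = 1[THEN arg_cong[where f="\<lambda>u. u * v" for v], unfolded mult.assoc mult_scaleC_left]
    2[THEN arg_cong[where f="\<lambda>u. u * v" for v], unfolded mult.assoc mult_scaleC_left]
  show ?thesis using assms(5)
    by (simp add: mult.assoc 3 scaleC_ring a del: One_nat_def split del: if_split) auto
qed

end

section \<open>The elements defined by Lusztig's automorphisms\<close>

lemma lusztig_fixed: "(\<And>x. x \<in> letters t \<Longrightarrow> lusztig_gen q \<alpha> x = Gen x) \<Longrightarrow> lusztig q \<alpha> t = t"
  by (induction t) auto

text \<open>Treats \<open>E\<close> and \<open>F\<close> together. For \<open>F\<close> the
  automorphism produces \<open>F \<gamma> * F \<alpha> - q *\<^sub>C (F \<alpha> * F
  \<gamma>)\<close>, which is \<open>- q\<close> times the bracket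
  \<open>qbr q (F \<alpha>) (F \<gamma>)\<close>; this is the origin of \<open>c\<close> and of the
  powers of \<open>- q\<close> in \<open>Wel_eq\<close>.\<close>

locale lusztig_bracket = serre_family n q X for n q and X :: "root \<Rightarrow> 'b::complex_algebra" +
  fixes g :: "gen \<Rightarrow> 'b::complex_algebra" and G :: "root \<Rightarrow> gen" and B :: "gen aterm \<Rightarrow> gen aterm \<Rightarrow> gen aterm"
    and c :: complex
  assumes X_g: "X \<alpha> = g (G \<alpha>)"
    and lusztig_B: "lusztig q \<alpha> (B s t) = B (lusztig q \<alpha> s) (lusztig q \<alpha> t)"
    and letters_B: "letters (B s t) = letters s \<union> letters t"
    and lusztig_near: "root_form \<alpha> \<gamma> = -1 \<Longrightarrow> lusztig_gen q \<alpha> (G \<gamma>) = B (Gen (G \<alpha>)) (Gen (G \<gamma>))"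
    and lusztig_far: "root_form \<alpha> \<gamma> = 0 \<Longrightarrow> lusztig_gen q \<alpha> (G \<gamma>) = Gen (G \<gamma>)"
    and eval_B: "eval_aterm g (B s t) = c *\<^sub>C qbr q (eval_aterm g s) (eval_aterm g t)"
begin

abbreviation "lfold M a b \<equiv> fold (\<lambda>k. lusztig q (M k)) [a..<b]"

lemma fold_B: "fold (\<lambda>k. lusztig q (M k)) ks (B s t) =
    B (fold (\<lambda>k. lusztig q (M k)) ks s) (fold (\<lambda>k. lusztig q (M k)) ks t)"
  by (induction ks arbitrary: s t) (simp_all add: lusztig_B)

lemma fold_fixed:
  assumes "\<And>k \<gamma>. k \<in> set ks \<Longrightarrow> \<gamma> \<in> R \<Longrightarrow> root_form (M k) \<gamma> = 0" "letters t \<subseteq> G ` R"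
  shows "fold (\<lambda>k. lusztig q (M k)) ks t = t"
  using assms(1)
proof (induction ks)
  case (Cons k ks)
  have "lusztig q (M k) t = t"
    by (rule lusztig_fixed) (use assms(2) Cons.prems lusztig_far in auto)
  then show ?case using Cons by simp
qed simp

text \<open>A root vector for the sum of the roots \<open>M a\<close> to \<open>M (b - 1)\<close>,
  as the automorphisms produce it.\<close>

definition segment :: "(nat \<Rightarrow> root) \<Rightarrow> nat \<Rightarrow> nat \<Rightarrow> gen aterm"
  where "segment M a b = lfold M (Suc a) b (Gen (G (M a)))"

lemma segment_Suc [simp]: "segment M a (Suc a) = Gen (G (M a))"
  unfolding segment_def by simp

lemma segment_rec:
  assumes "Suc a < b" "M \<in> {Mu, Nu}"
  shows "segment M a b = B (segment M (Suc a) b) (Gen (G (M a)))"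
proof -
  have "root_form (M (Suc a)) (M a) = -1" using assms(2) by (auto simp: root_form_def)
  moreover have "lfold M (Suc (Suc a)) b (Gen (G (M a))) = Gen (G (M a))"
    by (rule fold_fixed[of _ "{M a}"]) (use assms(2) in \<open>auto simp: root_form_def\<close>)
  ultimately show ?thesis using assms(1)
    by (simp add: segment_def upt_conv_Cons lusztig_near fold_B)
qed

lemma letters_segment: "M \<in> {Mu, Nu} \<Longrightarrow> a < b \<Longrightarrow> letters (segment M a b) \<subseteq> G ` M ` {a..<b}"
proof (induction "b - a" arbitrary: a rule: less_induct)
  case less
  show ?case
  proof (cases "Suc a = b")
    case True
    then show ?thesis by auto
  next
    case False
    then have "letters (segment M (Suc a) b) \<subseteq> G ` M ` {Suc a..<b}" using less by auto
    moreover have "segment M a b = B (segment M (Suc a) b) (Gen (G (M a)))"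
      using segment_rec[of a b M] less False by auto
    ultimately show ?thesis using less.prems by (force simp: letters_B)
  qed
qed

text \<open>The automorphisms nest brackets with the lowest root outermost on the right, whereas
  \<open>chain\<close> has the highest root outermost on the left. Nonadjacent generators commute,
  so \<open>qbr_assoc\<close> converts one nesting into the other.\<close>

lemma eval_segment_Suc:
  assumes "M \<in> {Mu, Nu}" "1 \<le> a" "a < b" "b < n"
  shows "eval_aterm g (segment M a (Suc b)) = c *\<^sub>C qbr q (X (M b)) (eval_aterm g (segment M a b))"
  using assms(2,3)
proof (induction "b - a" arbitrary: a rule: less_induct)
  case less
  show ?case
  proof (cases "Suc a = b")
    case True
    then show ?thesis using segment_rec[of a "Suc b" M] assms(1) by (auto simp: eval_B X_g)
  next
    case False
    have cm: "X (M b) * X (M a) = X (M a) * X (M b)"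
      by (rule X_comm) (use assms less.prems False in \<open>auto simp: root_form_def\<close>)
    have "eval_aterm g (segment M a (Suc b)) = c *\<^sub>C qbr q (eval_aterm g (segment M (Suc a) (Suc b))) (X (M a))"
      using segment_rec[of a "Suc b" M] assms(1) less.prems False by (simp add: eval_B X_g)
    also have "eval_aterm g (segment M (Suc a) (Suc b)) = c *\<^sub>C qbr q (X (M b)) (eval_aterm g (segment M (Suc a) b))"
      using less False by auto
    also have "c *\<^sub>C qbr q (c *\<^sub>C qbr q (X (M b)) (eval_aterm g (segment M (Suc a) b))) (X (M a)) =
        c *\<^sub>C qbr q (X (M b)) (c *\<^sub>C qbr q (eval_aterm g (segment M (Suc a) b)) (X (M a)))"
      by (simp add: qbr_scaleC qbr_assoc[OF cm])
    also have "c *\<^sub>C qbr q (eval_aterm g (segment M (Suc a) b)) (X (M a)) = eval_aterm g (segment M a b)"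
      using segment_rec[of a b M] assms(1) less.prems False by (simp add: eval_B X_g)
    finally show ?thesis .
  qed
qed

abbreviation "word i j \<equiv> lusztig_word q i j (Gen (G Beta))"

lemma lfold_Beta: assumes "M \<in> {Mu, Nu}" "1 \<le> k"
  shows "lfold M 1 (Suc k) (Gen (G Beta)) = B (segment M 1 (Suc k)) (Gen (G Beta))"
proof -
  have "root_form (M 1) Beta = -1" using assms(1) by (auto simp: root_form_def)
  moreover have "lfold M 2 (Suc k) (Gen (G Beta)) = Gen (G Beta)"
    by (rule fold_fixed[of _ "{Beta}"]) (use assms(1) in \<open>auto simp: root_form_def\<close>)
  ultimately show ?thesis using assms(2)
    by (simp add: segment_def upt_conv_Cons lusztig_near fold_B numeral_2_eq_2 del: upt_Suc)
qed

lemma word_Suc: assumes "1 \<le> i"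
  shows "word (Suc i) j = B (segment Mu 1 (Suc i)) (word 1 j)"
proof -
  have "lfold Nu 1 j (segment Mu 1 (Suc i)) = segment Mu 1 (Suc i)"
    by (rule fold_fixed[of _ "Mu ` {1..<Suc i}"])
       (use letters_segment[of Mu 1 "Suc i"] assms in \<open>auto simp: root_form_def\<close>)
  then show ?thesis using lfold_Beta[of Mu i] assms
    by (simp add: lusztig_word_def fold_B del: upt_Suc)
qed

lemma word_1_Suc: assumes "1 \<le> j"
  shows "word 1 (Suc j) = B (segment Nu 1 (Suc j)) (Gen (G Beta))"
  using lfold_Beta[of Nu j] assms by (simp add: lusztig_word_def del: upt_Suc)

lemma eval_bracket_segment:
  assumes "M \<in> {Mu, Nu}" "1 \<le> k" "k < n" "2 \<le> k \<Longrightarrow> X (M k) * y = y * X (M k)"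
  shows "c *\<^sub>C qbr q (eval_aterm g (segment M 1 (Suc k))) y =
    c *\<^sub>C qbr q (X (M k)) (if k = 1 then y else c *\<^sub>C qbr q (eval_aterm g (segment M 1 k)) y)"
proof (cases "k = 1")
  case True
  then show ?thesis using segment_Suc[of M 1] by (simp add: X_g)
next
  case False
  then have "X (M k) * y = y * X (M k)" using assms by auto
  then show ?thesis using eval_segment_Suc[of M 1 k] assms False
    by (simp add: qbr_scaleC qbr_assoc)
qed

lemma eval_word_1: "1 \<le> j \<Longrightarrow> j \<le> n \<Longrightarrow> eval_aterm g (word 1 j) = c ^ (j - 1) *\<^sub>C z 1 j"
proof (induction j rule: nat_induct_at_least)
  case base
  then show ?case by (simp add: lusztig_word_def z_11[simplified] X_g[symmetric])
next
  case (Suc j)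
  have "X (Nu j) * X Beta = X Beta * X (Nu j)" if "2 \<le> j"
    by (rule X_comm) (use Suc that in \<open>auto simp: root_form_def\<close>)
  from eval_bracket_segment[of Nu j, OF _ _ _ this]
  have "eval_aterm g (word 1 (Suc j)) = c *\<^sub>C qbr q (X (Nu j)) (eval_aterm g (word 1 j))"
    using Suc word_1_Suc[of j] word_1_Suc[of "j - 1"]
    by (auto simp: eval_B X_g lusztig_word_def)
  then show ?case using Suc
    by (simp add: qbr_scaleC scaleC_scaleC z_1_nu[simplified] power_Suc[symmetric] del: power_Suc)
qed

lemma eval_word:
  assumes "1 \<le> i" "i \<le> n" "1 \<le> j" "j \<le> n"
  shows "eval_aterm g (word i j) = c ^ (i - 1 + (j - 1)) *\<^sub>C z i j"
  using assms(1,2)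
proof (induction i rule: nat_induct_at_least)
  case base
  then show ?case using eval_word_1 assms by simp
next
  case (Suc i)
  have "X (Mu i) * eval_aterm g (word 1 j) = eval_aterm g (word 1 j) * X (Mu i)" if "2 \<le> i"
    using mu_z_off[of i 1 j] that Suc assms eval_word_1 by (simp add: scaleC_mult)
  from eval_bracket_segment[of Mu i, OF _ _ _ this]
  have "eval_aterm g (word (Suc i) j) = c *\<^sub>C qbr q (X (Mu i)) (eval_aterm g (word i j))"
    using Suc word_Suc[of i j] word_Suc[of "i - 1" j] by (auto simp: eval_B)
  then show ?case using Suc
    by (simp add: qbr_scaleC scaleC_scaleC z_mu power_Suc[symmetric] del: power_Suc)
qed

end

lemma Zel_eq:
  assumes "serre_family n q (\<lambda>\<alpha>. g (GenE \<alpha>))" "1 \<le> i" "i \<le> n" "1 \<le> j" "j \<le> n"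
  shows "Zel q g i j = qmat q (\<lambda>\<alpha>. g (GenE \<alpha>)) i j"
proof -
  interpret serre_family n q "\<lambda>\<alpha>. g (GenE \<alpha>)" by fact
  interpret lusztig_bracket n q "\<lambda>\<alpha>. g (GenE \<alpha>)" g GenE "\<lambda>s t. s \<odot> t \<ominus> Cst (inverse q) \<odot> (t \<odot> s)" 1
    by unfold_locales (auto simp: qbr_def scaleC_mult split: if_splits)
  show ?thesis using eval_word[OF assms(2-)] by (simp add: Zel_def)
qed

lemma Wel_eq:
  assumes "serre_family n q (\<lambda>\<alpha>. g (GenF \<alpha>))" "1 \<le> i" "i \<le> n" "1 \<le> j" "j \<le> n"
  shows "Wel q g i j = (- q) ^ (i - 1 + (j - 1)) *\<^sub>C qmat q (\<lambda>\<alpha>. g (GenF \<alpha>)) i j"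
proof -
  interpret serre_family n q "\<lambda>\<alpha>. g (GenF \<alpha>)" by fact
  interpret lusztig_bracket n q "\<lambda>\<alpha>. g (GenF \<alpha>)" g GenF "\<lambda>s t. t \<odot> s \<ominus> Cst q \<odot> (s \<odot> t)" "- q"
    by unfold_locales (auto simp: qbr_def scaleC_ring q0 cvs.scale_minus_left split: if_splits)
  show ?thesis using eval_word[OF assms(2-)] by (simp add: Wel_def)
qed

section \<open>Homomorphisms and representations of the quantized enveloping algebra\<close>

lemma Uq_relations_letters:
  assumes "(s, t) \<in> Uq_relations n q"
  shows "letters s \<subseteq> Uq_gens n" "letters t \<subseteq> Uq_gens n"
  using assms unfolding Uq_relations_def by (auto simp: Uq_gens_def serre_def split: if_splits)

locale uq_presented =
  fixes n :: nat and q :: complex and g :: "gen \<Rightarrow> 'a::complex_algebra"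
  assumes q0: "q \<noteq> 0" and q_pow: "\<And>m. 1 \<le> m \<Longrightarrow> q ^ m \<noteq> 1" and presented: "is_Uq n q g"
begin

abbreviation "E \<alpha> \<equiv> g (GenE \<alpha>)"
abbreviation "F \<alpha> \<equiv> g (GenF \<alpha>)"
abbreviation "K \<alpha> \<equiv> g (GenK \<alpha>)"
abbreviation "Ki \<alpha> \<equiv> g (GenKinv \<alpha>)"

lemma uq_algebra_g: "uq_algebra n q E F K Ki"
  unfolding uq_algebra_iff
proof clarify
  fix s t assume "(s, t) \<in> Uq_relations n q"
  then show "eval_aterm g s = eval_aterm g t"
    using presented Uq_relations_letters[of s t] unfolding is_Uq_def presented_by_def by (blast intro: alg_cong.rel)
qed

sublocale uq n q E F K Ki
  by (rule uq.intro[OF uq_algebra_g]) (unfold_locales, use q0 q_pow in auto)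

lemma ex_hom:
  fixes e f k ki :: "root \<Rightarrow> 'b::complex_algebra"
  assumes "uq_algebra n q e f k ki"
  obtains \<phi> where "alg_hom \<phi>" "\<And>\<alpha>. \<alpha> \<in> simple_roots n \<Longrightarrow> \<phi> (E \<alpha>) = e \<alpha>" "\<And>\<alpha>. \<alpha> \<in> simple_roots n \<Longrightarrow> \<phi> (F \<alpha>) = f \<alpha>"
    "\<And>\<alpha>. \<alpha> \<in> simple_roots n \<Longrightarrow> \<phi> (K \<alpha>) = k \<alpha>" "\<And>\<alpha>. \<alpha> \<in> simple_roots n \<Longrightarrow> \<phi> (Ki \<alpha>) = ki \<alpha>"
proof -
  define h where "h x = (case x of GenE \<alpha> \<Rightarrow> e \<alpha> | GenF \<alpha> \<Rightarrow> f \<alpha> | GenK \<alpha> \<Rightarrow> k \<alpha> | GenKinv \<alpha> \<Rightarrow> ki \<alpha>)" for x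
  have "\<forall>(s, t)\<in>Uq_relations n q. eval_aterm h s = eval_aterm h t"
    unfolding uq_algebra_iff[symmetric] by (simp add: h_def assms)
  note p = presented_hom[OF presented[unfolded is_Uq_def] this]
  show thesis
    by (rule that[OF p(1)]; subst p(2)) (simp_all add: Uq_gens_def h_def)
qed

lemma uq_induct [case_names E F K Ki cst add mult]:
  assumes "\<And>\<alpha>. \<alpha> \<in> simple_roots n \<Longrightarrow> P (E \<alpha>)" "\<And>\<alpha>. \<alpha> \<in> simple_roots n \<Longrightarrow> P (F \<alpha>)"
    "\<And>\<alpha>. \<alpha> \<in> simple_roots n \<Longrightarrow> P (K \<alpha>)" "\<And>\<alpha>. \<alpha> \<in> simple_roots n \<Longrightarrow> P (Ki \<alpha>)"
    "\<And>c. P (c *\<^sub>C 1)" "\<And>x y. P x \<Longrightarrow> P y \<Longrightarrow> P (x + y)" "\<And>x y. P x \<Longrightarrow> P y \<Longrightarrow> P (x * y)"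
  shows "P x"
  by (rule presented_induct[OF presented[unfolded is_Uq_def]]) (use assms in \<open>auto simp: Uq_gens_def\<close>)

text \<open>Carries linear independence from the monomials in the root vectors of \<open>F\<close>
  to those in the \<open>Z\<close>.\<close>

lemma chevalley: obtains \<omega> :: "'a \<Rightarrow> 'a" where "alg_hom \<omega>"
  "\<And>\<alpha>. \<alpha> \<in> simple_roots n \<Longrightarrow> \<omega> (E \<alpha>) = F \<alpha>" "\<And>\<alpha>. \<alpha> \<in> simple_roots n \<Longrightarrow> \<omega> (F \<alpha>) = E \<alpha>"
  "\<And>\<alpha>. \<alpha> \<in> simple_roots n \<Longrightarrow> \<omega> (K \<alpha>) = Ki \<alpha>" "\<And>\<alpha>. \<alpha> \<in> simple_roots n \<Longrightarrow> \<omega> (Ki \<alpha>) = K \<alpha>"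
proof -
  have "uq_algebra n q F E Ki K"
  proof
    fix \<alpha> \<gamma> assume a: "\<alpha> \<in> simple_roots n" and c: "\<gamma> \<in> simple_roots n"
    show "Ki \<alpha> * F \<gamma> * K \<alpha> = q powi root_form \<alpha> \<gamma> *\<^sub>C F \<gamma>"
      using Ki_F[OF a c] Ki_K[OF a] by (simp add: scaleC_mult mult.assoc)
    show "Ki \<alpha> * E \<gamma> * K \<alpha> = q powi - root_form \<alpha> \<gamma> *\<^sub>C E \<gamma>"
      using Ki_E[OF a c] Ki_K[OF a] by (simp add: scaleC_mult mult.assoc)
    show "F \<alpha> * E \<gamma> - E \<gamma> * F \<alpha> = (if \<alpha> = \<gamma> then (1 / (q - inverse q)) *\<^sub>C (Ki \<alpha> - K \<alpha>) else 0)"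
    proof -
      have "F \<alpha> * E \<gamma> - E \<gamma> * F \<alpha> = - (E \<gamma> * F \<alpha> - F \<alpha> * E \<gamma>)" by simp
      then show ?thesis unfolding E_F[OF c a] by (auto simp: scaleC_minus_right[symmetric])
    qed
  qed (auto intro: K_Ki Ki_K Ki_Ki_comm serre_E serre_F E_E F_F)
  then show thesis by (rule ex_hom) (use that in auto)
qed

end

lift_definition lmul :: "'a::complex_algebra \<Rightarrow> ('s, 'a) rend" is "\<lambda>u f s. u * f s"
  by (auto simp: ring_distribs mult.assoc)

lemma rend_eqI: "(\<And>f s. app S f s = app T f s) \<Longrightarrow> S = T"
  by (simp add: app_inject[symmetric] fun_eq_iff)

lemma lmul_hom: "alg_hom (lmul :: 'a::complex_algebra \<Rightarrow> ('s, 'a) rend)"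
  by unfold_locales (auto intro!: rend_eqI simp: lmul.rep_eq app_simps ring_distribs mult.assoc scaleC_mult)

lemma alg_hom_uq_algebra:
  assumes "alg_hom \<phi>" "uq_algebra n q E F K Ki"
  shows "uq_algebra n q (\<lambda>\<alpha>. \<phi> (E \<alpha>)) (\<lambda>\<alpha>. \<phi> (F \<alpha>)) (\<lambda>\<alpha>. \<phi> (K \<alpha>)) (\<lambda>\<alpha>. \<phi> (Ki \<alpha>))"
proof -
  interpret alg_hom \<phi> by fact
  interpret uq_algebra n q E F K Ki by fact
  show ?thesis
    by unfold_locales
       (simp_all add: mult[symmetric] scale[symmetric] add[symmetric] diff[symmetric] one[symmetric] zero[symmetric]
          K_Ki Ki_K K_E_Ki K_F_Ki E_F serre_E serre_F K_K[symmetric] del: mult_scaleC_left mult_scaleC_right, auto intro: arg_cong[where f = \<phi>] K_K E_E F_F)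
qed

text \<open>Twisting \<open>E\<close> by commuting units and \<open>F\<close> by their inverses.
  With a shift as the unit at \<open>Beta\<close> this records the degree in
  \<open>E Beta\<close>.\<close>

lemma uq_algebra_rescale:
  fixes E F K Ki s t :: "root \<Rightarrow> 'b::complex_algebra"
  assumes "uq_algebra n q E F K Ki"
    and st: "\<And>\<alpha>. s \<alpha> * t \<alpha> = 1" "\<And>\<alpha>. t \<alpha> * s \<alpha> = 1"
    and comm: "\<And>\<alpha> \<gamma> x y. x \<in> {s \<alpha>, t \<alpha>} \<Longrightarrow> y \<in> {E \<gamma>, F \<gamma>, K \<gamma>, Ki \<gamma>, s \<gamma>, t \<gamma>} \<Longrightarrow> y * x = x * y"
  shows "uq_algebra n q (\<lambda>\<alpha>. s \<alpha> * E \<alpha>) (\<lambda>\<alpha>. t \<alpha> * F \<alpha>) K Ki"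
proof -
  interpret uq_algebra n q E F K Ki by fact
  have big: "E \<gamma> * s \<alpha> = s \<alpha> * E \<gamma>" "E \<gamma> * t \<alpha> = t \<alpha> * E \<gamma>" "F \<gamma> * s \<alpha> = s \<alpha> * F \<gamma>" "F \<gamma> * t \<alpha> = t \<alpha> * F \<gamma>"
    "K \<gamma> * s \<alpha> = s \<alpha> * K \<gamma>" "K \<gamma> * t \<alpha> = t \<alpha> * K \<gamma>" "Ki \<gamma> * s \<alpha> = s \<alpha> * Ki \<gamma>" "Ki \<gamma> * t \<alpha> = t \<alpha> * Ki \<gamma>"
    "t \<gamma> * s \<alpha> = s \<alpha> * t \<gamma>"
    for \<alpha> \<gamma>
    by (rule comm[of _ \<alpha> _ \<gamma>]; simp)+
  have ss: "s \<gamma> * s \<alpha> = s \<alpha> * s \<gamma>" "t \<gamma> * t \<alpha> = t \<alpha> * t \<gamma>" for \<alpha> \<gamma>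
    by (rule comm[of _ \<alpha> _ \<gamma>]; simp)+
  note big = big big[THEN comm_assoc]
  show ?thesis
  proof
    fix \<alpha> \<gamma> assume a: "\<alpha> \<in> simple_roots n" and c: "\<gamma> \<in> simple_roots n"
    note st' = arg_cong[OF st(1), of "\<lambda>u. u * v" for v, unfolded mult.assoc mult_1_left]
    note ss' = ss(1)[of \<gamma> \<alpha>] ss(2)[of \<gamma> \<alpha>] ss(1)[of \<gamma> \<alpha>, THEN comm_assoc] ss(2)[of \<gamma> \<alpha>, THEN comm_assoc]
    show "K \<alpha> * (s \<gamma> * E \<gamma>) * Ki \<alpha> = q powi root_form \<alpha> \<gamma> *\<^sub>C (s \<gamma> * E \<gamma>)"
      using K_E_Ki[OF a c] by (simp add: mult.assoc big) (simp add: scaleC_mult)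
    show "K \<alpha> * (t \<gamma> * F \<gamma>) * Ki \<alpha> = q powi - root_form \<alpha> \<gamma> *\<^sub>C (t \<gamma> * F \<gamma>)"
      using K_F_Ki[OF a c] by (simp add: mult.assoc big) (simp add: scaleC_mult)
    show "s \<alpha> * E \<alpha> * (t \<gamma> * F \<gamma>) - t \<gamma> * F \<gamma> * (s \<alpha> * E \<alpha>) = (if \<alpha> = \<gamma> then (1 / (q - inverse q)) *\<^sub>C (K \<alpha> - Ki \<alpha>) else 0)"
    proof -
      have "s \<alpha> * E \<alpha> * (t \<gamma> * F \<gamma>) - t \<gamma> * F \<gamma> * (s \<alpha> * E \<alpha>) = s \<alpha> * t \<gamma> * (E \<alpha> * F \<gamma> - F \<gamma> * E \<alpha>)"
        by (simp add: right_diff_distrib mult.assoc big)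
      then show ?thesis unfolding E_F[OF a c] using st by auto
    qed
    show "s \<alpha> * E \<alpha> * (s \<alpha> * E \<alpha>) * (s \<gamma> * E \<gamma>) - (q + inverse q) *\<^sub>C (s \<alpha> * E \<alpha> * (s \<gamma> * E \<gamma>) * (s \<alpha> * E \<alpha>)) +
        s \<gamma> * E \<gamma> * (s \<alpha> * E \<alpha>) * (s \<alpha> * E \<alpha>) = 0" if "root_form \<alpha> \<gamma> = -1"
    proof -
      have "s \<alpha> * E \<alpha> * (s \<alpha> * E \<alpha>) * (s \<gamma> * E \<gamma>) - (q + inverse q) *\<^sub>C (s \<alpha> * E \<alpha> * (s \<gamma> * E \<gamma>) * (s \<alpha> * E \<alpha>)) +
        s \<gamma> * E \<gamma> * (s \<alpha> * E \<alpha>) * (s \<alpha> * E \<alpha>) = s \<alpha> * s \<alpha> * s \<gamma> *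
          (E \<alpha> * E \<alpha> * E \<gamma> - (q + inverse q) *\<^sub>C (E \<alpha> * E \<gamma> * E \<alpha>) + E \<gamma> * E \<alpha> * E \<alpha>)"
        by (simp add: scaleC_expand big ss(1)[of \<gamma> \<alpha>] ss(1)[of \<gamma> \<alpha>, THEN comm_assoc])
      then show ?thesis using serre_E[OF a c that] by simp
    qed
    show "t \<alpha> * F \<alpha> * (t \<alpha> * F \<alpha>) * (t \<gamma> * F \<gamma>) - (q + inverse q) *\<^sub>C (t \<alpha> * F \<alpha> * (t \<gamma> * F \<gamma>) * (t \<alpha> * F \<alpha>)) +
        t \<gamma> * F \<gamma> * (t \<alpha> * F \<alpha>) * (t \<alpha> * F \<alpha>) = 0" if "root_form \<alpha> \<gamma> = -1"
    proof -
      have "t \<alpha> * F \<alpha> * (t \<alpha> * F \<alpha>) * (t \<gamma> * F \<gamma>) - (q + inverse q) *\<^sub>C (t \<alpha> * F \<alpha> * (t \<gamma> * F \<gamma>) * (t \<alpha> * F \<alpha>)) +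
        t \<gamma> * F \<gamma> * (t \<alpha> * F \<alpha>) * (t \<alpha> * F \<alpha>) = t \<alpha> * t \<alpha> * t \<gamma> *
          (F \<alpha> * F \<alpha> * F \<gamma> - (q + inverse q) *\<^sub>C (F \<alpha> * F \<gamma> * F \<alpha>) + F \<gamma> * F \<alpha> * F \<alpha>)"
        by (simp add: scaleC_expand big ss(2)[of \<gamma> \<alpha>] ss(2)[of \<gamma> \<alpha>, THEN comm_assoc])
      then show ?thesis using serre_F[OF a c that] by simp
    qed
    assume rf: "root_form \<alpha> \<gamma> = 0"
    show "s \<alpha> * E \<alpha> * (s \<gamma> * E \<gamma>) = s \<gamma> * E \<gamma> * (s \<alpha> * E \<alpha>)"
      using E_E[OF a c rf] by (simp add: mult.assoc big ss(1)[of \<gamma> \<alpha>, THEN comm_assoc])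
    show "t \<alpha> * F \<alpha> * (t \<gamma> * F \<gamma>) = t \<gamma> * F \<gamma> * (t \<alpha> * F \<alpha>)"
      using F_F[OF a c rf] by (simp add: mult.assoc big ss(2)[of \<gamma> \<alpha>, THEN comm_assoc])
  qed (auto intro: K_Ki Ki_K K_K)
qed

section \<open>The degree shift and the semi-infinite Fock representation\<close>

lift_definition shift :: "int \<Rightarrow> (int, 'a::complex_algebra) rend" is "\<lambda>d f i. f (i - d)"
  by auto

definition exchange :: "int \<Rightarrow> (int \<Rightarrow> bool) \<Rightarrow> int \<Rightarrow> bool"
  where "exchange t S = S(t := S (t + 1), t + 1 := S t)"

text \<open>A state tells which sites of the integer line are occupied, and the root at position
  \<open>t\<close> joins the sites \<open>t\<close> and \<open>t + 1\<close>. Operators act on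
  coefficient functions, so the entry at \<open>S\<close> is read off the state before the move:
  \<open>fock_e t\<close> moves a particle from \<open>t + 1\<close> to \<open>t\<close>, and
  \<open>fock_f t\<close> moves it back.\<close>

lift_definition fock_e :: "int \<Rightarrow> (int \<Rightarrow> bool, 'a::complex_algebra) rend"
  is "\<lambda>t f S. if S t \<and> \<not> S (t + 1) then f (exchange t S) else 0" by auto

lift_definition fock_f :: "int \<Rightarrow> (int \<Rightarrow> bool, 'a::complex_algebra) rend"
  is "\<lambda>t f S. if \<not> S t \<and> S (t + 1) then f (exchange t S) else 0" by auto

lift_definition fock_k :: "complex \<Rightarrow> int \<Rightarrow> (int \<Rightarrow> bool, 'a::complex_algebra) rend"
  is "\<lambda>q t f S. q powi (of_bool (S t) - of_bool (S (t + 1))) *\<^sub>C f S"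
  by (auto simp: scaleC_add_right scaleC_mult)

lemmas fock_simps = fock_e.rep_eq fock_f.rep_eq fock_k.rep_eq shift.rep_eq lmul.rep_eq app_simps

text \<open>Every word of a Serre polynomial acts by zero: a particle would have to cross the same
  edge twice in the same direction, with at most one neighbouring move in between.\<close>

lemma uq_algebra_fock:
  assumes q: "q \<noteq> 0" "q - inverse q \<noteq> 0"
  shows "uq_algebra n q (\<lambda>\<alpha>. fock_e (root_position \<alpha>)) (\<lambda>\<alpha>. fock_f (root_position \<alpha>))
    (\<lambda>\<alpha>. fock_k q (root_position \<alpha>)) (\<lambda>\<alpha>. fock_k (inverse q) (root_position \<alpha>) :: (_, 'a::complex_algebra) rend)"
proof -
  have inj: "root_position \<alpha> = root_position \<gamma> \<longleftrightarrow> \<alpha> = \<gamma>" if "\<alpha> \<in> simple_roots n" "\<gamma> \<in> simple_roots n" for \<alpha> \<gamma>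
    using that by (cases \<alpha>; cases \<gamma>) auto
  have rf: "root_form \<alpha> \<gamma> = (if root_position \<alpha> = root_position \<gamma> then 2
      else if root_position \<gamma> = root_position \<alpha> + 1 \<or> root_position \<alpha> = root_position \<gamma> + 1 then -1 else 0)"
    if "\<alpha> \<in> simple_roots n" "\<gamma> \<in> simple_roots n" for \<alpha> \<gamma>
    using inj[OF that] unfolding root_form_def by auto
  show ?thesis
  proof
    fix \<alpha> \<gamma> assume a: "\<alpha> \<in> simple_roots n" and c: "\<gamma> \<in> simple_roots n"
    define s t where "s = root_position \<alpha>" and "t = root_position \<gamma>"
    note st = s_def[symmetric] t_def[symmetric]
    note r = rf[OF a c, unfolded st]
    show "fock_k q (root_position \<alpha>) * fock_k (inverse q) (root_position \<alpha>) = (1 :: (_, 'a) rend)"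
      by (rule rend_eqI) (use q in \<open>simp add: fock_simps scaleC_scaleC power_int_inverse\<close>)
    show "fock_k (inverse q) (root_position \<alpha>) * fock_k q (root_position \<alpha>) = (1 :: (_, 'a) rend)"
      by (rule rend_eqI) (use q in \<open>simp add: fock_simps scaleC_scaleC power_int_inverse\<close>)
    show "fock_k q (root_position \<alpha>) * fock_k q (root_position \<gamma>) = (fock_k q (root_position \<gamma>) * fock_k q (root_position \<alpha>) :: (_, 'a) rend)"
      by (rule rend_eqI) (simp add: fock_simps scaleC_scaleC mult.commute)
    show "fock_k q (root_position \<alpha>) * fock_e (root_position \<gamma>) * fock_k (inverse q) (root_position \<alpha>) =
      (q powi root_form \<alpha> \<gamma> *\<^sub>C fock_e (root_position \<gamma>) :: (_, 'a) rend)"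
      unfolding st r
      by (rule rend_eqI) (use q in \<open>auto simp: fock_simps exchange_def scaleC_scaleC power_int_inverse power_int_minus power_int_diff power_int_add power2_eq_square divide_inverse\<close>)
    show "fock_k q (root_position \<alpha>) * fock_f (root_position \<gamma>) * fock_k (inverse q) (root_position \<alpha>) =
      (q powi - root_form \<alpha> \<gamma> *\<^sub>C fock_f (root_position \<gamma>) :: (_, 'a) rend)"
      unfolding st r
      by (rule rend_eqI) (use q in \<open>auto simp: fock_simps exchange_def scaleC_scaleC power_int_inverse power_int_minus power_int_diff power_int_add power2_eq_square divide_inverse\<close>)
    show "fock_e (root_position \<alpha>) * fock_f (root_position \<gamma>) - fock_f (root_position \<gamma>) * fock_e (root_position \<alpha>) =
      (if \<alpha> = \<gamma> then (1 / (q - inverse q)) *\<^sub>C (fock_k q (root_position \<alpha>) - fock_k (inverse q) (root_position \<alpha>)) else 0 :: (_, 'a) rend)"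
    proof (cases "\<alpha> = \<gamma>")
      case True
      have ex: "exchange s (exchange s S) = S" for S by (auto simp: exchange_def fun_eq_iff)
      have ex': "exchange s S s = S (s + 1)" "exchange s S (s + 1) = S s" for S by (auto simp: exchange_def)
      have c: "(1 / (q - inverse q)) *\<^sub>C (q *\<^sub>C x - inverse q *\<^sub>C x) = x"
        "(1 / (q - inverse q)) *\<^sub>C (inverse q *\<^sub>C x - q *\<^sub>C x) = - x" for x :: 'a
      proof -
        show 1: "(1 / (q - inverse q)) *\<^sub>C (q *\<^sub>C x - inverse q *\<^sub>C x) = x"
          using q by (simp add: scaleC_diff_left[symmetric] scaleC_scaleC)
        have "inverse q *\<^sub>C x - q *\<^sub>C x = - (q *\<^sub>C x - inverse q *\<^sub>C x)" by simp
        then show "(1 / (q - inverse q)) *\<^sub>C (inverse q *\<^sub>C x - q *\<^sub>C x) = - x"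
          using 1 by (simp only: scaleC_minus_right)
      qed
      have "fock_e s * fock_f s - fock_f s * fock_e s = ((1 / (q - inverse q)) *\<^sub>C (fock_k q s - fock_k (inverse q) s) :: (_, 'a) rend)"
        by (rule rend_eqI) (auto simp: fock_simps ex ex' c power_int_minus split: if_split)
      then show ?thesis using True by (simp add: s_def)
    next
      case False
      then have ne: "s \<noteq> t" using inj[OF a c] by (simp add: s_def t_def)
      have "fock_e s * fock_f t = (fock_f t * fock_e s :: (_, 'a) rend)"
      proof (cases "t = s + 1 \<or> s = t + 1")
        case True
        then show ?thesis by (intro rend_eqI) (auto simp: fock_simps exchange_def)
      next
        case False
        then have ex: "exchange s (exchange t S) = exchange t (exchange s S)" for S
          using ne by (auto simp: exchange_def fun_eq_iff)
        have ex': "exchange s S t = S t" "exchange s S (t + 1) = S (t + 1)" "exchange t S s = S s" "exchange t S (s + 1) = S (s + 1)" for S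
          using ne False by (auto simp: exchange_def)
        show ?thesis by (rule rend_eqI) (simp add: fock_simps ex ex')
      qed
      then show ?thesis using False by (simp add: s_def t_def)
    qed
    show "fock_e (root_position \<alpha>) * fock_e (root_position \<alpha>) * fock_e (root_position \<gamma>) - (q + inverse q) *\<^sub>C (fock_e (root_position \<alpha>) * fock_e (root_position \<gamma>) * fock_e (root_position \<alpha>)) +
       fock_e (root_position \<gamma>) * fock_e (root_position \<alpha>) * fock_e (root_position \<alpha>) = (0 :: (_, 'a) rend)" if "root_form \<alpha> \<gamma> = -1"
      using that unfolding st r
      by (intro rend_eqI) (auto simp: fock_simps exchange_def)
    show "fock_f (root_position \<alpha>) * fock_f (root_position \<alpha>) * fock_f (root_position \<gamma>) - (q + inverse q) *\<^sub>C (fock_f (root_position \<alpha>) * fock_f (root_position \<gamma>) * fock_f (root_position \<alpha>)) +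
       fock_f (root_position \<gamma>) * fock_f (root_position \<alpha>) * fock_f (root_position \<alpha>) = (0 :: (_, 'a) rend)" if "root_form \<alpha> \<gamma> = -1"
      using that unfolding st r
      by (intro rend_eqI) (auto simp: fock_simps exchange_def)
    assume "root_form \<alpha> \<gamma> = 0"
    then have ne: "s \<noteq> t" "t \<noteq> s + 1" "s \<noteq> t + 1" using r by (auto split: if_splits)
    then have ex: "exchange s (exchange t S) = exchange t (exchange s S)" for S
      by (auto simp: exchange_def fun_eq_iff)
    have ex': "exchange s S t = S t" "exchange s S (t + 1) = S (t + 1)" "exchange t S s = S s" "exchange t S (s + 1) = S (s + 1)" for S
      using ne by (auto simp: exchange_def)
    show "fock_e (root_position \<alpha>) * fock_e (root_position \<gamma>) = (fock_e (root_position \<gamma>) * fock_e (root_position \<alpha>) :: (_, 'a) rend)"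
      unfolding st by (rule rend_eqI) (simp add: fock_simps ex ex')
    show "fock_f (root_position \<alpha>) * fock_f (root_position \<gamma>) = (fock_f (root_position \<gamma>) * fock_f (root_position \<alpha>) :: (_, 'a) rend)"
      unfolding st by (rule rend_eqI) (simp add: fock_simps ex ex')
  qed
qed

section \<open>Freeness over the parabolic subalgebra\<close>

definition omono :: "('i \<Rightarrow> 'a) \<Rightarrow> 'i list \<Rightarrow> ('i \<Rightarrow> nat) \<Rightarrow> 'a::monoid_mult"
  where "omono x ps a = prod_list (map (\<lambda>p. x p ^ a p) ps)"

lemma omono_Nil [simp]: "omono x [] a = 1"
  by (simp add: omono_def)

lemma omono_Cons [simp]: "omono x (p # ps) a = x p ^ a p * omono x ps a"
  by (simp add: omono_def)

lemma omono_append [simp]: "omono x (ps @ rs) a = omono x ps a * omono x rs a"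
  by (simp add: omono_def)

lemma omono_cong: "(\<And>p. p \<in> set ps \<Longrightarrow> a p = b p) \<Longrightarrow> omono x ps a = omono x ps b"
  by (induction ps) simp_all

definition before :: "nat \<times> nat \<Rightarrow> nat \<times> nat \<Rightarrow> bool"
  where "before p r \<longleftrightarrow> snd p < snd r \<or> snd p = snd r \<and> fst p < fst r"

text \<open>Turns one matrix entry into a multiplicative map. \<open>Adm\<close> is a condition
  preserved by the generators under which the entry at \<open>s\<close> of the image depends on
  \<open>f s\<close> alone; \<open>m\<close> is an admissible function with value 1 at
  \<open>s\<close>, which reads off the factor.\<close>

lemma coefficient_hom:
  fixes \<phi> :: "'a::complex_algebra \<Rightarrow> ('s, 'a) rend"
  assumes \<phi>: "alg_hom \<phi>"
    and Adm: "Adm m" "m s = 1" "\<And>f h. Adm f \<Longrightarrow> Adm h \<Longrightarrow> Adm (\<lambda>s. f s + h s)" "\<And>f c. Adm f \<Longrightarrow> Adm (\<lambda>s. c *\<^sub>C f s)"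
    and gens: "\<And>x f. x \<in> X \<Longrightarrow> Adm f \<Longrightarrow> Adm (app (\<phi> x) f) \<and> app (\<phi> x) f s = t x * f s"
    and "p \<in> subalgebra_gen X" "Adm f"
  shows "Adm (app (\<phi> p) f) \<and> app (\<phi> p) f s = app (\<phi> p) m s * f s"
proof -
  interpret H: alg_hom \<phi> by fact
  show ?thesis using assms(7,8)
  proof (induction p arbitrary: f)
    case (gen x)
    have "app (\<phi> x) m s = t x" using gens[OF gen(1) Adm(1)] Adm(2) by simp
    then show ?case using gens[OF gen] by simp
  next
    case one
    then show ?case using Adm(2) by (simp add: H.one app_simps)
  next
    case (add x y)
    have "Adm (\<lambda>s. app (\<phi> x) f s + app (\<phi> y) f s)"
      using add Adm(3) by blast
    then show ?case using add.IH[OF add.prems] by (simp add: H.add app_simps ring_distribs)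
  next
    case (scale x c)
    have "Adm (\<lambda>s. c *\<^sub>C app (\<phi> x) f s)"
      using scale Adm(4) by blast
    then show ?case using scale.IH[OF scale.prems] by (simp add: H.scale app_simps scaleC_mult)
  next
    case (mult x y)
    have y: "Adm (app (\<phi> y) h)" "app (\<phi> y) h s = app (\<phi> y) m s * h s" if "Adm h" for h
      using mult.IH(2)[OF that] by auto
    have x: "Adm (app (\<phi> x) h)" "app (\<phi> x) h s = app (\<phi> x) m s * h s" if "Adm h" for h
      using mult.IH(1)[OF that] by auto
    show ?case
      using x(1)[OF y(1)[OF mult.prems]] x(2)[OF y(1)[OF mult.prems]] y(2)[OF mult.prems] x(2)[OF y(1)[OF Adm(1)]]
      by (simp add: H.mult app_simps mult.assoc)
  qed
qed

lemma subalgebra_gen_mono: "X \<subseteq> Y \<Longrightarrow> x \<in> subalgebra_gen X \<Longrightarrow> x \<in> subalgebra_gen Y"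
proof -
  assume s: "X \<subseteq> Y" and "x \<in> subalgebra_gen X"
  from this(2) show ?thesis by induction (use s in \<open>auto intro: subalgebra_gen.intros\<close>)
qed

lemma subalgebra_gen_zero: "0 \<in> subalgebra_gen X"
  using subalgebra_gen.scale[OF subalgebra_gen.one, where c = 0] by simp

lemma subalgebra_gen_diff: "x \<in> subalgebra_gen X \<Longrightarrow> y \<in> subalgebra_gen X \<Longrightarrow> x - y \<in> subalgebra_gen X"
  using subalgebra_gen.add[of x X "(-1) *\<^sub>C y"] subalgebra_gen.scale[of y X, where c = "-1"] by simp

lemma subalgebra_gen_sum: "(\<And>i. i \<in> I \<Longrightarrow> f i \<in> subalgebra_gen X) \<Longrightarrow> sum f I \<in> subalgebra_gen X"
  by (induction I rule: infinite_finite_induct) (auto intro: subalgebra_gen_zero subalgebra_gen.add)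

lemma subalgebra_gen_qbr: "x \<in> subalgebra_gen X \<Longrightarrow> y \<in> subalgebra_gen X \<Longrightarrow> qbr q x y \<in> subalgebra_gen X"
  unfolding qbr_def by (intro subalgebra_gen_diff subalgebra_gen.mult subalgebra_gen.scale)

context uq_presented
begin

text \<open>The \<open>P\<close> of the overview. It contains all \<open>Z\<close>
  (\<open>Zel_par\<close>), so the action on \<open>V\<close> extends to it with the
  \<open>Z\<close> acting by 0.\<close>

definition par :: "'a set"
  where "par = subalgebra_gen (g ` (GenK ` simple_roots n \<union> GenKinv ` simple_roots n \<union>
    GenE ` simple_roots n \<union> GenF ` (simple_roots n - {Beta})))"

lemma par_gens: "\<alpha> \<in> simple_roots n \<Longrightarrow> K \<alpha> \<in> par" "\<alpha> \<in> simple_roots n \<Longrightarrow> Ki \<alpha> \<in> par"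
  "\<alpha> \<in> simple_roots n \<Longrightarrow> E \<alpha> \<in> par" "\<alpha> \<in> simple_roots n \<Longrightarrow> \<alpha> \<noteq> Beta \<Longrightarrow> F \<alpha> \<in> par"
  unfolding par_def by (auto intro!: subalgebra_gen.gen)

lemmas par_alg = subalgebra_gen.one[of "g ` (GenK ` simple_roots n \<union> GenKinv ` simple_roots n \<union>
    GenE ` simple_roots n \<union> GenF ` (simple_roots n - {Beta}))", folded par_def]
  subalgebra_gen.add[of _ "g ` (GenK ` simple_roots n \<union> GenKinv ` simple_roots n \<union>
    GenE ` simple_roots n \<union> GenF ` (simple_roots n - {Beta}))", folded par_def]
  subalgebra_gen.scale[of _ "g ` (GenK ` simple_roots n \<union> GenKinv ` simple_roots n \<union>
    GenE ` simple_roots n \<union> GenF ` (simple_roots n - {Beta}))", folded par_def]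
  subalgebra_gen.mult[of _ "g ` (GenK ` simple_roots n \<union> GenKinv ` simple_roots n \<union>
    GenE ` simple_roots n \<union> GenF ` (simple_roots n - {Beta}))", folded par_def]

lemma Uk_par: "x \<in> Uk n g \<Longrightarrow> x \<in> par"
  unfolding Uk_def par_def by (rule subalgebra_gen_mono) auto

end

locale uq_fock = uq_presented +
  fixes \<Psi> :: "'a \<Rightarrow> (int \<Rightarrow> bool, 'a) rend"
  assumes hom: "alg_hom \<Psi>"
    and \<Psi>_E: "\<alpha> \<in> simple_roots n \<Longrightarrow> \<Psi> (E \<alpha>) = fock_e (root_position \<alpha>) + fock_k q (root_position \<alpha>) * lmul (E \<alpha>)"
    and \<Psi>_F: "\<alpha> \<in> simple_roots n \<Longrightarrow> \<Psi> (F \<alpha>) = fock_f (root_position \<alpha>) * lmul (Ki \<alpha>) + lmul (F \<alpha>)"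
    and \<Psi>_K: "\<alpha> \<in> simple_roots n \<Longrightarrow> \<Psi> (K \<alpha>) = fock_k q (root_position \<alpha>) * lmul (K \<alpha>)"
    and \<Psi>_Ki: "\<alpha> \<in> simple_roots n \<Longrightarrow> \<Psi> (Ki \<alpha>) = fock_k (inverse q) (root_position \<alpha>) * lmul (Ki \<alpha>)"

lemma (in uq_presented) ex_fock: "\<exists>\<Psi>. uq_fock n q g \<Psi>"
proof -
  have "uq_algebra n q (\<lambda>\<alpha>. fock_e (root_position \<alpha>) + fock_k q (root_position \<alpha>) * lmul (E \<alpha>))
    (\<lambda>\<alpha>. fock_f (root_position \<alpha>) * lmul (Ki \<alpha>) + lmul (F \<alpha>))
    (\<lambda>\<alpha>. fock_k q (root_position \<alpha>) * lmul (K \<alpha>))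
    (\<lambda>\<alpha>. fock_k (inverse q) (root_position \<alpha>) * lmul (Ki \<alpha>) :: (_, 'a) rend)"
    by (rule uq_algebra_tensor[OF q0 q_pow uq_algebra_fock[OF q0 q_diff] alg_hom_uq_algebra[OF lmul_hom uq_algebra_g]])
       (auto intro!: rend_eqI simp: fock_simps scaleC_mult)
  from ex_hom[OF this] obtain \<Psi> :: "'a \<Rightarrow> (int \<Rightarrow> bool, 'a) rend" where "alg_hom \<Psi>"
    "\<And>\<alpha>. \<alpha> \<in> simple_roots n \<Longrightarrow> \<Psi> (E \<alpha>) = fock_e (root_position \<alpha>) + fock_k q (root_position \<alpha>) * lmul (E \<alpha>)"
    "\<And>\<alpha>. \<alpha> \<in> simple_roots n \<Longrightarrow> \<Psi> (F \<alpha>) = fock_f (root_position \<alpha>) * lmul (Ki \<alpha>) + lmul (F \<alpha>)"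
    "\<And>\<alpha>. \<alpha> \<in> simple_roots n \<Longrightarrow> \<Psi> (K \<alpha>) = fock_k q (root_position \<alpha>) * lmul (K \<alpha>)"
    "\<And>\<alpha>. \<alpha> \<in> simple_roots n \<Longrightarrow> \<Psi> (Ki \<alpha>) = fock_k (inverse q) (root_position \<alpha>) * lmul (Ki \<alpha>)"
    by blast
  then have "uq_fock n q g \<Psi>"
    by (intro uq_fock.intro uq_fock_axioms.intro uq_presented_axioms) auto
  then show ?thesis by blast
qed

section \<open>Vacuum coefficients and one-particle excitations\<close>

context uq_fock
begin

interpretation H: alg_hom \<Psi> by (rule hom)

text \<open>\<open>vac\<close> is the sea filled up to site 0. In \<open>exc i j\<close> the
  particle at site \<open>1 - i\<close> has moved to site \<open>j\<close>; this is the excitation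
  created by \<open>w i j\<close>. The complementary state \<open>vac'\<close> has the opposite
  weight under \<open>K Beta\<close> and is there to invert the map read off at
  \<open>vac\<close>.\<close>

definition vac :: "int \<Rightarrow> bool" where "vac r \<longleftrightarrow> r \<le> 0"
definition vac' :: "int \<Rightarrow> bool" where "vac' r \<longleftrightarrow> 1 \<le> r"
definition delta :: "(int \<Rightarrow> bool) \<Rightarrow> (int \<Rightarrow> bool) \<Rightarrow> 'a" where "delta S T = of_bool (S = T)"
definition exc :: "nat \<Rightarrow> nat \<Rightarrow> int \<Rightarrow> bool" where "exc i j = vac(1 - int i := False, int j := True)"

text \<open>The vacuum entry takes values in the algebra itself, through the regular factor: on
  generators it is the identity up to a power of \<open>q\<close>
  (\<open>\<tau>_gens\<close>).\<close>

definition \<tau> :: "'a \<Rightarrow> 'a" where "\<tau> p = app (\<Psi> p) (delta vac) vac"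
definition \<tau>' :: "'a \<Rightarrow> 'a" where "\<tau>' p = app (\<Psi> p) (delta vac') vac'"

lemma delta_self [simp]: "delta S S = 1"
  by (simp add: delta_def)

lemma exchange_vac: "t \<noteq> 0 \<Longrightarrow> exchange t vac = vac"
  by (auto simp: exchange_def vac_def fun_eq_iff)

lemma exchange_exchange [simp]: "exchange t (exchange t S) = S"
  by (auto simp: exchange_def fun_eq_iff)

lemma exchange_eq_iff: "exchange t S = T \<longleftrightarrow> S = exchange t T"
  by (metis exchange_exchange)

lemma position_nonzero: "\<alpha> \<in> simple_roots n \<Longrightarrow> root_position \<alpha> = 0 \<longleftrightarrow> \<alpha> = Beta"
  by (cases \<alpha>) auto

lemma fock_vac:
  "app (fock_e s) f vac = (if s = 0 then f (exchange 0 vac) else 0)" "app (fock_f s) f vac = 0"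
  "app (fock_k c s) f vac = c powi of_bool (s = 0) *\<^sub>C f vac"
  "app (fock_e s) f vac' = 0" "s \<noteq> 0 \<Longrightarrow> app (fock_f s) f vac' = 0"
  "app (fock_k c s) f vac' = c powi (- of_bool (s = 0)) *\<^sub>C f vac'"
proof -
  have 1: "(vac s \<and> \<not> vac (s + 1)) = (s = 0)" "(\<not> vac s \<and> vac (s + 1)) = False"
    "(vac' s \<and> \<not> vac' (s + 1)) = False" "s \<noteq> 0 \<Longrightarrow> (\<not> vac' s \<and> vac' (s + 1)) = False"
    unfolding vac_def vac'_def by presburger+
  have 2: "of_bool (vac s) - of_bool (vac (s + 1)) = (of_bool (s = 0) :: int)"
    "of_bool (vac' s) - of_bool (vac' (s + 1)) = - (of_bool (s = 0) :: int)"
    unfolding vac_def vac'_def by (simp_all only: of_bool_def) presburger+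
  show "app (fock_e s) f vac = (if s = 0 then f (exchange 0 vac) else 0)"
    unfolding fock_e.rep_eq 1 by (rule if_cong) auto
  show "app (fock_f s) f vac = 0"
    unfolding fock_f.rep_eq 1 by (rule if_False)
  show "app (fock_k c s) f vac = c powi of_bool (s = 0) *\<^sub>C f vac"
    unfolding fock_k.rep_eq 2 ..
  show "app (fock_e s) f vac' = 0"
    unfolding fock_e.rep_eq 1 by (rule if_False)
  show "s \<noteq> 0 \<Longrightarrow> app (fock_f s) f vac' = 0"
    unfolding fock_f.rep_eq using 1(4) by argo
  show "app (fock_k c s) f vac' = c powi (- of_bool (s = 0)) *\<^sub>C f vac'"
    unfolding fock_k.rep_eq 2 ..
qed

lemma delta_exchange_0 [simp]: "delta vac (exchange 0 vac) = 0"
proof -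
  have "vac 0 \<noteq> exchange 0 vac 0" by (simp add: exchange_def vac_def)
  then have "vac \<noteq> exchange 0 vac" by metis
  then show ?thesis by (simp add: delta_def)
qed

lemmas rend_rep = plus_rend.rep_eq times_rend.rep_eq lmul.rep_eq

text \<open>In the Fock factor the generators of \<open>par\<close> either annihilate the vacuum or
  scale it, since \<open>F Beta\<close>, the one generator that moves a particle out of the sea, is
  excluded.\<close>

lemma \<tau>_main:
  assumes "p \<in> par" "\<forall>S. S \<noteq> vac \<longrightarrow> f S = 0"
  shows "(\<forall>S. S \<noteq> vac \<longrightarrow> app (\<Psi> p) f S = 0) \<and> app (\<Psi> p) f vac = \<tau> p * f vac"
proof -
  define t where "t x = app (\<Psi> x) (delta vac) vac" for x
  have *: "(\<forall>S. S \<noteq> vac \<longrightarrow> app (\<Psi> x) f S = 0) \<and> app (\<Psi> x) f vac = t x * f vac"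
    if x: "x \<in> g ` (GenK ` simple_roots n \<union> GenKinv ` simple_roots n \<union>
    GenE ` simple_roots n \<union> GenF ` (simple_roots n - {Beta}))" and f: "\<forall>S. S \<noteq> vac \<longrightarrow> f S = 0" for x f
  proof -
    have d: "delta vac S = 0" if "S \<noteq> vac" for S using that by (auto simp: delta_def)
    have fe: "\<not> (S s \<and> \<not> S (s + 1) \<and> exchange s S = vac)" for S s
    proof
      assume a: "S s \<and> \<not> S (s + 1) \<and> exchange s S = vac"
      then have "S = exchange s vac" by (simp add: exchange_eq_iff)
      then show False using a by (auto simp: exchange_def vac_def)
    qed
    have e0: "app (fock_e s) f = (\<lambda>S. 0)" if "\<forall>S. S \<noteq> vac \<longrightarrow> f S = (0::'a)" for s f
      using fe that by (auto simp: fock_simps fun_eq_iff)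
    have ff: "\<not> (\<not> S s \<and> S (s + 1) \<and> exchange s S = vac)" if "s \<noteq> 0" for S s
    proof
      assume a: "\<not> S s \<and> S (s + 1) \<and> exchange s S = vac"
      then have "S = vac" using that exchange_vac by (simp add: exchange_eq_iff)
      then show False using a that by (auto simp: vac_def)
    qed
    have f0: "app (fock_f s) f = (\<lambda>S. 0)" if "s \<noteq> 0" "\<forall>S. S \<noteq> vac \<longrightarrow> f S = (0::'a)" for s f
      using ff that by (auto simp: fock_simps fun_eq_iff)
    from x consider \<alpha> where "\<alpha> \<in> simple_roots n" "x = K \<alpha> \<or> x = Ki \<alpha> \<or> x = E \<alpha>"
      | \<alpha> where "\<alpha> \<in> simple_roots n" "\<alpha> \<noteq> Beta" "x = F \<alpha>" by auto
    then show ?thesis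
    proof cases
      case 1
      then show ?thesis using f d unfolding t_def
        by (auto simp: \<Psi>_K \<Psi>_Ki \<Psi>_E rend_rep fock_k.rep_eq scaleC_mult e0[OF f] fock_vac(1))
    next
      case 2
      then have "root_position \<alpha> \<noteq> 0" by (simp add: position_nonzero)
      then have "app (fock_f (root_position \<alpha>) * lmul (Ki \<alpha>)) f = (\<lambda>S. 0)"
        if "\<forall>S. S \<noteq> vac \<longrightarrow> f S = 0" for f
        using f0[of "root_position \<alpha>" "app (lmul (Ki \<alpha>)) f"] that by (simp add: fock_simps)
      then show ?thesis using 2 f d unfolding t_def
        by (simp add: \<Psi>_F plus_rend.rep_eq lmul.rep_eq)
    qed
  qed
  show ?thesis unfolding \<tau>_def
    by (rule coefficient_hom[where t = t and Adm = "\<lambda>f. \<forall>S. S \<noteq> vac \<longrightarrow> f S = 0", OF hom _ _ _ _ * assms(1)[unfolded par_def] assms(2)])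
       (auto simp: delta_def)
qed

text \<open>No generator of \<open>par\<close> moves another state to \<open>vac'\<close>, so the
  entry there is determined by \<open>f vac'\<close>.\<close>

lemma \<tau>'_main:
  assumes "p \<in> par"
  shows "app (\<Psi> p) f vac' = \<tau>' p * f vac'"
proof -
  define t where "t x = app (\<Psi> x) (delta vac') vac'" for x
  have *: "True \<and> app (\<Psi> x) f vac' = t x * f vac'"
    if x: "x \<in> g ` (GenK ` simple_roots n \<union> GenKinv ` simple_roots n \<union>
    GenE ` simple_roots n \<union> GenF ` (simple_roots n - {Beta}))" for x f
  proof -
    from x consider \<alpha> where "\<alpha> \<in> simple_roots n" "x = K \<alpha> \<or> x = Ki \<alpha> \<or> x = E \<alpha>"
      | \<alpha> where "\<alpha> \<in> simple_roots n" "\<alpha> \<noteq> Beta" "x = F \<alpha>" by auto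
    then show ?thesis unfolding t_def
      by cases (auto simp: \<Psi>_K \<Psi>_Ki \<Psi>_E \<Psi>_F position_nonzero rend_rep fock_vac scaleC_mult)
  qed
  show ?thesis unfolding \<tau>'_def
    by (rule coefficient_hom[where t = t and Adm = "\<lambda>f. True", THEN conjunct2, OF hom _ _ _ _ * assms(1)[unfolded par_def]])
       simp_all
qed

lemma \<tau>_alg: "p \<in> par \<Longrightarrow> p' \<in> par \<Longrightarrow> \<tau> (p * p') = \<tau> p * \<tau> p'" "\<tau> 1 = 1"
    "\<tau> (x + y) = \<tau> x + \<tau> y" "\<tau> (c *\<^sub>C x) = c *\<^sub>C \<tau> x"
proof -
  assume p: "p \<in> par" "p' \<in> par"
  show "\<tau> (p * p') = \<tau> p * \<tau> p'"
  proof -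
    have d: "\<forall>S. S \<noteq> vac \<longrightarrow> delta vac S = 0" by (auto simp: delta_def)
    have "app (\<Psi> p) (app (\<Psi> p') (delta vac)) vac = \<tau> p * app (\<Psi> p') (delta vac) vac"
      using \<tau>_main[OF p(1)] \<tau>_main[OF p(2) d] by blast
    then show ?thesis by (simp only: \<tau>_def H.mult times_rend.rep_eq)
  qed
qed (simp_all add: \<tau>_def H.one H.add H.scale app_simps)

lemma \<tau>'_alg: "p \<in> par \<Longrightarrow> p' \<in> par \<Longrightarrow> \<tau>' (p * p') = \<tau>' p * \<tau>' p'" "\<tau>' 1 = 1"
    "\<tau>' (x + y) = \<tau>' x + \<tau>' y" "\<tau>' (c *\<^sub>C x) = c *\<^sub>C \<tau>' x"
proof -
  assume p: "p \<in> par" "p' \<in> par"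
  show "\<tau>' (p * p') = \<tau>' p * \<tau>' p'"
    using \<tau>'_main[OF p(1), of "app (\<Psi> p') (delta vac')"]
    by (simp only: \<tau>'_def H.mult times_rend.rep_eq)
qed (simp_all add: \<tau>'_def H.one H.add H.scale app_simps)

lemma \<tau>_gens:
  assumes "\<alpha> \<in> simple_roots n"
  shows "\<tau> (K \<alpha>) = q powi of_bool (\<alpha> = Beta) *\<^sub>C K \<alpha>" "\<tau> (Ki \<alpha>) = inverse q powi of_bool (\<alpha> = Beta) *\<^sub>C Ki \<alpha>"
    "\<tau> (E \<alpha>) = q powi of_bool (\<alpha> = Beta) *\<^sub>C E \<alpha>" "\<alpha> \<noteq> Beta \<Longrightarrow> \<tau> (F \<alpha>) = F \<alpha>"
    "\<tau>' (K \<alpha>) = q powi (- of_bool (\<alpha> = Beta)) *\<^sub>C K \<alpha>" "\<tau>' (Ki \<alpha>) = inverse q powi (- of_bool (\<alpha> = Beta)) *\<^sub>C Ki \<alpha>"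
    "\<tau>' (E \<alpha>) = q powi (- of_bool (\<alpha> = Beta)) *\<^sub>C E \<alpha>" "\<alpha> \<noteq> Beta \<Longrightarrow> \<tau>' (F \<alpha>) = F \<alpha>"
  unfolding \<tau>_def \<tau>'_def
  using position_nonzero[OF assms]
  by (simp_all add: \<Psi>_K[OF assms] \<Psi>_Ki[OF assms] \<Psi>_E[OF assms] \<Psi>_F[OF assms] rend_rep fock_vac)

text \<open>On each generator \<open>\<tau>\<close> and \<open>\<tau>'\<close> are multiplications
  by inverse powers of \<open>q\<close>, and both are multiplicative on \<open>par\<close>. The
  point is that \<open>\<tau>\<close> is injective there.\<close>

lemma \<tau>_inverse: "p \<in> par \<Longrightarrow> \<tau> p \<in> par \<and> \<tau>' (\<tau> p) = p"
  unfolding par_def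
proof (induction p rule: subalgebra_gen.induct)
  case (gen x)
  have sc: "\<tau> x \<in> par \<and> \<tau>' (\<tau> x) = x" if "x \<in> par" "\<tau> x = c *\<^sub>C x" "\<tau>' x = d *\<^sub>C x" "c * d = 1" for c d x
    using that by (simp add: \<tau>'_alg(4) scaleC_scaleC par_alg(3))
  from gen consider \<alpha> where "\<alpha> \<in> simple_roots n" "x = K \<alpha>" | \<alpha> where "\<alpha> \<in> simple_roots n" "x = Ki \<alpha>"
    | \<alpha> where "\<alpha> \<in> simple_roots n" "x = E \<alpha>" | \<alpha> where "\<alpha> \<in> simple_roots n" "\<alpha> \<noteq> Beta" "x = F \<alpha>" by auto
  then have "\<tau> x \<in> par \<and> \<tau>' (\<tau> x) = x"
  proof cases
    case 1
    show ?thesis unfolding 1(2) by (rule sc[OF par_gens(1)[OF 1(1)] \<tau>_gens(1)[OF 1(1)] \<tau>_gens(5)[OF 1(1)]])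
       (use q0 in \<open>cases "\<alpha> = Beta"; simp\<close>)
  next
    case 2
    show ?thesis unfolding 2(2) by (rule sc[OF par_gens(2)[OF 2(1)] \<tau>_gens(2)[OF 2(1)] \<tau>_gens(6)[OF 2(1)]])
       (use q0 in \<open>cases "\<alpha> = Beta"; simp\<close>)
  next
    case 3
    show ?thesis unfolding 3(2) by (rule sc[OF par_gens(3)[OF 3(1)] \<tau>_gens(3)[OF 3(1)] \<tau>_gens(7)[OF 3(1)]])
       (use q0 in \<open>cases "\<alpha> = Beta"; simp\<close>)
  next
    case 4
    then show ?thesis using par_gens(4)[of \<alpha>] \<tau>_gens(4,8)[of \<alpha>] by simp
  qed
  then show ?case unfolding par_def .
next
  case one
  show ?case unfolding par_def[symmetric] using \<tau>_alg(2) \<tau>'_alg(2) par_alg(1) by simp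
next
  case (add x y)
  then show ?case unfolding par_def[symmetric] using \<tau>_alg(3) \<tau>'_alg(3) par_alg(2) by simp
next
  case (scale x c)
  then show ?case unfolding par_def[symmetric] using \<tau>_alg(4) \<tau>'_alg(4) par_alg(3) by simp
next
  case (mult x y)
  then show ?case unfolding par_def[symmetric] using \<tau>_alg(1)[of x y] \<tau>'_alg(1) par_alg(4) by simp
qed

lemma \<tau>_eq_0: "p \<in> par \<Longrightarrow> \<tau> p = 0 \<Longrightarrow> p = 0"
  using \<tau>_inverse[of p] \<tau>'_alg(4)[of 0 0] by simp

lemma fock_f_exc_mu: assumes "1 \<le> k" "1 \<le> i" "1 \<le> j"
  shows "app (fock_f (- int k)) f (exc i j) = (if i = Suc k then f (exc k j) else 0)"
proof -
  have "(\<not> exc i j (- int k) \<and> exc i j (- int k + 1)) = (i = Suc k)"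
    using assms by (auto simp: exc_def vac_def)
  moreover have "exchange (- int k) (exc (Suc k) j) = exc k j"
    using assms by (auto simp: exc_def vac_def exchange_def fun_eq_iff)
  ultimately show ?thesis unfolding fock_f.rep_eq by auto
qed

lemma fock_f_exc_nu: assumes "1 \<le> k" "1 \<le> i" "1 \<le> j"
  shows "app (fock_f (int k)) f (exc i j) = (if j = Suc k then f (exc i k) else 0)"
proof -
  have "(\<not> exc i j (int k) \<and> exc i j (int k + 1)) = (j = Suc k)"
    using assms by (auto simp: exc_def vac_def)
  moreover have "exchange (int k) (exc i (Suc k)) = exc i k"
    using assms by (auto simp: exc_def vac_def exchange_def fun_eq_iff)
  ultimately show ?thesis unfolding fock_f.rep_eq by auto
qed

lemma fock_f_exc_beta: assumes "1 \<le> i" "1 \<le> j"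
  shows "app (fock_f 0) f (exc i j) = (if i = 1 \<and> j = 1 then f vac else 0)"
proof -
  have "(\<not> exc i j 0 \<and> exc i j (0 + 1)) = (i = 1 \<and> j = 1)"
    using assms by (auto simp: exc_def vac_def)
  moreover have "exchange 0 (exc 1 1) = vac"
    by (auto simp: exc_def vac_def exchange_def fun_eq_iff)
  ultimately show ?thesis unfolding fock_f.rep_eq by auto
qed

lemma exc_ne_vac: "1 \<le> j \<Longrightarrow> exc i j \<noteq> vac"
proof
  assume "1 \<le> j" "exc i j = vac"
  then have "exc i j (int j) = vac (int j)" by simp
  then show False using \<open>1 \<le> j\<close> by (simp add: exc_def vac_def)
qed

lemma delta_exc [simp]: "1 \<le> j \<Longrightarrow> delta vac (exc i j) = 0"
  using exc_ne_vac[of j i] by (simp add: delta_def)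

text \<open>On the part of degree at most one of the Fock space, \<open>\<Psi> u\<close> is lower triangular with \<open>u\<close> on the diagonal;
  the entries below the diagonal then form a derivation.\<close>

definition tri :: "'a \<Rightarrow> bool" where
  "tri u \<longleftrightarrow> (\<forall>f. app (\<Psi> u) f vac = u * f vac \<and>
    (f vac = 0 \<longrightarrow> (\<forall>i\<ge>1. \<forall>j\<ge>1. app (\<Psi> u) f (exc i j) = u * f (exc i j))))"

definition deriv1 :: "nat \<times> nat \<Rightarrow> 'a \<Rightarrow> 'a" where
  "deriv1 s u = app (\<Psi> u) (delta vac) (exc (fst s) (snd s))"

lemma tri_1: "tri 1"
  by (simp add: tri_def H.one app_simps)

lemma tri_mult: assumes "tri x" "tri y" shows "tri (x * y)"
  using assms unfolding tri_def H.mult times_rend.rep_eq by (simp add: mult.assoc)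

lemma tri_power: "tri x \<Longrightarrow> tri (x ^ k)"
  by (induction k) (simp_all add: tri_1 tri_mult)

lemma deriv1_1: "1 \<le> snd s \<Longrightarrow> deriv1 s 1 = 0"
  by (simp add: deriv1_def H.one app_simps)

lemma deriv1_mult:
  assumes "tri x" "tri y" "1 \<le> fst s" "1 \<le> snd s"
  shows "deriv1 s (x * y) = deriv1 s x * y + x * deriv1 s y"
proof -
  define h where "h S = app (\<Psi> y) (delta vac) S - delta vac S * y" for S
  have h: "app (\<Psi> y) (delta vac) = (\<lambda>S. delta vac S * y + h S)" by (auto simp: h_def)
  have "h vac = 0" using assms(2) by (simp add: h_def tri_def)
  then have "app (\<Psi> x) h (exc (fst s) (snd s)) = x * h (exc (fst s) (snd s))"
    using assms by (simp add: tri_def)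
  moreover have "h (exc (fst s) (snd s)) = deriv1 s y"
    using assms(4) by (simp add: h_def deriv1_def)
  moreover have "app (\<Psi> x) (app (\<Psi> y) (delta vac)) = (\<lambda>S. app (\<Psi> x) (delta vac) S * y + app (\<Psi> x) h S)"
    unfolding h app_add app_right ..
  ultimately show ?thesis
    by (simp add: deriv1_def H.mult times_rend.rep_eq)
qed

lemma Psi_F_delta: assumes "\<alpha> \<in> simple_roots n" "\<alpha> \<noteq> Beta"
  shows "app (\<Psi> (F \<alpha>)) (delta vac) = (\<lambda>S. delta vac S * F \<alpha>)"
proof -
  have nz: "root_position \<alpha> \<noteq> 0" using assms position_nonzero by simp
  have "\<not> (\<not> S s \<and> S (s + 1) \<and> vac = exchange s S)" if "s \<noteq> 0" for S s
  proof
    assume a: "\<not> S s \<and> S (s + 1) \<and> vac = exchange s S"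
    then have "S = vac" using that exchange_vac[of s] exchange_eq_iff[of s S vac] by simp
    then show False using a that by (auto simp: vac_def)
  qed
  then have "app (fock_f (root_position \<alpha>)) (\<lambda>S. Ki \<alpha> * delta vac S) S = 0" for S
    using nz by (auto simp: fock_f.rep_eq delta_def)
  then show ?thesis using assms
    by (auto simp: \<Psi>_F rend_rep fun_eq_iff delta_def)
qed

lemma Psi_F_exc:
  assumes "\<alpha> \<in> simple_roots n" "\<alpha> \<noteq> Beta" "1 \<le> i" "1 \<le> j"
  shows "app (\<Psi> (F \<alpha>)) f (exc i j) = F \<alpha> * f (exc i j) + Ki \<alpha> * (case \<alpha> of Mu k \<Rightarrow> if i = Suc k then f (exc k j) else 0
    | Nu k \<Rightarrow> if j = Suc k then f (exc i k) else 0 | Beta \<Rightarrow> 0)"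
  using assms
  by (cases \<alpha>) (auto simp: \<Psi>_F rend_rep fock_f_exc_mu fock_f_exc_nu)

text \<open>\<open>F \<alpha>\<close> alone moves excitations, with coefficient
  \<open>Ki \<alpha>\<close>. The weight of \<open>x\<close> under \<open>Ki \<alpha>\<close> equals
  the factor \<open>inverse q\<close> of the bracket, so these moves cancel and the bracket is
  diagonal again.\<close>

lemma tri_qbr:
  assumes \<alpha>: "\<alpha> \<in> simple_roots n" "\<alpha> \<noteq> Beta" and x: "tri x" and Kx: "Ki \<alpha> * x = inverse q *\<^sub>C (x * Ki \<alpha>)"
  shows "tri (qbr q (F \<alpha>) x)"
  unfolding tri_def
proof (intro allI conjI impI)
  fix f and i j :: nat
  have v: "app (\<Psi> (F \<alpha>)) f vac = F \<alpha> * f vac" for f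
    using \<alpha> by (simp add: \<Psi>_F rend_rep fock_vac)
  have q: "app (\<Psi> (qbr q (F \<alpha>) x)) f S = app (\<Psi> (F \<alpha>)) (app (\<Psi> x) f) S - inverse q *\<^sub>C app (\<Psi> x) (app (\<Psi> (F \<alpha>)) f) S" for S
    by (simp add: qbr_def H.diff H.mult H.scale app_simps)
  show "app (\<Psi> (qbr q (F \<alpha>) x)) f vac = qbr q (F \<alpha>) x * f vac"
    using x unfolding q by (simp add: tri_def v qbr_def left_diff_distrib mult.assoc scaleC_mult)
  assume f: "f vac = 0" and ij: "1 \<le> i" "1 \<le> j"
  have xf: "app (\<Psi> x) f (exc i j) = x * f (exc i j)" if "1 \<le> i" "1 \<le> j" "f vac = 0" for i j f
    using x that by (simp add: tri_def)
  define r where "r = (case \<alpha> of Mu k \<Rightarrow> if i = Suc k then f (exc k j) else 0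
    | Nu k \<Rightarrow> if j = Suc k then f (exc i k) else 0 | Beta \<Rightarrow> 0)"
  have 1: "app (\<Psi> (F \<alpha>)) (app (\<Psi> x) f) (exc i j) = F \<alpha> * (x * f (exc i j)) + Ki \<alpha> * (x * r)"
    using \<alpha> ij f by (cases \<alpha>) (auto simp: Psi_F_exc xf r_def)
  have 2: "app (\<Psi> x) (app (\<Psi> (F \<alpha>)) f) (exc i j) = x * (F \<alpha> * f (exc i j) + Ki \<alpha> * r)"
    using \<alpha> ij f v by (simp add: xf Psi_F_exc r_def)
  have "Ki \<alpha> * (x * r) = inverse q *\<^sub>C (x * (Ki \<alpha> * r))"
    using arg_cong[OF Kx, of "\<lambda>u. u * r"] by (simp add: mult.assoc scaleC_mult)
  then show "app (\<Psi> (qbr q (F \<alpha>) x)) f (exc i j) = qbr q (F \<alpha>) x * f (exc i j)"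
    unfolding q 1 2 by (simp add: qbr_def scaleC_expand)
qed

lemma deriv1_qbr:
  assumes \<alpha>: "\<alpha> \<in> simple_roots n" "\<alpha> \<noteq> Beta" and ij: "1 \<le> i" "1 \<le> j"
  shows "deriv1 (i, j) (qbr q (F \<alpha>) x) = qbr q (F \<alpha>) (deriv1 (i, j) x) + Ki \<alpha> * (case \<alpha> of
      Mu k \<Rightarrow> if i = Suc k then deriv1 (k, j) x else 0
    | Nu k \<Rightarrow> if j = Suc k then deriv1 (i, k) x else 0 | Beta \<Rightarrow> 0)"
proof -
  have "app (\<Psi> x) (\<lambda>S. delta vac S * F \<alpha>) = (\<lambda>S. app (\<Psi> x) (delta vac) S * F \<alpha>)"
    by (rule app_right)
  then show ?thesis
    using Psi_F_exc[OF \<alpha> ij, of "app (\<Psi> x) (delta vac)"] Psi_F_delta[OF \<alpha>]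
    by (cases \<alpha>) (simp_all add: deriv1_def qbr_def H.diff H.mult H.scale app_simps)
qed

lemma tri_F_Beta: "tri (F Beta)"
  unfolding tri_def by (auto simp: \<Psi>_F rend_rep fock_vac fock_f_exc_beta)

lemma Ki_w': "1 \<le> i \<Longrightarrow> i < n \<Longrightarrow> 1 \<le> j \<Longrightarrow> j \<le> n \<Longrightarrow> Ki (Mu i) * w i j = inverse q *\<^sub>C (w i j * Ki (Mu i))"
  "1 \<le> i \<Longrightarrow> i \<le> n \<Longrightarrow> 1 \<le> j \<Longrightarrow> j < n \<Longrightarrow> Ki (Nu j) * w i j = inverse q *\<^sub>C (w i j * Ki (Nu j))"
  using Ki_w[of "Mu i" i j] Ki_w[of "Nu j" i j] by simp_all

lemma tri_w: assumes "1 \<le> i" "i \<le> n" "1 \<le> j" "j \<le> n"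
  shows "tri (w i j)"
proof -
  have 1: "tri (w 1 j)" using assms(3,4)
  proof (induction j rule: nat_induct_at_least)
    case base
    then show ?case using tri_F_Beta by (simp add: f.z_11[simplified])
  next
    case (Suc j)
    then show ?case using tri_qbr[of "Nu j"] Ki_w'(2)[of 1 j] by (simp add: f.z_1_nu[simplified])
  qed
  show ?thesis using assms(1,2)
  proof (induction i rule: nat_induct_at_least)
    case base
    then show ?case using 1 by simp
  next
    case (Suc i)
    then show ?case using tri_qbr[of "Mu i"] Ki_w'(1)[of i j] assms by (simp add: f.z_mu)
  qed
qed

lemma deriv1_w_11: "1 \<le> i \<Longrightarrow> 1 \<le> j \<Longrightarrow> deriv1 (i, j) (w 1 1) = (if i = 1 \<and> j = 1 then Ki Beta else 0)"
  by (simp add: deriv1_def f.z_11[simplified] \<Psi>_F rend_rep fock_f_exc_beta)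

lemma qbr_0_right [simp]: "qbr q x 0 = 0"
  by (simp add: qbr_def)

text \<open>Each bracket lets the hole or the particle advance by at most one site, so
  \<open>w i j\<close> creates from the vacuum only excitations with both indices bounded by
  \<open>i\<close> and \<open>j\<close>.\<close>

lemma deriv1_w: assumes "1 \<le> i" "i \<le> n" "1 \<le> j" "j \<le> n" "1 \<le> i'" "1 \<le> j'" "\<not> (i' \<le> i \<and> j' \<le> j)"
  shows "deriv1 (i', j') (w i j) = 0"
proof -
  have 1: "deriv1 (i', j') (w 1 j) = 0" if "1 \<le> i'" "1 \<le> j'" "\<not> (i' \<le> 1 \<and> j' \<le> j)" for i' j'
    using assms(3,4) that
  proof (induction j arbitrary: j' rule: nat_induct_at_least)
    case base
    then show ?case using deriv1_w_11[of i' j'] by auto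
  next
    case (Suc j)
    then show ?case using Suc.IH[of j'] Suc.IH[of j] by (auto simp: f.z_1_nu[simplified] deriv1_qbr)
  qed
  show ?thesis using assms(1,2,5-)
  proof (induction i arbitrary: i' rule: nat_induct_at_least)
    case base
    then show ?case using 1[of i' j'] by simp
  next
    case (Suc i)
    then show ?case using Suc.IH[of i'] Suc.IH[of i] by (auto simp: f.z_mu deriv1_qbr)
  qed
qed

text \<open>The coefficient of the extreme excitation. It is the product of the \<open>Ki\<close>
  over the simple roots in the root of \<open>w i j\<close>, hence a unit of
  \<open>par\<close>.\<close>

definition kap :: "nat \<Rightarrow> nat \<Rightarrow> 'a" where "kap i j = deriv1 (i, j) (w i j)"

lemma kap_11: "kap 1 1 = Ki Beta"
  unfolding kap_def using deriv1_w_11[of 1 1] by simp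

lemma kap_1_Suc: "1 \<le> j \<Longrightarrow> j < n \<Longrightarrow> kap 1 (Suc j) = Ki (Nu j) * kap 1 j"
  unfolding kap_def using deriv1_w[of 1 j 1 "Suc j"] by (simp add: f.z_1_nu[simplified] deriv1_qbr)

lemma kap_Suc: "1 \<le> i \<Longrightarrow> i < n \<Longrightarrow> 1 \<le> j \<Longrightarrow> j \<le> n \<Longrightarrow> kap (Suc i) j = Ki (Mu i) * kap i j"
  unfolding kap_def using deriv1_w[of i j "Suc i" j] by (simp add: f.z_mu deriv1_qbr)

lemma kap_induct [consumes 4, case_names base nu mu]:
  assumes "1 \<le> i" "i \<le> n" "1 \<le> j" "j \<le> n"
    and "P 1 1 (Ki Beta)"
    and "\<And>j x. 1 \<le> j \<Longrightarrow> j < n \<Longrightarrow> P 1 j x \<Longrightarrow> P 1 (Suc j) (Ki (Nu j) * x)"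
    and "\<And>i j x. 1 \<le> i \<Longrightarrow> i < n \<Longrightarrow> 1 \<le> j \<Longrightarrow> j \<le> n \<Longrightarrow> P i j x \<Longrightarrow> P (Suc i) j (Ki (Mu i) * x)"
  shows "P i j (kap i j)"
proof -
  have 1: "P 1 j (kap 1 j)" using assms(3,4)
    by (induction j rule: nat_induct_at_least) (use assms(5,6) kap_11 kap_1_Suc in auto)
  show ?thesis using assms(1,2)
    by (induction i rule: nat_induct_at_least) (use 1 assms(3,4,7) kap_Suc in auto)
qed

lemma kap_par: assumes "1 \<le> i" "i \<le> n" "1 \<le> j" "j \<le> n"
  shows "kap i j \<in> par"
  using assms by (induction rule: kap_induct) (auto intro!: par_alg(4) par_gens)

lemma kap_unit: assumes "1 \<le> i" "i \<le> n" "1 \<le> j" "j \<le> n"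
  shows "\<exists>y. y * kap i j = 1"
  using assms
proof (induction rule: kap_induct)
  case base
  then show ?case using K_Ki[of Beta] by auto
next
  case (nu j x)
  then obtain y where "y * x = 1" by auto
  then have "y * K (Nu j) * (Ki (Nu j) * x) = 1"
    using K_Ki[of "Nu j"] nu by (simp add: mult.assoc) (simp add: mult.assoc[symmetric])
  then show ?case by blast
next
  case (mu i j x)
  then obtain y where "y * x = 1" by auto
  then have "y * K (Mu i) * (Ki (Mu i) * x) = 1"
    using K_Ki[of "Mu i"] mu by (simp add: mult.assoc) (simp add: mult.assoc[symmetric])
  then show ?case by blast
qed

lemma kap_w: assumes "1 \<le> i" "i \<le> n" "1 \<le> j" "j \<le> n"
  shows "kap i j * w i j = (q * q) *\<^sub>C (w i j * kap i j)"
proof -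
  have step: "Ki \<alpha> * x * w i0 j0 = q powi (a + b) *\<^sub>C (w i0 j0 * (Ki \<alpha> * x))"
    if "\<alpha> \<in> simple_roots n" "1 \<le> i0" "i0 \<le> n" "1 \<le> j0" "j0 \<le> n"
      "x * w i0 j0 = q powi b *\<^sub>C (w i0 j0 * x)" "- root_weight \<alpha> i0 j0 = a" for \<alpha> x i0 j0 a b
    using Ki_w[OF that(1-5)] that(6,7) q0
    by (simp add: mult.assoc scaleC_mult power_int_add) (simp add: mult.assoc[symmetric] scaleC_mult scaleC_scaleC mult.commute)
  \<comment> \<open>Generalized to all later entries \<open>(i0, j0)\<close>, because the partial
    products of \<open>kap\<close> have to pass the final entry rather than the one they belong to.
    At the final entry the exponent is 2, the norm of a root.\<close>
  have "\<forall>i0 j0. i \<le> i0 \<longrightarrow> i0 \<le> n \<longrightarrow> j \<le> j0 \<longrightarrow> j0 \<le> n \<longrightarrow>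
      kap i j * w i0 j0 = q powi (of_bool (i = i0) + of_bool (j = j0)) *\<^sub>C (w i0 j0 * kap i j)"
    using assms
  proof (induction rule: kap_induct)
    case base
    then show ?case using Ki_w[of Beta] by (auto simp: add.commute)
  next
    case (nu j x)
    show ?case
    proof (intro allI impI)
      fix i0 j0 assume a: "1 \<le> i0" "i0 \<le> n" "Suc j \<le> j0" "j0 \<le> n"
      then have "x * w i0 j0 = q powi (of_bool (1 = i0) + of_bool (j = j0)) *\<^sub>C (w i0 j0 * x)"
        using nu.IH by auto
      from step[OF _ _ _ _ _ this, of "Nu j" "of_bool (Suc j = j0)"]
      show "Ki (Nu j) * x * w i0 j0 = q powi (of_bool (1 = i0) + of_bool (Suc j = j0)) *\<^sub>C (w i0 j0 * (Ki (Nu j) * x))"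
        using a nu by (auto simp: add.commute)
    qed
  next
    case (mu i j x)
    show ?case
    proof (intro allI impI)
      fix i0 j0 assume a: "Suc i \<le> i0" "i0 \<le> n" "j \<le> j0" "j0 \<le> n"
      then have "x * w i0 j0 = q powi (of_bool (i = i0) + of_bool (j = j0)) *\<^sub>C (w i0 j0 * x)"
        using mu.IH by auto
      from step[OF _ _ _ _ _ this, of "Mu i" "of_bool (Suc i = i0)"]
      show "Ki (Mu i) * x * w i0 j0 = q powi (of_bool (Suc i = i0) + of_bool (j = j0)) *\<^sub>C (w i0 j0 * (Ki (Mu i) * x))"
        using a mu by (auto simp: add.commute)
    qed
  qed
  then show ?thesis using assms by (simp add: power2_eq_square)
qed

abbreviation "wp p \<equiv> w (fst p) (snd p)"

definition qq :: "nat \<Rightarrow> complex" where "qq a = (\<Sum>t<a. (q * q) ^ t)"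

lemma qq_nonzero: "1 \<le> a \<Longrightarrow> qq a \<noteq> 0"
proof
  assume a: "1 \<le> a" "qq a = 0"
  have "(q * q) ^ a - 1 = (q * q - 1) * qq a"
    unfolding qq_def by (simp add: power_diff_1_eq)
  then have "q ^ (2 * a) = 1" using a(2) by (simp add: power_mult power2_eq_square)
  then show False using q_pow[of "2 * a"] a(1) by simp
qed

lemma deriv1_power: assumes s: "s \<in> {1..n} \<times> {1..n}"
  shows "deriv1 s (wp s ^ Suc a) = qq (Suc a) *\<^sub>C (wp s ^ a * kap (fst s) (snd s))"
proof -
  have t: "tri (wp s)" using s by (auto intro: tri_w)
  have k: "kap (fst s) (snd s) * wp s = (q * q) *\<^sub>C (wp s * kap (fst s) (snd s))"
    using s by (auto intro: kap_w)
  have kp: "kap (fst s) (snd s) * wp s ^ a = (q * q) ^ a *\<^sub>C (wp s ^ a * kap (fst s) (snd s))" for a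
  proof (induction a)
    case (Suc a)
    have "kap (fst s) (snd s) * wp s ^ Suc a = (kap (fst s) (snd s) * wp s) * wp s ^ a"
      by (simp add: mult.assoc)
    also have "\<dots> = (q * q) *\<^sub>C (wp s * (kap (fst s) (snd s) * wp s ^ a))"
      unfolding k by (simp add: mult.assoc scaleC_mult)
    finally show ?case unfolding Suc by (simp add: scaleC_ring mult.assoc)
  qed simp
  have dk: "deriv1 s (wp s) = kap (fst s) (snd s)" by (simp add: kap_def)
  show ?thesis
  proof (induction a)
    case 0
    then show ?case using dk by (simp add: qq_def)
  next
    case (Suc a)
    have "deriv1 s (wp s ^ Suc (Suc a)) = deriv1 s (wp s * wp s ^ Suc a)" by simp
    also have "\<dots> = kap (fst s) (snd s) * wp s ^ Suc a + wp s * deriv1 s (wp s ^ Suc a)"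
      by (subst deriv1_mult[OF t tri_power[OF t]]) (use s dk in \<open>auto simp: mem_Times_iff\<close>)
    also have "\<dots> = ((q * q) ^ Suc a + qq (Suc a)) *\<^sub>C (wp s ^ Suc a * kap (fst s) (snd s))"
      unfolding Suc kp by (simp add: scaleC_mult scaleC_add_left mult.assoc)
    also have "(q * q) ^ Suc a + qq (Suc a) = qq (Suc (Suc a))"
      by (simp add: qq_def)
    finally show ?case .
  qed
qed

lemma tri_mono: "set rs \<subseteq> {1..n} \<times> {1..n} \<Longrightarrow> tri (omono wp rs b)"
  by (induction rs) (auto simp: tri_1 intro!: tri_mult tri_power tri_w)

lemma deriv1_mono_0:
  assumes "set rs \<subseteq> {1..n} \<times> {1..n}" "s \<in> {1..n} \<times> {1..n}" "\<And>r. r \<in> set rs \<Longrightarrow> before r s"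
  shows "deriv1 s (omono wp rs b) = 0"
  using assms(1,3)
proof (induction rs)
  case Nil
  then show ?case using deriv1_1[of s] assms(2) by auto
next
  case (Cons r rs)
  have s: "1 \<le> fst s" "1 \<le> snd s" using assms(2) by auto
  have t: "tri (wp r)" using Cons.prems by (auto intro!: tri_w)
  have "deriv1 s (wp r) = 0"
    using deriv1_w[of "fst r" "snd r" "fst s" "snd s"] Cons.prems(1) Cons.prems(2)[of r] s
    by (cases r) (auto simp: before_def)
  then have "deriv1 s (wp r ^ k) = 0" for k
    using deriv1_1[OF s(2)] deriv1_mult[OF t tri_power[OF t] s] by (induction k) simp_all
  then show ?case
    using Cons deriv1_mult[OF tri_power[OF t] tri_mono s] by (simp add: s)
qed

text \<open>The entry at the excitation of the last letter \<open>s\<close> differentiates with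
  respect to \<open>s\<close>: by \<open>deriv1_w\<close> all earlier letters are annihilated. A
  relation thus loses one degree in \<open>s\<close>, and its coefficients become nonzero multiples
  of \<open>k * \<tau> (pf b)\<close>, from which \<open>pf b\<close> is recovered because
  \<open>k\<close> has a left inverse and \<open>\<tau>\<close> is injective on
  \<open>par\<close>.\<close>

theorem omono_free:
  assumes "sorted_wrt before rs" "set rs \<subseteq> {1..n} \<times> {1..n}"
    and "finite B" "\<And>b r. b \<in> B \<Longrightarrow> r \<notin> set rs \<Longrightarrow> b r = 0" "\<And>b. b \<in> B \<Longrightarrow> pf b \<in> par"
    and "(\<Sum>b\<in>B. omono wp rs b * pf b) = 0" "b \<in> B"
  shows "pf b = 0"
  using assms
proof (induction rs arbitrary: B pf b rule: rev_induct)
  case Nil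
  have "c = (\<lambda>_. 0)" if "c \<in> B" for c using Nil.prems(4)[OF that] by auto
  then have "B = {b}" using Nil.prems(7) by auto
  then show ?case using Nil.prems(6) by simp
next
  case (snoc s rs)
  have s: "s \<in> {1..n} \<times> {1..n}" "1 \<le> fst s" "1 \<le> snd s" and rs: "set rs \<subseteq> {1..n} \<times> {1..n}"
    and bef: "\<And>r. r \<in> set rs \<Longrightarrow> before r s" and so: "sorted_wrt before rs"
    using snoc.prems(1,2) by (auto simp: sorted_wrt_append)
  have srs: "s \<notin> set rs" using bef[of s] by (auto simp: before_def)
  define k where "k = kap (fst s) (snd s)"
  have kpar: "k \<in> par" using s kap_par by (auto simp: k_def)
  obtain k' where k': "k' * k = 1"
    using kap_unit[of "fst s" "snd s"] s(1) unfolding k_def by (auto simp: mem_Times_iff)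
  have t: "tri (wp s)" using s by (auto intro!: tri_w)
  \<comment> \<open>Inner induction on a bound \<open>m\<close> for the exponent of
    \<open>s\<close>; removing the letter \<open>s\<close> itself is left to the outer
    induction.\<close>
  have main: "\<And>B pf b. \<lbrakk>finite B; \<And>b r. b \<in> B \<Longrightarrow> r \<notin> set (rs @ [s]) \<Longrightarrow> b r = 0; \<And>b. b \<in> B \<Longrightarrow> pf b \<in> par;
     (\<Sum>b\<in>B. omono wp (rs @ [s]) b * pf b) = 0; b \<in> B; \<And>b. b \<in> B \<Longrightarrow> b s \<le> m\<rbrakk> \<Longrightarrow> pf b = 0" for m
  proof (induction m)
    case 0
    have "(\<Sum>b\<in>B. omono wp rs b * pf b) = (\<Sum>b\<in>B. omono wp (rs @ [s]) b * pf b)"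
    proof (rule sum.cong[OF HOL.refl])
      fix b assume "b \<in> B"
      then have "b s = 0" using 0(6)[of b] by simp
      then show "omono wp rs b * pf b = omono wp (rs @ [s]) b * pf b" by simp
    qed
    then have sum: "(\<Sum>b\<in>B. omono wp rs b * pf b) = 0"
      using 0(4) by simp
    show ?case
    proof (rule snoc.IH[OF so rs 0(1) _ _ sum 0(5)])
      show "c r = 0" if "c \<in> B" "r \<notin> set rs" for c r
        using 0(2)[OF that(1), of r] 0(6)[OF that(1)] that by auto
    qed (rule 0(3))
  next
    case (Suc m)
    define B1 where "B1 = {b \<in> B. b s \<noteq> 0}"
    define dn where "dn b = b(s := b s - 1)" for b :: "nat \<times> nat \<Rightarrow> nat"
    define up where "up b = b(s := Suc (b s))" for b :: "nat \<times> nat \<Rightarrow> nat"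
    \<comment> \<open>The coefficients of the differentiated relation, indexed by the lowered
      exponent; \<open>up\<close> recovers the original one.\<close>
    define pg where "pg b = qq (Suc (b s)) *\<^sub>C (k * \<tau> (pf (up b)))" for b
    have updn: "up (dn b) = b" if "b \<in> B1" for b using that by (auto simp: up_def dn_def B1_def)
    have inj: "inj_on dn B1" using updn by (metis inj_onI)
    have fin: "finite B1" using Suc.prems(1) by (simp add: B1_def)
    have "deriv1 s (omono wp (rs @ [s]) b) * \<tau> (pf b) = (if b \<in> B1 then omono wp (rs @ [s]) (dn b) * pg (dn b) else 0)"
      if b: "b \<in> B" for b
    proof (cases "b s")
      case 0
      then show ?thesis using deriv1_mono_0[OF rs s(1) bef] by (simp add: B1_def)
    next
      case (Suc a)
      then have "b \<in> B1" using b by (simp add: B1_def)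
      have m: "omono wp rs (dn b) = omono wp rs b" by (rule omono_cong) (use srs in \<open>auto simp: dn_def\<close>)
      have "deriv1 s (omono wp (rs @ [s]) b) = omono wp rs b * deriv1 s (wp s ^ Suc a)"
        using deriv1_mult[OF tri_mono[OF rs] tri_power[OF t] s(2,3)] deriv1_mono_0[OF rs s(1) bef] Suc
        by (simp del: power_Suc)
      then have "deriv1 s (omono wp (rs @ [s]) b) * \<tau> (pf b) = omono wp (rs @ [s]) (dn b) * pg (dn b)"
        using updn[OF \<open>b \<in> B1\<close>] Suc
        unfolding pg_def deriv1_power[OF s(1)] omono_append m
        by (simp add: dn_def k_def mult.assoc scaleC_mult)
      then show ?thesis using \<open>b \<in> B1\<close> by simp
    qed
    note deriv_term = this
    have "app (\<Psi> (omono wp (rs @ [s]) b * pf b)) (delta vac) (exc (fst s) (snd s)) =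
        deriv1 s (omono wp (rs @ [s]) b) * \<tau> (pf b)" if "b \<in> B" for b
    proof -
      have d: "\<forall>S. S \<noteq> vac \<longrightarrow> delta vac S = 0" by (auto simp: delta_def)
      have "app (\<Psi> (pf b)) (delta vac) = (\<lambda>S. delta vac S * \<tau> (pf b))"
      proof
        fix S show "app (\<Psi> (pf b)) (delta vac) S = delta vac S * \<tau> (pf b)"
          using \<tau>_main[OF Suc.prems(3)[OF that] d] d by (cases "S = vac") simp_all
      qed
      then show ?thesis by (simp add: H.mult times_rend.rep_eq app_right deriv1_def)
    qed
    then have "(\<Sum>b\<in>B. deriv1 s (omono wp (rs @ [s]) b) * \<tau> (pf b)) =
        app (\<Psi> (\<Sum>b\<in>B. omono wp (rs @ [s]) b * pf b)) (delta vac) (exc (fst s) (snd s))"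
      by (simp add: H.sum app_sum)
    also have "\<dots> = 0" unfolding Suc.prems(4) by (simp add: H.zero app_simps)
    finally have "(\<Sum>b\<in>B. if b \<in> B1 then omono wp (rs @ [s]) (dn b) * pg (dn b) else 0) = 0"
      using deriv_term by simp
    then have "(\<Sum>b\<in>B1. omono wp (rs @ [s]) (dn b) * pg (dn b)) = 0"
      using Suc.prems(1) by (simp add: sum.If_cases B1_def Int_def)
    then have 1: "(\<Sum>b\<in>dn ` B1. omono wp (rs @ [s]) b * pg b) = 0"
      by (simp add: sum.reindex[OF inj])
    have pg0: "pg (dn b) = 0" if "b \<in> B1" for b
    proof (rule Suc.IH[OF _ _ _ 1])
      show "finite (dn ` B1)" using fin by simp
      show "c r = 0" if "c \<in> dn ` B1" "r \<notin> set (rs @ [s])" for c r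
        using that Suc.prems(2)[of _ r] by (auto simp: dn_def B1_def)
      show "pg c \<in> par" if "c \<in> dn ` B1" for c
        using that updn Suc.prems(3) kpar \<tau>_inverse unfolding pg_def by (auto intro!: par_alg simp: B1_def)
      show "dn b \<in> dn ` B1" using that by simp
      show "c s \<le> m" if "c \<in> dn ` B1" for c
        using that Suc.prems(6) by (fastforce simp: dn_def B1_def)
    qed
    have pf0: "pf b = 0" if "b \<in> B1" for b
    proof -
      have "qq (Suc (dn b s)) *\<^sub>C (k * \<tau> (pf b)) = 0" using pg0[OF that] updn[OF that] by (simp add: pg_def)
      then have "k * \<tau> (pf b) = 0" using qq_nonzero[of "Suc (dn b s)"] by simp
      then have "k' * (k * \<tau> (pf b)) = 0" by simp
      then have "\<tau> (pf b) = 0" using k' by (simp add: mult.assoc[symmetric])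
      then show ?thesis using \<tau>_eq_0 Suc.prems(3) that by (auto simp: B1_def)
    qed
    show ?case
    proof (cases "b \<in> B1")
      case True
      then show ?thesis by (rule pf0)
    next
      case False
      \<comment> \<open>The terms containing \<open>s\<close> have dropped out, and what remains is
        a relation in the letters \<open>rs\<close>.\<close>
      have "(\<Sum>b\<in>B. omono wp (rs @ [s]) b * pf b) = (\<Sum>b\<in>B - B1. omono wp (rs @ [s]) b * pf b)"
        by (rule sum.mono_neutral_right) (use Suc.prems(1) pf0 in auto)
      then have 2: "(\<Sum>b\<in>B - B1. omono wp rs b * pf b) = 0"
        using Suc.prems(4) by (simp add: B1_def)
      show ?thesis
      proof (rule snoc.IH[OF so rs _ _ _ 2])
        show "c r = 0" if "c \<in> B - B1" "r \<notin> set rs" for c r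
          using that Suc.prems(2)[of c r] by (auto simp: B1_def)
      qed (use Suc.prems False in auto)
    qed
  qed
  have "finite ((\<lambda>b. b s) ` B)" using snoc.prems(3) by simp
  then have le: "c s \<le> Max ((\<lambda>b. b s) ` B)" if "c \<in> B" for c using that by auto
  show ?case
  proof (rule main)
    show "finite B" "b \<in> B" "(\<Sum>b\<in>B. omono wp (rs @ [s]) b * pf b) = 0"
      using snoc.prems by blast+
    show "c r = 0" if "c \<in> B" "r \<notin> set (rs @ [s])" for c r using snoc.prems(4) that by blast
    show "pf c \<in> par" if "c \<in> B" for c using snoc.prems(5) that by blast
    show "c s \<le> Max ((\<lambda>b. b s) ` B)" if "c \<in> B" for c using le that by blast
  qed
qed

end

section \<open>Operators on a space with a monomial basis\<close>

definition exps :: "'i set \<Rightarrow> ('i \<Rightarrow> nat) set"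
  where "exps P = {a. \<forall>p. p \<notin> P \<longrightarrow> a p = 0}"

lemma exps_upd [simp]: "a \<in> exps P \<Longrightarrow> p \<in> P \<Longrightarrow> a(p := m) \<in> exps P"
  unfolding exps_def by auto

lemma exps_mono: "a \<in> exps P \<Longrightarrow> P \<subseteq> Q \<Longrightarrow> a \<in> exps Q"
  unfolding exps_def by auto

locale monomial_basis =
  fixes q :: complex and P :: "'i set" and e :: "('i \<Rightarrow> nat) \<Rightarrow> 'm::complex_module" and A :: "'m set"
  assumes q0: "q \<noteq> 0" and q_pow: "\<And>m. 1 \<le> m \<Longrightarrow> q ^ m \<noteq> 1"
    and free: "\<And>B c b. finite B \<Longrightarrow> B \<subseteq> exps P \<Longrightarrow> (\<Sum>b\<in>B. c b *\<^sub>C e b) = 0 \<Longrightarrow> b \<in> B \<Longrightarrow> c b = 0"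
    and A_eq: "A = cvs.span (e ` exps P)"
begin

lemma inj_e: "inj_on e (exps P)"
proof
  fix a b assume ab: "a \<in> exps P" "b \<in> exps P" "e a = e b"
  show "a = b"
  proof (rule ccontr)
    assume ne: "a \<noteq> b"
    have "(\<Sum>x\<in>{a, b}. (if x = a then 1 else -1) *\<^sub>C e x) = 0" using ab ne by simp
    from free[OF _ _ this, of a] ab show False by auto
  qed
qed

lemma independent: "cvs.independent (e ` exps P)"
  unfolding cvs.independent_explicit_finite_subsets
proof clarify
  fix S u v assume S: "S \<subseteq> e ` exps P" "finite S" "(\<Sum>v\<in>S. u v *\<^sub>C v) = 0" and v: "v \<in> S"
  obtain B where B: "B \<subseteq> exps P" "S = e ` B" using S(1) by (auto simp: subset_image_iff)
  have inj: "inj_on e B" using inj_e B(1) inj_on_subset by blast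
  then have fin: "finite B" using S(2) B(2) finite_imageD by blast
  have sum: "(\<Sum>b\<in>B. u (e b) *\<^sub>C e b) = 0"
    using S(3) unfolding B(2) sum.reindex[OF inj] by simp
  obtain b where b: "b \<in> B" "v = e b" using v B(2) by auto
  then show "u v = 0" using free[OF fin B(1) sum] by simp
qed

lemma e_in: "a \<in> exps P \<Longrightarrow> e a \<in> A"
  unfolding A_eq by (auto intro: cvs.span_base)

lemma A_zero: "0 \<in> A" and A_add: "x \<in> A \<Longrightarrow> y \<in> A \<Longrightarrow> x + y \<in> A"
  and A_scale: "x \<in> A \<Longrightarrow> c *\<^sub>C x \<in> A" and A_diff: "x \<in> A \<Longrightarrow> y \<in> A \<Longrightarrow> x - y \<in> A"
  unfolding A_eq by (auto intro: cvs.span_zero cvs.span_add cvs.span_scale cvs.span_diff)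

lemma A_induct [consumes 1, case_names zero step]:
  assumes "x \<in> A" "R 0" "\<And>c a y. a \<in> exps P \<Longrightarrow> y \<in> A \<Longrightarrow> R y \<Longrightarrow> R (c *\<^sub>C e a + y)"
  shows "R x"
proof -
  have "x \<in> A \<and> R x" using assms(1)[unfolded A_eq]
  proof (induction x rule: cvs.span_induct_alt)
    case base
    then show ?case using assms(2) A_zero by simp
  next
    case (step c x y)
    then show ?case using assms(3) by (auto intro!: A_add A_scale e_in)
  qed
  then show ?thesis ..
qed

lemma linear_onD: assumes "linear_on A T"
  shows "x \<in> A \<Longrightarrow> y \<in> A \<Longrightarrow> T (x + y) = T x + T y" "x \<in> A \<Longrightarrow> T (c *\<^sub>C x) = c *\<^sub>C T x" "T 0 = 0"
  using assms A_zero unfolding linear_on_def by (auto, metis scaleC_0_left)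

lemma linear_on_eq:
  assumes "linear_on A S" "linear_on A T" "\<And>a. a \<in> exps P \<Longrightarrow> S (e a) = T (e a)" "x \<in> A"
  shows "S x = T x"
  using assms(4) by (induction rule: A_induct) (simp_all add: linear_onD[OF assms(1)] linear_onD[OF assms(2)] A_scale e_in assms(3))

lemma operators_onD: "T \<in> operators_on A \<Longrightarrow> linear_on A T" "T \<in> operators_on A \<Longrightarrow> x \<in> A \<Longrightarrow> T x \<in> A"
  "T \<in> operators_on A \<Longrightarrow> x \<notin> A \<Longrightarrow> T x = undefined"
  unfolding operators_on_def by auto

lemma operators_on_eqI:
  assumes "S \<in> operators_on A" "T \<in> operators_on A" "\<And>a. a \<in> exps P \<Longrightarrow> S (e a) = T (e a)"
  shows "S = T"
proof
  fix x show "S x = T x"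
    using linear_on_eq[of S T x] assms operators_onD[of S] operators_onD[of T] by (cases "x \<in> A") auto
qed

text \<open>Phrased as the same definite description as \<open>M_op\<close> and \<open>D_op\<close>,
  which thereby become instances by mere unfolding.\<close>

definition opd :: "(('i \<Rightarrow> nat) \<Rightarrow> 'm) \<Rightarrow> 'm \<Rightarrow> 'm"
  where "opd \<phi> = (THE T. T \<in> operators_on A \<and> (\<forall>a\<in>exps P. T (e a) = \<phi> a))"

lemma opd:
  assumes "\<And>a. a \<in> exps P \<Longrightarrow> \<phi> a \<in> A"
  shows "opd \<phi> \<in> operators_on A" "a \<in> exps P \<Longrightarrow> opd \<phi> (e a) = \<phi> a"
proof -
  interpret vp: vector_space_pair "scaleC :: complex \<Rightarrow> 'm \<Rightarrow> 'm" "scaleC :: complex \<Rightarrow> 'm \<Rightarrow> 'm"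
    by unfold_locales
  define f where "f = \<phi> \<circ> inv_into (exps P) e"
  define T where "T = restrict (vp.construct (e ` exps P) f) A"
  interpret l: Vector_Spaces.linear "scaleC :: complex \<Rightarrow> 'm \<Rightarrow> 'm" "scaleC :: complex \<Rightarrow> 'm \<Rightarrow> 'm" "vp.construct (e ` exps P) f"
    by (rule vp.linear_construct[OF independent])
  have f: "f (e a) = \<phi> a" if "a \<in> exps P" for a using that inj_e by (simp add: f_def)
  have in_A: "vp.construct (e ` exps P) f x \<in> A" for x
  proof -
    have "f ` (e ` exps P) \<subseteq> A" using f assms by auto
    moreover have "vp.construct (e ` exps P) f x \<in> cvs.span (f ` (e ` exps P))"
      by (rule vp.construct_in_span[OF independent])
    ultimately show ?thesis unfolding A_eq using cvs.span_mono cvs.span_span by (metis subsetD)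
  qed
  have T: "T \<in> operators_on A" "\<forall>a\<in>exps P. T (e a) = \<phi> a"
    unfolding operators_on_def linear_on_def T_def
    using in_A A_add A_scale e_in vp.construct_basis[OF independent] f
    by (auto simp: l.add l.scale)
  have "opd \<phi> = T"
    unfolding opd_def by (rule the_equality) (use T operators_on_eqI in auto)
  then show "opd \<phi> \<in> operators_on A" "a \<in> exps P \<Longrightarrow> opd \<phi> (e a) = \<phi> a" using T by auto
qed

definition Mo :: "'i \<Rightarrow> 'm \<Rightarrow> 'm" where "Mo p = opd (\<lambda>a. e (a(p := a p + 1)))"
definition Do :: "'i \<Rightarrow> 'm \<Rightarrow> 'm" where "Do p = opd (\<lambda>a. qint q (a p) *\<^sub>C e (a(p := a p - 1)))"

lemma Mo: "p \<in> P \<Longrightarrow> Mo p \<in> operators_on A" "p \<in> P \<Longrightarrow> a \<in> exps P \<Longrightarrow> Mo p (e a) = e (a(p := a p + 1))"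
  unfolding Mo_def by (rule opd; simp add: e_in)+

lemma Do: "p \<in> P \<Longrightarrow> Do p \<in> operators_on A"
  "p \<in> P \<Longrightarrow> a \<in> exps P \<Longrightarrow> Do p (e a) = qint q (a p) *\<^sub>C e (a(p := a p - 1))"
  unfolding Do_def by (rule opd; simp add: e_in A_scale)+

definition Wa :: "'i set \<Rightarrow> ('m \<Rightarrow> 'm) set"
  where "Wa Q = operator_algebra A (Mo ` Q \<union> Do ` Q)"

end

section \<open>Membership in the Weyl algebra, and the operators \<open>q^(m a)\<close>\<close>

lemma operator_algebra_mono:
  "T \<in> operator_algebra A G \<Longrightarrow> G \<subseteq> operator_algebra A H \<Longrightarrow> T \<in> operator_algebra A H"
  by (induction rule: operator_algebra.induct) (auto intro: operator_algebra.intros)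

context monomial_basis
begin

lemma operator_algebra_in:
  assumes "G \<subseteq> operators_on A" "T \<in> operator_algebra A G" shows "T \<in> operators_on A"
  using assms(2)
proof induction
  case (gen T)
  then show ?case using assms(1) by auto
next
  case ident
  then show ?case by (auto simp: operators_on_def linear_on_def A_add A_scale)
next
  case (add S T)
  then have "S x \<in> A" "T x \<in> A" if "x \<in> A" for x using that operators_onD(2) by blast+
  then show ?case using add.IH A_add
    by (auto simp: operators_on_def linear_on_def A_scale scaleC_add_right algebra_simps)
next
  case (scale T c)
  then have "T x \<in> A" if "x \<in> A" for x using that operators_onD(2) by blast
  then show ?case using scale A_scale by (auto simp: operators_on_def linear_on_def A_add scaleC_add_right scaleC_scaleC mult.commute)
next
  case (comp S T)
  then show ?case by (auto simp: operators_on_def linear_on_def compose_def A_add A_scale Pi_def extensional_def PiE_def)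
qed

lemma Wa_operators: "Q \<subseteq> P \<Longrightarrow> T \<in> Wa Q \<Longrightarrow> T \<in> operators_on A"
  unfolding Wa_def by (erule operator_algebra_in[rotated]) (use Mo(1) Do(1) in auto)

lemma Wa_in: "Q \<subseteq> P \<Longrightarrow> T \<in> Wa Q \<Longrightarrow> x \<in> A \<Longrightarrow> T x \<in> A"
  using Wa_operators operators_onD by blast

lemma Wa_mono: "Q \<subseteq> R \<Longrightarrow> T \<in> Wa Q \<Longrightarrow> T \<in> Wa R"
  unfolding Wa_def by (erule operator_algebra_mono) (auto intro: operator_algebra.gen)

lemma Wa_gen: "p \<in> Q \<Longrightarrow> Mo p \<in> Wa Q" "p \<in> Q \<Longrightarrow> Do p \<in> Wa Q"
  unfolding Wa_def by (auto intro: operator_algebra.gen)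

text \<open>An operator is only determined by its values on \<open>A\<close>; \<open>inW Q f\<close> says that \<open>f\<close> agrees on \<open>A\<close> with an
  element of the algebra generated by the \<open>Mo p\<close> and \<open>Do p\<close> with \<open>p \<in> Q\<close>.\<close>

definition inW :: "'i set \<Rightarrow> ('m \<Rightarrow> 'm) \<Rightarrow> bool"
  where "inW Q f \<longleftrightarrow> restrict f A \<in> Wa Q"

lemma inW_cong: "(\<And>x. x \<in> A \<Longrightarrow> f x = h x) \<Longrightarrow> inW Q f = inW Q h"
  unfolding inW_def by (metis restrict_ext)

lemma inW_eq: "(\<And>x. x \<in> A \<Longrightarrow> f x = h x) \<Longrightarrow> inW Q h \<Longrightarrow> inW Q f"
  using inW_cong by blast

lemma Wa_restrict: "Q \<subseteq> P \<Longrightarrow> T \<in> Wa Q \<Longrightarrow> restrict T A = T"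
  using Wa_operators[of Q T] operators_onD(3)[of T] by (auto simp: fun_eq_iff restrict_def)

lemma inW_Wa: "Q \<subseteq> P \<Longrightarrow> T \<in> Wa Q \<Longrightarrow> inW Q T"
  unfolding inW_def by (simp add: Wa_restrict)

lemma inW_id: "inW Q (\<lambda>x. x)"
  unfolding inW_def Wa_def by (rule operator_algebra.ident)

lemma inW_add: "inW Q f \<Longrightarrow> inW Q h \<Longrightarrow> inW Q (\<lambda>x. f x + h x)"
  unfolding inW_def Wa_def using operator_algebra.add[of "restrict f A" A _ "restrict h A"]
  by (simp add: restrict_def cong: if_cong)

lemma inW_scale: "inW Q f \<Longrightarrow> inW Q (\<lambda>x. c *\<^sub>C f x)"
  unfolding inW_def Wa_def using operator_algebra.scale[of "restrict f A" A _ c]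
  by (simp add: restrict_def cong: if_cong)

lemma inW_diff: "inW Q f \<Longrightarrow> inW Q h \<Longrightarrow> inW Q (\<lambda>x. f x - h x)"
  using inW_add[of Q f "\<lambda>x. (-1) *\<^sub>C h x"] inW_scale[of Q h "-1"] by simp

lemma inW_zero: "inW Q (\<lambda>x. 0)"
  using inW_scale[OF inW_id, of Q 0] by simp

lemma inW_operators: "Q \<subseteq> P \<Longrightarrow> inW Q f \<Longrightarrow> restrict f A \<in> operators_on A"
  unfolding inW_def by (rule Wa_operators)

lemma inW_in: "Q \<subseteq> P \<Longrightarrow> inW Q f \<Longrightarrow> x \<in> A \<Longrightarrow> f x \<in> A"
  using inW_operators operators_onD(2)[of "restrict f A" x] by auto

lemma inW_linear: "Q \<subseteq> P \<Longrightarrow> inW Q f \<Longrightarrow> linear_on A f"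
  using inW_operators[of Q f] operators_onD(1)[of "restrict f A"] A_add A_scale unfolding linear_on_def by auto

lemma inW_comp: "Q \<subseteq> P \<Longrightarrow> inW Q f \<Longrightarrow> inW Q h \<Longrightarrow> inW Q (\<lambda>x. f (h x))"
proof -
  assume a: "Q \<subseteq> P" "inW Q f" "inW Q h"
  have "restrict (\<lambda>x. f (h x)) A = compose A (restrict f A) (restrict h A)"
    using inW_in[OF a(1,3)] by (auto simp: compose_def restrict_def fun_eq_iff)
  then show ?thesis using a unfolding inW_def Wa_def by (auto intro: operator_algebra.comp)
qed

lemma inW_mono: "Q \<subseteq> R \<Longrightarrow> inW Q f \<Longrightarrow> inW R f"
  unfolding inW_def by (rule Wa_mono)

lemma q_diff: "q - inverse q \<noteq> 0"
proof
  assume "q - inverse q = 0"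
  then have "q * q = q * inverse q" by simp
  then show False using q_pow[of 2] q0 by (simp add: power2_eq_square)
qed

lemma qint_rec: "qint q (Suc a) - q * qint q a = inverse q ^ a" "qint q (Suc a) - inverse q * qint q a = q ^ a"
proof -
  have "qint q (Suc a) - q * qint q a = (inverse q ^ a * (q - inverse q)) / (q - inverse q)"
    unfolding qint_def by (simp add: algebra_simps add_divide_distrib diff_divide_distrib)
  then show "qint q (Suc a) - q * qint q a = inverse q ^ a" using q_diff by simp
  have "qint q (Suc a) - inverse q * qint q a = (q ^ a * (q - inverse q)) / (q - inverse q)"
    unfolding qint_def by (simp add: algebra_simps add_divide_distrib diff_divide_distrib)
  then show "qint q (Suc a) - inverse q * qint q a = q ^ a" using q_diff by simp
qed

lemma qint_0 [simp]: "qint q 0 = 0"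
  by (simp add: qint_def)

definition Hpow :: "'i \<Rightarrow> int \<Rightarrow> 'm \<Rightarrow> 'm"
  where "Hpow p m = opd (\<lambda>a. q powi (m * int (a p)) *\<^sub>C e a)"

lemma Hpow: "Hpow p m \<in> operators_on A" "a \<in> exps P \<Longrightarrow> Hpow p m (e a) = q powi (m * int (a p)) *\<^sub>C e a"
  unfolding Hpow_def by (rule opd; simp add: e_in A_scale)+

lemma restrict_eq: "linear_on A f \<Longrightarrow> T \<in> operators_on A \<Longrightarrow> (\<And>a. a \<in> exps P \<Longrightarrow> f (e a) = T (e a)) \<Longrightarrow> x \<in> A \<Longrightarrow> f x = T x"
  using linear_on_eq operators_onD by blast

text \<open>On monomials \<open>D M - inverse q * M D\<close> and \<open>D M - q * M D\<close> are
  \<open>[a + 1] - q^(-1) [a] = q^a\<close> and \<open>[a + 1] - q [a] = q^(-a)\<close>, so both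
  diagonal operators lie in the algebra generated by one pair.\<close>

lemma Hpow_1: assumes "p \<in> P" shows "inW {p} (Hpow p 1)" "inW {p} (Hpow p (-1))"
proof -
  have s: "{p} \<subseteq> P" using assms by simp
  have MD: "inW {p} (\<lambda>x. Do p (Mo p x) - c *\<^sub>C Mo p (Do p x))" for c
  proof -
    have M: "inW {p} (Mo p)" and D: "inW {p} (Do p)"
      by (rule inW_Wa[OF s]; rule Wa_gen; simp)+
    show ?thesis by (rule inW_diff[OF inW_comp[OF s D M] inW_scale[OF inW_comp[OF s M D]]])
  qed
  have ea: "Do p (Mo p (e a)) - c *\<^sub>C Mo p (Do p (e a)) = (qint q (Suc (a p)) - c * qint q (a p)) *\<^sub>C e a" if a: "a \<in> exps P" for a c
  proof -
    have "Mo p (qint q (a p) *\<^sub>C e (a(p := a p - 1))) = qint q (a p) *\<^sub>C Mo p (e (a(p := a p - 1)))"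
      using linear_onD(2)[OF operators_onD(1)[OF Mo(1)[OF assms]]] a assms by (simp add: e_in)
    then have "Mo p (Do p (e a)) = qint q (a p) *\<^sub>C e a"
      using a assms by (cases "a p") (simp_all add: Mo Do fun_upd_idem)
    moreover have "Do p (Mo p (e a)) = qint q (Suc (a p)) *\<^sub>C e a"
      using a assms by (simp add: Mo Do)
    ultimately show ?thesis by (simp add: scaleC_diff_left scaleC_scaleC)
  qed
  have "Do p (Mo p x) - inverse q *\<^sub>C Mo p (Do p x) = Hpow p 1 x" if "x \<in> A" for x
    by (rule restrict_eq[OF inW_linear[OF s MD] Hpow(1) _ that]) (simp add: ea qint_rec Hpow)
  then show "inW {p} (Hpow p 1)" using inW_eq[OF _ MD[of "inverse q"]] by auto
  have "Do p (Mo p x) - q *\<^sub>C Mo p (Do p x) = Hpow p (-1) x" if "x \<in> A" for x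
    by (rule restrict_eq[OF inW_linear[OF s MD] Hpow(1) _ that])
       (simp add: ea qint_rec Hpow power_int_def)
  then show "inW {p} (Hpow p (-1))" using inW_eq[OF _ MD[of q]] by auto
qed

lemma Hpow_add: "x \<in> A \<Longrightarrow> Hpow p (k + m) x = Hpow p k (Hpow p m x)"
proof -
  assume x: "x \<in> A"
  have lin: "linear_on A (\<lambda>x. Hpow p k (Hpow p m x))"
    unfolding linear_on_def using Hpow(1)[THEN operators_onD(1)] Hpow(1)[THEN operators_onD(2)]
    by (simp add: linear_onD A_add A_scale)
  show ?thesis
    by (rule restrict_eq[OF lin Hpow(1) _ x, symmetric])
       (simp add: Hpow linear_onD(2)[OF operators_onD(1)[OF Hpow(1)]] e_in scaleC_scaleC power_int_add[symmetric] q0 ring_distribs add.commute)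
qed

lemma Hpow_0: "x \<in> A \<Longrightarrow> Hpow p 0 x = x"
  by (rule restrict_eq[OF _ Hpow(1), symmetric]) (auto simp: linear_on_def Hpow)

lemma inW_Hpow: assumes "p \<in> P" shows "inW {p} (Hpow p m)"
proof -
  have s: "{p} \<subseteq> P" using assms by simp
  have "inW {p} (Hpow p (int k))" for k
  proof (induction k)
    case 0
    then show ?case using inW_eq[of "Hpow p 0" "\<lambda>x. x", OF Hpow_0 inW_id] by simp
  next
    case (Suc k)
    have "Hpow p (int (Suc k)) x = Hpow p 1 (Hpow p (int k) x)" if "x \<in> A" for x
      using Hpow_add[OF that, of p 1 "int k"] by simp
    then show ?case by (rule inW_eq[OF _ inW_comp[OF s Hpow_1(1)[OF assms] Suc]])
  qed
  moreover have "inW {p} (Hpow p (- int k))" for k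
  proof (induction k)
    case 0
    then show ?case using inW_eq[of "Hpow p 0" "\<lambda>x. x", OF Hpow_0 inW_id] by simp
  next
    case (Suc k)
    have "Hpow p (- int (Suc k)) x = Hpow p (-1) (Hpow p (- int k) x)" if "x \<in> A" for x
      using Hpow_add[OF that, of p "-1" "- int k"] by simp
    then show ?case by (rule inW_eq[OF _ inW_comp[OF s Hpow_1(2)[OF assms] Suc]])
  qed
  ultimately show ?thesis by (cases m rule: int_cases2) auto
qed

text \<open>The inverse is required to lie in the same algebra, so that triangular systems can be
  solved inside it.\<close>

definition invW :: "'i set \<Rightarrow> ('m \<Rightarrow> 'm) \<Rightarrow> bool"
  where "invW Q f \<longleftrightarrow> inW Q f \<and> (\<exists>h. inW Q h \<and> (\<forall>x\<in>A. f (h x) = x \<and> h (f x) = x))"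

lemma invW_id: "invW Q (\<lambda>x. x)"
  unfolding invW_def using inW_id by auto

lemma invW_Hpow: "p \<in> P \<Longrightarrow> invW {p} (Hpow p m)"
  unfolding invW_def using inW_Hpow Hpow_add[of _ p m "- m"] Hpow_add[of _ p "- m" m] Hpow_0
  by (auto intro!: exI[of _ "Hpow p (- m)"])

lemma invW_mono: "Q \<subseteq> R \<Longrightarrow> invW Q f \<Longrightarrow> invW R f"
  unfolding invW_def using inW_mono by blast

lemma invW_comp: "Q \<subseteq> P \<Longrightarrow> invW Q f \<Longrightarrow> invW Q h \<Longrightarrow> invW Q (\<lambda>x. f (h x))"
proof -
  assume Q: "Q \<subseteq> P" and "invW Q f" "invW Q h"
  then obtain f' h' where f: "inW Q f" "inW Q f'" "\<forall>x\<in>A. f (f' x) = x \<and> f' (f x) = x"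
    and h: "inW Q h" "inW Q h'" "\<forall>x\<in>A. h (h' x) = x \<and> h' (h x) = x"
    unfolding invW_def by auto
  have "inW Q (\<lambda>x. h' (f' x))" by (rule inW_comp[OF Q h(2) f(2)])
  moreover have "\<forall>x\<in>A. f (h (h' (f' x))) = x \<and> h' (f' (f (h x))) = x"
    using f h inW_in[OF Q] by simp
  ultimately show ?thesis using inW_comp[OF Q f(1) h(1)] unfolding invW_def by blast
qed

text \<open>The coefficients \<open>q powi (m * (a - 1)) * [a]\<close> arise when \<open>u x = q powi (m - 1) x u + y\<close> is iterated,
  where \<open>y x = q powi (m + 1) x y\<close>, or with \<open>m - 1\<close> and \<open>m + 1\<close> exchanged.\<close>

definition Cop :: "'i \<Rightarrow> int \<Rightarrow> 'm \<Rightarrow> 'm"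
  where "Cop p m x = q powi (- m) *\<^sub>C Do p (Hpow p m x)"

lemma inW_Cop: "p \<in> P \<Longrightarrow> inW {p} (Cop p m)"
proof -
  assume p: "p \<in> P"
  then have s: "{p} \<subseteq> P" by simp
  have D: "inW {p} (Do p)" by (rule inW_Wa[OF s]; rule Wa_gen; simp)
  show ?thesis unfolding Cop_def by (rule inW_scale[OF inW_comp[OF s D inW_Hpow[OF p]]])
qed

lemma Cop: "p \<in> P \<Longrightarrow> a \<in> exps P \<Longrightarrow>
  Cop p m (e a) = (q powi (m * (int (a p) - 1)) * qint q (a p)) *\<^sub>C e (a(p := a p - 1))"
proof -
  assume a: "p \<in> P" "a \<in> exps P"
  have "Cop p m (e a) = (q powi (- m) * q powi (m * int (a p)) * qint q (a p)) *\<^sub>C e (a(p := a p - 1))"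
    unfolding Cop_def using a
    by (simp add: Hpow linear_onD(2)[OF operators_onD(1)[OF Do(1)]] e_in Do scaleC_scaleC mult.assoc)
  also have "q powi (- m) * q powi (m * int (a p)) = q powi (m * (int (a p) - 1))"
    unfolding power_int_add[OF disjI1[OF q0], symmetric] by (simp add: algebra_simps)
  finally show ?thesis .
qed

end

section \<open>Straightening\<close>

text \<open>One step of the induction in \<open>power_push\<close>, resting on
  \<open>[k + 1] - q^\<epsilon> [k] = q^(- \<epsilon> k)\<close> for either sign.\<close>

lemma power_push_coeff:
  assumes q0: "q \<noteq> 0" "q - inverse q \<noteq> 0" and \<epsilon>: "\<epsilon> = 1 \<or> \<epsilon> = -1"
  shows "q powi (c * int k) + q powi ((c + \<epsilon>) * (int k - 1)) * qint q k * q powi (c + 2 * \<epsilon>) =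
    q powi ((c + \<epsilon>) * int k) * qint q (Suc k)"
proof -
  have a: "qint q (Suc k) - q powi \<epsilon> * qint q k = q powi (- \<epsilon> * int k)"
  proof -
    have "(inverse q ^ k * (q - inverse q)) / (q - inverse q) = inverse q ^ k"
      "(q ^ k * (q - inverse q)) / (q - inverse q) = q ^ k" using q0(2) by simp_all
    then show ?thesis
      using \<epsilon> unfolding qint_def
      by (auto simp: power_int_def ring_distribs diff_divide_distrib[symmetric] mult.commute algebra_simps
          simp flip: power_Suc)
  qed
  have "q powi ((c + \<epsilon>) * (int k - 1)) * qint q k * q powi (c + 2 * \<epsilon>) = q powi ((c + \<epsilon>) * int k) * (q powi \<epsilon> * qint q k)"
  proof -
    have "q powi ((c + \<epsilon>) * (int k - 1)) * q powi (c + 2 * \<epsilon>) = q powi ((c + \<epsilon>) * int k) * q powi \<epsilon>"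
      unfolding power_int_add[OF disjI1[OF q0(1)], symmetric] by (simp add: algebra_simps)
    then show ?thesis by (simp add: ac_simps)
  qed
  moreover have "q powi (c * int k) = q powi ((c + \<epsilon>) * int k) * q powi (- \<epsilon> * int k)"
    unfolding power_int_add[OF disjI1[OF q0(1)], symmetric] by (simp add: algebra_simps)
  ultimately show ?thesis unfolding a[symmetric] by (simp add: ring_distribs)
qed

text \<open>Two error terms with independent signs serve \<open>E Beta * w 1 1\<close>, which
  produces \<open>K Beta\<close> and \<open>Ki Beta\<close> with opposite weights. In the other
  applications the second one is zero.\<close>

lemma power_push:
  fixes L U Y Y' :: "'m::complex_module \<Rightarrow> 'm"
  assumes q0: "q \<noteq> 0" "q - inverse q \<noteq> 0" and \<epsilon>: "\<epsilon> = 1 \<or> \<epsilon> = -1" "\<epsilon>' = 1 \<or> \<epsilon>' = -1"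
    and L: "linear_on UNIV L" and U: "\<And>v. U (L v) = q powi c *\<^sub>C L (U v) + Y v + Y' v"
    and Y: "\<And>v. Y (L v) = q powi (c + 2 * \<epsilon>) *\<^sub>C L (Y v)" "\<And>v. Y' (L v) = q powi (c + 2 * \<epsilon>') *\<^sub>C L (Y' v)"
  shows "U ((L ^^ k) v) = q powi (c * int k) *\<^sub>C (L ^^ k) (U v) +
    (q powi ((c + \<epsilon>) * (int k - 1)) * qint q k) *\<^sub>C (L ^^ (k - 1)) (Y v) +
    (q powi ((c + \<epsilon>') * (int k - 1)) * qint q k) *\<^sub>C (L ^^ (k - 1)) (Y' v)"
proof (induction k arbitrary: v)
  case 0
  then show ?case by (simp add: qint_def)
next
  case (Suc k)
  have lin: "(L ^^ j) (x + y) = (L ^^ j) x + (L ^^ j) y" "(L ^^ j) (d *\<^sub>C x) = d *\<^sub>C (L ^^ j) x" for j x y d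
    using L by (induction j) (simp_all add: linear_on_def)
  have t: "(q powi ((c + \<delta>) * (int k - 1)) * qint q k) *\<^sub>C (L ^^ (k - 1)) (T (L v)) =
      (q powi ((c + \<delta>) * (int k - 1)) * qint q k * q powi (c + 2 * \<delta>)) *\<^sub>C (L ^^ k) (T v)"
    if "T (L v) = q powi (c + 2 * \<delta>) *\<^sub>C L (T v)" for T \<delta>
    unfolding that by (cases k) (simp_all add: qint_def lin scaleC_scaleC funpow_swap1)
  have u: "U ((L ^^ Suc k) v) = (q powi (c * int k) * q powi c) *\<^sub>C (L ^^ Suc k) (U v) +
      q powi (c * int k) *\<^sub>C (L ^^ k) (Y v) + q powi (c * int k) *\<^sub>C (L ^^ k) (Y' v) +
      (q powi ((c + \<epsilon>) * (int k - 1)) * qint q k * q powi (c + 2 * \<epsilon>)) *\<^sub>C (L ^^ k) (Y v) +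
      (q powi ((c + \<epsilon>') * (int k - 1)) * qint q k * q powi (c + 2 * \<epsilon>')) *\<^sub>C (L ^^ k) (Y' v)"
    unfolding funpow_Suc_right comp_apply Suc t[where T = Y, OF Y(1)] t[where T = Y', OF Y(2)] U lin scaleC_add_right scaleC_scaleC ..
  have i: "int (Suc k) - 1 = int k" "Suc k - 1 = k" "q powi (c * int (Suc k)) = q powi (c * int k) * q powi c"
    using q0(1) by (simp_all add: power_int_add ring_distribs)
  show ?case
    unfolding u i power_push_coeff[OF q0 \<epsilon>(1), symmetric] power_push_coeff[OF q0 \<epsilon>(2), symmetric] scaleC_add_left
    by (simp only: add_ac)
qed

lemma power_push_mult:
  fixes u x y y' :: "'a::complex_algebra"
  assumes "q \<noteq> 0" "q - inverse q \<noteq> 0" "\<epsilon> = 1 \<or> \<epsilon> = -1" "\<epsilon>' = 1 \<or> \<epsilon>' = -1"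
    and ux: "u * x = q powi c *\<^sub>C (x * u) + y + y'"
    and yx: "y * x = q powi (c + 2 * \<epsilon>) *\<^sub>C (x * y)" "y' * x = q powi (c + 2 * \<epsilon>') *\<^sub>C (x * y')"
  shows "u * x ^ k = q powi (c * int k) *\<^sub>C (x ^ k * u) +
    (q powi ((c + \<epsilon>) * (int k - 1)) * qint q k) *\<^sub>C (x ^ (k - 1) * y) +
    (q powi ((c + \<epsilon>') * (int k - 1)) * qint q k) *\<^sub>C (x ^ (k - 1) * y')"
proof -
  have pw: "((\<lambda>v. x * v) ^^ j) v = x ^ j * v" for j v by (induction j) (simp_all add: mult.assoc)
  have "u * ((\<lambda>v. x * v) ^^ k) 1 = q powi (c * int k) *\<^sub>C ((\<lambda>v. x * v) ^^ k) (u * 1) +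
    (q powi ((c + \<epsilon>) * (int k - 1)) * qint q k) *\<^sub>C ((\<lambda>v. x * v) ^^ (k - 1)) (y * 1) +
    (q powi ((c + \<epsilon>') * (int k - 1)) * qint q k) *\<^sub>C ((\<lambda>v. x * v) ^^ (k - 1)) (y' * 1)"
  proof (rule power_push[OF assms(1-4)])
    show "linear_on UNIV (\<lambda>v. x * v)" by (simp add: linear_on_def ring_distribs scaleC_mult)
  qed (simp_all only: mult.assoc[symmetric] ux yx ring_distribs mult_scaleC_left)
  then show ?thesis unfolding pw by simp
qed

text \<open>Abstracts from the side of multiplication: \<open>l p\<close> multiplies by the letter
  \<open>p\<close>, from the left along the grid or from the right along its reverse. By
  \<open>straight\<close>, passing an earlier letter \<open>k\<close> costs a power of
  \<open>q\<close>, or leaves a product of two letters strictly between, which itself passes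
  \<open>k\<close> with factor \<open>q * q\<close>.\<close>

locale straightening = monomial_basis q "set ps" e A
  for q and ps :: "'i list" and e :: "('i \<Rightarrow> nat) \<Rightarrow> 'm::complex_module" and A +
  fixes l :: "'i \<Rightarrow> 'm \<Rightarrow> 'm"
  assumes dist: "distinct ps"
    and l_lin: "p \<in> set ps \<Longrightarrow> linear_on UNIV (l p)"
    and l_e: "ps = xs @ k # ys \<Longrightarrow> a \<in> exps (set (k # ys)) \<Longrightarrow> l k (e a) = e (a(k := Suc (a k)))"
    and straight: "ps = xs @ k # ys @ p # zs \<Longrightarrow>
      (\<exists>m. \<forall>u. l p (l k u) = q powi m *\<^sub>C l k (l p u)) \<or>
      (\<exists>r\<in>set ys. \<exists>r'\<in>set ys. \<exists>c. (\<forall>u. l p (l k u) = l k (l p u) + c *\<^sub>C l r (l r' u)) \<and>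
         (\<forall>u. l r (l r' (l k u)) = (q * q) *\<^sub>C l k (l r (l r' u))))"
begin

definition tail :: "'i list \<Rightarrow> 'm set" where "tail ys = cvs.span (e ` exps (set ys))"

lemma tail_A: "set ys \<subseteq> set ps \<Longrightarrow> x \<in> tail ys \<Longrightarrow> x \<in> A"
proof -
  assume "set ys \<subseteq> set ps"
  then have "e ` exps (set ys) \<subseteq> e ` exps (set ps)" using exps_mono by blast
  then show "x \<in> tail ys \<Longrightarrow> x \<in> A" unfolding tail_def A_eq using cvs.span_mono by blast
qed

lemma tail_all: "tail ps = A"
  unfolding tail_def A_eq ..

lemma tail_closed: "0 \<in> tail ys" "x \<in> tail ys \<Longrightarrow> y \<in> tail ys \<Longrightarrow> x + y \<in> tail ys" "x \<in> tail ys \<Longrightarrow> c *\<^sub>C x \<in> tail ys"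
  "a \<in> exps (set ys) \<Longrightarrow> e a \<in> tail ys"
  unfolding tail_def by (auto intro: cvs.span_zero cvs.span_add cvs.span_scale cvs.span_base)

lemma tail_induct [consumes 2, case_names zero step]:
  assumes "x \<in> tail ys" "set ys \<subseteq> set ps" "R 0"
    "\<And>c a y. a \<in> exps (set ys) \<Longrightarrow> a \<in> exps (set ps) \<Longrightarrow> y \<in> tail ys \<Longrightarrow> y \<in> A \<Longrightarrow> R y \<Longrightarrow> R (c *\<^sub>C e a + y)"
  shows "R x"
proof -
  have "x \<in> tail ys \<and> R x" using assms(1)[unfolded tail_def]
  proof (induction x rule: cvs.span_induct_alt)
    case base
    then show ?case using assms(3) by (simp add: tail_def cvs.span_zero)
  next
    case (step c x y)
    then obtain a where a: "a \<in> exps (set ys)" "x = e a" by auto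
    have y: "y \<in> tail ys" "R y" using step by auto
    have "c *\<^sub>C x + y \<in> tail ys" using y(1) a unfolding tail_def
      by (intro cvs.span_add cvs.span_scale) (auto intro: cvs.span_base)
    then show ?case using assms(4)[OF a(1) _ y(1) _ y(2), of c] a(1) exps_mono[OF a(1) assms(2)] tail_A[OF assms(2) y(1)] a(2)
      by blast
  qed
  then show ?thesis ..
qed

lemma linear_on_subset: "linear_on S T \<Longrightarrow> R \<subseteq> S \<Longrightarrow> linear_on R T"
  unfolding linear_on_def by blast

lemma tail_eq:
  assumes "linear_on (tail ys) S" "linear_on (tail ys) T" "set ys \<subseteq> set ps"
    "\<And>a. a \<in> exps (set ys) \<Longrightarrow> S (e a) = T (e a)" "x \<in> tail ys"
  shows "S x = T x"
proof -
  have lin: "R (c *\<^sub>C e a + y) = c *\<^sub>C R (e a) + R y"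
    if "linear_on (tail ys) R" "a \<in> exps (set ys)" "y \<in> tail ys" for R c a y
    using that tail_closed unfolding linear_on_def by simp
  have zero: "R 0 = 0" if "linear_on (tail ys) R" for R
    using that tail_closed(1) unfolding linear_on_def by (metis scaleC_0_left)
  show ?thesis using assms(5,3)
  proof (induction rule: tail_induct)
    case zero
    then show ?case using \<open>\<And>R. linear_on (tail ys) R \<Longrightarrow> R 0 = 0\<close>[OF assms(1)]
      \<open>\<And>R. linear_on (tail ys) R \<Longrightarrow> R 0 = 0\<close>[OF assms(2)] by simp
  next
    case (step c a y)
    then show ?case using lin[OF assms(1) step(1,3)] lin[OF assms(2) step(1,3)] assms(4)[OF step(1)] by simp
  qed
qed

lemma lpow_add: "p \<in> set ps \<Longrightarrow> (l p ^^ m) (x + y) = (l p ^^ m) x + (l p ^^ m) y"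
  and lpow_scale: "p \<in> set ps \<Longrightarrow> (l p ^^ m) (c *\<^sub>C x) = c *\<^sub>C (l p ^^ m) x"
  using l_lin[of p] by (induction m) (simp_all add: linear_on_def)

lemma lpow_e: "ps = xs @ k # ys \<Longrightarrow> a \<in> exps (set ys) \<Longrightarrow> (l k ^^ m) (e a) = e (a(k := m))"
proof (induction m)
  case 0
  then have "a k = 0" using dist by (auto simp: exps_def)
  then show ?case by (simp add: fun_upd_idem)
next
  case (Suc m)
  have "a(k := m) \<in> exps (set (k # ys))" using Suc.prems(2) by (auto simp: exps_def)
  from l_e[OF Suc.prems(1) this]
  have "l k (e (a(k := m))) = e (a(k := Suc m))" by (simp only: fun_upd_upd fun_upd_same)
  then show ?case unfolding funpow.simps comp_apply Suc.IH[OF Suc.prems] .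
qed

lemma lpow_in: assumes "ps = xs @ k # ys" "u \<in> tail ys"
  shows "(l k ^^ m) u \<in> A"
proof -
  have k: "k \<in> set ps" "set ys \<subseteq> set ps" using assms(1) by auto
  have z: "(l k ^^ m) 0 = 0" using lpow_scale[OF k(1), of m 0 0] by simp
  show ?thesis using assms(2) k(2)
    by (induction rule: tail_induct)
       (use k z in \<open>auto simp: lpow_add lpow_scale lpow_e[OF assms(1)] A_zero intro!: A_add A_scale e_in\<close>)
qed

text \<open>In front of a vector in the later letters, \<open>l k\<close> merely raises the exponent
  of \<open>k\<close>, and \<open>Mo\<close> and \<open>Do\<close> for later letters do not see that
  exponent.\<close>

lemma inW_tail:
  assumes "inW Q f" "ps = xs @ k # ys" "Q \<subseteq> set ys" "u \<in> tail ys"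
  shows "f u \<in> tail ys" "f ((l k ^^ m) u) = (l k ^^ m) (f u)"
proof -
  have Q: "Q \<subseteq> set ps" "set ys \<subseteq> set ps" "k \<in> set ps" using assms by auto
  have kys: "k \<notin> set ys" using assms(2) dist by auto
  note tail = tail_closed[where ys = ys]
  have "(\<forall>u\<in>tail ys. T u \<in> tail ys \<and> (\<forall>m. T ((l k ^^ m) u) = (l k ^^ m) (T u)))"
    if "T \<in> Wa Q" for T
    using that unfolding Wa_def
  proof (induction T rule: operator_algebra.induct)
    case (gen T)
    then obtain p where p: "p \<in> Q" "T = Mo p \<or> T = Do p" by auto
    have ps: "p \<in> set ps" "p \<in> set ys" "p \<noteq> k" using p Q assms(3) kys by auto
    have lT: "linear_on A T" "x \<in> A \<Longrightarrow> T x \<in> A" for x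
      using p ps Mo(1) Do(1) operators_onD by metis+
    have Te: "T (e a) \<in> tail ys" if "a \<in> exps (set ys)" for a
      using p(2) ps that exps_mono[OF that Q(2)] tail by (auto simp: Mo Do)
    have Tl: "T ((l k ^^ m) (e a)) = (l k ^^ m) (T (e a))" if "a \<in> exps (set ys)" for a m
    proof -
      have a: "a \<in> exps (set ps)" "a(k := m) \<in> exps (set ps)" "k \<in> set ps" using exps_mono[OF that Q(2)] Q(3) by auto
      show ?thesis using p(2)
      proof
        assume "T = Mo p"
        then show ?thesis using a ps that
          by (simp add: lpow_e[OF assms(2)] Mo fun_upd_twist)
      next
        assume "T = Do p"
        then show ?thesis using a ps that
          by (simp add: lpow_e[OF assms(2)] Do fun_upd_twist lpow_scale)
      qed
    qed
    show ?case
    proof (intro ballI conjI allI)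
      fix u m assume u: "u \<in> tail ys"
      show "T u \<in> tail ys" using u Q(2)
        by (induction rule: tail_induct) (use tail Te in \<open>simp_all add: linear_onD[OF lT(1)] A_scale e_in\<close>)
      have "linear_on (tail ys) (\<lambda>u. T ((l k ^^ m) u))" "linear_on (tail ys) (\<lambda>u. (l k ^^ m) (T u))"
        using lT(1) lpow_in[OF assms(2)] tail_A[OF Q(2)]
        by (simp_all add: linear_on_def lpow_add[OF Q(3)] lpow_scale[OF Q(3)])
      then show "T ((l k ^^ m) u) = (l k ^^ m) (T u)"
        using tail_eq[OF _ _ Q(2) _ u, of "\<lambda>u. T ((l k ^^ m) u)" "\<lambda>u. (l k ^^ m) (T u)"] Tl by blast
    qed
  next
    case ident
    then show ?case using tail_A[OF Q(2)] lpow_in[OF assms(2)] by simp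
  next
    case (add S T)
    have TS: "S \<in> operators_on A" "T \<in> operators_on A"
      using add.hyps Wa_operators[OF Q(1)] unfolding Wa_def by auto
    show ?case
    proof (intro ballI conjI allI)
      fix u m assume u: "u \<in> tail ys"
      have uA: "u \<in> A" "(l k ^^ m) u \<in> A" using tail_A[OF Q(2) u] lpow_in[OF assms(2) u] by auto
      show "(\<lambda>x\<in>A. S x + T x) u \<in> tail ys" using add.IH u uA tail by simp
      show "(\<lambda>x\<in>A. S x + T x) ((l k ^^ m) u) = (l k ^^ m) ((\<lambda>x\<in>A. S x + T x) u)"
        using add.IH u uA by (simp add: lpow_add[OF Q(3)])
    qed
  next
    case (scale T c)
    have TS: "T \<in> operators_on A"
      using scale.hyps Wa_operators[OF Q(1)] unfolding Wa_def by auto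
    show ?case
    proof (intro ballI conjI allI)
      fix u m assume u: "u \<in> tail ys"
      have uA: "u \<in> A" "(l k ^^ m) u \<in> A" using tail_A[OF Q(2) u] lpow_in[OF assms(2) u] by auto
      show "(\<lambda>x\<in>A. c *\<^sub>C T x) u \<in> tail ys" using scale.IH u uA tail by simp
      show "(\<lambda>x\<in>A. c *\<^sub>C T x) ((l k ^^ m) u) = (l k ^^ m) ((\<lambda>x\<in>A. c *\<^sub>C T x) u)"
        using scale.IH u uA by (simp add: lpow_scale[OF Q(3)])
    qed
  next
    case (comp S T)
    show ?case
    proof (intro ballI conjI allI)
      fix u m assume u: "u \<in> tail ys"
      have uA: "u \<in> A" "(l k ^^ m) u \<in> A" using tail_A[OF Q(2) u] lpow_in[OF assms(2) u] by auto
      show "compose A S T u \<in> tail ys" using comp.IH u uA by (simp add: compose_def)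
      show "compose A S T ((l k ^^ m) u) = (l k ^^ m) (compose A S T u)"
        using comp.IH u uA by (simp add: compose_def)
    qed
  qed
  from this[OF assms(1)[unfolded inW_def]]
  show "f u \<in> tail ys" "f ((l k ^^ m) u) = (l k ^^ m) (f u)"
    using assms(4) tail_A[OF Q(2) assms(4)] lpow_in[OF assms(2,4)] by (auto simp: restrict_def)
qed

lemma tail_Cons_eq:
  assumes ps: "ps = xs @ k # ys" and lin: "linear_on (tail (k # ys)) S" "linear_on (tail (k # ys)) T"
    and eq: "\<And>v j. v \<in> tail ys \<Longrightarrow> S ((l k ^^ j) v) = T ((l k ^^ j) v)" and x: "x \<in> tail (k # ys)"
  shows "S x = T x"
proof (rule tail_eq[OF lin _ _ x])
  show "set (k # ys) \<subseteq> set ps" using ps by auto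
  fix a assume a: "a \<in> exps (set (k # ys))"
  then have a0: "a(k := 0) \<in> exps (set ys)" by (auto simp: exps_def)
  then have "e (a(k := 0)) \<in> tail ys" by (rule tail_closed(4))
  from eq[OF this, of "a k"] show "S (e a) = T (e a)"
    by (simp add: lpow_e[OF ps a0])
qed

lemma linear_on_lpow:
  assumes ps: "ps = xs @ k # ys" and "linear_on A T"
  shows "linear_on (tail ys) (\<lambda>v. T ((l k ^^ j) v))" "linear_on (tail ys) (\<lambda>v. c *\<^sub>C (l k ^^ j) v)"
proof -
  have k: "k \<in> set ps" using ps by simp
  show "linear_on (tail ys) (\<lambda>v. T ((l k ^^ j) v))"
    using assms(2) lpow_in[OF ps] by (simp add: linear_on_def lpow_add[OF k] lpow_scale[OF k])
  show "linear_on (tail ys) (\<lambda>v. c *\<^sub>C (l k ^^ j) v)"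
    by (simp add: linear_on_def lpow_add[OF k] lpow_scale[OF k] scaleC_add_right scaleC_scaleC mult.commute)
qed

lemma Hpow_lpow: assumes ps: "ps = xs @ k # ys" and v: "v \<in> tail ys"
  shows "Hpow k m ((l k ^^ j) v) = q powi (m * int j) *\<^sub>C (l k ^^ j) v"
proof (rule tail_eq[OF linear_on_lpow[OF ps operators_onD(1)[OF Hpow(1)]] _ _ v])
  show s: "set ys \<subseteq> set ps" using ps by auto
  fix a assume a: "a \<in> exps (set ys)"
  have "k \<in> set ps" using ps by simp
  then show "Hpow k m ((l k ^^ j) (e a)) = q powi (m * int j) *\<^sub>C (l k ^^ j) (e a)"
    using exps_mono[OF a s] by (simp add: lpow_e[OF ps a] Hpow)
qed

lemma Cop_lpow: assumes ps: "ps = xs @ k # ys" and v: "v \<in> tail ys"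
  shows "Cop k m ((l k ^^ j) v) = (q powi (m * (int j - 1)) * qint q j) *\<^sub>C (l k ^^ (j - 1)) v"
proof -
  have k: "k \<in> set ps" "{k} \<subseteq> set ps" using ps by auto
  show ?thesis
  proof (rule tail_eq[OF linear_on_lpow[OF ps inW_linear[OF k(2) inW_Cop[OF k(1)]]] _ _ v])
    show s: "set ys \<subseteq> set ps" using ps by auto
    show "Cop k m ((l k ^^ j) (e a)) = (q powi (m * (int j - 1)) * qint q j) *\<^sub>C (l k ^^ (j - 1)) (e a)"
      if "a \<in> exps (set ys)" for a
      using that exps_mono[OF that s] k by (simp add: lpow_e[OF ps] Cop)
  qed
qed

text \<open>Push \<open>l p\<close> through the power of the first letter \<open>k\<close>. A letter
  that q-commutes contributes a factor \<open>Hpow k m\<close> to \<open>H\<close> and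
  \<open>Y\<close>; otherwise \<open>Y\<close> gains a term with \<open>Cop k 1\<close> and two
  letters between \<open>k\<close> and \<open>p\<close>. Induction on the length makes the claim
  available for those letters as well as for \<open>p\<close> on the shorter list.\<close>

lemma left_structure:
  "ps = xs @ ys @ p # zs \<Longrightarrow> \<exists>H Y. invW (set ys) H \<and> inW (set ys) Y \<and>
    (\<forall>u\<in>tail (ys @ p # zs). l p u = Mo p (H u) + Y u)"
proof (induction ys arbitrary: xs p zs rule: length_induct)
  case (1 ys)
  show ?case
  proof (cases ys)
    case Nil
    have d: "set (p # zs) \<subseteq> set ps" "p \<in> set ps" using 1(2) Nil by auto
    have "l p u = Mo p u" if "u \<in> tail (p # zs)" for u
    proof (rule tail_eq[OF linear_on_subset[OF l_lin] linear_on_subset[OF _ subsetI[OF tail_A]] d(1) _ that])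
      fix a assume a: "a \<in> exps (set (p # zs))"
      show "l p (e a) = Mo p (e a)"
        using l_e[OF _ a] 1(2) Nil Mo(2)[OF d(2) exps_mono[OF a d(1)]] by simp
    qed (use Mo(1)[OF d(2)] operators_onD(1)[of "Mo p"] d in auto)
    then have "\<forall>u\<in>tail (ys @ p # zs). l p u = Mo p u + 0" using Nil by simp
    then show ?thesis using invW_id inW_zero by blast
  next
    case (Cons k ys')
    define rest where "rest = ys' @ p # zs"
    have ps: "ps = xs @ k # rest" "ps = (xs @ [k]) @ ys' @ p # zs" using 1(2) Cons by (auto simp: rest_def)
    have sub: "set ys' \<subseteq> set rest" "set ys' \<subseteq> set ps" "set rest \<subseteq> set ps" "k \<in> set ps" "p \<in> set ps" "p \<in> set rest"
      "set (ys @ p # zs) \<subseteq> set ps" "set ys \<subseteq> set ps"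
      "set (k # rest) \<subseteq> set ps" "set rest \<subseteq> set (k # rest)"
      using ps Cons by (auto simp: rest_def)
    obtain H' Y' where HY: "invW (set ys') H'" "inW (set ys') Y'" "\<forall>u\<in>tail rest. l p u = Mo p (H' u) + Y' u"
      using 1(1)[rule_format, of ys' "xs @ [k]" p zs] ps(2) Cons unfolding rest_def by auto
    have tk: "ys @ p # zs = k # rest" using Cons by (simp add: rest_def)
    have H': "inW (set ys') H'" using HY(1) by (simp add: invW_def)
    have MH: "inW (set rest) (\<lambda>u. Mo p (H' u) + Y' u)"
      by (rule inW_add[OF inW_comp[OF sub(3) inW_Wa[OF sub(3) Wa_gen(1)[OF sub(6)]] inW_mono[OF sub(1) H']] inW_mono[OF sub(1) HY(2)]])
    have lin: "linear_on (tail (k # rest)) (l p)" using linear_on_subset[OF l_lin[OF sub(5)]] by simp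
    have lin': "linear_on A T \<Longrightarrow> linear_on (tail (k # rest)) T" for T
      by (rule linear_on_subset[OF _ subsetI[OF tail_A[OF sub(9)]]])
    have lk: "l k (d *\<^sub>C v) = d *\<^sub>C l k v" for d v using l_lin[OF sub(4)] by (simp add: linear_on_def)
    have lin0: "(l k ^^ i) 0 = 0" "l k 0 = 0" for i using lpow_scale[OF sub(4), of i 0 0] lk[of 0 0] by simp_all
    from straight[of xs k ys' p zs] ps(1) consider
      (comm) m where "\<forall>u. l p (l k u) = q powi m *\<^sub>C l k (l p u)"
      | (diag) r r' c where "r \<in> set ys'" "r' \<in> set ys'" "\<forall>u. l p (l k u) = l k (l p u) + c *\<^sub>C l r (l r' u)"
         "\<forall>u. l r (l r' (l k u)) = (q * q) *\<^sub>C l k (l r (l r' u))"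
      unfolding rest_def by blast
    then show ?thesis
    proof cases
      case comm
      define H where "H u = H' (Hpow k m u)" for u
      define Y where "Y u = Y' (Hpow k m u)" for u
      have Hk: "invW (set ys) (Hpow k m)" using invW_mono[OF _ invW_Hpow[OF sub(4)]] Cons by auto
      have s: "set ys' \<subseteq> set ys" using Cons by auto
      have HW: "invW (set ys) H" "inW (set ys) Y" unfolding H_def Y_def
        using invW_comp[OF sub(8) invW_mono[OF s HY(1)] Hk] inW_comp[OF sub(8) inW_mono[OF s HY(2)]] Hk
        unfolding invW_def by auto
      have "l p u = Mo p (H u) + Y u" if "u \<in> tail (k # rest)" for u
      proof (rule tail_Cons_eq[OF ps(1) lin lin' _ that])
        show "linear_on A (\<lambda>u. Mo p (H u) + Y u)"
          using inW_linear[OF sub(9) inW_comp[OF sub(9) inW_mono[OF sub(10) MH] inW_mono[OF _ inW_Hpow[OF sub(4)], of "set (k # rest)" m]]]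
          by (simp add: H_def Y_def)
        fix v j assume v: "v \<in> tail rest"
        have "l p ((l k ^^ j) v) = q powi (m * int j) *\<^sub>C (l k ^^ j) (l p v)"
          using power_push[OF q0 q_diff, of 1 1 "l k" "l p" m "\<lambda>_. 0" "\<lambda>_. 0" j v] comm l_lin[OF sub(4)] lin0 by simp
        then show "l p ((l k ^^ j) v) = Mo p (H ((l k ^^ j) v)) + Y ((l k ^^ j) v)"
          using inW_tail(2)[OF MH ps(1) order.refl v, of j] HY(3) v
            linear_onD(2)[OF inW_linear[OF sub(3) MH] lpow_in[OF ps(1) v]]
          by (simp add: H_def Y_def Hpow_lpow[OF ps(1) v])
      qed
      then show ?thesis using HW unfolding tk by blast
    next
      case diag
      \<comment> \<open>For a letter \<open>r\<close> of \<open>ys'\<close> the induction hypothesis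
        is used with the letters of \<open>ys'\<close> before \<open>r\<close>.\<close>
      have IH: "\<exists>h. inW (set ys') h \<and> (\<forall>u\<in>tail rest. l r u = h u)" if r: "r \<in> set ys'" for r
      proof -
        obtain ya yb where y: "ys' = ya @ r # yb" using r by (meson split_list)
        obtain H Y where H: "invW (set ya) H" "inW (set ya) Y" "\<forall>u\<in>tail rest. l r u = Mo r (H u) + Y u"
          using 1(1)[rule_format, of ya "xs @ [k]" r "yb @ p # zs"] ps(2) Cons y unfolding rest_def by auto
        have s: "set ya \<subseteq> set ys'" using y by auto
        have "inW (set ys') (\<lambda>u. Mo r (H u) + Y u)"
          using H(1) by (intro inW_add[OF inW_comp[OF sub(2) inW_Wa[OF sub(2) Wa_gen(1)[OF r]] inW_mono[OF s]] inW_mono[OF s H(2)]])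
            (simp add: invW_def)
        then show ?thesis using H(3) by blast
      qed
      obtain h where h: "inW (set ys') h" "\<forall>u\<in>tail rest. l r u = h u" using IH[OF diag(1)] by auto
      obtain h' where h': "inW (set ys') h'" "\<forall>u\<in>tail rest. l r' u = h' u" using IH[OF diag(2)] by auto
      define R where "R u = c *\<^sub>C h (h' u)" for u
      have R: "inW (set ys') R" unfolding R_def by (rule inW_scale[OF inW_comp[OF sub(2) h(1) h'(1)]])
      have Rl: "c *\<^sub>C l r (l r' u) = R u" if "u \<in> tail rest" for u
        using h(2) h'(2) that inW_tail(1)[OF h'(1) ps(1) sub(1) that] by (simp add: R_def)
      have rr: "r \<in> set ps" "r' \<in> set ps" using diag sub by auto
      \<comment> \<open>The quadratic term has weight 2 past \<open>k\<close> while
        \<open>l p\<close> has weight 0, so the coefficient after \<open>j\<close> passages is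
        \<open>q^(j - 1) [j]\<close>, the one realized by \<open>Cop k 1\<close>.\<close>
      define Y where "Y u = Y' u + R (Cop k 1 u)" for u
      have s: "set ys' \<subseteq> set ys" "{k} \<subseteq> set ys" using Cons by auto
      have Ck: "inW (set ys) (Cop k 1)" using inW_mono[OF s(2) inW_Cop[OF sub(4)]] .
      have YW: "inW (set ys) Y" unfolding Y_def
        by (rule inW_add[OF inW_mono[OF s(1) HY(2)] inW_comp[OF sub(8) inW_mono[OF s(1) R] Ck]])
      have "l p u = Mo p (H' u) + Y u" if "u \<in> tail (k # rest)" for u
      proof (rule tail_Cons_eq[OF ps(1) lin lin' _ that])
        have "inW (set ps) (\<lambda>u. Mo p (H' u) + Y' u)" by (rule inW_mono[OF sub(3) MH])
        from inW_add[OF this inW_mono[OF sub(8) inW_comp[OF sub(8) inW_mono[OF s(1) R] Ck]]]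
        show "linear_on A (\<lambda>u. Mo p (H' u) + Y u)" unfolding Y_def
          using inW_linear[OF order.refl] by (simp add: add.assoc)
        fix v j assume v: "v \<in> tail rest"
        have "l p ((l k ^^ j) v) = (l k ^^ j) (l p v) + (q powi (int j - 1) * qint q j) *\<^sub>C (l k ^^ (j - 1)) (R v)"
          using power_push[OF q0 q_diff, of 1 1 "l k" "l p" 0 "\<lambda>v. c *\<^sub>C l r (l r' v)" "\<lambda>_. 0" j v] diag(3,4) l_lin[OF sub(4)] lin0
            Rl[OF v]
          by (simp add: lk power2_eq_square scaleC_scaleC mult.commute)
        then show "l p ((l k ^^ j) v) = Mo p (H' ((l k ^^ j) v)) + Y ((l k ^^ j) v)"
          using inW_tail(2)[OF MH ps(1) order.refl v, of j] HY(3) v inW_tail(2)[OF R ps(1) sub(1) v, of "j - 1"]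
            linear_onD(2)[OF inW_linear[OF sub(2) R] lpow_in[OF ps(1) v]]
          by (simp add: Y_def Cop_lpow[OF ps(1) v])
      qed
      then show ?thesis using YW invW_mono[OF s(1) HY(1)] unfolding tk by blast
    qed
  qed
qed

lemma l_tail: assumes "ps = xs @ ys" "r \<in> set ys"
  obtains D where "inW (set ys) D" "\<And>v. v \<in> tail ys \<Longrightarrow> l r v = D v"
proof -
  obtain ya yb where y: "ys = ya @ r # yb" using assms(2) by (meson split_list)
  then obtain H Y where H: "invW (set ya) H" "inW (set ya) Y" "\<forall>u\<in>tail ys. l r u = Mo r (H u) + Y u"
    using left_structure[of xs ya r yb] assms(1) by auto
  have s: "set ya \<subseteq> set ys" "set ys \<subseteq> set ps" using y assms by auto
  have "inW (set ys) (\<lambda>u. Mo r (H u) + Y u)"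
    using H(1) by (intro inW_add[OF inW_comp[OF s(2) inW_Wa[OF s(2) Wa_gen(1)[OF assms(2)]] inW_mono[OF s(1)]] inW_mono[OF s(1) H(2)]])
      (simp add: invW_def)
  then show thesis using that H(3) by blast
qed

lemma inW_tail_in: assumes "inW (set ys) D" "ps = xs @ ys" "v \<in> tail ys" shows "D v \<in> tail ys"
proof (cases xs rule: rev_cases)
  case Nil
  then have "ys = ps" using assms(2) by simp
  then show ?thesis using inW_in[OF order.refl] assms tail_all by simp
next
  case (snoc xs' k)
  then show ?thesis using inW_tail(1)[OF assms(1) _ order.refl assms(3), of xs' k] assms(2) by simp
qed

end

section \<open>Adjoints with respect to a diagonal pairing of two monomial bases\<close>

context monomial_basis
begin

lemma A_expand: assumes "x \<in> A"
  shows "\<exists>B c. finite B \<and> B \<subseteq> exps P \<and> x = (\<Sum>b\<in>B. c b *\<^sub>C e b)"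
  using assms
proof (induction rule: A_induct)
  case zero
  then show ?case by (auto intro!: exI[of _ "{}"])
next
  case (step k a y)
  then obtain B c where B: "finite B" "B \<subseteq> exps P" "y = (\<Sum>b\<in>B. c b *\<^sub>C e b)" by auto
  define d where "d b = (if b \<in> B then c b else 0) + (if b = a then k else 0)" for b
  have y: "y = (\<Sum>b\<in>insert a B. (if b \<in> B then c b else 0) *\<^sub>C e b)"
    unfolding B(3) by (rule sum.mono_neutral_cong_left) (use B(1) in auto)
  have k: "(\<Sum>b\<in>insert a B. (if b = a then k else 0) *\<^sub>C e b) = k *\<^sub>C e a"
    by (subst sum.remove[of _ a]) (use B(1) in \<open>auto intro!: sum.neutral\<close>)
  have "k *\<^sub>C e a + y = (\<Sum>b\<in>insert a B. d b *\<^sub>C e b)"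
    unfolding d_def scaleC_add_left sum.distrib k[symmetric] y by (simp add: add.commute)
  then show ?case using B(1,2) step(1) by (intro exI[of _ "insert a B"] exI[of _ d]) auto
qed

definition inG :: "('m \<Rightarrow> 'm) set \<Rightarrow> ('m \<Rightarrow> 'm) \<Rightarrow> bool"
  where "inG G f \<longleftrightarrow> restrict f A \<in> operator_algebra A G"

lemma inG_add: "inG G f \<Longrightarrow> inG G h \<Longrightarrow> inG G (\<lambda>x. f x + h x)"
  unfolding inG_def using operator_algebra.add[of "restrict f A" A _ "restrict h A"]
  by (simp add: restrict_def cong: if_cong)

lemma inG_scale: "inG G f \<Longrightarrow> inG G (\<lambda>x. c *\<^sub>C f x)"
  unfolding inG_def using operator_algebra.scale[of "restrict f A" A _ c]
  by (simp add: restrict_def cong: if_cong)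

lemma inG_diff: "inG G f \<Longrightarrow> inG G h \<Longrightarrow> inG G (\<lambda>x. f x - h x)"
  using inG_add[of G f "\<lambda>x. (-1) *\<^sub>C h x"] inG_scale[of G h "-1"] by simp

lemma inG_comp: "inG G f \<Longrightarrow> inG G h \<Longrightarrow> (\<And>x. x \<in> A \<Longrightarrow> h x \<in> A) \<Longrightarrow> inG G (\<lambda>x. f (h x))"
proof -
  assume a: "inG G f" "inG G h" "\<And>x. x \<in> A \<Longrightarrow> h x \<in> A"
  have "restrict (\<lambda>x. f (h x)) A = compose A (restrict f A) (restrict h A)"
    using a(3) by (auto simp: compose_def restrict_def fun_eq_iff)
  then show ?thesis using a unfolding inG_def by (auto intro: operator_algebra.comp)
qed

lemma inG_eq: "(\<And>x. x \<in> A \<Longrightarrow> f x = h x) \<Longrightarrow> inG G h \<Longrightarrow> inG G f"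
  unfolding inG_def by (metis restrict_ext)

end

text \<open>The recursion for \<open>nrm\<close> says precisely that \<open>Mo p\<close> on one side
  is adjoint to \<open>c\<close> times \<open>Do p\<close> on the other.\<close>

locale dual_bases = Z: monomial_basis q P e A + W: monomial_basis q P e' A'
  for q and P :: "'i set" and e :: "('i \<Rightarrow> nat) \<Rightarrow> 'm::complex_module" and A
    and e' :: "('i \<Rightarrow> nat) \<Rightarrow> 'm" and A' +
  fixes B :: "'m \<Rightarrow> 'm \<Rightarrow> complex" and nrm :: "('i \<Rightarrow> nat) \<Rightarrow> complex" and c :: complex
  assumes B_add_left: "w \<in> A' \<Longrightarrow> w' \<in> A' \<Longrightarrow> z \<in> A \<Longrightarrow> B (w + w') z = B w z + B w' z"
    and B_add_right: "w \<in> A' \<Longrightarrow> z \<in> A \<Longrightarrow> z' \<in> A \<Longrightarrow> B w (z + z') = B w z + B w z'"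
    and B_scale: "w \<in> A' \<Longrightarrow> z \<in> A \<Longrightarrow> B (k *\<^sub>C w) z = k * B w z" "w \<in> A' \<Longrightarrow> z \<in> A \<Longrightarrow> B w (k *\<^sub>C z) = k * B w z"
    and B_e: "a \<in> exps P \<Longrightarrow> b \<in> exps P \<Longrightarrow> B (e' b) (e a) = (if a = b then nrm a else 0)"
    and nrm: "a \<in> exps P \<Longrightarrow> nrm a \<noteq> 0" "p \<in> P \<Longrightarrow> a \<in> exps P \<Longrightarrow> nrm (a(p := Suc (a p))) = c * qint q (Suc (a p)) * nrm a"
    and c0: "c \<noteq> 0"
begin

lemma B_zero: "w \<in> A' \<Longrightarrow> B w 0 = 0" "z \<in> A \<Longrightarrow> B 0 z = 0"
  using B_scale(2)[of w 0 0] B_scale(1)[of 0 z 0] Z.A_zero W.A_zero by auto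

lemma B_sum: "w \<in> A' \<Longrightarrow> (\<And>i. i \<in> I \<Longrightarrow> f i \<in> A) \<Longrightarrow> B w (\<Sum>i\<in>I. f i) = (\<Sum>i\<in>I. B w (f i))"
proof (induction I rule: infinite_finite_induct)
  case (insert i I)
  have "(\<Sum>i\<in>I. f i) \<in> A" using insert.prems Z.A_eq by (auto intro: cvs.span_sum)
  then show ?case using insert by (simp add: B_add_right)
qed (simp_all add: B_zero)

lemma nondegenerate:
  assumes "u \<in> A" "\<And>w. w \<in> A' \<Longrightarrow> B w u = 0"
  shows "u = 0"
proof -
  obtain C k where C: "finite C" "C \<subseteq> exps P" "u = (\<Sum>b\<in>C. k b *\<^sub>C e b)" using Z.A_expand[OF assms(1)] by auto
  have "k b = 0" if b: "b \<in> C" for b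
  proof -
    have bP: "b \<in> exps P" using b C by auto
    have "B (e' b) u = (\<Sum>x\<in>C. B (e' b) (k x *\<^sub>C e x))"
      unfolding C(3) by (rule B_sum) (use C bP W.e_in Z.e_in Z.A_scale in auto)
    also have "\<dots> = (\<Sum>x\<in>C. if x = b then k b * nrm b else 0)"
      by (rule sum.cong) (use C bP W.e_in Z.e_in B_scale B_e in auto)
    also have "\<dots> = k b * nrm b" using b C by simp
    finally have "k b * nrm b = 0" using assms(2) W.e_in[OF bP] by simp
    then show ?thesis using nrm(1)[OF bP] by simp
  qed
  then show ?thesis unfolding C(3) by simp
qed

definition adj :: "('m \<Rightarrow> 'm) \<Rightarrow> ('m \<Rightarrow> 'm) \<Rightarrow> bool"
  where "adj T T' \<longleftrightarrow> (\<forall>w\<in>A'. \<forall>u\<in>A. B (T w) u = B w (T' u))"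

lemma B_diff: "w \<in> A' \<Longrightarrow> z \<in> A \<Longrightarrow> z' \<in> A \<Longrightarrow> B w (z - z') = B w z - B w z'"
  using B_add_right[of w "z - z'" z'] Z.A_diff[of z z'] by simp

lemma adj_unique:
  assumes "adj T S" "adj T S'" "u \<in> A" "S u \<in> A" "S' u \<in> A"
  shows "S u = S' u"
  using nondegenerate[of "S u - S' u"] assms unfolding adj_def
  by (simp add: B_diff Z.A_diff)

lemma adj_basis:
  assumes "linear_on A' T" "linear_on A T'" "\<And>w. w \<in> A' \<Longrightarrow> T w \<in> A'" "\<And>u. u \<in> A \<Longrightarrow> T' u \<in> A"
    and "\<And>a b. a \<in> exps P \<Longrightarrow> b \<in> exps P \<Longrightarrow> B (T (e' b)) (e a) = B (e' b) (T' (e a))"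
  shows "adj T T'"
  unfolding adj_def
proof (intro ballI)
  fix w u assume w: "w \<in> A'" and u: "u \<in> A"
  have 1: "B (T (e' b)) u = B (e' b) (T' u)" if b: "b \<in> exps P" for b
    using u by (induction rule: Z.A_induct)
      (use b assms in \<open>simp_all add: B_zero Z.linear_onD[OF assms(2)] W.e_in Z.e_in Z.A_scale B_add_right B_scale\<close>)
  show "B (T w) u = B w (T' u)"
    using w by (induction rule: W.A_induct)
      (use u assms in \<open>simp_all add: B_zero W.linear_onD[OF assms(1)] W.e_in W.A_scale B_add_left B_scale 1\<close>)
qed

lemma adj_Mo: "p \<in> P \<Longrightarrow> adj (W.Mo p) (\<lambda>u. c *\<^sub>C Z.Do p u)"
proof (rule adj_basis)
  assume p: "p \<in> P"
  show "linear_on A (\<lambda>u. c *\<^sub>C Z.Do p u)"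
    using Z.inW_linear[of "{p}", OF _ Z.inW_scale[OF Z.inW_Wa[OF _ Z.Wa_gen(2)]]] p by auto
  fix a b assume ab: "a \<in> exps P" "b \<in> exps P"
  show "B (W.Mo p (e' b)) (e a) = B (e' b) (c *\<^sub>C Z.Do p (e a))"
  proof (cases "a = b(p := Suc (b p))")
    case True
    then show ?thesis using p ab by (simp add: W.Mo Z.Do B_e B_scale W.e_in Z.e_in Z.A_scale nrm)
  next
    case False
    have "a p = 0 \<or> a(p := a p - 1) \<noteq> b"
    proof (rule ccontr)
      assume "\<not> ?thesis"
      then have "b = a(p := a p - 1)" "a p \<noteq> 0" by auto
      then have "a = b(p := Suc (b p))" by simp
      then show False using False by simp
    qed
    then show ?thesis using p ab False by (auto simp: W.Mo Z.Do B_e B_scale W.e_in Z.e_in Z.A_scale)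
  qed
qed (use Z.Do(1) W.Mo(1) Z.operators_onD W.operators_onD Z.A_scale in blast)+

lemma adj_Do: "p \<in> P \<Longrightarrow> adj (W.Do p) (\<lambda>u. inverse c *\<^sub>C Z.Mo p u)"
proof (rule adj_basis)
  assume p: "p \<in> P"
  show "linear_on A (\<lambda>u. inverse c *\<^sub>C Z.Mo p u)"
    using Z.inW_linear[of "{p}", OF _ Z.inW_scale[OF Z.inW_Wa[OF _ Z.Wa_gen(1)]]] p by auto
  fix a b assume ab: "a \<in> exps P" "b \<in> exps P"
  show "B (W.Do p (e' b)) (e a) = B (e' b) (inverse c *\<^sub>C Z.Mo p (e a))"
  proof (cases "b = a(p := Suc (a p))")
    case True
    then show ?thesis using p ab c0 by (simp add: Z.Mo W.Do B_e B_scale W.e_in Z.e_in W.A_scale nrm)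
  next
    case False
    have "b p = 0 \<or> b(p := b p - 1) \<noteq> a"
    proof (rule ccontr)
      assume "\<not> ?thesis"
      then have "a = b(p := b p - 1)" "b p \<noteq> 0" by auto
      then have "b = a(p := Suc (a p))" by simp
      then show False using False by simp
    qed
    then show ?thesis using p ab False by (auto simp: Z.Mo W.Do B_e B_scale W.e_in Z.e_in W.A_scale)
  qed
qed (use Z.Mo(1) W.Do(1) Z.operators_onD W.operators_onD Z.A_scale in blast)+

lemma adj_Wa: assumes Q: "Q \<subseteq> P" and T: "T \<in> W.Wa Q" shows "\<exists>f. Z.inW Q f \<and> adj T f"
  using T unfolding W.Wa_def
proof (induction T rule: operator_algebra.induct)
  case (gen T)
  then obtain p where p: "p \<in> Q" "T = W.Mo p \<or> T = W.Do p" by auto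
  then have "p \<in> P" using Q by auto
  then show ?case using p adj_Mo adj_Do Z.inW_scale[OF Z.inW_Wa[OF Q Z.Wa_gen(1)[OF p(1)]]]
      Z.inW_scale[OF Z.inW_Wa[OF Q Z.Wa_gen(2)[OF p(1)]]] by blast
next
  case ident
  then show ?case using Z.inW_id by (auto simp: adj_def intro!: exI[of _ "\<lambda>x. x"])
next
  case (add S T)
  then obtain f h where fh: "Z.inW Q f" "adj S f" "Z.inW Q h" "adj T h" by auto
  have "S w \<in> A'" "T w \<in> A'" if "w \<in> A'" for w
    using add.hyps W.Wa_in[OF Q _ that] unfolding W.Wa_def by auto
  then have "adj (\<lambda>x\<in>A'. S x + T x) (\<lambda>u. f u + h u)"
    using fh Z.inW_in[OF Q] unfolding adj_def by (simp add: B_add_left B_add_right)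
  then show ?case using Z.inW_add fh by blast
next
  case (scale T k)
  then obtain h where fh: "Z.inW Q h" "adj T h" by auto
  have "T w \<in> A'" if "w \<in> A'" for w
    using scale.hyps W.Wa_in[OF Q _ that] unfolding W.Wa_def by auto
  then have "adj (\<lambda>x\<in>A'. k *\<^sub>C T x) (\<lambda>u. k *\<^sub>C h u)"
    using fh Z.inW_in[OF Q] unfolding adj_def by (simp add: B_scale)
  then show ?case using Z.inW_scale fh by blast
next
  case (comp S T)
  then obtain f h where fh: "Z.inW Q f" "adj S f" "Z.inW Q h" "adj T h" by auto
  have "S w \<in> A'" "T w \<in> A'" if "w \<in> A'" for w
    using comp.hyps W.Wa_in[OF Q _ that] unfolding W.Wa_def by auto
  then have "adj (compose A' S T) (\<lambda>u. h (f u))"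
    using fh Z.inW_in[OF Q] unfolding adj_def by (simp add: compose_def)
  then show ?case using Z.inW_comp[OF Q fh(3,1)] by blast
qed

lemma adj_inW: "Q \<subseteq> P \<Longrightarrow> W.inW Q f \<Longrightarrow> \<exists>h. Z.inW Q h \<and> adj f h"
  using adj_Wa[of Q "restrict f A'"] unfolding W.inW_def adj_def by simp

text \<open>Adjoints are unique on \<open>A\<close> by nondegeneracy, so the adjoint of the inverse
  inverts the adjoint.\<close>

lemma adj_invW: assumes "Q \<subseteq> P" "W.invW Q f"
  shows "\<exists>h. Z.invW Q h \<and> adj f h"
proof -
  obtain f' where f: "W.inW Q f" "W.inW Q f'" "\<forall>x\<in>A'. f (f' x) = x \<and> f' (f x) = x"
    using assms(2) unfolding W.invW_def by auto
  obtain h h' where h: "Z.inW Q h" "adj f h" "Z.inW Q h'" "adj f' h'"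
    using adj_inW[OF assms(1)] f by meson
  have hin: "h u \<in> A" "h' u \<in> A" if "u \<in> A" for u using that h Z.inW_in[OF assms(1)] by auto
  have fin: "f w \<in> A'" "f' w \<in> A'" if "w \<in> A'" for w using that f W.inW_in[OF assms(1)] by auto
  have "adj (\<lambda>x. x) (\<lambda>u. h (h' u))" "adj (\<lambda>x. x) (\<lambda>u. h' (h u))" "adj (\<lambda>x. x) (\<lambda>x. x)"
    using h(2,4) f(3) fin hin unfolding adj_def by (metis, metis, simp)
  then have "\<forall>u\<in>A. h (h' u) = u \<and> h' (h u) = u"
    using adj_unique[of "\<lambda>x. x"] hin by blast
  then show ?thesis using h unfolding Z.invW_def by blast
qed

end

locale dual_straightening = dual_bases q "set ps" e A e' A' B nrm c +
    Z: straightening q ps e A l + W: straightening q ps e' A' l'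
  for q and ps :: "'i list" and e :: "('i \<Rightarrow> nat) \<Rightarrow> 'm::complex_module" and A e' A' B nrm c l l'
begin

lemma l_inW: assumes "p \<in> set ps" shows "Z.inW (set ps) (l p)"
  using Z.l_tail[OF _ assms, of "[]"] Z.inW_eq[of "l p"] Z.tail_all by (metis append_Nil)

lemma adj_l': assumes "p \<in> set ps" shows "\<exists>h. Z.inW (set ps) h \<and> adj (l' p) h"
proof -
  have "W.inW (set ps) (l' p)"
    using W.l_tail[OF _ assms, of "[]"] W.inW_eq[of "l' p"] W.tail_all by (metis append_Nil)
  then show ?thesis using adj_inW[OF order.refl] by blast
qed

text \<open>Induction over initial segments of \<open>ps\<close>: the corrections at
  \<open>p\<close> involve earlier letters only and hence already belong to the algebra generated by
  \<open>G\<close>.\<close>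

lemma generation:
  assumes l: "\<And>p. p \<in> set ps \<Longrightarrow> Z.inG G (l p)"
    and d: "\<And>p. p \<in> set ps \<Longrightarrow> Z.inG G (d p) \<and> adj (l' p) (d p) \<and> (\<forall>u\<in>A. d p u \<in> A)"
  shows "Z.Wa (set ps) \<subseteq> operator_algebra A G"
proof -
  have "Z.Wa (set xs) \<subseteq> operator_algebra A G" if "ps = xs @ zs" for xs zs
    using that
  proof (induction xs arbitrary: zs rule: rev_induct)
    case Nil
    have "T \<in> operator_algebra A G" if "T \<in> Z.Wa {}" for T
      using that unfolding Z.Wa_def by (rule operator_algebra_mono) simp
    then show ?case by auto
  next
    case (snoc p xs)
    have ps: "ps = xs @ p # zs" "set xs \<subseteq> set ps" "p \<in> set ps" using snoc.prems by auto
    have IH: "Z.inG G f" if "Z.inW (set xs) f" for f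
      using snoc.IH[OF ps(1)] that unfolding Z.inG_def Z.inW_def by auto
    have Mp: "Z.inG G (Z.Mo p)"
    proof -
      obtain H Y where HY: "Z.invW (set xs) H" "Z.inW (set xs) Y" "\<forall>u\<in>A. l p u = Z.Mo p (H u) + Y u"
        using Z.left_structure[of "[]" xs p zs] ps(1) Z.tail_all by auto
      obtain H' where H': "Z.inW (set xs) H'" "\<forall>x\<in>A. H (H' x) = x"
        using HY(1) unfolding Z.invW_def by blast
      have in_A: "H' x \<in> A" if "x \<in> A" for x using Z.inW_in[OF ps(2) H'(1) that] .
      have "Z.inG G (\<lambda>x. l p (H' x) - Y (H' x))"
        by (rule Z.inG_diff[OF Z.inG_comp[OF l[OF ps(3)] IH[OF H'(1)] in_A] Z.inG_comp[OF IH[OF HY(2)] IH[OF H'(1)] in_A]])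
      then show ?thesis by (rule Z.inG_eq[rotated]) (use HY(3) H'(2) in_A in auto)
    qed
    have Dp: "Z.inG G (Z.Do p)"
    proof -
      obtain H Y where HY: "W.invW (set xs) H" "W.inW (set xs) Y" "\<forall>u\<in>A'. l' p u = W.Mo p (H u) + Y u"
        using W.left_structure[of "[]" xs p zs] ps(1) W.tail_all by auto
      obtain h where h: "Z.invW (set xs) h" "adj H h" using adj_invW[OF ps(2) HY(1)] by auto
      obtain y where y: "Z.inW (set xs) y" "adj Y y" using adj_inW[OF ps(2) HY(2)] by auto
      obtain h' where h': "Z.inW (set xs) h'" "\<forall>x\<in>A. h' (h x) = x" and hW: "Z.inW (set xs) h"
        using h(1) unfolding Z.invW_def by blast
      have in_A: "h x \<in> A" "h' x \<in> A" "y x \<in> A" "Z.Do p x \<in> A" "d p x \<in> A" if "x \<in> A" for x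
        using Z.inW_in[OF ps(2) hW that] Z.inW_in[OF ps(2) h'(1) that] Z.inW_in[OF ps(2) y(1) that]
          Z.operators_onD(2)[OF Z.Do(1)[OF ps(3)] that] d[OF ps(3)] that by auto
      have in_A': "H x \<in> A'" "Y x \<in> A'" "W.Mo p x \<in> A'" if "x \<in> A'" for x
        using W.inW_in[OF ps(2) _ that] HY that W.operators_onD(2)[OF W.Mo(1)[OF ps(3)] that]
        unfolding W.invW_def by auto
      \<comment> \<open>Adjunction reverses the composition: \<open>H\<close> applied before
        \<open>Mo p\<close> on the dual side becomes \<open>h\<close> applied after
        \<open>Do p\<close>. It can therefore be removed from the left, and \<open>d p\<close>
        determines \<open>Do p\<close>.\<close>
      have "adj (l' p) (\<lambda>u. h (c *\<^sub>C Z.Do p u) + y u)"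
        using h(2) y(2) adj_Mo[OF ps(3)] HY(3) in_A in_A' unfolding adj_def
        by (simp add: B_add_left B_add_right Z.A_scale)
      then have dp: "d p u = h (c *\<^sub>C Z.Do p u) + y u" if "u \<in> A" for u
        using adj_unique[of "l' p" "d p" "\<lambda>u. h (c *\<^sub>C Z.Do p u) + y u" u] d[OF ps(3)] that in_A Z.A_add Z.A_scale
        by simp
      have "Z.inG G (\<lambda>x. inverse c *\<^sub>C h' (d p x - y x))"
      proof (rule Z.inG_scale[OF Z.inG_comp[OF IH[OF h'(1)] Z.inG_diff[OF _ IH[OF y(1)]]]])
        show "Z.inG G (d p)" using d[OF ps(3)] by simp
        show "d p x - y x \<in> A" if "x \<in> A" for x using that in_A Z.A_diff by simp
      qed
      then show ?thesis
        by (rule Z.inG_eq[rotated]) (use dp h'(2) in_A Z.A_scale c0 in \<open>auto simp: scaleC_scaleC\<close>)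
    qed
    have gens: "Z.Mo r \<in> operator_algebra A G \<and> Z.Do r \<in> operator_algebra A G" if r: "r \<in> set (xs @ [p])" for r
    proof (cases "r = p")
      case True
      then show ?thesis using Mp Dp Z.Wa_restrict[OF order.refl Z.Wa_gen(1)[OF ps(3)]] Z.Wa_restrict[OF order.refl Z.Wa_gen(2)[OF ps(3)]]
        unfolding Z.inG_def by simp
    next
      case False
      then show ?thesis using snoc.IH[OF ps(1)] Z.Wa_gen[of r "set xs"] r by auto
    qed
    show ?case
    proof
      fix T assume "T \<in> Z.Wa (set (xs @ [p]))"
      then show "T \<in> operator_algebra A G" unfolding Z.Wa_def
        by (rule operator_algebra_mono) (use gens in blast)
    qed
  qed
  from this[of ps "[]"] show ?thesis by simp
qed

end

section \<open>The quantum matrix algebras and their operators\<close>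

definition grid :: "nat \<Rightarrow> (nat \<times> nat) list"
  where "grid n = concat (map (\<lambda>j. map (\<lambda>i. (i, j)) [1..<Suc n]) [1..<Suc n])"

lemma set_grid [simp]: "set (grid n) = {1..n} \<times> {1..n}"
proof -
  have "set (grid n) = (\<Union>j\<in>{1..<Suc n}. (\<lambda>i. (i, j)) ` {1..<Suc n})"
    unfolding grid_def by (simp del: upt_Suc)
  then show ?thesis unfolding atLeastLessThanSuc_atLeastAtMost by (auto simp: image_iff)
qed

lemma exps_zero: "a \<in> exps P \<Longrightarrow> p \<notin> P \<Longrightarrow> a p = 0"
  unfolding exps_def by blast

lemma sorted_grid: "sorted_wrt before (grid n)"
proof -
  have "sorted_wrt before (concat (map (\<lambda>j. map (\<lambda>i. (i, j)) is) js))"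
    if "sorted_wrt (<) is" "sorted_wrt (<) js" for "is" js :: "nat list"
    using that(2)
  proof (induction js)
    case (Cons j js)
    have "sorted_wrt before (map (\<lambda>i. (i, j)) is)"
      using that(1) by (simp add: sorted_wrt_map before_def)
    moreover have "\<forall>x\<in>set (map (\<lambda>i. (i, j)) is). \<forall>y\<in>set (concat (map (\<lambda>j. map (\<lambda>i. (i, j)) is) js)). before x y"
      using Cons.prems by (auto simp: before_def)
    ultimately show ?case using Cons by (simp add: sorted_wrt_append)
  qed simp
  then show ?thesis unfolding grid_def by (simp del: upt_Suc)
qed

lemma before_irrefl: "\<not> before p p" and before_asym: "before p r \<Longrightarrow> \<not> before r p"
  by (auto simp: before_def)

lemma sorted_distinct: "sorted_wrt before ps \<Longrightarrow> distinct ps"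
  by (induction ps) (auto simp: before_irrefl)

lemma ordered_monomial_eq: "ordered_monomial n X a = omono (\<lambda>p. X (fst p) (snd p)) (grid n) a"
  unfolding ordered_monomial_def omono_def grid_def
  by (simp add: map_concat comp_def del: upt_Suc)

lemma multi_indices_eq: "multi_indices n = exps ({1..n} \<times> {1..n})"
  unfolding multi_indices_def exps_def by auto

lemma omono_1: "(\<And>p. p \<in> set ps \<Longrightarrow> a p = 0) \<Longrightarrow> omono x ps a = 1"
  by (induction ps) simp_all

lemma omono_scaleC:
  assumes "\<And>p. p \<in> set ps \<Longrightarrow> x p = s p *\<^sub>C (y p :: 'a::complex_algebra) \<and> s p \<noteq> 0"
  shows "\<exists>c. c \<noteq> 0 \<and> omono x ps a = c *\<^sub>C omono y ps a"
  using assms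
proof (induction ps)
  case Nil
  then show ?case by (auto intro: exI[of _ 1])
next
  case (Cons p ps)
  then obtain c where c: "c \<noteq> 0" "omono x ps a = c *\<^sub>C omono y ps a" by auto
  have "x p ^ k = s p ^ k *\<^sub>C y p ^ k" for k
    using Cons.prems[of p] by (induction k) (simp_all add: scaleC_ring mult.commute)
  then have "omono x (p # ps) a = (s p ^ a p * c) *\<^sub>C omono y (p # ps) a"
    using c by (simp add: scaleC_ring mult.commute)
  then show ?case using c Cons.prems[of p] by (intro exI[of _ "s p ^ a p * c"]) simp
qed

definition quantum_matrix :: "nat \<Rightarrow> complex \<Rightarrow> (nat \<Rightarrow> nat \<Rightarrow> 'a::complex_algebra) \<Rightarrow> bool"
  where "quantum_matrix n q X \<longleftrightarrow>
    (\<forall>i k j. 1 \<le> i \<longrightarrow> i < k \<longrightarrow> k \<le> n \<longrightarrow> 1 \<le> j \<longrightarrow> j \<le> n \<longrightarrow> X k j * X i j = q *\<^sub>C (X i j * X k j)) \<and>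
    (\<forall>i j l. 1 \<le> i \<longrightarrow> i \<le> n \<longrightarrow> 1 \<le> j \<longrightarrow> j < l \<longrightarrow> l \<le> n \<longrightarrow> X i l * X i j = q *\<^sub>C (X i j * X i l)) \<and>
    (\<forall>i k j l. 1 \<le> i \<longrightarrow> i < k \<longrightarrow> k \<le> n \<longrightarrow> 1 \<le> j \<longrightarrow> j < l \<longrightarrow> l \<le> n \<longrightarrow>
      X k j * X i l = X i l * X k j \<and> X k l * X i j = X i j * X k l + (q - inverse q) *\<^sub>C (X i l * X k j))"

lemma (in serre_family) quantum_matrix_z: "quantum_matrix n q z"
  unfolding quantum_matrix_def using z_col z_row z_anti z_diag by (auto simp: diff_eq_eq add.commute)

text \<open>In every relation all products have the same total of indices, so they acquire the same
  power of \<open>s\<close>.\<close>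

lemma quantum_matrix_scale:
  assumes X: "quantum_matrix n q X"
    and Y: "\<And>i j. 1 \<le> i \<Longrightarrow> i \<le> n \<Longrightarrow> 1 \<le> j \<Longrightarrow> j \<le> n \<Longrightarrow> Y i j = s ^ (i - 1 + (j - 1)) *\<^sub>C X i j"
  shows "quantum_matrix n q Y"
proof -
  have "s ^ (k - 1 + (l - 1)) * s ^ (i - 1 + (j - 1)) = s ^ (i - 1 + (l - 1)) * s ^ (k - 1 + (j - 1))" for i j k l
    unfolding power_add[symmetric] by (simp add: ac_simps)
  note s = this
  have YY: "Y i j * Y k l = (s ^ (i - 1 + (j - 1)) * s ^ (k - 1 + (l - 1))) *\<^sub>C (X i j * X k l)"
    if "1 \<le> i" "i \<le> n" "1 \<le> j" "j \<le> n" "1 \<le> k" "k \<le> n" "1 \<le> l" "l \<le> n" for i j k l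
    using that by (simp add: Y scaleC_ring mult.commute)
  show ?thesis unfolding quantum_matrix_def
  proof (intro conjI allI impI)
    fix i k j assume a: "1 \<le> i" "i < k" "k \<le> n" "1 \<le> j" "j \<le> n"
    then have "X k j * X i j = q *\<^sub>C (X i j * X k j)" using X unfolding quantum_matrix_def by blast
    then show "Y k j * Y i j = q *\<^sub>C (Y i j * Y k j)" using a by (simp add: YY scaleC_scaleC mult.commute)
  next
    fix i j l assume a: "1 \<le> i" "i \<le> n" "1 \<le> j" "j < l" "l \<le> n"
    then have "X i l * X i j = q *\<^sub>C (X i j * X i l)" using X unfolding quantum_matrix_def by blast
    then show "Y i l * Y i j = q *\<^sub>C (Y i j * Y i l)" using a by (simp add: YY scaleC_scaleC mult.commute)
  next
    fix i k j l assume a: "1 \<le> i" "i < k" "k \<le> n" "1 \<le> j" "j < l" "l \<le> n"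
    then have x: "X k j * X i l = X i l * X k j" "X k l * X i j = X i j * X k l + (q - inverse q) *\<^sub>C (X i l * X k j)"
      using X unfolding quantum_matrix_def by blast+
    show "Y k j * Y i l = Y i l * Y k j" using a x(1) by (simp add: YY mult.commute)
    have "Y k l * Y i j = (s ^ (k - 1 + (l - 1)) * s ^ (i - 1 + (j - 1))) *\<^sub>C (X i j * X k l) +
       (q - inverse q) *\<^sub>C ((s ^ (i - 1 + (l - 1)) * s ^ (k - 1 + (j - 1))) *\<^sub>C (X i l * X k j))"
      using a unfolding s[of k l i j, symmetric] by (simp add: YY x(2) scaleC_add_right scaleC_scaleC mult.commute)
    then show "Y k l * Y i j = Y i j * Y k l + (q - inverse q) *\<^sub>C (Y i l * Y k j)"
      using a by (simp add: YY mult.commute)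
  qed
qed

text \<open>For entries in diagonal position the error consists of the two other corners of the
  rectangle. In the column order both lie strictly between the given entries, and each passes the
  first entry with factor \<open>q\<close>.\<close>

lemma straight_left:
  assumes X: "quantum_matrix n q X" and "grid n = xs @ k # ys @ p # zs"
  defines "l \<equiv> \<lambda>p u. X (fst p) (snd p) * u"
  shows "(\<exists>m. \<forall>u. l p (l k u) = q powi m *\<^sub>C l k (l p u)) \<or>
      (\<exists>r\<in>set ys. \<exists>r'\<in>set ys. \<exists>c. (\<forall>u. l p (l k u) = l k (l p u) + c *\<^sub>C l r (l r' u)) \<and>
         (\<forall>u. l r (l r' (l k u)) = (q * q) *\<^sub>C l k (l r (l r' u))))"
proof -
  have so: "sorted_wrt before (xs @ k # ys @ p # zs)" using sorted_grid[of n] assms(2) by simp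
  then have kp: "before k p" by (simp add: sorted_wrt_append)
  have mem: "r \<in> set ys" if "r \<in> set (grid n)" "before k r" "before r p" for r
    using so that before_irrefl[of k] before_irrefl[of p] before_asym[of k r] before_asym[of r p]
    unfolding assms(2) by (auto simp: sorted_wrt_append)
  obtain i j i' j' where e: "k = (i, j)" "p = (i', j')" by (cases k; cases p)
  have "k \<in> set (grid n)" "p \<in> set (grid n)" unfolding assms(2) by auto
  then have r: "1 \<le> i" "i \<le> n" "1 \<le> j" "j \<le> n" "1 \<le> i'" "i' \<le> n" "1 \<le> j'" "j' \<le> n" by (auto simp: e)
  consider "j = j'" "i < i'" | "j < j'" "i = i'" | "j < j'" "i' < i" | "j < j'" "i < i'"
    using kp by (auto simp: before_def e) linarith
  then show ?thesis
  proof cases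
    case 1
    then have "X i' j' * X i j = q *\<^sub>C (X i j * X i' j')" using X r unfolding quantum_matrix_def by blast
    then have "l p (l k u) = q powi 1 *\<^sub>C l k (l p u)" for u
      unfolding l_def by (simp add: e mult.assoc[symmetric] scaleC_mult)
    then show ?thesis by blast
  next
    case 2
    then have "X i' j' * X i j = q *\<^sub>C (X i j * X i' j')" using X r unfolding quantum_matrix_def by blast
    then have "l p (l k u) = q powi 1 *\<^sub>C l k (l p u)" for u
      unfolding l_def by (simp add: e mult.assoc[symmetric] scaleC_mult)
    then show ?thesis by blast
  next
    case 3
    then have "X i j * X i' j' = X i' j' * X i j" using X r unfolding quantum_matrix_def by blast
    then have "l p (l k u) = q powi 0 *\<^sub>C l k (l p u)" for u
      unfolding l_def by (simp add: e mult.assoc[symmetric])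
    then show ?thesis by blast
  next
    case 4
    then have d: "X i' j' * X i j = X i j * X i' j' + (q - inverse q) *\<^sub>C (X i j' * X i' j)"
      and c: "X i' j * X i j = q *\<^sub>C (X i j * X i' j)" "X i j' * X i j = q *\<^sub>C (X i j * X i j')"
      using X r unfolding quantum_matrix_def by blast+
    have "l p (l k u) = l k (l p u) + (q - inverse q) *\<^sub>C l (i, j') (l (i', j) u)" for u
      unfolding l_def using arg_cong[OF d, of "\<lambda>v. v * u"] by (simp add: e ring_distribs mult.assoc scaleC_mult)
    moreover have "l (i, j') (l (i', j) (l k u)) = (q * q) *\<^sub>C l k (l (i, j') (l (i', j) u))" for u
      using arg_cong[OF c(1), of "\<lambda>v. X i j' * v * u"] arg_cong[OF c(2), of "\<lambda>v. v * (X i' j * u)"]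
      unfolding l_def by (simp add: e mult.assoc scaleC_ring)
    moreover have "(i, j') \<in> set ys" "(i', j) \<in> set ys"
      using 4 r by (auto intro!: mem simp: before_def e)
    ultimately show ?thesis by blast
  qed
qed

text \<open>Right multiplication reverses products, and reversing the grid compensates for it; the
  roles of \<open>k\<close> and \<open>p\<close> in each relation are exchanged.\<close>

lemma straight_right:
  assumes X: "quantum_matrix n q X" and "rev (grid n) = xs @ k # ys @ p # zs"
  defines "l \<equiv> \<lambda>p u. u * X (fst p) (snd p)"
  shows "(\<exists>m. \<forall>u. l p (l k u) = q powi m *\<^sub>C l k (l p u)) \<or>
      (\<exists>r\<in>set ys. \<exists>r'\<in>set ys. \<exists>c. (\<forall>u. l p (l k u) = l k (l p u) + c *\<^sub>C l r (l r' u)) \<and>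
         (\<forall>u. l r (l r' (l k u)) = (q * q) *\<^sub>C l k (l r (l r' u))))"
proof -
  have so: "sorted_wrt (\<lambda>a b. before b a) (xs @ k # ys @ p # zs)"
    using sorted_grid[of n] assms(2) sorted_wrt_rev[of before "grid n"] by (metis rev_rev_ident sorted_wrt_rev)
  then have kp: "before p k" by (simp add: sorted_wrt_append)
  have st: "set (grid n) = set (xs @ k # ys @ p # zs)" unfolding assms(2)[symmetric] by (simp only: set_rev)
  have mem: "r \<in> set ys" if "r \<in> set (grid n)" "before r k" "before p r" for r
    using so that before_irrefl[of k] before_irrefl[of p] before_asym[of r k] before_asym[of p r]
    unfolding st by (auto simp: sorted_wrt_append)
  obtain i j i' j' where e: "k = (i', j')" "p = (i, j)" by (cases k; cases p)
  have "k \<in> set (grid n)" "p \<in> set (grid n)" unfolding st by auto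
  then have r: "1 \<le> i" "i \<le> n" "1 \<le> j" "j \<le> n" "1 \<le> i'" "i' \<le> n" "1 \<le> j'" "j' \<le> n" by (auto simp: e)
  consider "j = j'" "i < i'" | "j < j'" "i = i'" | "j < j'" "i' < i" | "j < j'" "i < i'"
    using kp by (auto simp: before_def e) linarith
  then show ?thesis
  proof cases
    case 1
    then have "X i' j' * X i j = q *\<^sub>C (X i j * X i' j')" using X r unfolding quantum_matrix_def by blast
    then have "l p (l k u) = q powi 1 *\<^sub>C l k (l p u)" for u
      unfolding l_def by (simp add: e mult.assoc scaleC_mult)
    then show ?thesis by blast
  next
    case 2
    then have "X i' j' * X i j = q *\<^sub>C (X i j * X i' j')" using X r unfolding quantum_matrix_def by blast
    then have "l p (l k u) = q powi 1 *\<^sub>C l k (l p u)" for u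
      unfolding l_def by (simp add: e mult.assoc scaleC_mult)
    then show ?thesis by blast
  next
    case 3
    then have "X i j * X i' j' = X i' j' * X i j" using X r unfolding quantum_matrix_def by blast
    then have "l p (l k u) = q powi 0 *\<^sub>C l k (l p u)" for u
      unfolding l_def by (simp add: e mult.assoc)
    then show ?thesis by blast
  next
    case 4
    then have d: "X i' j' * X i j = X i j * X i' j' + (q - inverse q) *\<^sub>C (X i j' * X i' j)"
      and c: "X i' j' * X i j' = q *\<^sub>C (X i j' * X i' j')" "X i' j' * X i' j = q *\<^sub>C (X i' j * X i' j')"
      using X r unfolding quantum_matrix_def by blast+
    have "l p (l k u) = l k (l p u) + (q - inverse q) *\<^sub>C l (i', j) (l (i, j') u)" for u
      unfolding l_def using arg_cong[OF d, of "\<lambda>v. u * v"] by (simp add: e ring_distribs mult.assoc scaleC_mult)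
    moreover have "l (i', j) (l (i, j') (l k u)) = (q * q) *\<^sub>C l k (l (i', j) (l (i, j') u))" for u
      using arg_cong[OF c(1), of "\<lambda>v. u * v * X i' j"] arg_cong[OF c(2), of "\<lambda>v. u * X i j' * v"]
      unfolding l_def by (simp add: e mult.assoc scaleC_ring)
    moreover have "(i', j) \<in> set ys" "(i, j') \<in> set ys"
      using 4 r by (auto intro!: mem simp: before_def e)
    ultimately show ?thesis by blast
  qed
qed

lemma omono_left:
  assumes "grid n = xs @ k # ys" "a \<in> exps (set (k # ys))"
  shows "X (fst k) (snd k) * omono (\<lambda>p. X (fst p) (snd p)) (grid n) a =
    omono (\<lambda>p. X (fst p) (snd p)) (grid n) (a(k := Suc (a k)))"
proof -
  have d: "distinct (xs @ k # ys)" using sorted_distinct[OF sorted_grid] assms(1) by metis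
  have z: "a p = 0" if "p \<in> set xs" for p
    using exps_zero[OF assms(2), of p] that d by auto
  have "omono x xs a = 1" "omono x xs (a(k := Suc (a k))) = 1" "omono x ys (a(k := Suc (a k))) = omono x ys a"
    for x :: "nat \<times> nat \<Rightarrow> 'a"
    using d z by (auto intro!: omono_1 omono_cong)
  then show ?thesis unfolding assms(1) by (simp add: mult.assoc)
qed

lemma omono_right:
  assumes "rev (grid n) = xs @ k # ys" "a \<in> exps (set (k # ys))"
  shows "omono (\<lambda>p. X (fst p) (snd p)) (grid n) a * X (fst k) (snd k) =
    omono (\<lambda>p. X (fst p) (snd p)) (grid n) (a(k := Suc (a k)))"
proof -
  have g: "grid n = rev ys @ k # rev xs" using assms(1) by (metis append.assoc append_Cons append_Nil rev.simps(2) rev_append rev_rev_ident)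
  have d: "distinct (rev ys @ k # rev xs)" using sorted_distinct[OF sorted_grid] g by metis
  have z: "a p = 0" if "p \<in> set xs" for p
    using exps_zero[OF assms(2), of p] that d by auto
  have "omono x (rev xs) a = 1" "omono x (rev xs) (a(k := Suc (a k))) = 1" "omono x (rev ys) (a(k := Suc (a k))) = omono x (rev ys) a"
    for x :: "nat \<times> nat \<Rightarrow> 'a"
    using d z by (auto intro!: omono_1 omono_cong)
  then show ?thesis unfolding g by (simp add: mult.assoc power_Suc2 del: power_Suc)
qed

locale quantum_matrix_basis =
  fixes n :: nat and q :: complex and X :: "nat \<Rightarrow> nat \<Rightarrow> 'a::complex_algebra"
  assumes q0: "q \<noteq> 0" and q_pow: "\<And>m. 1 \<le> m \<Longrightarrow> q ^ m \<noteq> 1"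
    and rel: "quantum_matrix n q X"
    and free: "\<And>B c b. finite B \<Longrightarrow> B \<subseteq> multi_indices n \<Longrightarrow> (\<Sum>b\<in>B. c b *\<^sub>C ordered_monomial n X b) = 0 \<Longrightarrow>
      b \<in> B \<Longrightarrow> c b = 0"
begin

definition alg :: "'a set" where "alg = subalgebra_gen {X i j | i j. i \<in> {1..n} \<and> j \<in> {1..n}}"

abbreviation "e \<equiv> ordered_monomial n X"

definition "A0 = cvs.span (e ` exps (set (grid n)))"

lemma basis0: "monomial_basis q (set (grid n)) e A0"
  by unfold_locales (use q0 q_pow free in \<open>auto simp: A0_def multi_indices_eq\<close>)

lemma left0: "straightening q (grid n) e A0 (\<lambda>p u. X (fst p) (snd p) * u)"
proof (intro straightening.intro basis0 straightening_axioms.intro)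
  show "distinct (grid n)" using sorted_distinct sorted_grid by blast
  show "linear_on UNIV ((*) (X (fst p) (snd p)))" for p
    by (simp add: linear_on_def ring_distribs scaleC_mult)
  show "X (fst k) (snd k) * e a = e (a(k := Suc (a k)))" if "grid n = xs @ k # ys" "a \<in> exps (set (k # ys))" for xs k ys a
    unfolding ordered_monomial_eq by (rule omono_left[OF that])
qed (rule straight_left[OF rel])

lemma right0: "straightening q (rev (grid n)) e A0 (\<lambda>p u. u * X (fst p) (snd p))"
proof (intro straightening.intro straightening_axioms.intro)
  show "monomial_basis q (set (rev (grid n))) e A0" using basis0 by (simp only: set_rev)
  show "distinct (rev (grid n))" using sorted_distinct sorted_grid by auto
  show "linear_on UNIV (\<lambda>u. u * X (fst p) (snd p))" for p
    by (simp add: linear_on_def ring_distribs scaleC_mult)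
  show "e a * X (fst k) (snd k) = e (a(k := Suc (a k)))" if "rev (grid n) = xs @ k # ys" "a \<in> exps (set (k # ys))" for xs k ys a
    unfolding ordered_monomial_eq by (rule omono_right[OF that])
qed (rule straight_right[OF rel])

text \<open>The spanning half of the basis property. \<open>left_structure\<close> on the span
  \<open>A0\<close> shows that \<open>A0\<close> is closed under left multiplication by the entries,
  and it contains 1.\<close>

lemma alg_eq: "alg = A0"
proof -
  interpret s: straightening q "grid n" e A0 "\<lambda>p u. X (fst p) (snd p) * u" by (rule left0)
  have gen: "X i j * u \<in> A0" if "i \<in> {1..n}" "j \<in> {1..n}" "u \<in> A0" for i j u
  proof -
    have "(i, j) \<in> set (grid n)" using that by simp
    then obtain xs zs where g: "grid n = xs @ (i, j) # zs" by (meson split_list)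
    obtain H Y where HY: "s.invW (set xs) H" "s.inW (set xs) Y" "\<forall>u\<in>A0. X i j * u = s.Mo (i, j) (H u) + Y u"
      using s.left_structure[of "[]" xs "(i, j)" zs] g s.tail_all by auto
    have sub: "set xs \<subseteq> set (grid n)" "(i, j) \<in> set (grid n)" using g by auto
    have "H u \<in> A0" "Y u \<in> A0" using s.inW_in[OF sub(1) _ that(3)] HY unfolding s.invW_def by auto
    then show ?thesis using HY(3) that(3) s.A_add s.operators_onD(2)[OF s.Mo(1)[OF sub(2)]] by simp
  qed
  have one: "1 \<in> A0" using s.e_in[of "\<lambda>_. 0"] by (simp add: exps_def ordered_monomial_eq omono_1)
  have "\<forall>u\<in>A0. x * u \<in> A0" if "x \<in> alg" for x
    using that unfolding alg_def
    by induction (auto simp: gen ring_distribs mult.assoc scaleC_mult intro: s.A_add s.A_scale)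
  then have "alg \<subseteq> A0" using one by fastforce
  moreover have "A0 \<subseteq> alg"
  proof
    fix x assume "x \<in> A0"
    have pw: "y ^ k \<in> subalgebra_gen S" if "y \<in> subalgebra_gen S" for y :: 'a and k S
      by (induction k) (auto intro: subalgebra_gen.intros that)
    have "omono (\<lambda>p. X (fst p) (snd p)) ps a \<in> alg" if "set ps \<subseteq> set (grid n)" for ps a
      using that
    proof (induction ps)
      case Nil
      then show ?case by (simp add: alg_def subalgebra_gen.one)
    next
      case (Cons p ps)
      have "X (fst p) (snd p) \<in> alg" unfolding alg_def
        by (rule subalgebra_gen.gen) (use Cons.prems in \<open>auto simp: mem_Times_iff\<close>)
      then show ?case using Cons pw unfolding alg_def by (simp add: subalgebra_gen.mult)
    qed
    then have ea: "e a \<in> alg" for a unfolding ordered_monomial_eq by simp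
    show "x \<in> alg" using \<open>x \<in> A0\<close>
      by (induction rule: s.A_induct) (use ea in \<open>auto simp: alg_def intro: subalgebra_gen_zero subalgebra_gen.add subalgebra_gen.scale\<close>)
  qed
  ultimately show ?thesis by blast
qed

lemma basis: "monomial_basis q ({1..n} \<times> {1..n}) e alg"
  and left: "straightening q (grid n) e alg (\<lambda>p u. X (fst p) (snd p) * u)"
  and right: "straightening q (rev (grid n)) e alg (\<lambda>p u. u * X (fst p) (snd p))"
  using basis0 left0 right0 unfolding alg_eq by simp_all

end

section \<open>The two quadratic algebras as instances\<close>

context uq_presented
begin

lemma w_free:
  assumes "finite B" "B \<subseteq> multi_indices n" "\<And>b. b \<in> B \<Longrightarrow> pf b \<in> par"
    and "(\<Sum>b\<in>B. ordered_monomial n w b * pf b) = 0" "b \<in> B"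
  shows "pf b = 0"
proof -
  obtain \<Psi> where "uq_fock n q g \<Psi>" using ex_fock by blast
  then interpret uq_fock n q g \<Psi> .
  show ?thesis
  proof (rule omono_free[OF sorted_grid _ assms(1) _ assms(3) _ assms(5)])
    show "set (grid n) \<subseteq> {1..n} \<times> {1..n}" by simp
    show "c r = 0" if "c \<in> B" "r \<notin> set (grid n)" for c r
      using exps_zero[of c "set (grid n)" r] that assms(2) by (auto simp: multi_indices_eq)
    show "(\<Sum>b\<in>B. omono wp (grid n) b * pf b) = 0" using assms(4) by (simp add: ordered_monomial_eq)
  qed
qed

lemma Wel_w: "1 \<le> i \<Longrightarrow> i \<le> n \<Longrightarrow> 1 \<le> j \<Longrightarrow> j \<le> n \<Longrightarrow> Wel q g i j = (- q) ^ (i - 1 + (j - 1)) *\<^sub>C w i j"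
  using Wel_eq[OF f.serre_family_axioms] .

lemma Zel_z: "1 \<le> i \<Longrightarrow> i \<le> n \<Longrightarrow> 1 \<le> j \<Longrightarrow> j \<le> n \<Longrightarrow> Zel q g i j = qmat q E i j"
  using Zel_eq[OF e.serre_family_axioms] .

lemma W_free_par:
  assumes "finite B" "B \<subseteq> multi_indices n" "\<And>b. b \<in> B \<Longrightarrow> pf b \<in> par"
    and "(\<Sum>b\<in>B. ordered_monomial n (Wel q g) b * pf b) = 0" "b \<in> B"
  shows "pf b = 0"
proof -
  have "\<exists>c. c \<noteq> 0 \<and> ordered_monomial n (Wel q g) b = c *\<^sub>C ordered_monomial n w b" for b
    unfolding ordered_monomial_eq
    by (rule omono_scaleC[where s = "\<lambda>p. (- q) ^ (fst p - 1 + (snd p - 1))"]) (use q0 in \<open>auto simp: Wel_w\<close>)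
  then obtain c where c: "\<And>b. c b \<noteq> 0" "\<And>b. ordered_monomial n (Wel q g) b = c b *\<^sub>C ordered_monomial n w b"
    by metis
  have "c b *\<^sub>C pf b = 0"
    by (rule w_free[OF assms(1,2) _ _ assms(5)])
       (use assms(3,4) in \<open>auto simp: c(2) scaleC_mult intro: par_alg(3)\<close>)
  then show ?thesis using c(1) by simp
qed

lemma quantum_matrix_W: "quantum_matrix n q (Wel q g)"
  by (rule quantum_matrix_scale[OF f.quantum_matrix_z]) (rule Wel_w)

lemma quantum_matrix_Z: "quantum_matrix n q (Zel q g)"
  by (rule quantum_matrix_scale[OF e.quantum_matrix_z, where s = 1]) (simp add: Zel_z)

lemma basis_W: "quantum_matrix_basis n q (Wel q g)"
proof (unfold_locales, fact q0, fact q_pow, fact quantum_matrix_W)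
  fix B and c :: "(nat \<times> nat \<Rightarrow> nat) \<Rightarrow> complex" and b
  assume "finite B" "B \<subseteq> multi_indices n" "(\<Sum>b\<in>B. c b *\<^sub>C ordered_monomial n (Wel q g) b) = 0" "b \<in> B"
  then have "c b *\<^sub>C (1 :: 'a) = 0"
    by (intro W_free_par[of B "\<lambda>b. c b *\<^sub>C 1"]) (auto simp: scaleC_mult intro: par_alg)
  then show "c b = 0" by simp
qed

text \<open>The Chevalley automorphism maps each \<open>Z\<close> to the corresponding
  \<open>w\<close>, both being built by the same brackets, so a relation between \<open>Z\<close>
  monomials becomes one between \<open>w\<close> monomials.\<close>

lemma basis_Z: "quantum_matrix_basis n q (Zel q g)"
proof (unfold_locales, fact q0, fact q_pow, fact quantum_matrix_Z)
  fix B and c :: "(nat \<times> nat \<Rightarrow> nat) \<Rightarrow> complex" and b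
  assume B: "finite B" "B \<subseteq> multi_indices n" "(\<Sum>b\<in>B. c b *\<^sub>C ordered_monomial n (Zel q g) b) = 0" "b \<in> B"
  obtain \<omega> :: "'a \<Rightarrow> 'a" where \<omega>: "alg_hom \<omega>" "\<And>\<alpha>. \<alpha> \<in> simple_roots n \<Longrightarrow> \<omega> (E \<alpha>) = F \<alpha>"
    using chevalley by metis
  interpret H: alg_hom \<omega> by fact
  have br: "\<omega> (qbr q x y) = qbr q (\<omega> x) (\<omega> y)" for x y
    unfolding qbr_def by (simp add: H.diff H.mult H.scale)
  have 1: "\<omega> (qmat q E 1 j) = w 1 j" if "1 \<le> j" "j \<le> n" for j
    using that by (induction j rule: nat_induct_at_least)
      (simp_all add: e.z_11[simplified] f.z_11[simplified] e.z_1_nu[simplified] f.z_1_nu[simplified] br \<omega>(2))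
  have "\<omega> (qmat q E i j) = w i j" if "1 \<le> i" "i \<le> n" "1 \<le> j" "j \<le> n" for i j
    using that(1,2) by (induction i rule: nat_induct_at_least)
      (use 1 that in \<open>simp_all add: e.z_mu f.z_mu br \<omega>(2)\<close>)
  then have zw: "\<omega> (Zel q g i j) = w i j" if "1 \<le> i" "i \<le> n" "1 \<le> j" "j \<le> n" for i j
    using that Zel_z by simp
  have "\<omega> (omono (\<lambda>p. Zel q g (fst p) (snd p)) ps a) = omono (\<lambda>p. w (fst p) (snd p)) ps a"
    if "set ps \<subseteq> {1..n} \<times> {1..n}" for ps a
    using that by (induction ps) (auto simp: H.one H.mult H.power zw)
  then have m: "\<omega> (ordered_monomial n (Zel q g) a) = ordered_monomial n w a" for a
    unfolding ordered_monomial_eq by simp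
  have "(\<Sum>b\<in>B. ordered_monomial n w b * (c b *\<^sub>C 1)) = 0"
    using arg_cong[OF B(3), of \<omega>] by (simp add: H.sum H.scale H.zero m scaleC_mult)
  then have "c b *\<^sub>C (1 :: 'a) = 0"
    by (intro w_free[of B "\<lambda>b. c b *\<^sub>C 1"]) (use B in \<open>auto intro: par_alg\<close>)
  then show "c b = 0" by simp
qed

sublocale Z: quantum_matrix_basis n q "Zel q g" by (rule basis_Z)
sublocale W: quantum_matrix_basis n q "Wel q g" by (rule basis_W)

sublocale Z: monomial_basis q "{1..n} \<times> {1..n}" "ordered_monomial n (Zel q g)" "Aplus n q g"
  using Z.basis unfolding Z.alg_def Aplus_def .

sublocale W: monomial_basis q "{1..n} \<times> {1..n}" "ordered_monomial n (Wel q g)" "Aminus n q g"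
  using W.basis unfolding W.alg_def Aminus_def .

abbreviation "Ap \<equiv> Aplus n q g"
abbreviation "Am \<equiv> Aminus n q g"
abbreviation "Zm \<equiv> ordered_monomial n (Zel q g)"
abbreviation "Wm \<equiv> ordered_monomial n (Wel q g)"

section \<open>The pairing and the algebras of differential operators\<close>

definition nrm :: "(nat \<times> nat \<Rightarrow> nat) \<Rightarrow> complex"
  where "nrm a = (- 1 / (q - inverse q)) ^ (\<Sum>p\<in>{1..n} \<times> {1..n}. a p) * (\<Prod>p\<in>{1..n} \<times> {1..n}. qfact q (a p))"

lemma qint_nonzero: "qint q (Suc a) \<noteq> 0"
proof
  assume "qint q (Suc a) = 0"
  then have "q ^ Suc a = inverse q ^ Suc a" using q_diff by (simp add: qint_def del: power_Suc)
  then have "q ^ Suc a * q ^ Suc a = (inverse q * q) ^ Suc a" by (simp add: power_mult_distrib del: power_Suc)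
  then have "q ^ Suc a * q ^ Suc a = 1" using q_inv by (simp del: power_Suc)
  then have "q ^ (Suc a + Suc a) = 1" by (simp only: power_add)
  then show False using q_pow[of "Suc a + Suc a"] by simp
qed

lemma qfact_Suc: "qfact q (Suc a) = qint q (Suc a) * qfact q a"
  unfolding qfact_def by (simp add: mult.commute)

lemma qfact_nonzero: "qfact q a \<noteq> 0"
  by (induction a) (simp_all add: qfact_Suc qint_nonzero, simp add: qfact_def)

lemma nrm_nonzero: "nrm a \<noteq> 0"
  using q_diff by (simp add: nrm_def qfact_nonzero)

lemma nrm_Suc: assumes "p \<in> {1..n} \<times> {1..n}"
  shows "nrm (a(p := Suc (a p))) = (- 1 / (q - inverse q)) * qint q (Suc (a p)) * nrm a"
proof -
  let ?P = "{1..n} \<times> {1..n}"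
  have fin: "finite ?P" by simp
  have "(\<Sum>r\<in>?P. (a(p := Suc (a p))) r) = Suc (\<Sum>r\<in>?P. a r)"
  proof -
    have "(\<Sum>r\<in>?P - {p}. (a(p := Suc (a p))) r) = (\<Sum>r\<in>?P - {p}. a r)" by (rule sum.cong) auto
    then show ?thesis unfolding sum.remove[OF fin assms] by simp
  qed
  moreover have "(\<Prod>r\<in>?P. qfact q ((a(p := Suc (a p))) r)) = qint q (Suc (a p)) * (\<Prod>r\<in>?P. qfact q (a r))"
  proof -
    have "(\<Prod>r\<in>?P - {p}. qfact q ((a(p := Suc (a p))) r)) = (\<Prod>r\<in>?P - {p}. qfact q (a r))" by (rule prod.cong) auto
    then show ?thesis unfolding prod.remove[OF fin assms] by (simp add: qfact_Suc mult.assoc)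
  qed
  ultimately show ?thesis unfolding nrm_def by simp
qed

definition pairing_spec :: "('a \<Rightarrow> 'a \<Rightarrow> complex) \<Rightarrow> bool" where
  "pairing_spec B \<longleftrightarrow> (\<forall>w z. w \<notin> Aminus n q g \<or> z \<notin> Aplus n q g \<longrightarrow> B w z = 0) \<and>
    (\<forall>w\<in>Aminus n q g. \<forall>w'\<in>Aminus n q g. \<forall>z\<in>Aplus n q g. B (w + w') z = B w z + B w' z) \<and>
    (\<forall>w\<in>Aminus n q g. \<forall>z\<in>Aplus n q g. \<forall>z'\<in>Aplus n q g. B w (z + z') = B w z + B w z') \<and>
    (\<forall>c. \<forall>w\<in>Aminus n q g. \<forall>z\<in>Aplus n q g. B (c *\<^sub>C w) z = c * B w z \<and> B w (c *\<^sub>C z) = c * B w z) \<and>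
    (\<forall>a\<in>multi_indices n. \<forall>b\<in>multi_indices n. B (Wm b) (Zm a) =
      (if a = b
       then (- 1 / (q - inverse q)) ^ (\<Sum>p\<in>{1..n} \<times> {1..n}. a p) *
         (\<Prod>p\<in>{1..n} \<times> {1..n}. qfact q (a p))
       else 0))"

lemma pairing_eq_The: "pairing n q g = (THE B. pairing_spec B)"
  unfolding pairing_def pairing_spec_def ..

lemma pairing_spec_unique: assumes "pairing_spec B" "pairing_spec B'" shows "B = B'"
proof (intro ext)
  fix w z
  show "B w z = B' w z"
  proof (cases "w \<in> Am \<and> z \<in> Ap")
    case False
    then show ?thesis using assms unfolding pairing_spec_def by metis
  next
    case True
    note L = assms(1)[unfolded pairing_spec_def] and R = assms(2)[unfolded pairing_spec_def]
    have add: "D (w + w') z = D w z + D w' z" "D (c *\<^sub>C w) z = c * D w z" "D 0 z = 0"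
      if "pairing_spec D" "w \<in> Am" "w' \<in> Am" "z \<in> Ap" for D w w' z c
    proof -
      show "D (w + w') z = D w z + D w' z" and s: "D (c *\<^sub>C w) z = c * D w z" for c
        using that unfolding pairing_spec_def by blast+
      show "D 0 z = 0" using s[of 0] by simp
    qed
    have add': "D w (z + z') = D w z + D w z'" "D w (c *\<^sub>C z) = c * D w z" "D w 0 = 0"
      if "pairing_spec D" "w \<in> Am" "z' \<in> Ap" "z \<in> Ap" for D w z z' c
    proof -
      show "D w (z + z') = D w z + D w z'" and s: "D w (c *\<^sub>C z) = c * D w z" for c
        using that unfolding pairing_spec_def by blast+
      show "D w 0 = 0" using s[of 0] by simp
    qed
    have bb: "B (Wm b) (Zm a) = B' (Wm b) (Zm a)" if "a \<in> multi_indices n" "b \<in> multi_indices n" for a b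
      using L R that by simp
    have 1: "B (Wm b) z = B' (Wm b) z" if b: "b \<in> multi_indices n" for b
      using conjunct2[OF True]
    proof (induction rule: Z.A_induct)
      case zero
      show ?case using add'(3)[OF assms(1)] add'(3)[OF assms(2)] b W.e_in Z.A_zero by (simp add: multi_indices_eq)
    next
      case (step c a y)
      then show ?case using add'[OF assms(1)] add'[OF assms(2)] b bb[of a b] W.e_in Z.e_in Z.A_scale
        by (simp add: multi_indices_eq)
    qed
    show ?thesis using conjunct1[OF True]
    proof (induction rule: W.A_induct)
      case zero
      show ?case using add(3)[OF assms(1)] add(3)[OF assms(2)] True W.A_zero by simp
    next
      case (step c b y)
      then show ?case using add[OF assms(1)] add[OF assms(2)] 1[of b] W.e_in W.A_scale True
        by (simp add: multi_indices_eq)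
    qed
  qed
qed

lemma ex_pairing_spec: "\<exists>B. pairing_spec B"
proof -
  let ?P = "exps ({1..n} \<times> {1..n})"
  interpret vs: vector_space "(*) :: complex \<Rightarrow> complex \<Rightarrow> complex"
    by unfold_locales (simp_all add: algebra_simps)
  interpret vp: vector_space_pair "scaleC :: complex \<Rightarrow> 'a \<Rightarrow> 'a" "(*) :: complex \<Rightarrow> complex \<Rightarrow> complex"
    by unfold_locales
  \<comment> \<open>\<open>zc a\<close> is the coordinate at the monomial \<open>a\<close>. The form
    pairs a \<open>W\<close> monomial with \<open>z\<close> as the coordinate of \<open>z\<close>
    times the norm, extended linearly; it is set to 0 elsewhere, since the specification fixes a
    total function.\<close>
  define zc where "zc a = vp.construct (Zm ` ?P) (\<lambda>x. of_bool (x = Zm a))" for a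
  define D where "D z = vp.construct (Wm ` ?P) (\<lambda>x. zc (inv_into ?P Wm x) z * nrm (inv_into ?P Wm x))" for z
  define B where "B w z = (if w \<in> Am \<and> z \<in> Ap then D z w else 0)" for w z
  have lzc: "Vector_Spaces.linear scaleC (*) (zc a)" for a
    unfolding zc_def by (rule vp.linear_construct[OF Z.independent])
  have lD: "Vector_Spaces.linear scaleC (*) (D z)" for z
    unfolding D_def by (rule vp.linear_construct[OF W.independent])
  have zc_add: "zc a (x + y) = zc a x + zc a y" "zc a (c *\<^sub>C x) = c * zc a x" for a x y c
    using lzc[of a] by (simp_all add: Vector_Spaces.linear_iff)
  have D_add: "D z (x + y) = D z x + D z y" "D z (c *\<^sub>C x) = c * D z x" for z x y c
    using lD[of z] by (simp_all add: Vector_Spaces.linear_iff)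
  have Dz: "D (z + z') x = D z x + D z' x" "D (c *\<^sub>C z) x = c * D z x" for z z' x c
    unfolding D_def zc_add vp.construct_add[OF W.independent, symmetric] vp.construct_scale[OF W.independent, symmetric]
    by (simp_all only: ring_distribs mult.assoc)
  have zz: "zc a (Zm b) = of_bool (b = a)" if "a \<in> ?P" "b \<in> ?P" for a b
    unfolding zc_def using that Z.inj_e by (subst vp.construct_basis[OF Z.independent]) (auto dest: inj_onD)
  have DB: "D (Zm a) (Wm b) = (if a = b then nrm a else 0)" if "a \<in> ?P" "b \<in> ?P" for a b
  proof -
    have iv: "inv_into ?P Wm (Wm b) = b" by (rule inv_into_f_f[OF W.inj_e that(2)])
    have "D (Zm a) (Wm b) = zc (inv_into ?P Wm (Wm b)) (Zm a) * nrm (inv_into ?P Wm (Wm b))"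
      unfolding D_def using that(2) by (intro vp.construct_basis[OF W.independent]) blast
    then show ?thesis unfolding iv using zz[OF that(2,1)] by auto
  qed
  have "pairing_spec B"
    unfolding pairing_spec_def B_def
    using D_add Dz DB Z.A_add W.A_add Z.A_scale W.A_scale Z.e_in W.e_in
    by (auto simp: multi_indices_eq nrm_def)
  then show ?thesis by blast
qed

lemma pairing_spec: "pairing_spec (pairing n q g)"
  unfolding pairing_eq_The using ex_pairing_spec pairing_spec_unique by (metis theI')

lemma dual: "dual_bases q ({1..n} \<times> {1..n}) Zm Ap Wm Am (pairing n q g) nrm (- 1 / (q - inverse q))"
proof -
  note P = pairing_spec[unfolded pairing_spec_def]
  show ?thesis
  proof (intro dual_bases.intro dual_bases_axioms.intro Z.monomial_basis_axioms W.monomial_basis_axioms)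
    show "nrm a \<noteq> 0" for a by (rule nrm_nonzero)
    show "- 1 / (q - inverse q) \<noteq> 0" using q_diff by simp
    show "nrm (a(p := Suc (a p))) = (- 1 / (q - inverse q)) * qint q (Suc (a p)) * nrm a"
      if "p \<in> {1..n} \<times> {1..n}" for a p by (rule nrm_Suc[OF that])
    show "pairing n q g (Wm b) (Zm a) = (if a = b then nrm a else 0)"
      if "a \<in> exps ({1..n} \<times> {1..n})" "b \<in> exps ({1..n} \<times> {1..n})" for a b
      using P that unfolding nrm_def multi_indices_eq by blast
  qed (use P in blast)+
qed

sublocale dual_bases q "{1..n} \<times> {1..n}" Zm Ap Wm Am "pairing n q g" nrm "- 1 / (q - inverse q)"
  by (rule dual)

lemma dual_left: "dual_straightening q (grid n) Zm Ap Wm Am (pairing n q g) nrm (- 1 / (q - inverse q))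
    (\<lambda>p u. Zel q g (fst p) (snd p) * u) (\<lambda>p u. Wel q g (fst p) (snd p) * u)"
  using dual Z.left W.left unfolding Z.alg_def W.alg_def Aplus_def Aminus_def
  by (simp add: dual_straightening_def)

lemma dual_right: "dual_straightening q (rev (grid n)) Zm Ap Wm Am (pairing n q g) nrm (- 1 / (q - inverse q))
    (\<lambda>p u. u * Zel q g (fst p) (snd p)) (\<lambda>p u. u * Wel q g (fst p) (snd p))"
  using dual Z.right W.right unfolding Z.alg_def W.alg_def Aplus_def Aminus_def
  by (simp add: dual_straightening_def)

lemma M_op_eq: "M_op n q g i j = Z.Mo (i, j)"
  unfolding M_op_def Z.Mo_def Z.opd_def multi_indices_eq ..

lemma D_op_eq: "D_op n q g i j = Z.Do (i, j)"
  unfolding D_op_def Z.Do_def Z.opd_def multi_indices_eq ..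

lemma image_grid: "{f i j | i j. i \<in> {1..n} \<and> j \<in> {1..n}} = (\<lambda>p. f (fst p) (snd p)) ` ({1..n} \<times> {1..n})"
  by force

lemma Weyl_eq: "Weyl n q g = Z.Wa ({1..n} \<times> {1..n})"
  unfolding Weyl_def Z.Wa_def M_op_eq D_op_eq image_grid by simp

lemma adjoint_L_eq:
  assumes "adj T f" "Z.inW ({1..n} \<times> {1..n}) f"
  shows "adjoint_L n q g T = restrict f Ap"
  unfolding adjoint_L_def
proof (rule the_equality)
  have f: "restrict f Ap \<in> operators_on Ap" "\<And>u. u \<in> Ap \<Longrightarrow> f u \<in> Ap"
    using Z.inW_operators[OF order.refl assms(2)] Z.inW_in[OF order.refl assms(2)] by auto
  show "restrict f Ap \<in> operators_on Ap \<and>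
    (\<forall>w\<in>Am. \<forall>u\<in>Ap. pairing n q g (T w) u = pairing n q g w (restrict f Ap u))"
    using assms(1) f unfolding adj_def by simp
  fix S assume S: "S \<in> operators_on Ap \<and> (\<forall>w\<in>Am. \<forall>u\<in>Ap. pairing n q g (T w) u = pairing n q g w (S u))"
  then have "adj T S" unfolding adj_def by blast
  then have "S u = f u" if "u \<in> Ap" for u
    using adj_unique[OF _ assms(1) that] Z.operators_onD(2)[of S u] S f(2) that by blast
  then show "S = restrict f Ap"
    using Z.operators_onD(3)[of S] S by (auto simp: fun_eq_iff restrict_def)
qed

text \<open>Left and right multiplication straighten along \<open>grid n\<close> and its reverse respectively; \<open>l\<close> and \<open>l'\<close>
  are either of them.\<close>

lemma D_L_eq_Weyl:
  assumes "dual_straightening q ps Zm Ap Wm Am (pairing n q g) nrm (- 1 / (q - inverse q)) l l'"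
    and ps: "set ps = {1..n} \<times> {1..n}"
    and T: "\<And>p w. p \<in> set ps \<Longrightarrow> w \<in> Am \<Longrightarrow> T p w = l' p w"
    and G: "G = (\<lambda>p. adjoint_L n q g (T p)) ` set ps \<union> (\<lambda>p. restrict (\<lambda>u. u * Zel q g (fst p) (snd p)) Ap) ` set ps \<union>
        (\<lambda>p. restrict (\<lambda>u. Zel q g (fst p) (snd p) * u) Ap) ` set ps"
    and l: "\<And>p. p \<in> set ps \<Longrightarrow> restrict (l p) Ap \<in> G"
  shows "operator_algebra Ap G = Weyl n q g"
proof -
  interpret d: dual_straightening q ps Zm Ap Wm Am "pairing n q g" nrm "- 1 / (q - inverse q)" l l' by fact
  interpret L: dual_straightening q "grid n" Zm Ap Wm Am "pairing n q g" nrm "- 1 / (q - inverse q)"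
    "\<lambda>p u. Zel q g (fst p) (snd p) * u" "\<lambda>p u. Wel q g (fst p) (snd p) * u" by (rule dual_left)
  interpret R: dual_straightening q "rev (grid n)" Zm Ap Wm Am "pairing n q g" nrm "- 1 / (q - inverse q)"
    "\<lambda>p u. u * Zel q g (fst p) (snd p)" "\<lambda>p u. u * Wel q g (fst p) (snd p)" by (rule dual_right)
  have "\<exists>h. \<forall>p\<in>set ps. Z.inW ({1..n} \<times> {1..n}) (h p) \<and> adj (l' p) (h p)"
    using d.adj_l' unfolding ps by (intro bchoice) blast
  then obtain h where h: "\<And>p. p \<in> set ps \<Longrightarrow> Z.inW ({1..n} \<times> {1..n}) (h p)" "\<And>p. p \<in> set ps \<Longrightarrow> adj (l' p) (h p)" by blast
  have Th: "adjoint_L n q g (T p) = restrict (h p) Ap" if "p \<in> set ps" for p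
    by (rule adjoint_L_eq[OF _ h(1)[OF that]]) (use h(2)[OF that] T[OF that] in \<open>simp add: adj_def\<close>)
  have LR: "Z.inW ({1..n} \<times> {1..n}) (\<lambda>u. Zel q g (fst p) (snd p) * u)" "Z.inW ({1..n} \<times> {1..n}) (\<lambda>u. u * Zel q g (fst p) (snd p))"
    if "p \<in> set ps" for p
    using L.l_inW[of p] R.l_inW[of p] that unfolding ps set_rev set_grid by blast+
  have "G \<subseteq> Z.Wa ({1..n} \<times> {1..n})"
  proof
    fix S assume "S \<in> G"
    then obtain p where p: "p \<in> set ps" "S = restrict (h p) Ap \<or> S = restrict (\<lambda>u. u * Zel q g (fst p) (snd p)) Ap \<or>
        S = restrict (\<lambda>u. Zel q g (fst p) (snd p) * u) Ap"
      unfolding G using Th by blast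
    then show "S \<in> Z.Wa ({1..n} \<times> {1..n})"
      using LR[OF p(1)] h(1)[OF p(1)] unfolding Z.inW_def by blast
  qed
  then have 1: "operator_algebra Ap G \<subseteq> Weyl n q g"
    unfolding Weyl_eq Z.Wa_def by (auto elim: operator_algebra_mono)
  have "Z.Wa ({1..n} \<times> {1..n}) \<subseteq> operator_algebra Ap G"
  proof (rule d.generation[unfolded ps])
    fix p assume "p \<in> {1..n} \<times> {1..n}"
    then have p: "p \<in> set ps" unfolding ps .
    show "Z.inG G (l p)" unfolding Z.inG_def by (rule operator_algebra.gen[OF l[OF p]])
    show "Z.inG G (h p) \<and> adj (l' p) (h p) \<and> (\<forall>u\<in>Ap. h p u \<in> Ap)"
    proof (intro conjI ballI)
      have "adjoint_L n q g (T p) \<in> G" unfolding G using p by blast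
      then show "Z.inG G (h p)" unfolding Z.inG_def Th[OF p, symmetric] by (rule operator_algebra.gen)
      show "adj (l' p) (h p)" by (rule h(2)[OF p])
      show "h p u \<in> Ap" if "u \<in> Ap" for u by (rule Z.inW_in[OF order.refl h(1)[OF p] that])
    qed
  qed
  then show ?thesis using 1 unfolding Weyl_eq by blast
qed

lemma D_L_L_eq: "D_L_L n q g = Weyl n q g"
  unfolding D_L_L_def image_grid left_mult_def right_mult_def
  by (rule D_L_eq_Weyl[OF dual_left, where T = "\<lambda>p. left_mult Am (Wel q g (fst p) (snd p))"])
     (simp_all add: left_mult_def)

lemma D_L_R_eq: "D_L_R n q g = Weyl n q g"
  unfolding D_L_R_def image_grid left_mult_def right_mult_def
  by (rule D_L_eq_Weyl[OF dual_right, where T = "\<lambda>p. right_mult Am (Wel q g (fst p) (snd p))"])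
     (simp_all add: right_mult_def)

end

section \<open>Left multiplication on the negative quadratic algebra\<close>

context uq_presented
begin

abbreviation "Wp p \<equiv> Wel q g (fst p) (snd p)"

sublocale WL: straightening q "grid n" Wm Am "\<lambda>p u. Wp p * u"
  rewrites "set (grid n) = {1..n} \<times> {1..n}"
  using W.left unfolding W.alg_def Aminus_def by simp_all

sublocale WR: straightening q "rev (grid n)" Wm Am "\<lambda>p u. u * Wp p"
  rewrites "set (rev (grid n)) = {1..n} \<times> {1..n}"
  using W.right unfolding W.alg_def Aminus_def by simp_all

text \<open>Sums of maps \<open>v -> D v * x\<close>, standing for the tensor product of the Weyl
  algebra with \<open>par\<close>. Only values on the span of the monomials in \<open>ys\<close>
  count, because these sums are built up one letter at a time.\<close>

inductive Weyl_par :: "(nat \<times> nat) list \<Rightarrow> ('a \<Rightarrow> 'a) \<Rightarrow> bool" for ys where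
  elem: "W.inW (set ys) D \<Longrightarrow> x \<in> par \<Longrightarrow> (\<And>v. v \<in> WL.tail ys \<Longrightarrow> T v = D v * x) \<Longrightarrow> Weyl_par ys T"
| add: "Weyl_par ys S \<Longrightarrow> Weyl_par ys T \<Longrightarrow> (\<And>v. v \<in> WL.tail ys \<Longrightarrow> R v = S v + T v) \<Longrightarrow> Weyl_par ys R"

lemma Weyl_par_eq: "Weyl_par ys T \<Longrightarrow> (\<And>v. v \<in> WL.tail ys \<Longrightarrow> S v = T v) \<Longrightarrow> Weyl_par ys S"
  by (induction rule: Weyl_par.induct) (auto intro: Weyl_par.intros)

lemma Weyl_par_scale: "Weyl_par ys T \<Longrightarrow> Weyl_par ys (\<lambda>v. c *\<^sub>C T v)"
proof (induction rule: Weyl_par.induct)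
  case (elem D x T)
  show ?case by (rule Weyl_par.elem[OF W.inW_scale[OF elem(1), of c] elem(2)]) (simp add: elem(3) mult_scaleC_left)
next
  case (add S T R)
  show ?case by (rule Weyl_par.add[OF add.IH]) (simp add: add.hyps scaleC_add_right)
qed

definition Weyl_left :: "(nat \<times> nat) list \<Rightarrow> 'a \<Rightarrow> bool" where "Weyl_left ys u \<longleftrightarrow> Weyl_par ys (\<lambda>v. u * v)"

lemma Weyl_left_add: "Weyl_left ys u \<Longrightarrow> Weyl_left ys u' \<Longrightarrow> Weyl_left ys (u + u')"
  unfolding Weyl_left_def by (erule Weyl_par.add) (auto simp: ring_distribs)

lemma Weyl_left_scale: "Weyl_left ys u \<Longrightarrow> Weyl_left ys (c *\<^sub>C u)"
  unfolding Weyl_left_def by (rule Weyl_par_eq[OF Weyl_par_scale[of ys "\<lambda>v. u * v" c]]) (simp_all add: mult_scaleC_left)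

lemma Weyl_left_1: "Weyl_left ys 1"
  unfolding Weyl_left_def by (rule Weyl_par.elem[OF W.inW_id par_alg(1)]) simp

text \<open>If \<open>u' * v\<close> is a sum of terms \<open>D v * x\<close>, then \<open>u\<close>
  can act on each \<open>D v\<close>, because an operator in the letters of a final segment of the
  grid preserves the span of their monomials (\<open>inW_tail_in\<close>).\<close>

lemma Weyl_left_mult:
  assumes ys: "grid n = xs @ ys" and "Weyl_left ys u" "Weyl_left ys u'"
  shows "Weyl_left ys (u * u')"
proof -
  have Q: "set ys \<subseteq> {1..n} \<times> {1..n}" unfolding set_grid[symmetric] ys by auto
  have 1: "Weyl_par ys (\<lambda>v. T (D v) * x)" if "Weyl_par ys T" "W.inW (set ys) D" "x \<in> par" for T D x
    using that(1)
  proof (induction rule: Weyl_par.induct)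
    case (elem D' x' T)
    show ?case
      by (rule Weyl_par.elem[OF W.inW_comp[OF Q elem(1) that(2)] par_alg(4)[OF elem(2) that(3)]])
         (simp add: elem(3)[OF WL.inW_tail_in[OF that(2) ys]] mult.assoc)
  next
    case (add S T R)
    show ?case by (rule Weyl_par.add[OF add.IH]) (simp add: add.hyps WL.inW_tail_in[OF that(2) ys] ring_distribs)
  qed
  have "Weyl_par ys (\<lambda>v. u * T v)" if "Weyl_par ys T" for T
    using that
  proof (induction rule: Weyl_par.induct)
    case (elem D x T)
    show ?case by (rule Weyl_par_eq[OF 1[OF assms(2)[unfolded Weyl_left_def] elem(1,2)]]) (simp add: elem(3) mult.assoc)
  next
    case (add S T R)
    show ?case by (rule Weyl_par.add[OF add.IH]) (simp add: add.hyps ring_distribs)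
  qed
  from this[OF assms(3)[unfolded Weyl_left_def]] show ?thesis
    unfolding Weyl_left_def by (rule Weyl_par_eq) (simp add: mult.assoc)
qed

lemma span_Wm_empty: assumes "v \<in> cvs.span (Wm ` exps {})" shows "u * v = v * u"
proof -
  have "Wm a = 1" if "a \<in> exps {}" for a
    using that unfolding ordered_monomial_eq by (intro omono_1) (auto simp: exps_def)
  then have "Wm ` exps {} \<subseteq> {1}" by auto
  then have "v \<in> cvs.span {1}" using cvs.span_mono[of "Wm ` exps {}" "{1}"] assms by auto
  then obtain c where "v = c *\<^sub>C 1" by (auto simp: cvs.span_singleton)
  then show "u * v = v * u" by (simp add: scaleC_mult)
qed

lemma Weyl_left_Nil: "u \<in> par \<Longrightarrow> Weyl_left [] u"
  unfolding Weyl_left_def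
  by (rule Weyl_par.elem[OF W.inW_id]) (use span_Wm_empty in \<open>simp_all add: WL.tail_def\<close>)

lemma Weyl_left_W: assumes "grid n = xs @ ys" "r \<in> set ys" shows "Weyl_left ys (Wp r)"
proof -
  obtain D where D: "W.inW (set ys) D" "\<And>v. v \<in> WL.tail ys \<Longrightarrow> Wp r * v = D v"
    using WL.l_tail[OF assms] by metis
  show ?thesis unfolding Weyl_left_def by (rule Weyl_par.elem[OF D(1) par_alg(1)]) (simp add: D(2))
qed

text \<open>Transfers a map on the later letters to monomials with an additional power of
  \<open>k\<close>. \<open>H\<close> supplies the scalar \<open>h j\<close> and the new exponent
  \<open>d j\<close>: it is \<open>Hpow\<close> with \<open>d j = j\<close>, or \<open>Cop\<close>
  with \<open>d j = j - 1\<close>.\<close>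

lemma Weyl_par_lift:
  assumes ys: "grid n = xs @ k # ys" and H: "W.inW (set (k # ys)) H"
    "\<And>v j. v \<in> WL.tail ys \<Longrightarrow> H (((\<lambda>u. Wp k * u) ^^ j) v) = h j *\<^sub>C ((\<lambda>u. Wp k * u) ^^ d j) v"
    and T: "Weyl_par ys T"
  shows "\<exists>T'. Weyl_par (k # ys) T' \<and> linear_on Am T' \<and> (\<forall>v\<in>WL.tail ys. \<forall>j. T' (Wp k ^ j * v) = h j *\<^sub>C (Wp k ^ d j * T v))"
  using T
proof (induction rule: Weyl_par.induct)
  case (elem D x T)
  have Q: "set (k # ys) \<subseteq> {1..n} \<times> {1..n}" "set ys \<subseteq> {1..n} \<times> {1..n}" "set ys \<subseteq> set (k # ys)"
    unfolding set_grid[symmetric] ys by auto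
  have pw: "((\<lambda>u. Wp k * u) ^^ j) v = Wp k ^ j * v" for j v by (induction j) (simp_all add: mult.assoc)
  have DH: "W.inW (set (k # ys)) (\<lambda>v. D (H v))" by (rule W.inW_comp[OF Q(1) W.inW_mono[OF Q(3) elem(1)] H(1)])
  have "linear_on Am (\<lambda>v. D (H v) * x)"
    using W.inW_linear[OF Q(1) DH] by (simp add: linear_on_def ring_distribs mult_scaleC_left)
  moreover have "D (H (Wp k ^ j * v)) * x = h j *\<^sub>C (Wp k ^ d j * T v)" if v: "v \<in> WL.tail ys" for v j
  proof -
    have "Wp k ^ d j * v \<in> Am" using WL.lpow_in[OF ys v, of "d j"] by (simp add: pw)
    then show ?thesis
      using H(2)[OF v, of j] WL.inW_tail(2)[OF elem(1) ys order.refl v, of "d j"] elem(3)[OF v]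
        W.linear_onD(2)[OF W.inW_linear[OF Q(2) elem(1)]]
      by (simp add: pw mult_scaleC_left mult.assoc)
  qed
  ultimately show ?case using Weyl_par.elem[OF DH elem(2), of "\<lambda>v. D (H v) * x"] by blast
next
  case (add S T R)
  then obtain S' T' where "Weyl_par (k # ys) S'" "linear_on Am S'" "\<forall>v\<in>WL.tail ys. \<forall>j. S' (Wp k ^ j * v) = h j *\<^sub>C (Wp k ^ d j * S v)"
    "Weyl_par (k # ys) T'" "linear_on Am T'" "\<forall>v\<in>WL.tail ys. \<forall>j. T' (Wp k ^ j * v) = h j *\<^sub>C (Wp k ^ d j * T v)"
    by blast
  then show ?case using add.hyps
    by (intro exI[of _ "\<lambda>v. S' v + T' v"])
       (auto simp: linear_on_def scaleC_add_right ring_distribs algebra_simps intro: Weyl_par.add)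
qed

text \<open>\<open>power_push_mult\<close> splits \<open>u * Wp k ^ j\<close> into three terms whose
  coefficients are those of \<open>Hpow\<close> and \<open>Cop\<close>; each term lifts by
  \<open>Weyl_par_lift\<close>.\<close>

lemma Weyl_left_step:
  assumes ys: "grid n = xs @ k # ys" and g: "Weyl_left ys u" "Weyl_left ys y" "Weyl_left ys y'"
    and \<epsilon>: "\<epsilon> = 1 \<or> \<epsilon> = -1" "\<epsilon>' = 1 \<or> \<epsilon>' = -1"
    and ux: "u * Wp k = q powi c *\<^sub>C (Wp k * u) + y + y'"
    and yx: "y * Wp k = q powi (c + 2 * \<epsilon>) *\<^sub>C (Wp k * y)" "y' * Wp k = q powi (c + 2 * \<epsilon>') *\<^sub>C (Wp k * y')"
  shows "Weyl_left (k # ys) u"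
proof -
  have k: "k \<in> {1..n} \<times> {1..n}" "set (k # ys) \<subseteq> {1..n} \<times> {1..n}" "{k} \<subseteq> set (k # ys)" unfolding set_grid[symmetric] ys by auto
  have pw: "((\<lambda>u. Wp k * u) ^^ j) v = Wp k ^ j * v" for j v by (induction j) (simp_all add: mult.assoc)
  obtain T1 where T1: "Weyl_par (k # ys) T1" "linear_on Am T1"
      "\<forall>v\<in>WL.tail ys. \<forall>j. T1 (Wp k ^ j * v) = q powi (c * int j) *\<^sub>C (Wp k ^ j * (u * v))"
    using Weyl_par_lift[OF ys W.inW_mono[OF k(3) W.inW_Hpow[OF k(1)]] WL.Hpow_lpow[OF ys] g(1)[unfolded Weyl_left_def]] by blast
  have C: "\<exists>T. Weyl_par (k # ys) T \<and> linear_on Am T \<and> (\<forall>v\<in>WL.tail ys. \<forall>j. T (Wp k ^ j * v) =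
      (q powi (m * (int j - 1)) * qint q j) *\<^sub>C (Wp k ^ (j - 1) * (z * v)))" if "Weyl_left ys z" for z m
    using Weyl_par_lift[OF ys W.inW_mono[OF k(3) W.inW_Cop[OF k(1)]] WL.Cop_lpow[OF ys] that[unfolded Weyl_left_def]] by blast
  obtain T2 where T2: "Weyl_par (k # ys) T2" "linear_on Am T2" "\<forall>v\<in>WL.tail ys. \<forall>j. T2 (Wp k ^ j * v) =
      (q powi ((c + \<epsilon>) * (int j - 1)) * qint q j) *\<^sub>C (Wp k ^ (j - 1) * (y * v))"
    using C[OF g(2)] by blast
  obtain T3 where T3: "Weyl_par (k # ys) T3" "linear_on Am T3" "\<forall>v\<in>WL.tail ys. \<forall>j. T3 (Wp k ^ j * v) =
      (q powi ((c + \<epsilon>') * (int j - 1)) * qint q j) *\<^sub>C (Wp k ^ (j - 1) * (y' * v))"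
    using C[OF g(3)] by blast
  have "u * v = T1 v + T2 v + T3 v" if v: "v \<in> WL.tail (k # ys)" for v
  proof (rule WL.tail_Cons_eq[OF ys _ _ _ v])
    show "linear_on (WL.tail (k # ys)) (\<lambda>v. u * v)" by (simp add: linear_on_def ring_distribs scaleC_mult)
    have "linear_on Am (\<lambda>v. T1 v + T2 v + T3 v)"
      using T1(2) T2(2) T3(2) by (simp add: linear_on_def scaleC_add_right)
    then show "linear_on (WL.tail (k # ys)) (\<lambda>v. T1 v + T2 v + T3 v)"
      by (rule WL.linear_on_subset) (use WL.tail_A[OF k(2)] in auto)
    fix v j assume "v \<in> WL.tail ys"
    then show "u * ((\<lambda>u. Wp k * u) ^^ j) v = T1 (((\<lambda>u. Wp k * u) ^^ j) v) + T2 (((\<lambda>u. Wp k * u) ^^ j) v) + T3 (((\<lambda>u. Wp k * u) ^^ j) v)"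
      using power_push_mult[OF q0 q_diff \<epsilon> ux yx, of j] T1(3) T2(3) T3(3)
      unfolding pw by (simp add: mult.assoc[symmetric] ring_distribs mult_scaleC_left)
  qed
  then show ?thesis unfolding Weyl_left_def
    by (intro Weyl_par.add[OF Weyl_par.add[OF T1(1) T2(1) HOL.refl] T3(1)])
qed

lemma Weyl_left_zero: "Weyl_left ys 0"
  using Weyl_left_scale[OF Weyl_left_1, of ys 0] by simp

lemma Wp_w: "k \<in> {1..n} \<times> {1..n} \<Longrightarrow> \<exists>s. s \<noteq> 0 \<and> Wp k = s *\<^sub>C w (fst k) (snd k)"
  using Wel_w[of "fst k" "snd k"] q0 by (intro exI[of _ "(- q) ^ (fst k - 1 + (snd k - 1))"]) auto

lemma Weyl_left_w: assumes "grid n = xs @ ys" "r \<in> set ys" shows "Weyl_left ys (w (fst r) (snd r))"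
proof -
  have "r \<in> {1..n} \<times> {1..n}" unfolding set_grid[symmetric] using assms by auto
  then obtain s where s: "s \<noteq> 0" "Wp r = s *\<^sub>C w (fst r) (snd r)" using Wp_w by blast
  have "Weyl_left ys (inverse s *\<^sub>C Wp r)" by (rule Weyl_left_scale[OF Weyl_left_W[OF assms]])
  then show ?thesis using s by (simp add: scaleC_scaleC scaleC_one)
qed

text \<open>Induction over final segments of the grid, starting from scalars, which commute with
  \<open>u\<close>. The error terms need only be under control on the shorter segment.\<close>

lemma Weyl_left_induct:
  assumes "u \<in> par" and ys: "grid n = xs @ ys"
    and step: "\<And>xs k ys. grid n = xs @ k # ys \<Longrightarrow> k \<in> {1..n} \<times> {1..n} \<Longrightarrow>
      \<exists>c y y' \<epsilon> \<epsilon>'. Weyl_left ys y \<and> Weyl_left ys y' \<and> (\<epsilon> = 1 \<or> \<epsilon> = -1) \<and> (\<epsilon>' = 1 \<or> \<epsilon>' = -1) \<and>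
        u * w (fst k) (snd k) = q powi c *\<^sub>C (w (fst k) (snd k) * u) + y + y' \<and>
        y * w (fst k) (snd k) = q powi (c + 2 * \<epsilon>) *\<^sub>C (w (fst k) (snd k) * y) \<and>
        y' * w (fst k) (snd k) = q powi (c + 2 * \<epsilon>') *\<^sub>C (w (fst k) (snd k) * y')"
  shows "Weyl_left ys u"
  using ys
proof (induction ys arbitrary: xs)
  case Nil
  then show ?case using Weyl_left_Nil assms(1) by simp
next
  case (Cons k ys)
  have k: "k \<in> {1..n} \<times> {1..n}" unfolding set_grid[symmetric] Cons.prems by simp
  obtain c y y' \<epsilon> \<epsilon>' where st: "Weyl_left ys y" "Weyl_left ys y'" "\<epsilon> = 1 \<or> \<epsilon> = -1" "\<epsilon>' = 1 \<or> \<epsilon>' = -1"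
     "u * w (fst k) (snd k) = q powi c *\<^sub>C (w (fst k) (snd k) * u) + y + y'"
     "y * w (fst k) (snd k) = q powi (c + 2 * \<epsilon>) *\<^sub>C (w (fst k) (snd k) * y)"
     "y' * w (fst k) (snd k) = q powi (c + 2 * \<epsilon>') *\<^sub>C (w (fst k) (snd k) * y')"
    using step[OF Cons.prems k] by blast
  obtain s where s: "Wp k = s *\<^sub>C w (fst k) (snd k)" using Wp_w[OF k] by blast
  have "Weyl_left ys u" using Cons.IH[of "xs @ [k]"] Cons.prems by simp
  then show ?case
    by (rule Weyl_left_step[OF Cons.prems _ Weyl_left_scale[OF st(1), of s] Weyl_left_scale[OF st(2), of s] st(3,4), where c = c])
       (simp_all add: s mult_scaleC_left mult_scaleC_right st scaleC_add_right scaleC_scaleC mult.commute)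
qed

lemma Weyl_left_weight:
  assumes "u \<in> par" "grid n = xs @ ys" "\<And>i j. i \<in> {1..n} \<Longrightarrow> j \<in> {1..n} \<Longrightarrow> \<exists>c. u * w i j = q powi c *\<^sub>C (w i j * u)"
  shows "Weyl_left ys u"
  using assms(1,2)
proof (rule Weyl_left_induct)
  fix xs k ys assume "k \<in> {1..n} \<times> {1..n}"
  then obtain c where "u * w (fst k) (snd k) = q powi c *\<^sub>C (w (fst k) (snd k) * u)" using assms(3) by (cases k) auto
  then show "\<exists>c y y' \<epsilon> \<epsilon>'. Weyl_left ys y \<and> Weyl_left ys y' \<and> (\<epsilon> = 1 \<or> \<epsilon> = -1) \<and> (\<epsilon>' = 1 \<or> \<epsilon>' = -1) \<and>
        u * w (fst k) (snd k) = q powi c *\<^sub>C (w (fst k) (snd k) * u) + y + y' \<and>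
        y * w (fst k) (snd k) = q powi (c + 2 * \<epsilon>) *\<^sub>C (w (fst k) (snd k) * y) \<and>
        y' * w (fst k) (snd k) = q powi (c + 2 * \<epsilon>') *\<^sub>C (w (fst k) (snd k) * y')"
    by (intro exI[of _ c] exI[of _ "0::'a"] exI[of _ 1]) (simp add: Weyl_left_zero)
qed

lemma Weyl_left_K: "\<alpha> \<in> simple_roots n \<Longrightarrow> grid n = xs @ ys \<Longrightarrow> Weyl_left ys (K \<alpha>)"
  by (rule Weyl_left_weight[OF par_gens(1)]) (use K_w in auto)

lemma Weyl_left_Ki: "\<alpha> \<in> simple_roots n \<Longrightarrow> grid n = xs @ ys \<Longrightarrow> Weyl_left ys (Ki \<alpha>)"
  by (rule Weyl_left_weight[OF par_gens(2)]) (use Ki_w in auto)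

lemma grid_before: "grid n = xs @ k # ys \<Longrightarrow> r \<in> {1..n} \<times> {1..n} \<Longrightarrow> before k r \<Longrightarrow> r \<in> set ys"
  "grid n = xs @ k # ys \<Longrightarrow> r \<in> {1..n} \<times> {1..n} \<Longrightarrow> before r k \<Longrightarrow> r \<in> set xs"
proof -
  assume a: "grid n = xs @ k # ys" "r \<in> {1..n} \<times> {1..n}"
  have s: "sorted_wrt before (xs @ k # ys)" using sorted_grid[of n] a(1) by simp
  have "r \<in> set (xs @ k # ys)" using a(2) unfolding set_grid[symmetric] a(1) .
  then show "before k r \<Longrightarrow> r \<in> set ys" "before r k \<Longrightarrow> r \<in> set xs"
    using s before_irrefl[of k] before_asym[of k r] by (auto simp: sorted_wrt_append)
qed

text \<open>\<open>F \<alpha>\<close> turns an entry into its neighbour in the next row or column.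
  That neighbour stands later in the grid, so multiplication by it is already known on the remaining
  letters.\<close>

lemma Weyl_left_F: assumes "\<alpha> \<in> simple_roots n" "\<alpha> \<noteq> Beta" "grid n = xs @ ys" shows "Weyl_left ys (F \<alpha>)"
  using par_gens(4)[OF assms(1,2)] assms(3)
proof (rule Weyl_left_induct)
  fix xs k ys assume g: "grid n = xs @ k # ys" and "k \<in> {1..n} \<times> {1..n}"
  then obtain i j where k: "k = (i, j)" "1 \<le> i" "i \<le> n" "1 \<le> j" "j \<le> n" by (cases k) auto
  have main: "\<exists>c y. Weyl_left ys y \<and> F \<alpha> * w i j = q powi c *\<^sub>C (w i j * F \<alpha>) + y \<and> y * w i j = q powi (c + 2) *\<^sub>C (w i j * y)"
  proof (cases \<alpha>)
    case (Mu m)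
    then have m: "1 \<le> m" "m < n" using assms(1) by (auto simp: simple_roots_def)
    consider "i = m" | "i = Suc m" | "i \<noteq> m" "i \<noteq> Suc m" by blast
    then show ?thesis
    proof cases
      case 1
      have "Weyl_left ys (w (Suc m) j)" using Weyl_left_w[of "xs @ [k]" ys "(Suc m, j)"] grid_before(1)[OF g, of "(Suc m, j)"] g k m 1
        by (auto simp: before_def)
      moreover have "F \<alpha> * w i j = q powi (-1) *\<^sub>C (w i j * F \<alpha>) + w (Suc m) j"
        using f.z_mu[of m j] m 1 Mu by (simp add: qbr_def)
      ultimately show ?thesis using f.z_col[of i "Suc m" j] 1 m k
        by (intro exI[of _ "-1"] exI[of _ "w (Suc m) j"]) simp
    next
      case 2
      then show ?thesis using f.mu_z_top[of m j] m k Mu Weyl_left_zero by (intro exI[of _ 1] exI[of _ 0]) simp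
    next
      case 3
      then show ?thesis using f.mu_z_off[of m i j] m k Mu Weyl_left_zero by (intro exI[of _ 0]) auto
    qed
  next
    case (Nu m)
    then have m: "1 \<le> m" "m < n" using assms(1) by (auto simp: simple_roots_def)
    consider "j = m" | "j = Suc m" | "j \<noteq> m" "j \<noteq> Suc m" by blast
    then show ?thesis
    proof cases
      case 1
      have "Weyl_left ys (w i (Suc m))" using Weyl_left_w[of "xs @ [k]" ys "(i, Suc m)"] grid_before(1)[OF g, of "(i, Suc m)"] g k m 1
        by (auto simp: before_def)
      moreover have "F \<alpha> * w i j = q powi (-1) *\<^sub>C (w i j * F \<alpha>) + w i (Suc m)"
        using f.z_nu[of i m] m 1 k Nu by (simp add: qbr_def)
      ultimately show ?thesis using f.z_row[of i j "Suc m"] 1 m k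
        by (intro exI[of _ "-1"] exI[of _ "w i (Suc m)"]) simp
    next
      case 2
      then show ?thesis using f.nu_z_top[of m i] m k Nu Weyl_left_zero by (intro exI[of _ 1] exI[of _ 0]) simp
    next
      case 3
      then show ?thesis using f.nu_z_off[of m i j] m k Nu Weyl_left_zero by (intro exI[of _ 0]) auto
    qed
  qed (use assms in simp)
  then obtain c y where "Weyl_left ys y" "F \<alpha> * w i j = q powi c *\<^sub>C (w i j * F \<alpha>) + y" "y * w i j = q powi (c + 2) *\<^sub>C (w i j * y)"
    by blast
  then show "\<exists>c y y' \<epsilon> \<epsilon>'. Weyl_left ys y \<and> Weyl_left ys y' \<and> (\<epsilon> = 1 \<or> \<epsilon> = -1) \<and> (\<epsilon>' = 1 \<or> \<epsilon>' = -1) \<and>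
        F \<alpha> * w (fst k) (snd k) = q powi c *\<^sub>C (w (fst k) (snd k) * F \<alpha>) + y + y' \<and>
        y * w (fst k) (snd k) = q powi (c + 2 * \<epsilon>) *\<^sub>C (w (fst k) (snd k) * y) \<and>
        y' * w (fst k) (snd k) = q powi (c + 2 * \<epsilon>') *\<^sub>C (w (fst k) (snd k) * y')"
    by (intro exI[of _ c] exI[of _ y] exI[of _ "0::'a"] exI[of _ 1]) (simp add: Weyl_left_zero k)
qed

lemma Weyl_left_unit_chain:
  assumes "\<And>m. 1 \<le> m \<Longrightarrow> m < i \<Longrightarrow> Weyl_left ys (x m)" "grid n = xs @ ys"
  shows "Weyl_left ys (unit_chain q x i)"
  using assms(1)
proof (induction i)
  case (Suc i)
  have gd: "Weyl_left ys (a - b)" if "Weyl_left ys a" "Weyl_left ys b" for a b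
    using Weyl_left_add[OF that(1) Weyl_left_scale[OF that(2), of "-1"]] by simp
  show ?case using Suc Weyl_left_1 by (auto simp: qbr_def intro!: gd Weyl_left_scale Weyl_left_mult[OF assms(2)])
qed (simp add: Weyl_left_1)

text \<open>Past \<open>w 1 1\<close> the errors are multiples of \<open>K Beta\<close> and
  \<open>Ki Beta\<close>; past any other entry the error is a product of generators
  \<open>F \<alpha>\<close> with \<alpha> other than \<open>Beta\<close> and \<open>Ki Beta\<close>.
  All of these have been treated before.\<close>

lemma Weyl_left_E_Beta: assumes "grid n = xs @ ys" shows "Weyl_left ys (E Beta)"
  using par_gens(3)[of Beta] assms
proof (rule Weyl_left_induct)
  show "Beta \<in> simple_roots n" by simp
  fix xs k ys assume g: "grid n = xs @ k # ys" and "k \<in> {1..n} \<times> {1..n}"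
  then obtain i j where k: "k = (i, j)" "1 \<le> i" "i \<le> n" "1 \<le> j" "j \<le> n" by (cases k) auto
  have g': "grid n = (xs @ [k]) @ ys" using g by simp
  have "\<exists>c y y' \<epsilon> \<epsilon>'. Weyl_left ys y \<and> Weyl_left ys y' \<and> (\<epsilon> = 1 \<or> \<epsilon> = -1) \<and> (\<epsilon>' = 1 \<or> \<epsilon>' = -1) \<and>
        E Beta * w i j = q powi c *\<^sub>C (w i j * E Beta) + y + y' \<and>
        y * w i j = q powi (c + 2 * \<epsilon>) *\<^sub>C (w i j * y) \<and>
        y' * w i j = q powi (c + 2 * \<epsilon>') *\<^sub>C (w i j * y')"
  proof (cases "(i, j) = (1, 1)")
    case True
    define t where "t = 1 / (q - inverse q)"
    have KK: "K Beta * w i j = q powi (-2) *\<^sub>C (w i j * K Beta)" "Ki Beta * w i j = q powi 2 *\<^sub>C (w i j * Ki Beta)"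
      using K_w[of Beta i j] Ki_w[of Beta i j] k True by simp_all
    show ?thesis
    proof (intro exI conjI)
      show "Weyl_left ys (t *\<^sub>C K Beta)" by (rule Weyl_left_scale[OF Weyl_left_K[OF _ g']]) simp
      show "Weyl_left ys (- t *\<^sub>C Ki Beta)" by (rule Weyl_left_scale[OF Weyl_left_Ki[OF _ g']]) simp
      show "E Beta * w i j = q powi 0 *\<^sub>C (w i j * E Beta) + t *\<^sub>C K Beta + - t *\<^sub>C Ki Beta"
        using E_beta_w_11 True by (simp add: t_def[symmetric] scaleC_diff_right)
      show "t *\<^sub>C K Beta * w i j = q powi (0 + 2 * -1) *\<^sub>C (w i j * t *\<^sub>C K Beta)"
        "- t *\<^sub>C Ki Beta * w i j = q powi (0 + 2 * 1) *\<^sub>C (w i j * - t *\<^sub>C Ki Beta)"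
        using KK by (simp_all add: mult_scaleC_left mult_scaleC_right scaleC_scaleC mult.commute)
    qed auto
  next
    case False
    then obtain d where d: "E Beta * w i j = w i j * E Beta + d *\<^sub>C (fm i * fn j * Ki Beta)"
      using E_beta_w[of i j] k by blast
    have "Weyl_left ys (fm i)" "Weyl_left ys (fn j)"
      by (rule Weyl_left_unit_chain[OF Weyl_left_F[OF _ _ g'] g'], use k in auto)+
    then have "Weyl_left ys (d *\<^sub>C (fm i * fn j * Ki Beta))"
      by (intro Weyl_left_scale Weyl_left_mult[OF g'] Weyl_left_Ki[OF _ g']) auto
    then show ?thesis using d E_beta_coeff[of i j] False k
      by (intro exI[of _ 0] exI[of _ "d *\<^sub>C (fm i * fn j * Ki Beta)"] exI[of _ 0] exI[of _ 1])
         (simp add: Weyl_left_zero power2_eq_square mult_scaleC_left mult_scaleC_right scaleC_scaleC mult.commute)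
  qed
  then show "\<exists>c y y' \<epsilon> \<epsilon>'. Weyl_left ys y \<and> Weyl_left ys y' \<and> (\<epsilon> = 1 \<or> \<epsilon> = -1) \<and> (\<epsilon>' = 1 \<or> \<epsilon>' = -1) \<and>
        E Beta * w (fst k) (snd k) = q powi c *\<^sub>C (w (fst k) (snd k) * E Beta) + y + y' \<and>
        y * w (fst k) (snd k) = q powi (c + 2 * \<epsilon>) *\<^sub>C (w (fst k) (snd k) * y) \<and>
        y' * w (fst k) (snd k) = q powi (c + 2 * \<epsilon>') *\<^sub>C (w (fst k) (snd k) * y')"
    by (simp add: k)
qed

text \<open>In contrast to the other generators, \<open>E \<alpha>\<close> for \<open>\<alpha> \<noteq> Beta\<close> moves a factor of a monomial to an
  earlier position, so the induction runs over initial segments of \<open>grid n\<close>.\<close>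

lemma skew_derivation:
  assumes ys: "rev (grid n) = xs @ ys"
    and \<kappa>: "\<And>k. k \<in> {1..n} \<times> {1..n} \<Longrightarrow> \<kappa> * w (fst k) (snd k) = q powi c k *\<^sub>C (w (fst k) (snd k) * \<kappa>)"
    and step: "\<And>xs k ys. rev (grid n) = xs @ k # ys \<Longrightarrow> k \<in> {1..n} \<times> {1..n} \<Longrightarrow>
      u * w (fst k) (snd k) = w (fst k) (snd k) * u \<or>
      (\<exists>r\<in>set ys. c k = -1 \<and> u * w (fst k) (snd k) = w (fst k) (snd k) * u + w (fst r) (snd r) * \<kappa> \<and>
         w (fst k) (snd k) * w (fst r) (snd r) = q *\<^sub>C (w (fst r) (snd r) * w (fst k) (snd k)))"
  shows "\<exists>D. W.inW (set ys) D \<and> (\<forall>v\<in>WR.tail ys. u * v = v * u + D v * \<kappa>)"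
  using ys
proof (induction ys arbitrary: xs)
  case Nil
  have "\<forall>v\<in>WR.tail []. u * v = v * u + 0 * \<kappa>" using span_Wm_empty[of _ u] by (simp add: WR.tail_def)
  then show ?case using W.inW_zero by blast
next
  case (Cons k ys)
  note ps = Cons.prems
  have k: "k \<in> {1..n} \<times> {1..n}" "set (k # ys) \<subseteq> {1..n} \<times> {1..n}" "{k} \<subseteq> set (k # ys)" "set ys \<subseteq> set (k # ys)"
    unfolding set_grid[symmetric] set_rev[of "grid n", symmetric] ps by auto
  have ys: "set ys \<subseteq> {1..n} \<times> {1..n}" using k by auto
  obtain D where D: "W.inW (set ys) D" "\<forall>v\<in>WR.tail ys. u * v = v * u + D v * \<kappa>"
    using Cons.IH[of "xs @ [k]"] ps by auto
  obtain s where s: "s \<noteq> 0" "Wp k = s *\<^sub>C w (fst k) (snd k)" using Wp_w[OF k(1)] by blast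
  let ?x = "Wp k"
  have \<kappa>x: "\<kappa> * ?x = q powi c k *\<^sub>C (?x * \<kappa>)"
    using \<kappa>[OF k(1)] by (simp add: s mult_scaleC_left mult_scaleC_right scaleC_scaleC mult.commute)
  \<comment> \<open>\<open>z * \<kappa>\<close> is the error of moving \<open>u\<close> past
    \<open>Wp k\<close>, with \<open>z\<close> zero or a multiple of an earlier entry, and
    \<open>R\<close> is right multiplication by \<open>z\<close>. The weight -2 consists of -1 from
    \<open>z\<close> and -1 from \<open>\<kappa>\<close>, so pushing through powers applies with
    \<epsilon> equal to -1.\<close>
  have "\<exists>z R. W.inW (set ys) R \<and> (\<forall>v\<in>WR.tail ys. R v = v * z) \<and> u * ?x = ?x * u + z * \<kappa> \<and> ?x * z = q *\<^sub>C (z * ?x) \<and>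
      z * \<kappa> * ?x = q powi (-2) *\<^sub>C (?x * (z * \<kappa>))"
  proof (cases "u * w (fst k) (snd k) = w (fst k) (snd k) * u")
    case True
    then show ?thesis using W.inW_zero
      by (intro exI[of _ 0] exI[of _ "\<lambda>v. 0"]) (simp add: s mult_scaleC_left mult_scaleC_right)
  next
    case False
    then obtain r where r: "r \<in> set ys" "c k = -1" "u * w (fst k) (snd k) = w (fst k) (snd k) * u + w (fst r) (snd r) * \<kappa>"
      "w (fst k) (snd k) * w (fst r) (snd r) = q *\<^sub>C (w (fst r) (snd r) * w (fst k) (snd k))"
      using step[OF ps k(1)] by blast
    obtain t where t: "t \<noteq> 0" "Wp r = t *\<^sub>C w (fst r) (snd r)" using Wp_w[of r] r(1) ys by blast
    then have w: "w (fst r) (snd r) = inverse t *\<^sub>C Wp r" by (simp add: scaleC_scaleC scaleC_one)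
    obtain R where R: "W.inW (set ys) R" "\<And>v. v \<in> WR.tail ys \<Longrightarrow> v * Wp r = R v"
      using WR.l_tail[of "xs @ [k]" ys r] r(1) ps by auto
    define z where "z = s *\<^sub>C w (fst r) (snd r)"
    have "v * z = (s * inverse t) *\<^sub>C R v" if "v \<in> WR.tail ys" for v
      unfolding z_def w R(2)[OF that, symmetric] by (simp add: mult_scaleC_right scaleC_scaleC)
    moreover have xz: "?x * z = q *\<^sub>C (z * ?x)"
      using r(4) unfolding z_def s by (simp add: mult_scaleC_left mult_scaleC_right scaleC_scaleC ac_simps)
    moreover have "z * \<kappa> * ?x = q powi (-2) *\<^sub>C (?x * (z * \<kappa>))"
    proof -
      have "z * ?x = inverse q *\<^sub>C (?x * z)" unfolding xz using q0 by (simp add: scaleC_scaleC scaleC_one)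
      moreover have "z * \<kappa> * ?x = q powi (-1) *\<^sub>C (z * ?x * \<kappa>)" using \<kappa>x r(2) by (simp add: mult.assoc mult_scaleC_right)
      ultimately show ?thesis by (simp add: mult_scaleC_left scaleC_scaleC mult.assoc power_int_minus power2_eq_square)
    qed
    moreover have "u * ?x = ?x * u + z * \<kappa>"
      using r(3) by (simp add: s z_def mult_scaleC_left mult_scaleC_right scaleC_add_right)
    ultimately show ?thesis using W.inW_scale[OF R(1), of "s * inverse t"]
      by (intro exI[of _ z] exI[of _ "\<lambda>v. (s * inverse t) *\<^sub>C R v"]) simp
  qed
  then obtain z R where R: "W.inW (set ys) R" "\<And>v. v \<in> WR.tail ys \<Longrightarrow> R v = v * z"
    and z: "u * ?x = ?x * u + z * \<kappa>" "?x * z = q *\<^sub>C (z * ?x)" "z * \<kappa> * ?x = q powi (-2) *\<^sub>C (?x * (z * \<kappa>))" by blast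
  define D' where "D' v = D (W.Hpow k (c k) v) + R (W.Cop k 0 v)" for v
  have D': "W.inW (set (k # ys)) D'" unfolding D'_def
    by (rule W.inW_add[OF W.inW_comp[OF k(2) W.inW_mono[OF k(4) D(1)] W.inW_mono[OF k(3) W.inW_Hpow[OF k(1)]]]
      W.inW_comp[OF k(2) W.inW_mono[OF k(4) R(1)] W.inW_mono[OF k(3) W.inW_Cop[OF k(1)]]]])
  have pw: "((\<lambda>u. u * ?x) ^^ j) v = v * ?x ^ j" for j v
    by (induction j) (simp_all add: mult.assoc power_Suc2 del: power_Suc)
  have \<kappa>p: "\<kappa> * ?x ^ j = q powi (c k * int j) *\<^sub>C (?x ^ j * \<kappa>)" for j
    using power_push_mult[OF q0 q_diff, of 1 1 \<kappa> ?x "c k" 0 0 j] \<kappa>x by simp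
  have zp: "?x ^ j * z = q ^ j *\<^sub>C (z * ?x ^ j)" for j
  proof (induction j)
    case (Suc j)
    have "?x ^ Suc j * z = ?x ^ j * (?x * z)" by (simp add: power_Suc2 mult.assoc del: power_Suc)
    also have "\<dots> = q *\<^sub>C (?x ^ j * z * ?x)" unfolding z(2) by (simp add: mult_scaleC_right mult.assoc)
    finally show ?case unfolding Suc by (simp add: mult_scaleC_left scaleC_scaleC mult.assoc power_Suc2 del: power_Suc)
  qed simp
  \<comment> \<open>Moving \<open>z\<close> to the front cancels the power of \<open>q\<close> left
    by the push. The coefficient becomes the bare \<open>qint q j\<close>, which
    \<open>Cop k 0\<close> provides.\<close>
  have up: "u * ?x ^ j = ?x ^ j * u + qint q j *\<^sub>C (z * ?x ^ (j - 1) * \<kappa>)" for j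
  proof (cases j)
    case (Suc i)
    have "u * ?x ^ j = ?x ^ j * u + (q powi (- int i) * qint q j) *\<^sub>C (?x ^ i * (z * \<kappa>))"
      using power_push_mult[OF q0 q_diff, of "-1" 1 u ?x 0 "z * \<kappa>" 0 j] z(1,3) Suc by simp
    also have "?x ^ i * (z * \<kappa>) = q ^ i *\<^sub>C (z * ?x ^ i * \<kappa>)"
      using arg_cong[OF zp[of i], of "\<lambda>v. v * \<kappa>"] by (simp add: mult.assoc mult_scaleC_left)
    finally show ?thesis using q0 Suc by (simp add: scaleC_scaleC power_int_minus)
  qed simp
  have "u * v = v * u + D' v * \<kappa>" if v: "v \<in> WR.tail (k # ys)" for v
  proof (rule WR.tail_Cons_eq[OF ps _ _ _ v])
    show "linear_on (WR.tail (k # ys)) (\<lambda>v. u * v)" by (simp add: linear_on_def ring_distribs scaleC_mult)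
    have "linear_on Am (\<lambda>v. v * u + D' v * \<kappa>)"
      using W.inW_linear[OF k(2) D'] by (simp add: linear_on_def ring_distribs scaleC_mult scaleC_add_right)
    then show "linear_on (WR.tail (k # ys)) (\<lambda>v. v * u + D' v * \<kappa>)"
      by (rule WR.linear_on_subset) (use WR.tail_A[OF k(2)] in auto)
    fix v j assume v: "v \<in> WR.tail ys"
    have in_A: "v * ?x ^ i \<in> Am" for i using WR.lpow_in[OF ps v, of i] by (simp add: pw)
    have "u * (v * ?x ^ j) = v * (u * ?x ^ j) + D v * (\<kappa> * ?x ^ j)"
      using D(2) v by (simp add: mult.assoc[symmetric] ring_distribs)
    also have "v * (u * ?x ^ j) = v * ?x ^ j * u + qint q j *\<^sub>C (R v * ?x ^ (j - 1) * \<kappa>)"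
      unfolding up R(2)[OF v] by (simp add: ring_distribs mult.assoc mult_scaleC_right)
    also have "qint q j *\<^sub>C (R v * ?x ^ (j - 1) * \<kappa>) = R (W.Cop k 0 (v * ?x ^ j)) * \<kappa>"
      using WR.Cop_lpow[OF ps v, of 0 j] WR.inW_tail(2)[OF R(1) ps order.refl v, of "j - 1"]
        W.linear_onD(2)[OF W.inW_linear[OF ys R(1)] in_A] by (simp add: pw mult_scaleC_left)
    also have "D v * (\<kappa> * ?x ^ j) = D (W.Hpow k (c k) (v * ?x ^ j)) * \<kappa>"
      using WR.Hpow_lpow[OF ps v, of "c k" j] WR.inW_tail(2)[OF D(1) ps order.refl v, of j]
        W.linear_onD(2)[OF W.inW_linear[OF ys D(1)] in_A] by (simp add: pw \<kappa>p mult_scaleC_left mult_scaleC_right mult.assoc)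
    finally show "u * ((\<lambda>u. u * ?x) ^^ j) v = ((\<lambda>u. u * ?x) ^^ j) v * u + D' (((\<lambda>u. u * ?x) ^^ j) v) * \<kappa>"
      unfolding pw D'_def by (simp add: ring_distribs)
  qed
  then show ?case using D' by blast
qed

lemma rev_grid_before: "rev (grid n) = xs @ k # ys \<Longrightarrow> r \<in> {1..n} \<times> {1..n} \<Longrightarrow> before r k \<Longrightarrow> r \<in> set ys"
  using grid_before(2)[of "rev ys" k "rev xs" r] by (metis append.assoc append_Cons append_Nil rev.simps(2) rev_append rev_rev_ident set_rev)

lemma Weyl_left_E: assumes "\<alpha> \<in> simple_roots n" "\<alpha> \<noteq> Beta" shows "Weyl_left (grid n) (E \<alpha>)"
proof -
  have "\<exists>D. W.inW (set (rev (grid n))) D \<and> (\<forall>v\<in>WR.tail (rev (grid n)). E \<alpha> * v = v * E \<alpha> + D v * K \<alpha>)"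
  proof (rule skew_derivation[where c = "\<lambda>k. root_weight \<alpha> (fst k) (snd k)" and xs = "[]"])
    show "K \<alpha> * w (fst k) (snd k) = q powi root_weight \<alpha> (fst k) (snd k) *\<^sub>C (w (fst k) (snd k) * K \<alpha>)" if "k \<in> {1..n} \<times> {1..n}" for k
      by (rule K_w) (use that assms in auto)
    fix xs k ys assume g: "rev (grid n) = xs @ k # ys" and "k \<in> {1..n} \<times> {1..n}"
    then obtain i j where k: "k = (i, j)" "1 \<le> i" "i \<le> n" "1 \<le> j" "j \<le> n" by (cases k) auto
    show "E \<alpha> * w (fst k) (snd k) = w (fst k) (snd k) * E \<alpha> \<or>
      (\<exists>r\<in>set ys. root_weight \<alpha> (fst k) (snd k) = -1 \<and> E \<alpha> * w (fst k) (snd k) = w (fst k) (snd k) * E \<alpha> + w (fst r) (snd r) * K \<alpha> \<and>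
         w (fst k) (snd k) * w (fst r) (snd r) = q *\<^sub>C (w (fst r) (snd r) * w (fst k) (snd k)))"
    proof (cases \<alpha>)
      case (Mu m)
      then have m: "1 \<le> m" "m < n" using assms(1) by (auto simp: simple_roots_def)
      show ?thesis
      proof (cases "i = Suc m")
        case True
        have "(m, j) \<in> set ys" using rev_grid_before[OF g, of "(m, j)"] k m True by (auto simp: before_def)
        then show ?thesis using E_mu_w[of m j] f.z_col[of m i j] k m True Mu by (auto intro!: bexI[of _ "(m, j)"])
      next
        case False
        then show ?thesis using E_mu_w_off[of m i j] k m Mu by simp
      qed
    next
      case (Nu m)
      then have m: "1 \<le> m" "m < n" using assms(1) by (auto simp: simple_roots_def)
      show ?thesis
      proof (cases "j = Suc m")
        case True
        have "(i, m) \<in> set ys" using rev_grid_before[OF g, of "(i, m)"] k m True by (auto simp: before_def)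
        then show ?thesis using E_nu_w[of i m] f.z_row[of i m j] k m True Nu by (auto intro!: bexI[of _ "(i, m)"])
      next
        case False
        then show ?thesis using E_nu_w_off[of m i j] k m Nu by simp
      qed
    qed (use assms in simp)
  qed simp
  then obtain D where D: "W.inW (set (grid n)) D" "\<forall>v\<in>Am. E \<alpha> * v = v * E \<alpha> + D v * K \<alpha>"
    unfolding WR.tail_all set_rev by blast
  show ?thesis unfolding Weyl_left_def
    by (rule Weyl_par.add[OF Weyl_par.elem[OF W.inW_id par_gens(3)[OF assms(1)] HOL.refl] Weyl_par.elem[OF D(1) par_gens(1)[OF assms(1)] HOL.refl]])
       (use D(2) in \<open>simp add: WL.tail_all\<close>)
qed

lemma Weyl_left_all: assumes "1 \<le> n" shows "Weyl_left (grid n) u"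
proof (induction u rule: uq_induct)
  case (E \<alpha>)
  then show ?case using Weyl_left_E Weyl_left_E_Beta[of "[]"] by (cases "\<alpha> = Beta") auto
next
  case (F \<alpha>)
  show ?case
  proof (cases "\<alpha> = Beta")
    case True
    \<comment> \<open>\<open>F Beta\<close> lies outside \<open>par\<close>; it is itself the first
      entry \<open>w 1 1\<close>.\<close>
    have "Weyl_left (grid n) (w 1 1)" using Weyl_left_w[of "[]" "grid n" "(1, 1)"] assms by simp
    then show ?thesis using True f.z_11 by simp
  qed (use F Weyl_left_F[of \<alpha> "[]"] in simp)
next
  case (K \<alpha>)
  then show ?case using Weyl_left_K[of \<alpha> "[]"] by simp
next
  case (Ki \<alpha>)
  then show ?case using Weyl_left_Ki[of \<alpha> "[]"] by simp
next
  case (cst c)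
  show ?case by (rule Weyl_left_scale[OF Weyl_left_1])
qed (auto intro: Weyl_left_add Weyl_left_mult[of "[]"])

end

section \<open>Generalized Verma modules\<close>

context uq_presented
begin

text \<open>The projection onto the part of degree 0 for the grading in which \<open>E Beta\<close> has degree 1.\<close>

lemma ex_projection:
  obtains \<pi> :: "'a \<Rightarrow> 'a" where
    "\<And>x y. x \<in> par \<Longrightarrow> y \<in> par \<Longrightarrow> \<pi> (x + y) = \<pi> x + \<pi> y" "\<And>c x. x \<in> par \<Longrightarrow> \<pi> (c *\<^sub>C x) = c *\<^sub>C \<pi> x"
    "\<And>x y. x \<in> par \<Longrightarrow> y \<in> par \<Longrightarrow> \<pi> (x * y) = \<pi> x * \<pi> y"
    "\<And>x. x \<in> Uk n g \<Longrightarrow> \<pi> x = x" "\<pi> (E Beta) = 0" "\<And>x. x \<in> par \<Longrightarrow> \<pi> x \<in> Uk n g"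
proof -
  define s :: "root \<Rightarrow> (int, 'a) rend" where "s \<alpha> = (if \<alpha> = Beta then shift 1 else 1)" for \<alpha>
  define t :: "root \<Rightarrow> (int, 'a) rend" where "t \<alpha> = (if \<alpha> = Beta then shift (-1) else 1)" for \<alpha>
  have "uq_algebra n q (\<lambda>\<alpha>. s \<alpha> * lmul (E \<alpha>)) (\<lambda>\<alpha>. t \<alpha> * lmul (F \<alpha>)) (\<lambda>\<alpha>. lmul (K \<alpha>)) (\<lambda>\<alpha>. lmul (Ki \<alpha>))"
    by (rule uq_algebra_rescale[OF alg_hom_uq_algebra[OF lmul_hom uq_algebra_g]])
       (auto simp: s_def t_def shift.rep_eq lmul.rep_eq app_simps fun_eq_iff intro!: rend_eqI split: if_splits)
  then obtain \<phi> :: "'a \<Rightarrow> (int, 'a) rend" where \<phi>: "alg_hom \<phi>"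
    "\<And>\<alpha>. \<alpha> \<in> simple_roots n \<Longrightarrow> \<phi> (E \<alpha>) = s \<alpha> * lmul (E \<alpha>)" "\<And>\<alpha>. \<alpha> \<in> simple_roots n \<Longrightarrow> \<phi> (F \<alpha>) = t \<alpha> * lmul (F \<alpha>)"
    "\<And>\<alpha>. \<alpha> \<in> simple_roots n \<Longrightarrow> \<phi> (K \<alpha>) = lmul (K \<alpha>)" "\<And>\<alpha>. \<alpha> \<in> simple_roots n \<Longrightarrow> \<phi> (Ki \<alpha>) = lmul (Ki \<alpha>)"
    by (rule ex_hom) blast
  interpret H: alg_hom \<phi> by fact
  define m :: "int \<Rightarrow> 'a" where "m i = of_bool (i = 0)" for i
  \<comment> \<open>On \<open>par\<close> the degree never decreases: \<open>E Beta\<close> acts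
    with \<open>shift 1\<close>, the other generators without a shift. So functions supported in
    degrees at least 0 form an invariant space on which the entry in degree 0 is
    multiplicative.\<close>
  define Adm :: "(int \<Rightarrow> 'a) \<Rightarrow> bool" where "Adm f \<longleftrightarrow> (\<forall>i<0. f i = 0)" for f
  define \<pi> where "\<pi> x = app (\<phi> x) m 0" for x
  define X where "X = GenK ` simple_roots n \<union> GenKinv ` simple_roots n \<union> GenE ` (simple_roots n - {Beta}) \<union> GenF ` (simple_roots n - {Beta})"
  have \<phi>X: "\<phi> (g x) = lmul (g x)" if "x \<in> X" for x
    using that unfolding X_def by (auto simp: \<phi>(2-5) s_def t_def split: if_splits)
  have Ukeq: "Uk n g = subalgebra_gen (g ` X)" unfolding Uk_def X_def by simp
  have pareq: "par = subalgebra_gen (insert (E Beta) (g ` X))"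
    unfolding par_def X_def by (rule arg_cong[of _ _ subalgebra_gen]) auto
  have main: "Adm (app (\<phi> p) f) \<and> app (\<phi> p) f 0 = \<pi> p * f 0" if "p \<in> par" "Adm f" for p f
    unfolding \<pi>_def
  proof (rule coefficient_hom[where Adm = Adm and t = "\<lambda>x. app (\<phi> x) m 0", OF \<phi>(1) _ _ _ _ _ that(1)[unfolded pareq] that(2)])
    show "Adm (app (\<phi> x) f) \<and> app (\<phi> x) f 0 = app (\<phi> x) m 0 * f 0" if x: "x \<in> insert (E Beta) (g ` X)" and f: "Adm f" for x f
      using x
    proof
      assume "x = E Beta"
      then show ?thesis using f by (simp add: \<phi>(2) s_def Adm_def m_def shift.rep_eq lmul.rep_eq app_simps)
    next
      assume "x \<in> g ` X"
      then show ?thesis using f by (auto simp: \<phi>X Adm_def m_def lmul.rep_eq)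
    qed
  qed (simp_all add: Adm_def m_def)
  have Am: "Adm m" "m 0 = 1" by (simp_all add: Adm_def m_def)
  have mult: "\<pi> (x * y) = \<pi> x * \<pi> y" if "x \<in> par" "y \<in> par" for x y
    using main[OF that(1)] main[OF that(2) Am(1)] Am(2) by (simp add: \<pi>_def H.mult app_simps)
  have lin: "\<pi> (x + y) = \<pi> x + \<pi> y" "\<pi> (c *\<^sub>C x) = c *\<^sub>C \<pi> x" "\<pi> 1 = 1" for x y c
    by (simp_all add: \<pi>_def H.add H.scale H.one app_simps Am)
  have gen: "\<pi> (g x) = g x" if "x \<in> X" for x using \<phi>X[OF that] by (simp add: \<pi>_def lmul.rep_eq Am)
  have Eb: "\<pi> (E Beta) = 0" by (simp add: \<pi>_def \<phi>(2) s_def m_def shift.rep_eq lmul.rep_eq app_simps)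
  have id: "\<pi> x = x" if "x \<in> Uk n g" for x
    using that unfolding Ukeq
    by induction (auto simp: gen lin mult Uk_par[unfolded Ukeq])
  have "\<pi> x \<in> Uk n g" if "x \<in> par" for x
    using that unfolding pareq
  proof induction
    case (mult x y)
    then show ?case using \<open>\<And>x y. x \<in> par \<Longrightarrow> y \<in> par \<Longrightarrow> \<pi> (x * y) = \<pi> x * \<pi> y\<close>[of x y]
      unfolding pareq Ukeq by (simp add: subalgebra_gen.mult)
  qed (auto simp: lin gen Eb Ukeq intro: subalgebra_gen.intros subalgebra_gen_zero)
  then show thesis by (intro that[of \<pi>] lin(1,2) mult id Eb)
qed

text \<open>Every \<open>Z\<close> is a nested bracket with \<open>E Beta\<close> innermost, so a
  linear multiplicative map on \<open>par\<close> that kills \<open>E Beta\<close> kills them all.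
  The map is left general; it is applied to the projection of \<open>ex_projection\<close>.\<close>

lemma Zel_par:
  assumes "1 \<le> i" "i \<le> n" "1 \<le> j" "j \<le> n"
  shows "Zel q g i j \<in> par"
    and "\<lbrakk>\<And>x y. x \<in> par \<Longrightarrow> y \<in> par \<Longrightarrow> f (x + y) = f x + f y; \<And>c x. x \<in> par \<Longrightarrow> f (c *\<^sub>C x) = c *\<^sub>C f x;
      \<And>x y. x \<in> par \<Longrightarrow> y \<in> par \<Longrightarrow> f (x * y) = f x * f y; f (E Beta) = (0 :: 'a)\<rbrakk> \<Longrightarrow> f (Zel q g i j) = 0"
proof -
  have qb: "qbr q x y \<in> par" if "x \<in> par" "y \<in> par" for x y
    using subalgebra_gen_qbr that unfolding par_def by blast
  have "qmat q E i j \<in> par \<and> ((\<forall>x\<in>par. \<forall>y\<in>par. f (x + y) = f x + f y) \<longrightarrow> (\<forall>c. \<forall>x\<in>par. f (c *\<^sub>C x) = c *\<^sub>C f x) \<longrightarrow>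
      (\<forall>x\<in>par. \<forall>y\<in>par. f (x * y) = f x * f y) \<longrightarrow> f (E Beta) = 0 \<longrightarrow> f (qmat q E i j) = 0)" (is "?P i j")
  proof -
    have q: "f (qbr q x y) = 0" if "\<forall>x\<in>par. \<forall>y\<in>par. f (x + y) = f x + f y" "\<forall>c. \<forall>x\<in>par. f (c *\<^sub>C x) = c *\<^sub>C f x"
      "\<forall>x\<in>par. \<forall>y\<in>par. f (x * y) = f x * f y" "x \<in> par" "y \<in> par" "f y = 0" for x y
    proof -
      have "qbr q x y = x * y + (- inverse q) *\<^sub>C (y * x)" by (simp add: qbr_def)
      then have "f (qbr q x y) = f (x * y) + f ((- inverse q) *\<^sub>C (y * x))"
        by (simp only:) (use that(1,4,5) par_alg(3,4) in blast)
      moreover have "f ((- inverse q) *\<^sub>C (y * x)) = (- inverse q) *\<^sub>C f (y * x)"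
        using that(2,4,5) par_alg(4) by blast
      moreover have "f (x * y) = f x * f y" "f (y * x) = f y * f x" using that(3-5) by blast+
      ultimately show ?thesis using that(6) by simp
    qed
    have 1: "?P 1 j" using assms(3,4)
    proof (induction j rule: nat_induct_at_least)
      case base
      then show ?case using par_gens(3)[of Beta] e.z_11 by simp
    next
      case (Suc j)
      then show ?case using e.z_1_nu[of j] qb q par_gens(3)[of "Nu j"] by simp
    qed
    show ?thesis using assms(1,2)
    proof (induction i rule: nat_induct_at_least)
      case (Suc i)
      then show ?case using e.z_mu[of i j] qb q par_gens(3)[of "Mu i"] by simp
    qed (rule 1)
  qed
  then show "Zel q g i j \<in> par" "\<lbrakk>\<And>x y. x \<in> par \<Longrightarrow> y \<in> par \<Longrightarrow> f (x + y) = f x + f y; \<And>c x. x \<in> par \<Longrightarrow> f (c *\<^sub>C x) = c *\<^sub>C f x;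
      \<And>x y. x \<in> par \<Longrightarrow> y \<in> par \<Longrightarrow> f (x * y) = f x * f y; f (E Beta) = (0 :: 'a)\<rbrakk> \<Longrightarrow> f (Zel q g i j) = 0"
    unfolding Zel_z[OF assms] by blast+
qed

text \<open>The coefficients form a total function that vanishes off a finite set, so that
  uniqueness of the expansion becomes the plain equation \<open>p = p'\<close>.\<close>

definition expn :: "'a \<Rightarrow> ((nat \<times> nat \<Rightarrow> nat) \<Rightarrow> 'a) \<Rightarrow> bool" where
  "expn u p \<longleftrightarrow> (\<forall>b. p b \<in> par) \<and>
    (\<exists>B. finite B \<and> B \<subseteq> multi_indices n \<and> (\<forall>b. b \<notin> B \<longrightarrow> p b = 0) \<and> u = (\<Sum>b\<in>B. Wm b * p b))"

lemma expn_sum: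
  assumes "finite B" "B \<subseteq> C" "finite C" "\<forall>b. b \<notin> B \<longrightarrow> p b = 0"
  shows "(\<Sum>b\<in>B. Wm b * p b) = (\<Sum>b\<in>C. Wm b * p b)"
  by (rule sum.mono_neutral_left) (use assms in auto)

lemma expn_add: assumes "expn u p" "expn v p'" shows "expn (u + v) (\<lambda>b. p b + p' b)"
proof -
  obtain B where B: "finite B" "B \<subseteq> multi_indices n" "\<forall>b. b \<notin> B \<longrightarrow> p b = 0" "u = (\<Sum>b\<in>B. Wm b * p b)"
    using assms(1) unfolding expn_def by blast
  obtain C where C: "finite C" "C \<subseteq> multi_indices n" "\<forall>b. b \<notin> C \<longrightarrow> p' b = 0" "v = (\<Sum>b\<in>C. Wm b * p' b)"
    using assms(2) unfolding expn_def by blast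
  have "u + v = (\<Sum>b\<in>B \<union> C. Wm b * (p b + p' b))"
    using expn_sum[OF B(1) _ _ B(3), of "B \<union> C"] expn_sum[OF C(1) _ _ C(3), of "B \<union> C"] B C
    by (simp add: ring_distribs sum.distrib)
  then show ?thesis using assms B C par_alg(2) unfolding expn_def by (auto intro!: exI[of _ "B \<union> C"])
qed

lemma expn_mult: "expn u p \<Longrightarrow> x \<in> par \<Longrightarrow> expn (u * x) (\<lambda>b. p b * x)"
  unfolding expn_def using par_alg(4) by (auto simp: sum_distrib_right mult.assoc)

lemma expn_scale: "expn u p \<Longrightarrow> expn (c *\<^sub>C u) (\<lambda>b. c *\<^sub>C p b)"
  using expn_mult[of u p "c *\<^sub>C 1"] par_alg(1,3) by (simp add: scaleC_mult)

lemma expn_unique: assumes "expn u p" "expn u p'" shows "p = p'"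
proof
  fix b
  have d: "expn 0 (\<lambda>b. p b + (-1) *\<^sub>C p' b)"
    using expn_add[OF assms(1) expn_scale[OF assms(2), of "-1"]] by simp
  then obtain B where "finite B" "B \<subseteq> multi_indices n" "\<forall>b. b \<notin> B \<longrightarrow> p b + (-1) *\<^sub>C p' b = 0"
    "0 = (\<Sum>b\<in>B. Wm b * (p b + (-1) *\<^sub>C p' b))" unfolding expn_def by blast
  then have "p b + (-1) *\<^sub>C p' b = 0"
    using W_free_par[of B "\<lambda>b. p b + (-1) *\<^sub>C p' b" b] d unfolding expn_def by metis
  then show "p b = p' b" by simp
qed

lemma expn_Am: assumes "v \<in> Am" shows "\<exists>c. expn v (\<lambda>b. c b *\<^sub>C 1) \<and> (v = 0 \<longleftrightarrow> c = (\<lambda>b. 0))"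
proof -
  obtain B c where B: "finite B" "B \<subseteq> exps ({1..n} \<times> {1..n})" "v = (\<Sum>b\<in>B. c b *\<^sub>C Wm b)"
    using W.A_expand[OF assms] by blast
  define d where "d b = (if b \<in> B then c b else 0)" for b
  have v: "v = (\<Sum>b\<in>B. Wm b * (d b *\<^sub>C 1))" unfolding B(3) by (rule sum.cong) (auto simp: d_def scaleC_mult)
  have e: "expn v (\<lambda>b. d b *\<^sub>C 1)"
    unfolding expn_def using B v par_alg(1,3) by (auto simp: multi_indices_eq d_def intro!: exI[of _ B])
  have "d = (\<lambda>b. 0)" if "v = 0"
    using expn_unique[OF e[unfolded that] expn_scale[OF e, of 0, simplified]] by (auto simp: fun_eq_iff dest: fun_cong)
  then show ?thesis using e v by auto
qed

text \<open>Apply \<open>Weyl_left_all\<close> to the vector 1: then \<open>u\<close> is a sum of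
  products of elements \<open>D 1\<close> of \<open>Am\<close> with elements of
  \<open>par\<close>.\<close>

lemma ex_expn: assumes "1 \<le> n" shows "\<exists>p. expn u p"
proof -
  have A1: "1 \<in> Am" unfolding Aminus_def by (rule subalgebra_gen.one)
  then have t: "1 \<in> WL.tail (grid n)" unfolding WL.tail_all .
  have "\<exists>p. expn (T 1) p" if "Weyl_par (grid n) T" for T
    using that
  proof (induction rule: Weyl_par.induct)
    case (elem D x T)
    have "D 1 \<in> Am" by (rule W.inW_in[OF _ elem(1) A1]) simp
    then show ?case using expn_Am[of "D 1"] expn_mult[OF _ elem(2)] elem(3)[OF t] by metis
  next
    case (add S T R)
    then show ?case using expn_add add.hyps(3)[OF t] by metis
  qed
  from this[OF Weyl_left_all[OF assms, of u, unfolded Weyl_left_def]] show ?thesis by simp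
qed

end

text \<open>\<open>\<sigma>\<close> is the action of \<open>par\<close> on \<open>V\<close> that
  extends \<open>\<rho>\<close>; it arises as \<open>\<rho>\<close> after the projection of
  \<open>par\<close> onto \<open>Uk n g\<close>.\<close>

locale parabolic_rep = uq_presented n q g for n q and g :: "gen \<Rightarrow> 'a::complex_algebra" +
  fixes \<rho> \<sigma> :: "'a \<Rightarrow> complex ^ 'd ^ 'd"
  assumes n1: "1 \<le> n"
    and \<sigma>_add: "x \<in> par \<Longrightarrow> y \<in> par \<Longrightarrow> \<sigma> (x + y) = \<sigma> x + \<sigma> y"
    and \<sigma>_mult: "x \<in> par \<Longrightarrow> y \<in> par \<Longrightarrow> \<sigma> (x * y) = \<sigma> x ** \<sigma> y"
    and \<sigma>_scale: "x \<in> par \<Longrightarrow> \<sigma> (c *\<^sub>C x) = (\<chi> i j. c * \<sigma> x $ i $ j)"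
    and \<sigma>_1: "\<sigma> 1 = mat 1"
    and \<sigma>_Uk: "x \<in> Uk n g \<Longrightarrow> \<sigma> x = \<rho> x"
    and \<sigma>_Z: "i \<in> {1..n} \<Longrightarrow> j \<in> {1..n} \<Longrightarrow> \<sigma> (Zel q g i j) = 0"

lemma (in uq_presented) ex_parabolic_rep:
  assumes "1 \<le> n" "Uk_rep n g \<rho>" shows "\<exists>\<sigma>. parabolic_rep n q g \<rho> \<sigma>"
proof -
  obtain \<pi> :: "'a \<Rightarrow> 'a" where \<pi>:
    "\<And>x y. x \<in> par \<Longrightarrow> y \<in> par \<Longrightarrow> \<pi> (x + y) = \<pi> x + \<pi> y" "\<And>c x. x \<in> par \<Longrightarrow> \<pi> (c *\<^sub>C x) = c *\<^sub>C \<pi> x"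
    "\<And>x y. x \<in> par \<Longrightarrow> y \<in> par \<Longrightarrow> \<pi> (x * y) = \<pi> x * \<pi> y"
    "\<And>x. x \<in> Uk n g \<Longrightarrow> \<pi> x = x" "\<pi> (E Beta) = 0" "\<And>x. x \<in> par \<Longrightarrow> \<pi> x \<in> Uk n g"
    by (rule ex_projection) blast
  note \<rho> = assms(2)[unfolded Uk_rep_def]
  have one: "1 \<in> Uk n g" unfolding Uk_def by (rule subalgebra_gen.one)
  have "\<rho> (0 *\<^sub>C 1) = (\<chi> i j. 0 * \<rho> 1 $ i $ j)" using \<rho> one by blast
  then have zero: "\<rho> 0 = 0" by (simp add: vec_eq_iff)
  have "parabolic_rep n q g \<rho> (\<lambda>x. \<rho> (\<pi> x))"
  proof unfold_locales
    show "\<rho> (\<pi> (Zel q g i j)) = 0" if "i \<in> {1..n}" "j \<in> {1..n}" for i j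
      using Zel_par(2)[of i j \<pi>] \<pi>(1,2,3,5) that zero by simp
  qed (use assms(1) \<rho> \<pi> one in simp_all)
  then show ?thesis by blast
qed

context parabolic_rep
begin

abbreviation "bal \<equiv> balancing n q g \<rho>"

lemma bal_closed: "0 \<in> bal" "x \<in> bal \<Longrightarrow> y \<in> bal \<Longrightarrow> x + y \<in> bal" "x \<in> bal \<Longrightarrow> c *\<^sub>C x \<in> bal"
  "x \<in> bal \<Longrightarrow> y \<in> bal \<Longrightarrow> x - y \<in> bal" "(\<And>i. i \<in> I \<Longrightarrow> f i \<in> bal) \<Longrightarrow> sum f I \<in> bal"
  unfolding balancing_def by (auto intro: cvs.span_zero cvs.span_add cvs.span_scale cvs.span_diff cvs.span_sum)

lemma tensor_add: "a \<otimes>\<^sub>C (v + v') = a \<otimes>\<^sub>C v + a \<otimes>\<^sub>C v'" "(a + a') \<otimes>\<^sub>C v = a \<otimes>\<^sub>C v + a' \<otimes>\<^sub>C v"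
  "(c *\<^sub>C a) \<otimes>\<^sub>C v = c *\<^sub>C (a \<otimes>\<^sub>C v)" "a \<otimes>\<^sub>C (c *s v) = c *\<^sub>C (a \<otimes>\<^sub>C v)" "a \<otimes>\<^sub>C 0 = 0"
  unfolding tensor_def
  by (simp_all add: vec_eq_iff scaleC_add_left scaleC_add_right scaleC_vec_def scaleC_scaleC mult.commute)

text \<open>The balancing relations are imposed for \<open>Uk n g\<close> and the \<open>Z\<close>
  only. They extend to \<open>par\<close> because its remaining generator \<open>E Beta\<close> is
  \<open>Zel q g 1 1\<close>.\<close>

lemma balanced: assumes "x \<in> par" shows "(u * x) \<otimes>\<^sub>C v - u \<otimes>\<^sub>C (\<sigma> x *v v) \<in> bal"
proof -
  have "\<forall>u v. (u * x) \<otimes>\<^sub>C v - u \<otimes>\<^sub>C (\<sigma> x *v v) \<in> bal" if "x \<in> par" for x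
    using that unfolding par_def
  proof induction
    case (gen x)
    show ?case
    proof (cases "x = E Beta")
      case True
      have z: "E Beta = Zel q g 1 1" using Zel_z[of 1 1] n1 e.z_11 by simp
      have "\<sigma> x = 0" unfolding True z by (rule \<sigma>_Z) (use n1 in auto)
      moreover have "(u * x) \<otimes>\<^sub>C v \<in> bal" for u v
        unfolding True z balancing_def
        by (rule cvs.span_base, rule UnI2) (use n1 in \<open>auto intro!: exI[of _ u] exI[of _ "1::nat"] exI[of _ v]\<close>)
      ultimately show ?thesis by (simp add: tensor_add)
    next
      case False
      then have "x \<in> Uk n g" using gen unfolding Uk_def by (auto intro!: subalgebra_gen.gen)
      then show ?thesis unfolding \<sigma>_Uk[OF \<open>x \<in> Uk n g\<close>] balancing_def by (auto intro!: cvs.span_base)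
    qed
  next
    case one
    then show ?case by (simp add: \<sigma>_1 bal_closed)
  next
    case (add x y)
    then have p: "x \<in> par" "y \<in> par" by (simp_all add: par_def)
    show ?case
    proof (intro allI)
      fix u v
      have "(u * (x + y)) \<otimes>\<^sub>C v - u \<otimes>\<^sub>C (\<sigma> (x + y) *v v) = ((u * x) \<otimes>\<^sub>C v - u \<otimes>\<^sub>C (\<sigma> x *v v)) + ((u * y) \<otimes>\<^sub>C v - u \<otimes>\<^sub>C (\<sigma> y *v v))"
        by (simp add: \<sigma>_add[OF p] ring_distribs tensor_add matrix_vector_mult_add_rdistrib)
      then show "(u * (x + y)) \<otimes>\<^sub>C v - u \<otimes>\<^sub>C (\<sigma> (x + y) *v v) \<in> bal" using add.IH bal_closed(2) by simp
    qed
  next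
    case (scale x c)
    then have p: "x \<in> par" by (simp add: par_def)
    show ?case
    proof (intro allI)
      fix u v
      have "\<sigma> (c *\<^sub>C x) *v v = c *s (\<sigma> x *v v)"
        unfolding \<sigma>_scale[OF p] by (simp add: vec_eq_iff matrix_vector_mult_def sum_distrib_left mult.assoc)
      then have "(u * (c *\<^sub>C x)) \<otimes>\<^sub>C v - u \<otimes>\<^sub>C (\<sigma> (c *\<^sub>C x) *v v) = c *\<^sub>C ((u * x) \<otimes>\<^sub>C v - u \<otimes>\<^sub>C (\<sigma> x *v v))"
        by (simp add: mult_scaleC_right tensor_add cvs.scale_right_diff_distrib)
      then show "(u * (c *\<^sub>C x)) \<otimes>\<^sub>C v - u \<otimes>\<^sub>C (\<sigma> (c *\<^sub>C x) *v v) \<in> bal" using scale.IH bal_closed(3) by simp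
    qed
  next
    case (mult x y)
    then have p: "x \<in> par" "y \<in> par" by (simp_all add: par_def)
    show ?case
    proof (intro allI)
      fix u v
      have "(u * (x * y)) \<otimes>\<^sub>C v - u \<otimes>\<^sub>C (\<sigma> (x * y) *v v) = ((u * x * y) \<otimes>\<^sub>C v - (u * x) \<otimes>\<^sub>C (\<sigma> y *v v)) +
         ((u * x) \<otimes>\<^sub>C (\<sigma> y *v v) - u \<otimes>\<^sub>C (\<sigma> x *v (\<sigma> y *v v)))"
        by (simp add: \<sigma>_mult[OF p] mult.assoc matrix_vector_mul_assoc)
      then show "(u * (x * y)) \<otimes>\<^sub>C v - u \<otimes>\<^sub>C (\<sigma> (x * y) *v v) \<in> bal"
        using mult.IH bal_closed(2) by (simp only:)
    qed
  qed
  then show ?thesis using assms by blast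
qed

definition cf :: "'a \<Rightarrow> (nat \<times> nat \<Rightarrow> nat) \<Rightarrow> 'a" where "cf u = (SOME p. expn u p)"

lemma cf: "expn u (cf u)"
  unfolding cf_def using ex_expn[OF n1] by (rule someI_ex)

lemma cf_eq: "expn u p \<Longrightarrow> cf u = p"
  using expn_unique[OF cf] .

lemma cf_par: "cf u b \<in> par"
  using cf unfolding expn_def by blast

text \<open>Coordinates of the class of \<open>\<xi>\<close> in the Verma module with respect to the
  products of \<open>W\<close> monomials and basis vectors of \<open>V\<close>: expand over
  \<open>par\<close>, then let the coefficients act on \<open>V\<close>.\<close>

definition \<Phi> :: "'a ^ 'd \<Rightarrow> (nat \<times> nat \<Rightarrow> nat) \<Rightarrow> 'd \<Rightarrow> complex"
  where "\<Phi> \<xi> b k = (\<Sum>i\<in>UNIV. \<sigma> (cf (\<xi> $ i) b) $ k $ i)"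

lemma \<Phi>_lin: "\<Phi> (\<xi> + \<xi>') b k = \<Phi> \<xi> b k + \<Phi> \<xi>' b k" "\<Phi> (c *\<^sub>C \<xi>) b k = c * \<Phi> \<xi> b k"
  unfolding \<Phi>_def scaleC_vec_def
  by (simp_all add: cf_eq[OF expn_add[OF cf cf]] cf_eq[OF expn_scale[OF cf]] \<sigma>_add[OF cf_par cf_par] \<sigma>_scale[OF cf_par]
      sum.distrib sum_distrib_left)

lemma \<Phi>_tensor: "\<Phi> (u \<otimes>\<^sub>C v) b k = (\<sigma> (cf u b) *v v) $ k"
  unfolding \<Phi>_def tensor_def
  by (simp add: cf_eq[OF expn_scale[OF cf]] \<sigma>_scale[OF cf_par] matrix_vector_mult_def mult.commute)

lemma \<Phi>_bal: assumes "\<xi> \<in> bal" shows "\<Phi> \<xi> b k = 0"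
  using assms unfolding balancing_def
proof (induction rule: cvs.span_induct_alt)
  case base
  show ?case using \<Phi>_lin(2)[of 0 0 b k] by simp
next
  case (step c \<eta> \<zeta>)
  have diff: "\<Phi> (x - y) b k = \<Phi> x b k - \<Phi> y b k" for x y
    using \<Phi>_lin(1)[of "x - y" y b k] by simp
  have m: "\<sigma> (cf (u * x) b) = \<sigma> (cf u b) ** \<sigma> x" if "x \<in> par" for u x
    using cf_eq[OF expn_mult[OF cf that], of u] \<sigma>_mult[OF cf_par that] by simp
  have "\<Phi> \<eta> b k = 0"
    using step(1)
  proof
    assume "\<eta> \<in> {(u * x) \<otimes>\<^sub>C v - u \<otimes>\<^sub>C (\<rho> x *v v) | u x v. x \<in> Uk n g}"
    then show ?thesis by (auto simp: diff \<Phi>_tensor m Uk_par \<sigma>_Uk matrix_vector_mul_assoc)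
  next
    assume "\<eta> \<in> {(u * Zel q g i j) \<otimes>\<^sub>C v | u i j v. i \<in> {1..n} \<and> j \<in> {1..n}}"
    then show ?thesis using Zel_par(1) by (auto simp: \<Phi>_tensor m \<sigma>_Z matrix_vector_mult_def matrix_matrix_mult_def)
  qed
  then show ?case using step by (simp add: \<Phi>_lin)
qed

text \<open>Uniqueness of the representative in \<open>L_action\<close>. On vectors with entries in
  \<open>Am\<close> the coefficients are scalars, and \<open>\<Phi>\<close>, which vanishes on
  \<open>bal\<close>, reads them off.\<close>

lemma bal_Am: assumes "\<xi> \<in> bal" "\<xi> \<in> tensor_space Am" shows "\<xi> = 0"
proof -
  have "\<forall>i. \<exists>c. expn (\<xi> $ i) (\<lambda>b. c b *\<^sub>C 1) \<and> (\<xi> $ i = 0 \<longleftrightarrow> c = (\<lambda>b. 0))"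
    using assms(2) expn_Am unfolding tensor_space_def by blast
  then obtain c where c: "\<And>i. expn (\<xi> $ i) (\<lambda>b. c i b *\<^sub>C 1)" "\<And>i. \<xi> $ i = 0 \<longleftrightarrow> c i = (\<lambda>b. 0)" by metis
  have "c k b = 0" for k b
  proof -
    have "\<sigma> (cf (\<xi> $ i) b) $ k $ i = (if i = k then c i b else 0)" for i
      by (auto simp: cf_eq[OF c(1)] \<sigma>_scale[OF par_alg(1)] \<sigma>_1 mat_def)
    then have "\<Phi> \<xi> b k = c k b" unfolding \<Phi>_def by simp
    then show ?thesis using \<Phi>_bal[OF assms(1)] by simp
  qed
  then show ?thesis using c(2) by (simp add: vec_eq_iff fun_eq_iff)
qed

lemma tensor_space_operators:
  "Ob \<in> Weyl_tensor_End n q g \<Longrightarrow> (Ob :: 'a ^ 'd \<Rightarrow> 'a ^ 'd) \<in> operators_on (tensor_space Ap)"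
proof (induction rule: Weyl_tensor_End.induct)
  case (elementary D \<phi>)
  then have D: "D \<in> operators_on Ap" using Z.Wa_operators[OF order.refl] unfolding Weyl_eq by blast
  note l = Z.linear_onD[OF Z.operators_onD(1)[OF D]]
  have "(\<Sum>j\<in>UNIV. \<phi> $ i $ j *\<^sub>C D (\<xi> $ j)) \<in> Ap" if "\<xi> \<in> tensor_space Ap" for \<xi> i
    using that Z.operators_onD(2)[OF D] Z.A_scale unfolding tensor_space_def Aplus_def
    by (intro subalgebra_gen_sum) auto
  then have "tensor_op Ap D \<phi> \<in> tensor_space Ap \<rightarrow>\<^sub>E tensor_space Ap"
    unfolding tensor_op_def by (intro PiE_I) (auto simp: tensor_space_def)
  moreover have ts: "x + y \<in> tensor_space Ap" "c *\<^sub>C x \<in> tensor_space Ap" if "x \<in> tensor_space Ap" "y \<in> tensor_space Ap" for x y :: "'a ^ 'd" and c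
    using that Z.A_add Z.A_scale by (auto simp: tensor_space_def scaleC_vec_def)
  have "linear_on (tensor_space Ap) (tensor_op Ap D \<phi>)"
    unfolding linear_on_def
  proof (intro conjI ballI allI)
    fix x y :: "'a ^ 'd" and c assume x: "x \<in> tensor_space Ap" and y: "y \<in> tensor_space Ap"
    then have "x $ i \<in> Ap" "y $ i \<in> Ap" for i by (simp_all add: tensor_space_def)
    then show "tensor_op Ap D \<phi> (x + y) = tensor_op Ap D \<phi> x + tensor_op Ap D \<phi> y"
      using x y ts(1)[OF x y] by (simp add: tensor_op_def vec_eq_iff l scaleC_add_right sum.distrib)
  next
    fix c and x :: "'a ^ 'd" assume x: "x \<in> tensor_space Ap"
    then have "x $ i \<in> Ap" for i by (simp add: tensor_space_def)
    then show "tensor_op Ap D \<phi> (c *\<^sub>C x) = c *\<^sub>C tensor_op Ap D \<phi> x"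
      using x ts(2)[OF x x, of c] by (simp add: tensor_op_def vec_eq_iff scaleC_vec_def l cvs.scale_sum_right scaleC_scaleC mult.commute)
  qed
  ultimately show ?case unfolding operators_on_def by simp
next
  case (add S T)
  have ts: "x + y \<in> tensor_space Ap" "c *\<^sub>C x \<in> tensor_space Ap" if "x \<in> tensor_space Ap" "y \<in> tensor_space Ap" for x y :: "'a ^ 'd" and c
    using that Z.A_add Z.A_scale by (auto simp: tensor_space_def scaleC_vec_def)
  have "S x \<in> tensor_space Ap" "T x \<in> tensor_space Ap" if "x \<in> tensor_space Ap" for x
    using add.IH that unfolding operators_on_def by auto
  then show ?case using add.IH ts unfolding operators_on_def linear_on_def
    by (auto simp: scaleC_add_right add_ac)
qed

text \<open>For a term \<open>v -> D v * x\<close> the factor \<open>x\<close> moves across the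
  tensor sign: the class is represented by \<open>D\<close> on the entries together with
  \<open>\<sigma> x\<close> on \<open>V\<close>, and the adjoint is the adjoint of \<open>D\<close>
  together with the transpose of \<open>\<sigma> x\<close>.\<close>

lemma Weyl_par_adjoint:
  assumes "Weyl_par (grid n) T"
  shows "\<exists>\<Lambda> Ob. (\<forall>\<eta>\<in>tensor_space Am. \<Lambda> \<eta> \<in> tensor_space Am \<and> (\<chi> i. T (\<eta> $ i)) - \<Lambda> \<eta> \<in> bal) \<and>
    Ob \<in> Weyl_tensor_End n q g \<and>
    (\<forall>\<eta>\<in>tensor_space Am. \<forall>\<xi>\<in>tensor_space Ap. tensor_pairing n q g \<eta> (Ob \<xi>) = tensor_pairing n q g (\<Lambda> \<eta>) \<xi>)"
  using assms
proof (induction rule: Weyl_par.induct)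
  case (elem D x T)
  define \<Lambda> where "\<Lambda> \<eta> = (\<chi> k. \<Sum>i\<in>UNIV. (\<sigma> x $ k $ i) *\<^sub>C D (\<eta> $ i))" for \<eta> :: "'a ^ 'd"
  have D: "W.inW ({1..n} \<times> {1..n}) D" using elem(1) by simp
  obtain h where h: "Z.inW ({1..n} \<times> {1..n}) h" "adj D h" using adj_inW[OF order.refl D] by blast
  define h' where "h' = restrict h Ap"
  have h': "h' \<in> Weyl n q g" using h(1) unfolding Weyl_eq Z.inW_def h'_def .
  have hin: "u \<in> Ap \<Longrightarrow> h u \<in> Ap" for u by (rule Z.inW_in[OF order.refl h(1)])
  have Din: "w \<in> Am \<Longrightarrow> D w \<in> Am" for w by (rule W.inW_in[OF order.refl D])
  \<comment> \<open>The indices of \<open>\<sigma> x\<close> are exchanged because the operator acts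
    on the dual space, in the dual basis.\<close>
  define Ob where "Ob = tensor_op Ap h' (\<chi> i j. \<sigma> x $ j $ i)"
  have sumAm: "(\<And>i. f i \<in> Am) \<Longrightarrow> (\<Sum>i\<in>UNIV. f i) \<in> Am" for f :: "'d \<Rightarrow> 'a"
    unfolding Aminus_def by (intro subalgebra_gen_sum) auto
  have \<Lambda>: "\<Lambda> \<eta> \<in> tensor_space Am" if "\<eta> \<in> tensor_space Am" for \<eta>
    using that Din W.A_scale sumAm unfolding tensor_space_def \<Lambda>_def by auto
  moreover have "(\<chi> i. T (\<eta> $ i)) - \<Lambda> \<eta> \<in> bal" if "\<eta> \<in> tensor_space Am" for \<eta>
  proof -
    have "(\<chi> i. T (\<eta> $ i)) - \<Lambda> \<eta> = (\<Sum>i\<in>UNIV. (D (\<eta> $ i) * x) \<otimes>\<^sub>C axis i 1 - D (\<eta> $ i) \<otimes>\<^sub>C (\<sigma> x *v axis i 1))"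
    proof -
      have "T (\<eta> $ i) = D (\<eta> $ i) * x" for i
        using elem(3) that unfolding WL.tail_all tensor_space_def by blast
      moreover have "(\<Sum>i\<in>UNIV. (axis i 1 :: complex ^ 'd) $ k *\<^sub>C f i) = f k" for k and f :: "'d \<Rightarrow> 'a"
      proof -
        have "(\<Sum>i\<in>UNIV. (axis i 1 :: complex ^ 'd) $ k *\<^sub>C f i) = (\<Sum>i\<in>UNIV. if i = k then f i else 0)"
          by (rule sum.cong) (auto simp: axis_def scaleC_one)
        then show ?thesis by simp
      qed
      moreover have "(\<sigma> x *v axis i 1) $ k = \<sigma> x $ k $ i" for i k
        by (simp add: matrix_vector_mult_def axis_def if_distrib cong: if_cong)
      ultimately show ?thesis
        by (simp add: vec_eq_iff \<Lambda>_def tensor_def sum_subtractf)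
    qed
    then show ?thesis using balanced[OF elem(2)] by (simp add: bal_closed(5))
  qed
  moreover have "Ob \<in> Weyl_tensor_End n q g" unfolding Ob_def by (rule Weyl_tensor_End.elementary[OF h'])
  moreover have "tensor_pairing n q g \<eta> (Ob \<xi>) = tensor_pairing n q g (\<Lambda> \<eta>) \<xi>"
    if \<eta>: "\<eta> \<in> tensor_space Am" and \<xi>: "\<xi> \<in> tensor_space Ap" for \<eta> \<xi>
  proof -
    have e: "\<eta> $ i \<in> Am" "\<xi> $ i \<in> Ap" for i using \<eta> \<xi> by (auto simp: tensor_space_def)
    have sl: "pairing n q g (\<Sum>i\<in>I. f i) z = (\<Sum>i\<in>I. pairing n q g (f i) z)" if "\<And>i. f i \<in> Am" "z \<in> Ap" for f z and I :: "'d set"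
    proof (induction I rule: infinite_finite_induct)
      case (insert i I)
      have "(\<Sum>i\<in>I. f i) \<in> Am" using that(1) unfolding Aminus_def by (intro subalgebra_gen_sum) auto
      then show ?case using insert that by (simp add: B_add_left)
    qed (simp_all add: B_zero that)
    have "tensor_pairing n q g \<eta> (Ob \<xi>) = (\<Sum>i\<in>UNIV. \<Sum>j\<in>UNIV. \<sigma> x $ j $ i * pairing n q g (D (\<eta> $ i)) (\<xi> $ j))"
      unfolding tensor_pairing_def Ob_def tensor_op_def using \<xi> e h(2) hin
      by (simp add: B_sum B_scale Z.A_scale h'_def adj_def)
    also have "\<dots> = tensor_pairing n q g (\<Lambda> \<eta>) \<xi>"
      unfolding tensor_pairing_def \<Lambda>_def using e Din
      by (subst sum.swap) (simp add: sl B_scale W.A_scale)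
    finally show ?thesis .
  qed
  ultimately show ?case by blast
next
  case (add S T R)
  obtain \<Lambda> Ob where 1: "\<forall>\<eta>\<in>tensor_space Am. \<Lambda> \<eta> \<in> tensor_space Am \<and> (\<chi> i. S (\<eta> $ i)) - \<Lambda> \<eta> \<in> bal"
    "Ob \<in> Weyl_tensor_End n q g"
    "\<forall>\<eta>\<in>tensor_space Am. \<forall>\<xi>\<in>tensor_space Ap. tensor_pairing n q g \<eta> (Ob \<xi>) = tensor_pairing n q g (\<Lambda> \<eta>) \<xi>"
    using add.IH(1) by blast
  obtain \<Lambda>' Ob' where 2: "\<forall>\<eta>\<in>tensor_space Am. \<Lambda>' \<eta> \<in> tensor_space Am \<and> (\<chi> i. T (\<eta> $ i)) - \<Lambda>' \<eta> \<in> bal"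
    "Ob' \<in> Weyl_tensor_End n q g"
    "\<forall>\<eta>\<in>tensor_space Am. \<forall>\<xi>\<in>tensor_space Ap. tensor_pairing n q g \<eta> (Ob' \<xi>) = tensor_pairing n q g (\<Lambda>' \<eta>) \<xi>"
    using add.IH(2) by blast
  have OO: "Ob \<xi> \<in> tensor_space Ap" "Ob' \<xi> \<in> tensor_space Ap" if "\<xi> \<in> tensor_space Ap" for \<xi>
    using tensor_space_operators[OF 1(2)] tensor_space_operators[OF 2(2)] that unfolding operators_on_def by auto
  show ?case
  proof (intro exI conjI ballI)
    fix \<eta> :: "'a ^ 'd" assume \<eta>: "\<eta> \<in> tensor_space Am"
    show "\<Lambda> \<eta> + \<Lambda>' \<eta> \<in> tensor_space Am" using 1(1) 2(1) \<eta> W.A_add by (simp add: tensor_space_def)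
    have "R (\<eta> $ i) = S (\<eta> $ i) + T (\<eta> $ i)" for i
      using add.hyps(3) \<eta> unfolding WL.tail_all tensor_space_def by blast
    then have "(\<chi> i. R (\<eta> $ i)) - (\<Lambda> \<eta> + \<Lambda>' \<eta>) = ((\<chi> i. S (\<eta> $ i)) - \<Lambda> \<eta>) + ((\<chi> i. T (\<eta> $ i)) - \<Lambda>' \<eta>)"
      by (simp add: vec_eq_iff)
    then show "(\<chi> i. R (\<eta> $ i)) - (\<Lambda> \<eta> + \<Lambda>' \<eta>) \<in> bal"
      using 1(1) 2(1) \<eta> bal_closed(2) by (simp only:)
  next
    show "(\<lambda>\<xi>\<in>tensor_space Ap. Ob \<xi> + Ob' \<xi>) \<in> Weyl_tensor_End n q g"
      by (rule Weyl_tensor_End.add[OF 1(2) 2(2)])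
  next
    fix \<eta> \<xi> :: "'a ^ 'd" assume \<eta>: "\<eta> \<in> tensor_space Am" and \<xi>: "\<xi> \<in> tensor_space Ap"
    have "\<eta> $ i \<in> Am" "\<xi> $ i \<in> Ap" "Ob \<xi> $ i \<in> Ap" "Ob' \<xi> $ i \<in> Ap" "\<Lambda> \<eta> $ i \<in> Am" "\<Lambda>' \<eta> $ i \<in> Am" for i
      using \<eta> \<xi> OO[OF \<xi>] 1(1) 2(1) by (auto simp: tensor_space_def)
    then have "tensor_pairing n q g \<eta> (Ob \<xi> + Ob' \<xi>) = tensor_pairing n q g \<eta> (Ob \<xi>) + tensor_pairing n q g \<eta> (Ob' \<xi>)"
      "tensor_pairing n q g (\<Lambda> \<eta> + \<Lambda>' \<eta>) \<xi> = tensor_pairing n q g (\<Lambda> \<eta>) \<xi> + tensor_pairing n q g (\<Lambda>' \<eta>) \<xi>"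
      by (simp_all add: tensor_pairing_def B_add_left B_add_right sum.distrib)
    then show "tensor_pairing n q g \<eta> ((\<lambda>\<xi>\<in>tensor_space Ap. Ob \<xi> + Ob' \<xi>) \<xi>) = tensor_pairing n q g (\<Lambda> \<eta> + \<Lambda>' \<eta>) \<xi>"
      using 1(3) 2(3) \<eta> \<xi> by simp
  qed
qed

lemma tensor_nondegenerate:
  assumes "\<xi> \<in> tensor_space Ap" "\<xi>' \<in> tensor_space Ap"
    and "\<And>\<eta>. \<eta> \<in> tensor_space Am \<Longrightarrow> tensor_pairing n q g \<eta> \<xi> = tensor_pairing n q g \<eta> \<xi>'"
  shows "\<xi> = (\<xi>' :: 'a ^ 'd)"
proof -
  have "\<xi> $ i - \<xi>' $ i = 0" for i
  proof (rule nondegenerate)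
    show d: "\<xi> $ i - \<xi>' $ i \<in> Ap" using assms(1,2) Z.A_diff by (simp add: tensor_space_def)
    fix v assume v: "v \<in> Am"
    define \<eta> :: "'a ^ 'd" where "\<eta> = (\<chi> k. if k = i then v else 0)"
    have p: "tensor_pairing n q g \<eta> \<zeta> = pairing n q g v (\<zeta> $ i)" if "\<zeta> \<in> tensor_space Ap" for \<zeta>
    proof -
      have "pairing n q g (\<eta> $ k) (\<zeta> $ k) = (if k = i then pairing n q g v (\<zeta> $ i) else 0)" for k
        using that B_zero(2) by (simp add: \<eta>_def tensor_space_def)
      then show ?thesis by (simp add: tensor_pairing_def)
    qed
    have "\<eta> \<in> tensor_space Am" using v W.A_zero by (simp add: \<eta>_def tensor_space_def)
    from assms(3)[OF this] show "pairing n q g v (\<xi> $ i - \<xi>' $ i) = 0"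
      using v assms(1,2) by (simp add: p B_diff tensor_space_def)
  qed
  then show ?thesis by (simp add: vec_eq_iff)
qed

text \<open>\<open>Weyl_left_all\<close> holds for every element, in particular for
  \<open>antipode n g u\<close>. The two definite descriptions are then resolved by
  \<open>bal_Am\<close>, for the left action, and by nondegeneracy of the pairing, for the
  adjoint.\<close>

theorem O_L_Weyl: "O_L n q g \<rho> u \<in> Weyl_tensor_End n q g"
proof -
  define s where "s = antipode n g u"
  obtain \<Lambda> Ob where \<Lambda>: "\<And>\<eta>. \<eta> \<in> tensor_space Am \<Longrightarrow> \<Lambda> \<eta> \<in> tensor_space Am"
     "\<And>\<eta>. \<eta> \<in> tensor_space Am \<Longrightarrow> (\<chi> i. s * \<eta> $ i) - \<Lambda> \<eta> \<in> bal"
    and Ob: "Ob \<in> Weyl_tensor_End n q g"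
      "\<And>\<eta> \<xi>. \<eta> \<in> tensor_space Am \<Longrightarrow> \<xi> \<in> tensor_space Ap \<Longrightarrow> tensor_pairing n q g \<eta> (Ob \<xi>) = tensor_pairing n q g (\<Lambda> \<eta>) \<xi>"
    using Weyl_par_adjoint[OF Weyl_left_all[OF n1, of s, unfolded Weyl_left_def]] by blast
  have L: "L_action n q g \<rho> s \<eta> = \<Lambda> \<eta>" if \<eta>: "\<eta> \<in> tensor_space Am" for \<eta>
  proof -
    have sm: "s *s \<eta> = (\<chi> i. s * \<eta> $ i)" by (simp add: vec_eq_iff)
    have "(THE \<eta>'. \<eta>' \<in> tensor_space Am \<and> s *s \<eta> - \<eta>' \<in> bal) = \<Lambda> \<eta>"
    proof (rule the_equality)
      show "\<Lambda> \<eta> \<in> tensor_space Am \<and> s *s \<eta> - \<Lambda> \<eta> \<in> bal" using \<Lambda>[OF \<eta>] sm by simp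
      fix \<zeta> assume z: "\<zeta> \<in> tensor_space Am \<and> s *s \<eta> - \<zeta> \<in> bal"
      have "((\<chi> i. s * \<eta> $ i) - \<Lambda> \<eta>) - ((\<chi> i. s * \<eta> $ i) - \<zeta>) \<in> bal"
        by (rule bal_closed(4)[OF \<Lambda>(2)[OF \<eta>]]) (use z sm in simp)
      then have "\<zeta> - \<Lambda> \<eta> \<in> bal" by simp
      moreover have "\<zeta> - \<Lambda> \<eta> \<in> tensor_space Am" using z \<Lambda>(1)[OF \<eta>] W.A_diff by (simp add: tensor_space_def)
      ultimately show "\<zeta> = \<Lambda> \<eta>" using bal_Am by fastforce
    qed
    then show ?thesis using \<eta> by (simp add: L_action_def)
  qed
  have "O_L n q g \<rho> u = Ob"
    unfolding O_L_def s_def[symmetric]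
  proof (rule the_equality)
    show "Ob \<in> operators_on (tensor_space Ap) \<and> (\<forall>\<eta>\<in>tensor_space Am. \<forall>\<xi>\<in>tensor_space Ap.
      tensor_pairing n q g \<eta> (Ob \<xi>) = tensor_pairing n q g (L_action n q g \<rho> s \<eta>) \<xi>)"
      using tensor_space_operators[OF Ob(1)] Ob(2) L by simp
    fix T assume T: "T \<in> operators_on (tensor_space Ap) \<and> (\<forall>\<eta>\<in>tensor_space Am. \<forall>\<xi>\<in>tensor_space Ap.
      tensor_pairing n q g \<eta> (T \<xi>) = tensor_pairing n q g (L_action n q g \<rho> s \<eta>) \<xi>)"
    have "T \<xi> = Ob \<xi>" if "\<xi> \<in> tensor_space Ap" for \<xi>
      by (rule tensor_nondegenerate)
         (use T tensor_space_operators[OF Ob(1)] that Ob(2) L in \<open>auto simp: operators_on_def\<close>)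
    then show "T = Ob" using T tensor_space_operators[OF Ob(1)]
      unfolding operators_on_def by (auto intro: PiE_ext)
  qed
  then show ?thesis using Ob(1) by simp
qed

end

theorem theorem8p6p3:
  fixes n :: nat and q :: complex and g :: "gen \<Rightarrow> 'a::complex_algebra"
  assumes "n \<ge> 1" and "q \<noteq> 0" and "\<forall>m\<ge>1::nat. q ^ m \<noteq> 1"
    and "is_Uq n q g"
  shows "D_L_R n q g = D_L_L n q g \<and> D_L_L n q g = Weyl n q g \<and>
    (\<forall>(\<rho> :: 'a \<Rightarrow> complex ^ 'd::finite ^ 'd) lam_mu lam_nu (lam :: real) l v.
      Uk_rep n g \<rho> \<longrightarrow> irreducible_rep n g \<rho> \<longrightarrow>
      highest_weight_vector n q g \<rho> lam_mu lam_nu lam l v \<longrightarrow>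
      (\<forall>u. O_L n q g \<rho> u \<in> Weyl_tensor_End n q g))"
proof -
  interpret uq_presented n q g
    by unfold_locales (use assms in auto)
  have "O_L n q g \<rho> u \<in> Weyl_tensor_End n q g" if "Uk_rep n g \<rho>" for \<rho> :: "'a \<Rightarrow> complex ^ 'd::finite ^ 'd" and u
  proof -
    obtain \<sigma> where "parabolic_rep n q g \<rho> \<sigma>" using ex_parabolic_rep[OF assms(1) \<open>Uk_rep n g \<rho>\<close>] by blast
    then show ?thesis by (rule parabolic_rep.O_L_Weyl)
  qed
  then show ?thesis using D_L_R_eq D_L_L_eq by simp
qed

end
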